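(* Let $C$ and $\tilde{C}$ be germs of complex analytic plane curves at $0\in\mathbb{C}^2$. Let $C_1,\dots,C_r$ and $\tilde{C}_1,\dots,\tilde{C}_s$ be the branches of $C$ and $\tilde{C}$, respectively. If, for each $\alpha\in(0,1)$, there exists a bi-$\alpha$-Hölder homeomorphism between $(C,0)$ and $(\tilde{C},0)$, then there is a bijection $\sigma\colon\{1,\dots,r\}\to\{1,\dots,s\}$ such that: (i) the branches $C_i$ and $\tilde{C}_{\sigma(i)}$ have the same characteristic exponents, for $i=1,\dots,r$; (ii) the pairs of branches $(C_i,C_j)$ and $(\tilde{C}_{\sigma(i)},\tilde{C}_{\sigma(j)})$ have the same intersection multiplicity at $0$, for all $i\neq j\in\{1,\dots,r\}$.
   Context: $\mathbb{C}^2\cong\mathbb{R}^4$ carries the Euclidean norm. The branches of a germ of complex analytic plane curve (regarded as a set germ) are its irreducible components at $0$; a branch is a germ of analytically irreducible complex analytic curve. Hölder equivalence: for a real $\alpha>0$, a map $f\colon U\subset\mathbb{R}^n\to\mathbb{R}^m$ is $\alpha$-Hölder if there is $c>0$ with $\|f(p)-f(q)\|\le c\|p-q\|^{\alpha}$ for all $p,q\in U$. A bi-$\alpha$-Hölder homeomorphism between germs $(X,x_0)$, $(Y,y_0)$ of Euclidean subsets is a germ of homeomorphism $f\colon(X,x_0)\to(Y,y_0)$ (so $f(x_0)=y_0$) such that $f$ and $f^{-1}$ are $\alpha$-Hölder. Characteristic exponents: after an analytic change of coordinates, a branch $C$ has a parametrization $x=t^n$, $y=a_1t^{m}+\cdots\in\mathbb{C}\{t\}$,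 where $n$ is the multiplicity of $C$ at $0$, $a_1\neq0$, and, if $C$ is singular at $0$, $n$ does not divide $m$. For $C$ singular put $\beta_0=n$, $\beta_1=m$, $e_1=\gcd(\beta_0,\beta_1)$; inductively, as long as $e_i>1$, let $\beta_{i+1}$ be the smallest exponent appearing with nonzero coefficient in $y(t)$ that is not a multiple of $e_i$, and $e_{i+1}=\gcd(e_i,\beta_{i+1})$. Let $g$ be the index with $e_g=1$. The sequence $(\beta_0,\beta_1,\dots,\beta_g)$ is the sequence of characteristic exponents of $C$. For a smooth branch the sequence is $(1)$. *)

theory Defs
  imports "HOL-Analysis.Analysis"
begin

text \<open>
  The plane is \<^typ>\<open>complex \<times> complex\<close>, whose library norm is the Euclidean one.  Set germs at the
  origin are represented by arbitrary subsets, compared near \<^term>\<open>0\<close> only; likewise elements of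
  the ring of germs of analytic functions are represented by functions defined everywhere.
\<close>

definition germ_eq :: "(complex \<times> complex) set \<Rightarrow> (complex \<times> complex) set \<Rightarrow> bool" where
  "germ_eq A B \<longleftrightarrow> (\<forall>\<^sub>F p in nhds 0. p \<in> A \<longleftrightarrow> p \<in> B)"

definition germ_le :: "(complex \<times> complex) set \<Rightarrow> (complex \<times> complex) set \<Rightarrow> bool" where
  "germ_le A B \<longleftrightarrow> (\<forall>\<^sub>F p in nhds 0. p \<in> A \<longrightarrow> p \<in> B)"


subsection \<open>Analytic functions of two variables near the origin\<close>

definition has_expansion2 :: "(complex \<times> complex \<Rightarrow> complex) \<Rightarrow> (nat \<Rightarrow> nat \<Rightarrow> complex) \<Rightarrow> bool" where
  "has_expansion2 f a \<longleftrightarrow>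
     (\<exists>\<rho>>0. \<forall>x y. norm x < \<rho> \<and> norm y < \<rho> \<longrightarrow>
        ((\<lambda>(i, j). a i j * x ^ i * y ^ j) has_sum f (x, y)) UNIV)"

definition analytic2 :: "(complex \<times> complex \<Rightarrow> complex) \<Rightarrow> bool" where
  "analytic2 f \<longleftrightarrow> (\<exists>a. has_expansion2 f a)"

definition has_order2 :: "(complex \<times> complex \<Rightarrow> complex) \<Rightarrow> nat \<Rightarrow> bool" where
  "has_order2 f n \<longleftrightarrow>
     (\<exists>a. has_expansion2 f a \<and> (\<exists>i j. i + j = n \<and> a i j \<noteq> 0) \<and> (\<forall>i j. i + j < n \<longrightarrow> a i j = 0))"

definition coordinate_change :: "(complex \<times> complex \<Rightarrow> complex \<times> complex) \<Rightarrow> bool" where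
  "coordinate_change \<psi> \<longleftrightarrow>
     \<psi> 0 = 0 \<and> analytic2 (\<lambda>p. fst (\<psi> p)) \<and> analytic2 (\<lambda>p. snd (\<psi> p)) \<and>
     (\<exists>\<phi>. \<phi> 0 = 0 \<and> analytic2 (\<lambda>p. fst (\<phi> p)) \<and> analytic2 (\<lambda>p. snd (\<phi> p)) \<and>
          (\<forall>\<^sub>F p in nhds 0. \<phi> (\<psi> p) = p \<and> \<psi> (\<phi> p) = p))"


subsection \<open>Plane curve germs and their branches\<close>

definition analytic_germ :: "(complex \<times> complex) set \<Rightarrow> bool" where
  "analytic_germ A \<longleftrightarrow>
     (\<exists>F. finite F \<and> (\<forall>f\<in>F. analytic2 f) \<and> germ_eq A {p. \<forall>f\<in>F. f p = 0})"

definition plane_curve_germ :: "(complex \<times> complex) set \<Rightarrow> bool" where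
  "plane_curve_germ C \<longleftrightarrow>
     (\<exists>f. analytic2 f \<and> f 0 = 0 \<and> \<not> (\<forall>\<^sub>F p in nhds 0. f p = 0) \<and> germ_eq C {p. f p = 0})"

definition irreducible_germ :: "(complex \<times> complex) set \<Rightarrow> bool" where
  "irreducible_germ D \<longleftrightarrow>
     analytic_germ D \<and> \<not> germ_eq D {} \<and>
     (\<forall>A B. analytic_germ A \<and> analytic_germ B \<and> germ_eq D (A \<union> B) \<longrightarrow> germ_eq D A \<or> germ_eq D B)"

definition branch :: "(complex \<times> complex) set \<Rightarrow> bool" where
  "branch D \<longleftrightarrow> plane_curve_germ D \<and> irreducible_germ D"

text \<open>
  The irreducible components are the members of the irredundant decomposition into irreducible
  germs, which is unique up to order; \<open>B 1, \<dots>, B r\<close> enumerates them without repetition.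
\<close>

definition branches :: "(complex \<times> complex) set \<Rightarrow> nat \<Rightarrow> (nat \<Rightarrow> (complex \<times> complex) set) \<Rightarrow> bool" where
  "branches C r B \<longleftrightarrow>
     (\<forall>i\<in>{1..r}. branch (B i)) \<and>
     germ_eq C (\<Union>i\<in>{1..r}. B i) \<and>
     (\<forall>i\<in>{1..r}. \<forall>j\<in>{1..r}. i \<noteq> j \<longrightarrow> \<not> germ_le (B i) (B j))"


subsection \<open>Hoelder equivalence\<close>

definition holder_on :: "real \<Rightarrow> 'a::real_normed_vector set \<Rightarrow> ('a \<Rightarrow> 'b::real_normed_vector) \<Rightarrow> bool" where
  "holder_on \<alpha> U f \<longleftrightarrow> (\<exists>c>0. \<forall>p\<in>U. \<forall>q\<in>U. norm (f p - f q) \<le> c * norm (p - q) powr \<alpha>)"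

definition bi_holder_equivalent :: "real \<Rightarrow> (complex \<times> complex) set \<Rightarrow> (complex \<times> complex) set \<Rightarrow> bool" where
  "bi_holder_equivalent \<alpha> X Y \<longleftrightarrow>
     (\<exists>U V f g. open U \<and> 0 \<in> U \<and> open V \<and> 0 \<in> V \<and>
        homeomorphism (X \<inter> U) (Y \<inter> V) f g \<and> f 0 = 0 \<and>
        holder_on \<alpha> (X \<inter> U) f \<and> holder_on \<alpha> (Y \<inter> V) g)"


subsection \<open>Multiplicity, parametrizations and intersection multiplicity\<close>

definition vanishes_on :: "(complex \<times> complex \<Rightarrow> complex) \<Rightarrow> (complex \<times> complex) set \<Rightarrow> bool" where
  "vanishes_on f C \<longleftrightarrow> (\<forall>\<^sub>F p in nhds 0. p \<in> C \<longrightarrow> f p = 0)"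

text \<open>A reduced equation generates the ideal of all analytic germs vanishing on the curve.\<close>

definition reduced_equation :: "(complex \<times> complex) set \<Rightarrow> (complex \<times> complex \<Rightarrow> complex) \<Rightarrow> bool" where
  "reduced_equation C f \<longleftrightarrow>
     analytic2 f \<and> vanishes_on f C \<and>
     (\<forall>g. analytic2 g \<and> vanishes_on g C \<longrightarrow>
        (\<exists>h. analytic2 h \<and> (\<forall>\<^sub>F p in nhds 0. g p = h p * f p)))"

definition has_multiplicity :: "(complex \<times> complex) set \<Rightarrow> nat \<Rightarrow> bool" where
  "has_multiplicity C n \<longleftrightarrow> (\<exists>f. reduced_equation C f \<and> has_order2 f n)"

text \<open>Injectivity makes the parametrization primitive, i.e. it traces the branch exactly once.\<close>

definition parametrizes :: "(complex \<Rightarrow> complex \<times> complex) \<Rightarrow> (complex \<times> complex) set \<Rightarrow> bool" where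
  "parametrizes \<gamma> D \<longleftrightarrow>
     \<gamma> 0 = 0 \<and> (\<lambda>t. fst (\<gamma> t)) analytic_on {0} \<and> (\<lambda>t. snd (\<gamma> t)) analytic_on {0} \<and>
     (\<forall>\<^sub>F \<epsilon> in at_right 0. inj_on \<gamma> (ball 0 \<epsilon>) \<and> germ_eq D (\<gamma> ` ball 0 \<epsilon>))"

text \<open>
  The intersection multiplicity of two branches is the order in \<open>t\<close> of \<open>f (\<gamma> t)\<close>, for \<open>\<gamma>\<close> a primitive
  parametrization of the first and \<open>f\<close> a reduced equation of the second.  It is independent of the
  choices, symmetric, and finite for distinct branches.
\<close>

definition has_intersection_multiplicity ::
    "(complex \<times> complex) set \<Rightarrow> (complex \<times> complex) set \<Rightarrow> nat \<Rightarrow> bool" where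
  "has_intersection_multiplicity D E k \<longleftrightarrow>
     (\<exists>\<gamma> f F. parametrizes \<gamma> D \<and> reduced_equation E f \<and>
        (\<lambda>t. f (\<gamma> t)) has_fps_expansion F \<and> F \<noteq> 0 \<and> subdegree F = k)"


subsection \<open>Characteristic exponents\<close>

text \<open>
  \<^term>\<open>\<beta> ! i\<close> is the exponent \<open>\<beta>\<^sub>i\<close>, and \<open>e\<^sub>i\<close> is the gcd of \<open>\<beta>\<^sub>0, \<dots>, \<beta>\<^sub>i\<close>; the last index \<open>g\<close> is the
  first one with \<open>e\<^sub>g = 1\<close>.
\<close>

definition exponent_gcd :: "nat list \<Rightarrow> nat \<Rightarrow> nat" where
  "exponent_gcd \<beta> i = Gcd (set (take (Suc i) \<beta>))"

definition characteristic_sequence :: "nat \<Rightarrow> complex fps \<Rightarrow> nat list \<Rightarrow> bool" where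
  "characteristic_sequence n Y \<beta> \<longleftrightarrow>
     (\<exists>g\<ge>1. length \<beta> = Suc g \<and> \<beta> ! 0 = n \<and> \<beta> ! 1 = subdegree Y \<and>
        (\<forall>i\<in>{1..<g}. exponent_gcd \<beta> i > 1 \<and>
           fps_nth Y (\<beta> ! Suc i) \<noteq> 0 \<and> \<not> exponent_gcd \<beta> i dvd \<beta> ! Suc i \<and>
           (\<forall>k. fps_nth Y k \<noteq> 0 \<and> \<not> exponent_gcd \<beta> i dvd k \<longrightarrow> \<beta> ! Suc i \<le> k)) \<and>
        exponent_gcd \<beta> g = 1)"

text \<open>
  A branch is smooth iff its multiplicity is 1.  Otherwise \<^term>\<open>\<psi>\<close> maps the new coordinates, in
  which the branch is \<open>x = t\<^sup>n\<close>, \<open>y = Y(t)\<close>, to the original ones.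
\<close>

definition has_characteristic_exponents :: "(complex \<times> complex) set \<Rightarrow> nat list \<Rightarrow> bool" where
  "has_characteristic_exponents D \<beta> \<longleftrightarrow>
     (has_multiplicity D 1 \<and> \<beta> = [1]) \<or>
     (\<exists>n>1. has_multiplicity D n \<and>
        (\<exists>\<psi> Y. coordinate_change \<psi> \<and> fps_conv_radius Y > 0 \<and> Y \<noteq> 0 \<and> \<not> n dvd subdegree Y \<and>
           parametrizes (\<lambda>t. \<psi> (t ^ n, eval_fps Y t)) D \<and>
           characteristic_sequence n Y \<beta>))"

end

theory Submission
  imports Defs "HOL-Complex_Analysis.Complex_Analysis"
begin

text \<open>
  Every branch has, after a shear, a Puiseux parametrization \<open>\<gamma> t = (t ^ n, y t)\<close>.  A homeomorphism
  of the curves matches the branches and lifts to homeomorphisms \<open>\<phi>\<close> of the parameter discs.  If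
  \<open>z = exp (2 * \<pi> * \<i> * k / n)\<close>, the points \<open>\<gamma> (z * t)\<close> and \<open>\<gamma> t\<close> are very close, so for \<open>\<alpha>\<close> near 1 their images
  are too close for \<open>\<phi> (z * t) / \<phi> t\<close> to stay away from a root of unity.  Since \<open>\<phi>\<close> has degree 1 or -1
  around 0, that root is \<open>z\<close> or its inverse; hence the multiplicities agree and, as \<open>\<alpha>\<close> tends to 1, so do
  the orders of \<open>y (z * t) - y t\<close>, which are the characteristic exponents.  The same comparison
  applied to two branches shows that their contact order is preserved; together with the characteristic exponents it
  determines the intersection multiplicity.  The orders are integers bounded in advance, so a single
  \<open>\<alpha>\<close> close to 1 suffices.
\<close>

section \<open>Complex differentiable functions of two variables\<close>

text \<open>The lifted maps are merely continuous, so no derivative tells where they send a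
  rotation. A winding number does: the logarithms of the ratios along the orbit of \<open>t\<close>
  under \<open>z\<close> add up to a value fixed by the degree, and this pins down the one integer
  that closeness to a root of unity leaves open. The shear is chosen once for a whole curve, so that
  on every branch \<open>norm x\<close> is comparable to the distance from 0 and two branches can be
  compared over the same \<open>x\<close>. Each transfer loses the exponent \<alpha> twice, once
  when \<open>norm t\<close> is bounded by its image through the Hoelder inverse and once when a
  distance is pushed forward; hence \<open>\<alpha>\<^sup>2\<close>. Rotations survive the loss
  because conjugate orders strictly exceed the multiplicity. A transfer yields only an inequality;
  the reverse one comes from the inverse map. Solutions are found by Newton polygons applied
  directly to analytic functions, and equations and quotients descend from \<open>t\<close> to
  \<open>x = t ^ n\<close> by averaging over roots of unity.\<close>

definition cdiff2 :: "(complex \<times> complex \<Rightarrow> complex) \<Rightarrow> complex \<times> complex \<Rightarrow> bool" where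
  "cdiff2 F p \<longleftrightarrow> (\<exists>a b. (F has_derivative (\<lambda>h. a * fst h + b * snd h)) (at p))"

text \<open>Separate holomorphy with joint continuity is easily verified for limits and difference
  quotients, while \<open>cdiff2\<close> is what passes through the chain rule. On open sets the two
  agree, by \<open>sholo_cdiff2\<close> and \<open>cdiff2_sholo\<close>.\<close>

definition sholo :: "(complex \<times> complex \<Rightarrow> complex) \<Rightarrow> (complex \<times> complex) set \<Rightarrow> bool" where
  "sholo F U \<longleftrightarrow> open U \<and> continuous_on U F \<and>
     (\<forall>x y. (x, y) \<in> U \<longrightarrow> (\<lambda>u. F (u, y)) field_differentiable at x \<and>
                            (\<lambda>v. F (x, v)) field_differentiable at y)"

text \<open>Cauchy's inequality on circles of radius \<open>R/4\<close> bounds the second derivative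
  on the half-size disc, and Taylor's formula turns this into an estimate that sees \<open>g\<close>
  only through \<open>M\<close>. That uniformity makes difference quotients in one variable converge
  uniformly in the other.\<close>

lemma second_order_bound:
  assumes g: "g holomorphic_on ball y0 R" and R: "0 < R"
    and M: "\<And>y. y \<in> ball y0 R \<Longrightarrow> norm (g y) \<le> M"
    and z: "z \<in> ball y0 (R/2)" "z + h \<in> ball y0 (R/2)"
  shows "norm (g (z + h) - g z - deriv g z * h) \<le> 2 * M / (R/4)^2 * norm h ^ 2"
proof -
  have "cmod ((deriv ^^ 0) g (z + h) - (\<Sum>i\<le>1. (deriv ^^ i) g z * (z + h - z) ^ i / fact i))
          \<le> (2 * M / (R/4)^2) * cmod (z + h - z) ^ Suc 1 / fact 1"
  proof (rule complex_Taylor[where S = "ball y0 (R/2)"])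
    fix i and x assume x: "x \<in> ball y0 (R/2)"
    have "(deriv ^^ i) g holomorphic_on ball y0 R"
      using g by (intro holomorphic_higher_deriv) auto
    moreover have "x \<in> ball y0 R" using x R by auto
    ultimately have "((deriv ^^ i) g has_field_derivative deriv ((deriv ^^ i) g) x) (at x)"
      by (meson holomorphic_derivI open_ball)
    then show "((deriv ^^ i) g has_field_derivative (deriv ^^ Suc i) g x) (at x within ball y0 (R/2))"
      by (simp add: has_field_derivative_at_within)
  next
    fix x assume x: "x \<in> ball y0 (R/2)"
    have sub: "cball x (R/4) \<subseteq> ball y0 R"
    proof
      fix u assume "u \<in> cball x (R/4)"
      with x R show "u \<in> ball y0 R"
        using dist_triangle[of y0 u x] by auto
    qed
    have "norm ((deriv ^^ 2) g x) \<le> fact 2 * M / (R/4)^2"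
    proof (rule Cauchy_inequality)
      show "g holomorphic_on ball x (R/4)"
        using g sub ball_subset_cball holomorphic_on_subset by blast
      show "continuous_on (cball x (R/4)) g"
        using g sub holomorphic_on_imp_continuous_on holomorphic_on_subset by blast
      fix u assume "norm (x - u) = R/4"
      then have "u \<in> cball x (R/4)" by (simp add: dist_norm)
      then show "norm (g u) \<le> M" using sub M by blast
    qed (use R in auto)
    then show "norm ((deriv ^^ Suc 1) g x) \<le> 2 * M / (R/4)^2" by (simp add: numeral_2_eq_2)
  qed (use z in auto)
  then show ?thesis
    by (simp add: algebra_simps power2_eq_square)
qed

lemma sholo_box:
  assumes "sholo F U" "(x0, y0) \<in> U"
  obtains R M where "0 < R" "cball x0 R \<times> cball y0 R \<subseteq> U" "0 < M"
    "\<And>x y. x \<in> cball x0 R \<Longrightarrow> y \<in> cball y0 R \<Longrightarrow> norm (F (x, y)) \<le> M"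
    "\<And>x. x \<in> cball x0 R \<Longrightarrow> (\<lambda>v. F (x, v)) holomorphic_on ball y0 R"
    "\<And>y. y \<in> cball y0 R \<Longrightarrow> (\<lambda>u. F (u, y)) holomorphic_on ball x0 R"
proof -
  have "open U" "continuous_on U F" using assms by (auto simp: sholo_def)
  then obtain A B where AB: "open A" "open B" "x0 \<in> A" "y0 \<in> B" "A \<times> B \<subseteq> U"
    using assms(2) open_prod_elim[of U "(x0, y0)"] by (metis mem_Sigma_iff)
  obtain r1 where r1: "r1 > 0" "cball x0 r1 \<subseteq> A" using AB open_contains_cball by blast
  obtain r2 where r2: "r2 > 0" "cball y0 r2 \<subseteq> B" using AB open_contains_cball by blast
  define R where "R = min r1 r2"
  have sub: "cball x0 R \<times> cball y0 R \<subseteq> U"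
    using r1 r2 AB unfolding R_def by force
  have "compact (cball x0 R \<times> cball y0 R)" by (intro compact_Times compact_cball)
  then have "bounded (F ` (cball x0 R \<times> cball y0 R))"
    by (rule compact_imp_bounded[OF compact_continuous_image[OF continuous_on_subset[OF \<open>continuous_on U F\<close> sub]]])
  then obtain M where M: "M > 0" "\<And>p. p \<in> cball x0 R \<times> cball y0 R \<Longrightarrow> norm (F p) \<le> M"
    unfolding bounded_pos by blast
  show ?thesis
  proof
    show "0 < R" using r1 r2 by (simp add: R_def)
    show "0 < M" by fact
    show "cball x0 R \<times> cball y0 R \<subseteq> U" by fact
    show "norm (F (x, y)) \<le> M" if "x \<in> cball x0 R" "y \<in> cball y0 R" for x y
      using M that by blast
    show "(\<lambda>v. F (x, v)) holomorphic_on ball y0 R" if "x \<in> cball x0 R" for x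
      unfolding holomorphic_on_def
    proof
      fix y assume "y \<in> ball y0 R"
      then have "(x, y) \<in> U" using that sub by auto
      then show "(\<lambda>v. F (x, v)) field_differentiable at y within ball y0 R"
        using assms(1) by (simp add: sholo_def field_differentiable_at_within)
    qed
    show "(\<lambda>u. F (u, y)) holomorphic_on ball x0 R" if "y \<in> cball y0 R" for y
      unfolding holomorphic_on_def
    proof
      fix x assume "x \<in> ball x0 R"
      then have "(x, y) \<in> U" using that sub by auto
      then show "(\<lambda>u. F (u, y)) field_differentiable at x within ball x0 R"
        using assms(1) by (simp add: sholo_def field_differentiable_at_within)
    qed
  qed
qed

definition dsnd :: "(complex \<times> complex \<Rightarrow> complex) \<Rightarrow> complex \<times> complex \<Rightarrow> complex" where
  "dsnd F p = deriv (\<lambda>v. F (fst p, v)) (snd p)"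

text \<open>Near each point the difference quotients in the second variable converge uniformly to
  \<open>dsnd F\<close>, by \<open>second_order_bound\<close>; continuity and holomorphy in the
  first variable pass to the limit.\<close>

lemma sholo_dsnd:
  assumes F: "sholo F U"
  shows "sholo (dsnd F) U"
proof -
  have key: "isCont (dsnd F) (x0, y0) \<and> (\<lambda>u. dsnd F (u, y0)) field_differentiable at x0 \<and>
        (\<lambda>v. dsnd F (x0, v)) field_differentiable at y0"
    if p: "(x0, y0) \<in> U" for x0 y0
  proof -
    obtain R M where R: "0 < R" "cball x0 R \<times> cball y0 R \<subseteq> U" "0 < M"
      and M: "\<And>x y. x \<in> cball x0 R \<Longrightarrow> y \<in> cball y0 R \<Longrightarrow> norm (F (x, y)) \<le> M"
      and hv: "\<And>x. x \<in> cball x0 R \<Longrightarrow> (\<lambda>v. F (x, v)) holomorphic_on ball y0 R"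
      and hu: "\<And>y. y \<in> cball y0 R \<Longrightarrow> (\<lambda>u. F (u, y)) holomorphic_on ball x0 R"
      using sholo_box[OF F p] by metis
    \<comment> \<open>Steps of size at most \<open>R/4\<close> keep \<open>y + h n\<close> in the
      disc of radius \<open>R/2\<close> for \<open>y\<close> within \<open>R/4\<close> of
      \<open>y0\<close>, as \<open>second_order_bound\<close> requires.\<close>
    define h where "h = (\<lambda>n::nat. of_real (R/4 / real (Suc n)) :: complex)"
    have hn: "h n \<noteq> 0" "norm (h n) \<le> R/4" "norm (h n) = R/4 / real (Suc n)" for n
    proof -
      show "norm (h n) = R/4 / real (Suc n)" using R by (simp add: h_def norm_divide del: of_nat_Suc)
      moreover have "R/4 / real (Suc n) \<le> R/4 / 1" using R by (intro divide_left_mono) auto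
      ultimately show "norm (h n) \<le> R/4" by linarith
      show "h n \<noteq> 0" using R by (simp add: h_def del: of_nat_Suc)
    qed
    define Dn where "Dn = (\<lambda>n p. (F (fst p, snd p + h n) - F p) / h n)"
    define C where "C = 2 * M / (R/4)^2"
    have C: "C > 0" using R by (simp add: C_def)
    have bound: "norm (Dn n (x, y) - dsnd F (x, y)) \<le> C * norm (h n)"
      if "x \<in> ball x0 R" "y \<in> ball y0 (R/4)" for n x y
    proof -
      have "y + h n \<in> ball y0 (R/2)"
        using that hn(2)[of n] norm_triangle_ineq4[of "y0 - y" "h n"]
        by (simp add: dist_norm algebra_simps)
      moreover have "y \<in> ball y0 (R/2)" using that R by auto
      ultimately have "norm (F (x, y + h n) - F (x, y) - deriv (\<lambda>v. F (x, v)) y * h n)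
          \<le> 2 * M / (R/4)^2 * norm (h n) ^ 2"
        using that R(1) M hv by (intro second_order_bound[where M = M]) auto
      moreover have "Dn n (x, y) - dsnd F (x, y) =
          (F (x, y + h n) - F (x, y) - deriv (\<lambda>v. F (x, v)) y * h n) / h n"
        using hn(1)[of n] by (simp add: Dn_def dsnd_def field_simps)
      ultimately show ?thesis
        using hn(1)[of n] by (simp add: norm_divide C_def divide_le_eq power2_eq_square mult.assoc)
    qed
    have lim0: "(\<lambda>n. C * norm (h n)) \<longlonglongrightarrow> 0"
    proof -
      have "(\<lambda>n. C * (R/4) * inverse (real (Suc n))) \<longlonglongrightarrow> C * (R/4) * 0"
        by (intro tendsto_mult tendsto_const LIMSEQ_inverse_real_of_nat)
      moreover have "C * (R/4) * inverse (real (Suc n)) = C * norm (h n)" for n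
        unfolding hn(3) by (simp only: divide_inverse mult.assoc)
      ultimately show ?thesis by (simp only: mult_zero_right)
    qed
    have ul: "uniform_limit (ball x0 R \<times> ball y0 (R/4)) Dn (dsnd F) sequentially"
    proof (rule uniform_limitI)
      fix e :: real assume "e > 0"
      then have "\<forall>\<^sub>F n in sequentially. C * norm (h n) < e"
        using order_tendstoD(2)[OF lim0] by blast 
      then show "\<forall>\<^sub>F n in sequentially. \<forall>p\<in>ball x0 R \<times> ball y0 (R/4). dist (Dn n p) (dsnd F p) < e"
      proof eventually_elim
        case (elim n)
        show ?case
        proof
          fix p assume "p \<in> ball x0 R \<times> ball y0 (R/4)"
          then have "norm (Dn n (fst p, snd p) - dsnd F (fst p, snd p)) \<le> C * norm (h n)"
            by (intro bound) (auto simp: mem_Times_iff)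
          with elim show "dist (Dn n p) (dsnd F p) < e" by (simp add: dist_norm)
        qed
      qed
    qed
    have sub2: "(x, y + h n) \<in> cball x0 R \<times> cball y0 R" "(x, y) \<in> cball x0 R \<times> cball y0 R"
      if "x \<in> ball x0 R" "y \<in> ball y0 (R/4)" for x y n
    proof -
      have "norm (y0 - (y + h n)) \<le> R/4 + R/4"
        using that hn(2)[of n] norm_triangle_ineq4[of "y0 - y" "h n"]
        by (simp add: dist_norm algebra_simps)
      then show "(x, y + h n) \<in> cball x0 R \<times> cball y0 R"
        using that R by (auto simp: dist_norm)
      show "(x, y) \<in> cball x0 R \<times> cball y0 R" using that R by auto
    qed
    have contF: "continuous_on (cball x0 R \<times> cball y0 R) F"
      using F R continuous_on_subset by (auto simp: sholo_def)
    have "continuous_on (ball x0 R \<times> ball y0 (R/4)) (Dn n)" for n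
      unfolding Dn_def
    proof (intro continuous_intros)
      show "continuous_on (ball x0 R \<times> ball y0 (R/4)) F"
        by (rule continuous_on_subset[OF contF]) (use sub2 in auto)
      show "continuous_on (ball x0 R \<times> ball y0 (R/4)) (\<lambda>p. F (fst p, snd p + h n))"
        by (rule continuous_on_compose2[OF contF]) (use sub2 in \<open>auto intro!: continuous_intros\<close>)
      show "\<forall>x\<in>ball x0 R \<times> ball y0 (R/4). h n \<noteq> 0" using hn by auto
    qed
    then have "continuous_on (ball x0 R \<times> ball y0 (R/4)) (dsnd F)"
      by (intro uniform_limit_theorem[OF _ ul]) auto
    then have 1: "isCont (dsnd F) (x0, y0)"
      using R by (intro continuous_on_interior[of "ball x0 R \<times> ball y0 (R/4)"]) (auto simp: interior_Times)
    have "(\<lambda>u. dsnd F (u, y0)) holomorphic_on ball x0 R"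
    proof (rule holomorphic_uniform_sequence)
      show "(\<lambda>u. Dn n (u, y0)) holomorphic_on ball x0 R" for n
        unfolding Dn_def using hn(1)[of n] hu[of y0] hu[of "y0 + h n"] R sub2(1)[of x0 y0 n]
        by (auto intro!: holomorphic_intros)
      fix x assume "x \<in> ball x0 R"
      then obtain d where d: "d > 0" "cball x d \<subseteq> ball x0 R"
        using open_contains_cball[of "ball x0 R"] by (meson open_ball)
      have "uniform_limit (cball x d) (\<lambda>n u. Dn n (u, y0)) (\<lambda>u. dsnd F (u, y0)) sequentially"
        unfolding uniform_limit_iff
      proof (intro allI impI)
        fix e :: real assume "e > 0"
        then have "\<forall>\<^sub>F n in sequentially. \<forall>p\<in>ball x0 R \<times> ball y0 (R/4). dist (Dn n p) (dsnd F p) < e"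
          using ul unfolding uniform_limit_iff by blast
        then show "\<forall>\<^sub>F n in sequentially. \<forall>u\<in>cball x d. dist (Dn n (u, y0)) (dsnd F (u, y0)) < e"
        proof eventually_elim
          case (elim n)
          show ?case
          proof
            fix u assume "u \<in> cball x d"
            then have "(u, y0) \<in> ball x0 R \<times> ball y0 (R/4)" using d R by auto
            then show "dist (Dn n (u, y0)) (dsnd F (u, y0)) < e" using elim by blast
          qed
        qed
      qed
      then show "\<exists>d>0. cball x d \<subseteq> ball x0 R \<and>
          uniform_limit (cball x d) (\<lambda>n u. Dn n (u, y0)) (\<lambda>u. dsnd F (u, y0)) sequentially"
        using d by blast
    qed auto
    then have 2: "(\<lambda>u. dsnd F (u, y0)) field_differentiable at x0"
      using R by (simp add: holomorphic_on_imp_differentiable_at)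
    have "deriv (\<lambda>v. F (x0, v)) holomorphic_on ball y0 R"
      using hv[of x0] R by (intro holomorphic_deriv) auto
    then have 3: "(\<lambda>v. dsnd F (x0, v)) field_differentiable at y0"
      using R by (simp add: holomorphic_on_imp_differentiable_at dsnd_def)
    show ?thesis using 1 2 3 by blast
  qed
  have "open U" using F by (simp add: sholo_def)
  moreover have "continuous_on U (dsnd F)"
  proof (rule continuous_at_imp_continuous_on, rule ballI)
    fix p assume "p \<in> U"
    then show "isCont (dsnd F) p" using key[of "fst p" "snd p"] by simp
  qed
  ultimately show ?thesis
    using key by (simp add: sholo_def)
qed

text \<open>Joint differentiability follows from one partial derivative at the point and continuity
  of the other around it; the latter is part of \<open>sholo_dsnd\<close>.\<close>

lemma sholo_cdiff2:
  assumes F: "sholo F U" and p: "p \<in> U"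
  shows "cdiff2 F p"
proof -
  obtain x0 y0 where p0: "p = (x0, y0)" by (cases p)
  obtain R M where R: "0 < R" "cball x0 R \<times> cball y0 R \<subseteq> U"
    using sholo_box[OF F] p p0 by metis
  define X where "X = ball x0 R"
  define Y where "Y = ball y0 R"
  have XY: "X \<times> Y \<subseteq> U" using R unfolding X_def Y_def by force
  have D: "sholo (dsnd F) U" using F by (rule sholo_dsnd)
  have d: "(\<lambda>u. F (u, y)) field_differentiable at x" "(\<lambda>v. F (x, v)) field_differentiable at y"
    if "x \<in> X" "y \<in> Y" for x y
    using F XY that by (auto simp: sholo_def)
  have mem: "x0 \<in> X" "y0 \<in> Y" using R by (auto simp: X_def Y_def)
  define a where "a = deriv (\<lambda>u. F (u, y0)) x0"
  have "((\<lambda>(x, y). F (x, y)) has_derivative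
      (\<lambda>(tx, ty). a * tx + blinfun_apply (blinfun_mult_right (dsnd F (x0, y0))) ty)) (at (x0, y0) within X \<times> Y)"
  proof (rule has_derivative_partialsI)
    show "((\<lambda>x. F (x, y0)) has_derivative (*) a) (at x0 within X)"
    proof -
      have "((\<lambda>x. F (x, y0)) has_field_derivative a) (at x0 within X)"
        using field_differentiable_derivI[OF d(1)[OF mem]] unfolding a_def by (simp add: has_field_derivative_at_within)
      then show ?thesis by (simp only: has_field_derivative_def)
    qed
    show "((\<lambda>y. F (x, y)) has_derivative blinfun_apply (blinfun_mult_right (dsnd F (x, y)))) (at y within Y)"
      if "x \<in> X" "y \<in> Y" for x y
    proof -
      have "((\<lambda>y. F (x, y)) has_field_derivative dsnd F (x, y)) (at y within Y)"
        using field_differentiable_derivI[OF d(2)[OF that]]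
        by (simp add: has_field_derivative_at_within dsnd_def)
      then show ?thesis unfolding has_field_derivative_def blinfun_mult_right.rep_eq .
    qed
    have "continuous (at (x0, y0) within X \<times> Y) (dsnd F)"
    proof -
      have "continuous_on (X \<times> Y) (dsnd F)"
        using D XY continuous_on_subset unfolding sholo_def by blast
      then show ?thesis using mem by (simp add: continuous_on_eq_continuous_within)
    qed
    from bounded_linear.continuous[OF bounded_linear_blinfun_mult_right this]
    show "continuous (at (x0, y0) within X \<times> Y) (\<lambda>(x, y). blinfun_mult_right (dsnd F (x, y)))"
      unfolding case_prod_unfold prod.collapse .
    show "y0 \<in> Y" by fact
    show "convex Y" by (simp add: Y_def)
  qed
  moreover have "at (x0, y0) within X \<times> Y = at (x0, y0)"
    using mem by (intro at_within_open) (auto simp: X_def Y_def open_Times)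
  moreover have "(\<lambda>(tx, ty). a * tx + blinfun_apply (blinfun_mult_right (dsnd F (x0, y0))) ty) =
      (\<lambda>h. a * fst h + dsnd F (x0, y0) * snd h)"
    by (auto simp: fun_eq_iff)
  moreover have "(\<lambda>(x, y). F (x, y)) = F" by auto
  ultimately have "(F has_derivative (\<lambda>h. a * fst h + dsnd F (x0, y0) * snd h)) (at (x0, y0))"
    by (simp only:)
  then show ?thesis
    unfolding cdiff2_def p0 by - (rule exI[of _ a], rule exI[of _ "dsnd F (x0, y0)"])
qed

lemma cdiff2_compose:
  assumes "cdiff2 F (P p, Q p)" "cdiff2 P p" "cdiff2 Q p"
  shows "cdiff2 (\<lambda>p. F (P p, Q p)) p"
proof -
  obtain a b where F: "(F has_derivative (\<lambda>h. a * fst h + b * snd h)) (at (P p, Q p))"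
    using assms by (auto simp: cdiff2_def)
  obtain a1 b1 where P: "(P has_derivative (\<lambda>h. a1 * fst h + b1 * snd h)) (at p)"
    using assms by (auto simp: cdiff2_def)
  obtain a2 b2 where Q: "(Q has_derivative (\<lambda>h. a2 * fst h + b2 * snd h)) (at p)"
    using assms by (auto simp: cdiff2_def)
  have "((\<lambda>p. F (P p, Q p)) has_derivative
     (\<lambda>h. (a * a1 + b * a2) * fst h + (a * b1 + b * b2) * snd h)) (at p)"
    using has_derivative_compose[OF has_derivative_Pair[OF P Q] F] by (simp add: algebra_simps)
  then show ?thesis unfolding cdiff2_def by blast
qed

lemma cdiff2_compose1:
  assumes "h field_differentiable at (P p)" "cdiff2 P p"
  shows "cdiff2 (\<lambda>p. h (P p)) p"
proof -
  obtain c where h: "(h has_derivative (*) c) (at (P p))"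
    using assms by (auto simp: field_differentiable_def has_field_derivative_def)
  obtain a1 b1 where P: "(P has_derivative (\<lambda>h. a1 * fst h + b1 * snd h)) (at p)"
    using assms by (auto simp: cdiff2_def)
  have "((\<lambda>p. h (P p)) has_derivative (\<lambda>h. (c * a1) * fst h + (c * b1) * snd h)) (at p)"
    using has_derivative_compose[OF P h] by (simp add: algebra_simps)
  then show ?thesis unfolding cdiff2_def by blast
qed

lemma cdiff2_compose_curve:
  assumes "cdiff2 F (u t, v t)" "u field_differentiable at t" "v field_differentiable at t"
  shows "(\<lambda>t. F (u t, v t)) field_differentiable at t"
proof -
  obtain a b where F: "(F has_derivative (\<lambda>h. a * fst h + b * snd h)) (at (u t, v t))"
    using assms by (auto simp: cdiff2_def)
  obtain c where u: "(u has_derivative (*) c) (at t)"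
    using assms by (auto simp: field_differentiable_def has_field_derivative_def)
  obtain d where v: "(v has_derivative (*) d) (at t)"
    using assms by (auto simp: field_differentiable_def has_field_derivative_def)
  have "((\<lambda>t. F (u t, v t)) has_derivative (*) (a * c + b * d)) (at t)"
    by (rule has_derivative_eq_rhs[OF has_derivative_compose[OF has_derivative_Pair[OF u v] F]])
       (simp add: fun_eq_iff algebra_simps)
  then show ?thesis by (auto simp: field_differentiable_def has_field_derivative_def)
qed

lemma cdiff2_fst: "cdiff2 fst p" and cdiff2_snd: "cdiff2 snd p" and cdiff2_const: "cdiff2 (\<lambda>_. c) p"
proof -
  have "(fst has_derivative (\<lambda>h. 1 * fst h + 0 * snd h)) (at p)"
    by (auto intro!: derivative_eq_intros)
  then show "cdiff2 fst p" unfolding cdiff2_def by blast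
  have "(snd has_derivative (\<lambda>h. 0 * fst h + 1 * snd h)) (at p)"
    by (auto intro!: derivative_eq_intros)
  then show "cdiff2 snd p" unfolding cdiff2_def by blast
  have "((\<lambda>_. c) has_derivative (\<lambda>h. 0 * fst h + 0 * snd h)) (at p)"
    by (auto intro!: derivative_eq_intros)
  then show "cdiff2 (\<lambda>_. c) p" unfolding cdiff2_def by blast
qed

lemma cdiff2_isCont: "cdiff2 F p \<Longrightarrow> isCont F p"
  unfolding cdiff2_def using has_derivative_continuous by blast

lemma cdiff2_add: assumes "cdiff2 P p" "cdiff2 Q p" shows "cdiff2 (\<lambda>p. P p + Q p) p"
proof -
  obtain a1 b1 where P: "(P has_derivative (\<lambda>h. a1 * fst h + b1 * snd h)) (at p)"
    using assms by (auto simp: cdiff2_def)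
  obtain a2 b2 where Q: "(Q has_derivative (\<lambda>h. a2 * fst h + b2 * snd h)) (at p)"
    using assms by (auto simp: cdiff2_def)
  have "((\<lambda>p. P p + Q p) has_derivative (\<lambda>h. (a1 + a2) * fst h + (b1 + b2) * snd h)) (at p)"
    using has_derivative_add[OF P Q] by (simp add: algebra_simps)
  then show ?thesis unfolding cdiff2_def by blast
qed

lemma cdiff2_mult: assumes "cdiff2 P p" "cdiff2 Q p" shows "cdiff2 (\<lambda>p. P p * Q p) p"
proof -
  obtain a1 b1 where P: "(P has_derivative (\<lambda>h. a1 * fst h + b1 * snd h)) (at p)"
    using assms by (auto simp: cdiff2_def)
  obtain a2 b2 where Q: "(Q has_derivative (\<lambda>h. a2 * fst h + b2 * snd h)) (at p)"
    using assms by (auto simp: cdiff2_def)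
  have "((\<lambda>p. P p * Q p) has_derivative
      (\<lambda>h. (P p * a2 + a1 * Q p) * fst h + (P p * b2 + b1 * Q p) * snd h)) (at p)"
    using has_derivative_mult[OF P Q] by (simp add: algebra_simps)
  then show ?thesis unfolding cdiff2_def by blast
qed

lemma cdiff2_sholo:
  assumes "open U" "\<And>p. p \<in> U \<Longrightarrow> cdiff2 F p"
  shows "sholo F U"
proof -
  have "(\<lambda>u. F (u, y)) field_differentiable at x" "(\<lambda>v. F (x, v)) field_differentiable at y"
    if "(x, y) \<in> U" for x y
    using cdiff2_compose_curve[of F "\<lambda>u. u" x "\<lambda>_. y"] cdiff2_compose_curve[of F "\<lambda>_. x" y "\<lambda>v. v"]
      assms(2)[OF that] by auto
  moreover have "continuous_on U F"
    using assms cdiff2_isCont by (simp add: continuous_at_imp_continuous_on)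
  ultimately show ?thesis using assms unfolding sholo_def by blast
qed

section \<open>Power series in two variables\<close>

lemma dsnd_apply: "dsnd F (x, y) = deriv (\<lambda>v. F (x, v)) y"
  by (simp add: dsnd_def)

lemma dsnd_funpow: "(dsnd ^^ j) F (x, y) = (deriv ^^ j) (\<lambda>v. F (x, v)) y"
proof (induction j arbitrary: y)
  case (Suc j)
  have "(\<lambda>v. (dsnd ^^ j) F (x, v)) = (deriv ^^ j) (\<lambda>v. F (x, v))"
    using Suc by auto
  then show ?case by (simp add: dsnd_apply)
qed simp

lemma sholo_dsnd_funpow: "sholo F U \<Longrightarrow> sholo ((dsnd ^^ j) F) U"
  by (induction j) (auto intro: sholo_dsnd)

lemma geometric2_summable:
  fixes s t C :: real
  assumes "0 \<le> s" "s < 1" "0 \<le> t" "t < 1" "0 \<le> C"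
  shows "(\<lambda>(i, j). C * s ^ i * t ^ j) summable_on (UNIV :: (nat \<times> nat) set)"
proof -
  have geo: "((\<lambda>j. t ^ j) has_sum (1 / (1 - t))) (UNIV :: nat set)"
    if "0 \<le> t" "t < 1" for t :: real
    using that geometric_sums[of t] by (intro sums_nonneg_imp_has_sum) auto
  have "(\<lambda>(i, j). C * s ^ i * t ^ j) summable_on Sigma (UNIV :: nat set) (\<lambda>_. UNIV :: nat set)"
  proof (rule summable_on_SigmaI)
    fix i :: nat
    show "((\<lambda>j. case (i, j) of (i, j) \<Rightarrow> C * s ^ i * t ^ j) has_sum (C * s ^ i * (1 / (1 - t)))) UNIV"
      using has_sum_cmult_right[OF geo[of t], of "C * s ^ i"] assms by simp
  next
    have "((\<lambda>i. (C * (1 / (1 - t))) * s ^ i) has_sum ((C * (1 / (1 - t))) * (1 / (1 - s)))) UNIV"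
      using assms by (intro has_sum_cmult_right geo)
    then show "(\<lambda>i. C * s ^ i * (1 / (1 - t))) summable_on UNIV"
      by (auto simp: mult_ac dest: has_sum_imp_summable)
  qed (use assms in auto)
  then show ?thesis by simp
qed

text \<open>Expanding in \<open>y\<close> and then expanding the coefficients \<open>c j\<close> in
  \<open>x\<close> gives an iterated series, which Cauchy's inequality applied twice makes
  absolutely summable as a double series. The coefficient bound is kept in the conclusion because
  \<open>order_criterion\<close> reads off the order from it.\<close>

lemma sholo_expansion:
  assumes F: "sholo F U" and U0: "0 \<in> U"
  obtains a \<rho> where "0 < \<rho>" "has_expansion2 F a"
    "\<And>R M i j. \<lbrakk>0 < R; R < \<rho>; \<And>x y. \<lbrakk>norm x \<le> R; norm y \<le> R\<rbrakk> \<Longrightarrow> norm (F (x, y)) \<le> M\<rbrakk>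
        \<Longrightarrow> norm (a i j) \<le> M / R ^ (i + j)"
proof -
  have U00: "(0, 0) \<in> U" using U0 by (simp add: zero_prod_def)
  obtain \<rho> M0 where \<rho>: "0 < \<rho>" and sub: "cball 0 \<rho> \<times> cball 0 \<rho> \<subseteq> U" and M0pos: "0 < M0"
    and M0: "\<And>x y. x \<in> cball 0 \<rho> \<Longrightarrow> y \<in> cball 0 \<rho> \<Longrightarrow> norm (F (x, y)) \<le> M0"
    and hv: "\<And>x. x \<in> cball 0 \<rho> \<Longrightarrow> (\<lambda>v. F (x, v)) holomorphic_on ball 0 \<rho>"
    and hu: "\<And>y. y \<in> cball 0 \<rho> \<Longrightarrow> (\<lambda>u. F (u, y)) holomorphic_on ball 0 \<rho>"
    using sholo_box[OF F U00] by metis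
  define c where "c = (\<lambda>j x. (deriv ^^ j) (\<lambda>v. F (x, v)) 0 / fact j)"
  define a where "a = (\<lambda>i j. (deriv ^^ i) (c j) 0 / fact i)"
  have hc: "c j holomorphic_on ball 0 \<rho>" for j
    unfolding holomorphic_on_def
  proof
    fix x :: complex assume x: "x \<in> ball 0 \<rho>"
    then have "(x, 0) \<in> U" using sub \<rho> by auto
    then have "(\<lambda>u. (dsnd ^^ j) F (u, 0)) field_differentiable at x"
      using sholo_dsnd_funpow[OF F] by (simp add: sholo_def)
    then have "(\<lambda>u. (deriv ^^ j) (\<lambda>v. F (u, v)) 0) field_differentiable at x"
      by (simp add: dsnd_funpow)
    then show "c j field_differentiable at x within ball 0 \<rho>"
      unfolding c_def using field_differentiable_divide[of _ x UNIV "\<lambda>_. fact j"]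
      by (simp add: field_differentiable_at_within)
  qed
  have ball_cball: "cball 0 R \<subseteq> ball (0::complex) \<rho>" "ball 0 R \<subseteq> ball (0::complex) \<rho>" if "R < \<rho>" for R
    using that by auto
  have cb: "norm (c j x) \<le> M / R ^ j"
    if R: "0 < R" "R < \<rho>" and M: "\<And>x y. \<lbrakk>norm x \<le> R; norm y \<le> R\<rbrakk> \<Longrightarrow> norm (F (x, y)) \<le> M"
      and x: "norm x \<le> R" for R M j x
  proof -
    have h: "(\<lambda>v. F (x, v)) holomorphic_on ball 0 \<rho>" using hv[of x] x R by auto
    have "norm ((deriv ^^ j) (\<lambda>v. F (x, v)) 0) \<le> fact j * M / R ^ j"
    proof (rule Cauchy_inequality)
      show "(\<lambda>v. F (x, v)) holomorphic_on ball 0 R"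
        using h ball_cball(2)[OF R(2)] by (rule holomorphic_on_subset)
      show "continuous_on (cball 0 R) (\<lambda>v. F (x, v))"
        using holomorphic_on_imp_continuous_on[OF h] ball_cball(1)[OF R(2)] by (rule continuous_on_subset)
    qed (use R M x in auto)
    then show ?thesis by (simp add: c_def norm_divide field_simps)
  qed
  have ab: "norm (a i j) \<le> M / R ^ (i + j)"
    if R: "0 < R" "R < \<rho>" and M: "\<And>x y. \<lbrakk>norm x \<le> R; norm y \<le> R\<rbrakk> \<Longrightarrow> norm (F (x, y)) \<le> M"
    for R M i j
  proof -
    have "norm ((deriv ^^ i) (c j) 0) \<le> fact i * (M / R ^ j) / R ^ i"
    proof (rule Cauchy_inequality)
      show "c j holomorphic_on ball 0 R"
        using hc ball_cball(2)[OF R(2)] by (rule holomorphic_on_subset)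
      show "continuous_on (cball 0 R) (c j)"
        using holomorphic_on_imp_continuous_on[OF hc] ball_cball(1)[OF R(2)] by (rule continuous_on_subset)
      show "norm (c j x) \<le> M / R ^ j" if "norm (0 - x) = R" for x
        using that by (intro cb R M) auto
    qed (use R in auto)
    then show ?thesis by (simp add: a_def norm_divide field_simps power_add)
  qed
  have "has_expansion2 F a"
    unfolding has_expansion2_def
  proof (intro exI conjI allI impI)
    define R where "R = \<rho> / 2"
    have R: "0 < R" "R < \<rho>" using \<rho> by (auto simp: R_def)
    have MR: "norm (F (x, y)) \<le> M0" if "norm x \<le> R" "norm y \<le> R" for x y
      using that R by (intro M0) auto
    show "0 < \<rho> / 2" using \<rho> by simp
    fix x y :: complex assume xy: "norm x < \<rho> / 2 \<and> norm y < \<rho> / 2"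
    define s where "s = norm x / R"
    define t where "t = norm y / R"
    have st: "0 \<le> s" "s < 1" "0 \<le> t" "t < 1" using xy R by (auto simp: s_def t_def R_def field_simps)
    have tb: "norm (a i j * x ^ i * y ^ j) \<le> M0 * s ^ i * t ^ j" for i j
    proof -
      have "norm (a i j * x ^ i * y ^ j) \<le> (M0 / R ^ (i + j)) * norm x ^ i * norm y ^ j"
        unfolding norm_mult norm_power using ab[OF R MR, of i j]
        by (intro mult_right_mono) auto
      also have "\<dots> = M0 * s ^ i * t ^ j"
        by (simp add: s_def t_def power_divide power_add)
      finally show ?thesis .
    qed
    define f where "f = (\<lambda>(j, i). a i j * x ^ i * y ^ j)"
    have sumf: "f summable_on UNIV"
    proof (rule Infinite_Sum.abs_summable_summable, rule Infinite_Sum.abs_summable_on_comparison_test')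
      show "(\<lambda>(j, i). M0 * t ^ j * s ^ i) summable_on (UNIV :: (nat \<times> nat) set)"
        using st M0pos by (intro geometric2_summable) auto
      show "norm (f p) \<le> (case p of (j, i) \<Rightarrow> M0 * t ^ j * s ^ i)" for p
        using tb by (auto simp: f_def mult_ac split: prod.splits)
    qed
    \<comment> \<open>Pairs are indexed as \<open>(j, i)\<close> so that the inner sum runs over
      powers of \<open>x\<close>; a swap at the end restores the order of
      \<open>has_expansion2\<close>.\<close>
    have "(f has_sum F (x, y)) (Sigma UNIV (\<lambda>_. UNIV))"
    proof (rule has_sum_SigmaI)
      show "((\<lambda>i. f (j, i)) has_sum (c j x * y ^ j)) UNIV" for j
      proof -
        have "((\<lambda>i. (deriv ^^ i) (c j) 0 / fact i * (x - 0) ^ i) sums c j x)"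
          using xy \<rho> by (intro holomorphic_power_series[OF hc]) auto
        then have 1: "(\<lambda>i. f (j, i)) sums (c j x * y ^ j)"
          unfolding f_def using sums_mult2[of "\<lambda>i. a i j * x ^ i" "c j x" "y ^ j"] by (simp add: a_def)
        have "(\<lambda>i. f (j, i)) summable_on UNIV"
          using summable_on_subset_banach[OF sumf subset_UNIV, of "range (Pair j)"]
            summable_on_reindex[of "Pair j" UNIV f] by (auto simp: o_def inj_on_def)
        then show ?thesis using 1
          by (metis has_sum_imp_sums has_sum_infsum sums_unique2)
      qed
      have "((\<lambda>j. (deriv ^^ j) (\<lambda>v. F (x, v)) 0 / fact j * (y - 0) ^ j) sums F (x, y))"
        using xy \<rho> by (intro holomorphic_power_series[OF hv]) auto
      then have 1: "(\<lambda>j. c j x * y ^ j) sums F (x, y)" by (simp add: c_def)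
      have "summable (\<lambda>j. norm (c j x * y ^ j))"
      proof (rule summable_comparison_test')
        show "summable (\<lambda>j. M0 * t ^ j)" using st by (intro summable_mult summable_geometric) auto
        show "norm (norm (c j x * y ^ j)) \<le> M0 * t ^ j" if "j \<ge> 0" for j
        proof -
          have "norm (c j x * y ^ j) \<le> (M0 / R ^ j) * norm y ^ j"
            unfolding norm_mult norm_power using cb[OF R MR, of x j] xy
            by (intro mult_right_mono) (auto simp: R_def)
          then show ?thesis by (simp add: t_def power_divide)
        qed
      qed
      then show "((\<lambda>j. c j x * y ^ j) has_sum F (x, y)) UNIV"
        using 1 by (rule norm_summable_imp_has_sum)
      show "f summable_on Sigma UNIV (\<lambda>_. UNIV)" using sumf by simp
    qed
    then show "((\<lambda>(i, j). a i j * x ^ i * y ^ j) has_sum F (x, y)) UNIV"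
      using has_sum_swap[where f = f and S = "F (x, y)" and A = UNIV and B = UNIV] by (simp add: f_def case_prod_unfold)
  qed
  then show ?thesis using that \<rho> ab by blast
qed

lemma expansion_abs_summable:
  fixes a :: "nat \<Rightarrow> nat \<Rightarrow> complex"
  assumes e: "\<And>x y. norm x < \<rho> \<Longrightarrow> norm y < \<rho> \<Longrightarrow> ((\<lambda>(i, j). a i j * x ^ i * y ^ j) has_sum f (x, y)) UNIV"
    and r: "0 \<le> r" "r < \<rho>"
  shows "(\<lambda>(i, j). norm (a i j) * r ^ i * r ^ j) summable_on UNIV"
proof -
  have "(\<lambda>(i, j). a i j * of_real r ^ i * of_real r ^ j) summable_on UNIV"
    using e[of "of_real r" "of_real r"] r by (auto dest: has_sum_imp_summable)
  then have "(\<lambda>p. norm (case p of (i, j) \<Rightarrow> a i j * of_real r ^ i * of_real r ^ j)) summable_on UNIV"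
    by (simp only: summable_on_iff_abs_summable_on_complex)
  moreover have "(\<lambda>p. norm (case p of (i, j) \<Rightarrow> a i j * of_real r ^ i * of_real r ^ j)) =
      (\<lambda>(i, j). norm (a i j) * r ^ i * r ^ j)"
    using r by (auto simp: norm_mult norm_power fun_eq_iff)
  ultimately show ?thesis by simp
qed

text \<open>On a smaller closed bidisc the series is dominated by its absolute values at radius
  \<open>r\<close>, so its finite partial sums converge uniformly and hand on continuity and
  holomorphy in each variable.\<close>

lemma expansion_sholo:
  assumes "has_expansion2 F a"
  obtains r where "0 < r" "sholo F (ball 0 r \<times> ball 0 r)"
proof -
  obtain \<rho> where \<rho>: "\<rho> > 0"
    and e: "\<And>x y. norm x < \<rho> \<Longrightarrow> norm y < \<rho> \<Longrightarrow> ((\<lambda>(i, j). a i j * x ^ i * y ^ j) has_sum F (x, y)) UNIV"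
    using assms unfolding has_expansion2_def by blast
  define r where "r = \<rho> / 2"
  have r: "0 < r" "r < \<rho>" using \<rho> by (auto simp: r_def)
  define f where "f = (\<lambda>q p. a (fst q) (snd q) * fst p ^ fst q * snd p ^ snd q)"
  have ul: "uniform_limit (cball 0 r \<times> cball 0 r) (\<lambda>X p. \<Sum>q\<in>X. f q p) F (finite_subsets_at_top UNIV)"
  proof (rule Weierstrass_m_test_general')
    show "(\<lambda>(i, j). norm (a i j) * r ^ i * r ^ j) summable_on UNIV"
      using expansion_abs_summable[OF e] r by auto
    show "((\<lambda>q. f q p) has_sum F p) UNIV" if "p \<in> cball 0 r \<times> cball 0 r" for p
      using e[of "fst p" "snd p"] that r by (auto simp: f_def case_prod_unfold mem_Times_iff)
    show "norm (f q p) \<le> (case q of (i, j) \<Rightarrow> norm (a i j) * r ^ i * r ^ j)"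
      if "q \<in> UNIV" "p \<in> cball 0 r \<times> cball 0 r" for q p
      using that r unfolding f_def case_prod_unfold norm_mult norm_power
      by (intro mult_mono power_mono) (auto simp: mem_Times_iff)
  qed
  have "continuous_on (cball 0 r \<times> cball 0 r) F"
    by (rule uniform_limit_theorem[OF _ ul])
       (auto simp: f_def intro!: always_eventually continuous_intros)
  then have cont: "continuous_on (ball 0 r \<times> ball 0 r) F"
    by (rule continuous_on_subset) auto
  have hu: "(\<lambda>u. F (u, y)) holomorphic_on ball 0 r" if y: "y \<in> ball 0 r" for y
  proof (rule holomorphic_uniform_limit[where z = 0 and r = r and f = "\<lambda>X u. \<Sum>q\<in>X. f q (u, y)"
        and g = "\<lambda>u. F (u, y)" and F = "finite_subsets_at_top UNIV"])
    show "uniform_limit (cball 0 r) (\<lambda>X u. \<Sum>q\<in>X. f q (u, y)) (\<lambda>u. F (u, y)) (finite_subsets_at_top UNIV)"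
    proof (rule uniform_limitI)
      fix e :: real assume "e > 0"
      from uniform_limitD[OF ul this]
      show "\<forall>\<^sub>F X in finite_subsets_at_top UNIV. \<forall>u\<in>cball 0 r. dist (\<Sum>q\<in>X. f q (u, y)) (F (u, y)) < e"
        by (rule eventually_mono) (use y in auto)
    qed
  qed (auto simp: f_def intro!: always_eventually continuous_intros holomorphic_intros)
  have hv: "(\<lambda>v. F (x, v)) holomorphic_on ball 0 r" if x: "x \<in> ball 0 r" for x
  proof (rule holomorphic_uniform_limit[where z = 0 and r = r and f = "\<lambda>X v. \<Sum>q\<in>X. f q (x, v)"
        and g = "\<lambda>v. F (x, v)" and F = "finite_subsets_at_top UNIV"])
    show "uniform_limit (cball 0 r) (\<lambda>X v. \<Sum>q\<in>X. f q (x, v)) (\<lambda>v. F (x, v)) (finite_subsets_at_top UNIV)"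
    proof (rule uniform_limitI)
      fix e :: real assume "e > 0"
      from uniform_limitD[OF ul this]
      show "\<forall>\<^sub>F X in finite_subsets_at_top UNIV. \<forall>v\<in>cball 0 r. dist (\<Sum>q\<in>X. f q (x, v)) (F (x, v)) < e"
        by (rule eventually_mono) (use x in auto)
    qed
  qed (auto simp: f_def intro!: always_eventually continuous_intros holomorphic_intros)
  have "sholo F (ball 0 r \<times> ball 0 r)"
    unfolding sholo_def
  proof (intro conjI allI impI)
    fix x y :: complex assume "(x, y) \<in> ball 0 r \<times> ball 0 r"
    then show "(\<lambda>u. F (u, y)) field_differentiable at x" "(\<lambda>v. F (x, v)) field_differentiable at y"
      using hu[of y] hv[of x] holomorphic_on_imp_differentiable_at[of _ "ball 0 r"] by auto
  qed (use cont in \<open>auto intro: open_Times\<close>)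
  then show ?thesis using that r by blast
qed

text \<open>The bridge between convergent double series and complex differentiability near 0;
  closure under arithmetic and composition is proved on the differentiable side.\<close>

lemma analytic2_iff: "analytic2 F \<longleftrightarrow> (\<forall>\<^sub>F p in nhds 0. cdiff2 F p)"
proof
  assume "analytic2 F"
  then obtain a where "has_expansion2 F a" by (auto simp: analytic2_def)
  then obtain r where r: "0 < r" "sholo F (ball 0 r \<times> ball 0 r)" by (rule expansion_sholo)
  have "\<forall>\<^sub>F p in nhds 0. p \<in> ball 0 r \<times> ball (0::complex) r"
    using r by (intro eventually_nhds_in_open) (auto simp: zero_prod_def intro: open_Times)
  then show "\<forall>\<^sub>F p in nhds 0. cdiff2 F p"
    by (rule eventually_mono) (use sholo_cdiff2[OF r(2)] in blast)
next
  assume "\<forall>\<^sub>F p in nhds 0. cdiff2 F p"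
  then obtain U where "open U" "0 \<in> U" "\<And>p. p \<in> U \<Longrightarrow> cdiff2 F p"
    unfolding eventually_nhds by blast
  then show "analytic2 F"
    using sholo_expansion[OF cdiff2_sholo] unfolding analytic2_def by metis
qed

lemma analytic_at_iff_eventually:
  "h analytic_on {z} \<longleftrightarrow> (\<forall>\<^sub>F t in nhds z. h field_differentiable at t)"
proof
  assume "h analytic_on {z}"
  then obtain S where "open S" "z \<in> S" "h holomorphic_on S" by (auto simp: analytic_at)
  then show "\<forall>\<^sub>F t in nhds z. h field_differentiable at t"
    unfolding eventually_nhds using holomorphic_on_imp_differentiable_at by blast
next
  assume "\<forall>\<^sub>F t in nhds z. h field_differentiable at t"
  then obtain S where "open S" "z \<in> S" "\<And>t. t \<in> S \<Longrightarrow> h field_differentiable at t"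
    by (auto simp: eventually_nhds)
  then show "h analytic_on {z}"
    by (auto simp: analytic_at holomorphic_on_def intro: field_differentiable_at_within)
qed

section \<open>Analytic germs: limits, arithmetic and composition\<close>

lemma analytic2_isCont: "analytic2 F \<Longrightarrow> isCont F 0"
  unfolding analytic2_iff using cdiff2_isCont eventually_nhds_x_imp_x by blast

lemma analytic2_tendsto: "analytic2 F \<Longrightarrow> filterlim F (nhds (F 0)) (nhds 0)"
  using analytic2_isCont[of F] by (simp add: isCont_def tendsto_at_iff_tendsto_nhds)

lemma analytic_tendsto: "h analytic_on {z} \<Longrightarrow> filterlim h (nhds (h z)) (nhds z)"
  using analytic_at_imp_isCont[of h z] by (simp add: isCont_def tendsto_at_iff_tendsto_nhds)

lemma eventually_compose2:
  assumes "\<forall>\<^sub>F p in nhds 0. A p" "analytic2 P" "analytic2 Q" "P 0 = 0" "Q 0 = 0"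
  shows "\<forall>\<^sub>F p in nhds 0. A (P p, Q p)"
proof (rule eventually_compose_filterlim[OF assms(1)])
  show "filterlim (\<lambda>p. (P p, Q p)) (nhds 0) (nhds 0)"
    using tendsto_Pair[OF analytic2_tendsto[OF assms(2)] analytic2_tendsto[OF assms(3)]] assms
    by (simp add: zero_prod_def)
qed

lemma eventually_compose_curve:
  assumes "\<forall>\<^sub>F p in nhds 0. A p" "u analytic_on {0}" "v analytic_on {0}" "u 0 = 0" "v 0 = 0"
  shows "\<forall>\<^sub>F t in nhds 0. A (u t, v t)"
proof (rule eventually_compose_filterlim[OF assms(1)])
  show "filterlim (\<lambda>t. (u t, v t)) (nhds 0) (nhds 0)"
    using tendsto_Pair[OF analytic_tendsto[OF assms(2)] analytic_tendsto[OF assms(3)]] assms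
    by (simp add: zero_prod_def)
qed

lemma eventually_compose21:
  assumes "\<forall>\<^sub>F t in nhds (P 0). A t" "analytic2 P"
  shows "\<forall>\<^sub>F p in nhds 0. A (P p)"
  using eventually_compose_filterlim[OF assms(1) analytic2_tendsto[OF assms(2)]] .

lemma eventually_compose11:
  assumes "\<forall>\<^sub>F t in nhds (u z). A t" "u analytic_on {z}"
  shows "\<forall>\<^sub>F t in nhds z. A (u t)"
  using eventually_compose_filterlim[OF assms(1) analytic_tendsto[OF assms(2)]] .

lemma analytic2_const: "analytic2 (\<lambda>_. c)"
  and analytic2_fst: "analytic2 (\<lambda>p. fst p)"
  and analytic2_snd: "analytic2 (\<lambda>p. snd p)"
  by (simp_all add: analytic2_iff cdiff2_const cdiff2_fst cdiff2_snd)

lemma analytic2_add: "analytic2 P \<Longrightarrow> analytic2 Q \<Longrightarrow> analytic2 (\<lambda>p. P p + Q p)"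
  unfolding analytic2_iff by (erule (1) eventually_elim2) (rule cdiff2_add)

lemma analytic2_mult: "analytic2 P \<Longrightarrow> analytic2 Q \<Longrightarrow> analytic2 (\<lambda>p. P p * Q p)"
  unfolding analytic2_iff by (erule (1) eventually_elim2) (rule cdiff2_mult)

lemma analytic2_diff: "analytic2 P \<Longrightarrow> analytic2 Q \<Longrightarrow> analytic2 (\<lambda>p. P p - Q p)"
  using analytic2_add[OF _ analytic2_mult[OF analytic2_const[of "-1"]], of P Q] by simp

lemma analytic2_power: "analytic2 P \<Longrightarrow> analytic2 (\<lambda>p. P p ^ n)"
  by (induction n) (auto intro: analytic2_const analytic2_mult)

lemma analytic2_sum: "(\<And>i. i \<in> I \<Longrightarrow> analytic2 (P i)) \<Longrightarrow> analytic2 (\<lambda>p. \<Sum>i\<in>I. P i p)"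
  by (induction I rule: infinite_finite_induct) (auto intro: analytic2_const analytic2_add)

lemma analytic2_prod: "(\<And>i. i \<in> I \<Longrightarrow> analytic2 (P i)) \<Longrightarrow> analytic2 (\<lambda>p. \<Prod>i\<in>I. P i p)"
  by (induction I rule: infinite_finite_induct) (auto intro: analytic2_const analytic2_mult)

lemma analytic2_compose:
  assumes "analytic2 F" "analytic2 P" "analytic2 Q" "P 0 = 0" "Q 0 = 0"
  shows "analytic2 (\<lambda>p. F (P p, Q p))"
proof -
  have "\<forall>\<^sub>F p in nhds 0. cdiff2 F (P p, Q p)"
    using assms by (intro eventually_compose2) (auto simp: analytic2_iff)
  moreover have "\<forall>\<^sub>F p in nhds 0. cdiff2 P p" "\<forall>\<^sub>F p in nhds 0. cdiff2 Q p"
    using assms by (auto simp: analytic2_iff)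
  ultimately show ?thesis
    unfolding analytic2_iff by eventually_elim (rule cdiff2_compose)
qed

lemma analytic2_compose1:
  assumes "h analytic_on {P 0}" "analytic2 P"
  shows "analytic2 (\<lambda>p. h (P p))"
proof -
  have "\<forall>\<^sub>F p in nhds 0. h field_differentiable at (P p)"
    using assms by (intro eventually_compose21) (auto simp: analytic_at_iff_eventually)
  moreover have "\<forall>\<^sub>F p in nhds 0. cdiff2 P p" using assms by (auto simp: analytic2_iff)
  ultimately show ?thesis
    unfolding analytic2_iff by eventually_elim (rule cdiff2_compose1)
qed

lemma analytic2_compose_fst: "h analytic_on {0} \<Longrightarrow> analytic2 (\<lambda>p. h (fst p))"
  by (rule analytic2_compose1[OF _ analytic2_fst]) simp

lemma analytic_compose_curve:
  assumes "analytic2 F" "u analytic_on {0}" "v analytic_on {0}" "u 0 = 0" "v 0 = 0"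
  shows "(\<lambda>t. F (u t, v t)) analytic_on {0}"
proof -
  have "\<forall>\<^sub>F t in nhds 0. cdiff2 F (u t, v t)"
    using assms by (intro eventually_compose_curve) (auto simp: analytic2_iff)
  moreover have "\<forall>\<^sub>F t in nhds 0. u field_differentiable at t" "\<forall>\<^sub>F t in nhds 0. v field_differentiable at t"
    using assms by (auto simp: analytic_at_iff_eventually)
  ultimately show ?thesis
    unfolding analytic_at_iff_eventually by eventually_elim (rule cdiff2_compose_curve)
qed

lemmas analytic2_intros = analytic2_const analytic2_fst analytic2_snd analytic2_add analytic2_mult
  analytic2_diff analytic2_power analytic2_sum analytic2_prod

lemma analytic2_sholo:
  assumes "analytic2 F"
  obtains U where "sholo F U" "0 \<in> U"
  using assms cdiff2_sholo unfolding analytic2_iff eventually_nhds by blast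

lemma sholo_analytic2: "sholo F U \<Longrightarrow> 0 \<in> U \<Longrightarrow> analytic2 F"
  using sholo_cdiff2 unfolding analytic2_iff eventually_nhds sholo_def by blast

lemma analytic2_dsnd: "analytic2 F \<Longrightarrow> analytic2 (dsnd F)"
  by (metis analytic2_sholo sholo_analytic2 sholo_dsnd)

lemma analytic2_dsnd_funpow: "analytic2 F \<Longrightarrow> analytic2 ((dsnd ^^ j) F)"
  by (induction j) (auto intro: analytic2_dsnd)

section \<open>Division by a graph, expansion in the second variable, implicit functions\<close>

lemma eventually_slice:
  assumes "\<forall>\<^sub>F p in nhds (0 :: complex \<times> complex). A p"
  shows "\<forall>\<^sub>F x in nhds 0. \<forall>\<^sub>F y in nhds 0. A (x, y)"
proof -
  have "\<forall>\<^sub>F p in nhds (0 :: complex \<times> complex). \<forall>\<^sub>F q in nhds p. A q"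
    using assms by (simp add: eventually_eventually)
  then have "\<forall>\<^sub>F x in nhds 0. \<forall>\<^sub>F q in nhds (x, 0 :: complex). A q"
    by (rule eventually_compose_curve) (auto intro!: analytic_intros)
  then show ?thesis
  proof eventually_elim
    case (elim x)
    have "filterlim (\<lambda>y. (x, y)) (nhds (x, 0)) (nhds (0::complex))"
      by (intro tendsto_Pair tendsto_const filterlim_ident)
    with elim show ?case by (rule eventually_compose_filterlim)
  qed
qed

text \<open>On the axis the quotient is defined by the derivative. Continuity there is the only
  delicate point: \<open>second_order_bound\<close> shows that the quotient differs from
  \<open>dsnd F (x, 0)\<close> by at most a multiple of \<open>norm y\<close>, uniformly in
  \<open>x\<close>.\<close>

lemma analytic2_divide_snd:
  assumes F: "analytic2 F" and F0: "\<forall>\<^sub>F x in nhds 0. F (x, 0) = 0"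
  shows "\<exists>G. analytic2 G \<and> (\<forall>\<^sub>F p in nhds 0. F p = snd p * G p)"
proof -
  obtain U where U: "sholo F U" "0 \<in> U" using F by (rule analytic2_sholo)
  obtain R M where R: "0 < R" and sub: "cball 0 R \<times> cball 0 R \<subseteq> U" and M0: "0 < M"
    and M: "\<And>x y. x \<in> cball 0 R \<Longrightarrow> y \<in> cball 0 R \<Longrightarrow> norm (F (x, y)) \<le> M"
    and hv: "\<And>x. x \<in> cball 0 R \<Longrightarrow> (\<lambda>v. F (x, v)) holomorphic_on ball 0 R"
    and hu: "\<And>y. y \<in> cball 0 R \<Longrightarrow> (\<lambda>u. F (u, y)) holomorphic_on ball 0 R"
    using sholo_box[OF U(1), of 0 0] U(2) by (metis zero_prod_def)
  obtain R' where R': "R' > 0" "\<And>x. norm x < R' \<Longrightarrow> F (x, 0) = 0"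
    using F0 unfolding eventually_nhds_metric by auto
  define R2 where "R2 = min R R'"
  have R2: "0 < R2" "R2 \<le> R" "R2 \<le> R'" using R R' by (auto simp: R2_def)
  define V where "V = ball (0::complex) R2 \<times> ball (0::complex) (R/2)"
  define G where "G = (\<lambda>p. if snd p = 0 then dsnd F (fst p, 0) else F p / snd p)"
  have oV: "open V" by (simp add: V_def open_Times)
  have VU: "V \<subseteq> U"
  proof
    fix p assume "p \<in> V"
    then have "fst p \<in> cball 0 R" "snd p \<in> cball 0 R" using R2 R by (auto simp: V_def mem_Times_iff)
    then show "p \<in> U" using sub by (metis mem_Times_iff subsetD)
  qed
  have sF: "sholo F V" and sD: "sholo (dsnd F) V"
    using U VU oV sholo_dsnd[OF U(1)] unfolding sholo_def
    by (auto intro: continuous_on_subset)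
  define C where "C = 2 * M / (R/4)^2"
  have C: "norm (G p - dsnd F (fst p, 0)) \<le> C * norm (snd p)" if p: "p \<in> V" for p
  proof (cases "snd p = 0")
    case False
    obtain x y where xy: "p = (x, y)" by (cases p)
    have x: "norm x < R" "norm x < R'" "norm y < R/2" using p R2 by (auto simp: xy V_def)
    have "norm (F (x, 0 + y) - F (x, 0) - deriv (\<lambda>v. F (x, v)) 0 * y) \<le> 2 * M / (R/4)^2 * norm y ^ 2"
      using x R M hv by (intro second_order_bound[where M = M and ?y0.0 = 0]) auto
    then have "norm (F (x, y) - dsnd F (x, 0) * y) \<le> C * norm y ^ 2"
      using R'(2)[OF x(2)] by (simp add: C_def dsnd_apply)
    moreover have "G p - dsnd F (fst p, 0) = (F (x, y) - dsnd F (x, 0) * y) / y"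
      using False by (simp add: G_def xy field_simps)
    ultimately show ?thesis
      using False by (simp add: xy norm_divide divide_le_eq power2_eq_square mult.assoc)
  qed (simp add: G_def)
  have "sholo G V"
    unfolding sholo_def
  proof (intro conjI allI impI)
    show "open V" by fact
    fix x y assume p: "(x, y) \<in> V"
    have x: "norm x < R" "norm x < R'" "norm y < R/2" using p R2 by (auto simp: V_def)
    show "(\<lambda>u. G (u, y)) field_differentiable at x"
    proof (cases "y = 0")
      case True
      then show ?thesis using sD p by (simp add: G_def sholo_def)
    next
      case False
      have "(\<lambda>u. F (u, y)) field_differentiable at x" using sF p by (simp add: sholo_def)
      then have "(\<lambda>u. F (u, y) / y) field_differentiable at x"
        using False by (intro field_differentiable_divide) auto
      then show ?thesis using False by (simp add: G_def)
    qed
    have "(\<lambda>z. if z = 0 then deriv (\<lambda>v. F (x, v)) 0 else (F (x, z) - F (x, 0)) / (z - 0)) holomorphic_on ball 0 R"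
      using hv[of x] x by (intro pole_lemma_open) auto
    moreover have "(\<lambda>z. if z = 0 then deriv (\<lambda>v. F (x, v)) 0 else (F (x, z) - F (x, 0)) / (z - 0)) = (\<lambda>v. G (x, v))"
      using R'(2)[OF x(2)] by (auto simp: G_def dsnd_apply fun_eq_iff)
    ultimately show "(\<lambda>v. G (x, v)) field_differentiable at y"
      using x R by (auto intro: holomorphic_on_imp_differentiable_at)
  next
    show "continuous_on V G"
    proof (rule continuous_at_imp_continuous_on, rule ballI)
      fix p assume p: "p \<in> V"
      have evV: "\<forall>\<^sub>F q in nhds p. q \<in> V" using oV p by (rule eventually_nhds_in_open)
      show "isCont G p"
      proof (cases "snd p = 0")
        case False
        have "isCont F p" using sF p oV by (simp add: sholo_def continuous_on_eq_continuous_at)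
        then have c: "isCont (\<lambda>q. F q / snd q) p" using False by (intro continuous_intros)
        have "\<forall>\<^sub>F q in nhds p. snd q \<noteq> 0"
        proof -
          have "filterlim snd (nhds (snd p)) (nhds p)" by (intro tendsto_intros filterlim_ident)
          then show ?thesis using False by (rule tendsto_imp_eventually_ne)
        qed
        then have "\<forall>\<^sub>F q in nhds p. G q = F q / snd q" by eventually_elim (simp add: G_def)
        then show ?thesis using c by (simp add: isCont_cong)
      next
        case True
        have cD: "isCont (dsnd F) (fst p, 0)"
          using sD p oV True by (metis continuous_on_eq_continuous_at prod.collapse sholo_def)
        have "(\<lambda>q. dsnd F (fst q, 0)) \<midarrow>p\<rightarrow> dsnd F (fst p, 0)"
          by (rule isCont_tendsto_compose[OF cD]) (intro tendsto_intros)
        moreover have "(\<lambda>q. G q - dsnd F (fst q, 0)) \<midarrow>p\<rightarrow> 0"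
        proof (rule Lim_null_comparison)
          show "\<forall>\<^sub>F q in at p. norm (G q - dsnd F (fst q, 0)) \<le> C * norm (snd q)"
            using evV C by (auto simp: eventually_at_filter elim: eventually_mono)
          have "(\<lambda>q. C * norm (snd q)) \<midarrow>p\<rightarrow> C * norm (snd p)" by (intro tendsto_intros)
          then show "(\<lambda>q. C * norm (snd q)) \<midarrow>p\<rightarrow> 0" using True by simp
        qed
        ultimately have "(\<lambda>q. G q - dsnd F (fst q, 0) + dsnd F (fst q, 0)) \<midarrow>p\<rightarrow> 0 + dsnd F (fst p, 0)"
          by (intro tendsto_add)
        then show ?thesis using True by (simp add: isCont_def G_def)
      qed
    qed
  qed
  moreover have V0: "0 \<in> V" using R R2 by (simp add: V_def zero_prod_def)
  ultimately have "analytic2 G" by (rule sholo_analytic2)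
  moreover have "\<forall>\<^sub>F p in nhds 0. p \<in> V" using oV V0 by (rule eventually_nhds_in_open)
  then have "\<forall>\<^sub>F p in nhds 0. F p = snd p * G p"
  proof eventually_elim
    case (elim p)
    then have "norm (fst p) < R'" using R2 by (auto simp: V_def mem_Times_iff)
    then show ?case using R'(2)[of "fst p"] by (cases p) (auto simp: G_def)
  qed
  ultimately show ?thesis by blast
qed

text \<open>The substitution of \<open>y + \<eta> x\<close> for \<open>y\<close> straightens the
  graph to the axis, where \<open>analytic2_divide_snd\<close> applies.\<close>

lemma analytic2_divide_graph:
  assumes F: "analytic2 F" and \<eta>: "\<eta> analytic_on {0}" "\<eta> 0 = 0"
    and F0: "\<forall>\<^sub>F x in nhds 0. F (x, \<eta> x) = 0"
  shows "\<exists>G. analytic2 G \<and> (\<forall>\<^sub>F p in nhds 0. F p = (snd p - \<eta> (fst p)) * G p)"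
proof -
  have a\<eta>: "analytic2 (\<lambda>p. \<eta> (fst p))"
    using \<eta>(1) by (rule analytic2_compose_fst)
  have "analytic2 (\<lambda>p. F (fst p, snd p + \<eta> (fst p)))"
    using \<eta>(2) by (intro analytic2_compose[OF F analytic2_fst analytic2_add[OF analytic2_snd a\<eta>]]) auto
  moreover have "\<forall>\<^sub>F x in nhds 0. F (fst (x, 0), snd (x, 0) + \<eta> (fst (x, 0))) = 0"
    using F0 by simp
  ultimately obtain G where G: "analytic2 G"
    "\<forall>\<^sub>F p in nhds 0. F (fst p, snd p + \<eta> (fst p)) = snd p * G p"
    using analytic2_divide_snd[of "\<lambda>p. F (fst p, snd p + \<eta> (fst p))"] by auto
  have aq: "analytic2 (\<lambda>p. snd p - \<eta> (fst p))" by (intro analytic2_intros a\<eta>)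
  have "analytic2 (\<lambda>p. G (fst p, snd p - \<eta> (fst p)))"
    using \<eta>(2) by (intro analytic2_compose[OF G(1) analytic2_fst aq]) auto
  moreover have "\<forall>\<^sub>F p in nhds 0. F p = (snd p - \<eta> (fst p)) * G (fst p, snd p - \<eta> (fst p))"
    using eventually_compose2[OF G(2) analytic2_fst aq] \<eta> by simp
  ultimately show ?thesis by (intro exI[of _ "\<lambda>p. G (fst p, snd p - \<eta> (fst p))"]) auto
qed

text \<open>Repeated division by \<open>y\<close>: the next coefficient is the remainder factor
  restricted to the axis, hence analytic in \<open>x\<close>.\<close>

lemma analytic2_taylor:
  assumes F: "analytic2 F"
  shows "\<exists>a U. (\<forall>j. a j analytic_on {0}) \<and> analytic2 U \<and>
    (\<forall>\<^sub>F p in nhds 0. F p = (\<Sum>j<m. a j (fst p) * snd p ^ j) + snd p ^ m * U p)"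
proof (induction m)
  case 0
  show ?case by (rule exI[of _ "\<lambda>_ _. 0"], rule exI[of _ F]) (use F in auto)
next
  case (Suc m)
  then obtain a U where a: "\<And>j. a j analytic_on {0}" and U: "analytic2 U"
    and eq: "\<forall>\<^sub>F p in nhds 0. F p = (\<Sum>j<m. a j (fst p) * snd p ^ j) + snd p ^ m * U p" by blast
  define b where "b = (\<lambda>x. U (x, 0))"
  have b: "b analytic_on {0}"
    unfolding b_def by (rule analytic_compose_curve[OF U]) (auto intro!: analytic_intros)
  have ab: "analytic2 (\<lambda>p. b (fst p))" using b by (rule analytic2_compose_fst)
  have "analytic2 (\<lambda>p. U p - b (fst p))" by (intro analytic2_diff U ab)
  then obtain V where V: "analytic2 V" "\<forall>\<^sub>F p in nhds 0. U p - b (fst p) = snd p * V p"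
    using analytic2_divide_snd[of "\<lambda>p. U p - b (fst p)"] by (auto simp: b_def)
  show ?case
  proof (intro exI conjI allI)
    show "(a(m := b)) j analytic_on {0}" for j using a b by auto
    show "analytic2 V" by fact
    show "\<forall>\<^sub>F p in nhds 0. F p = (\<Sum>j<Suc m. (a(m := b)) j (fst p) * snd p ^ j) + snd p ^ Suc m * V p"
      using eq V(2)
    proof eventually_elim
      case (elim p)
      have "U p = b (fst p) + snd p * V p" using elim(2) by (simp add: algebra_simps)
      moreover have "(\<Sum>j<m. (a(m := b)) j (fst p) * snd p ^ j) = (\<Sum>j<m. a j (fst p) * snd p ^ j)"
        by (intro sum.cong) auto
      ultimately show ?case using elim(1) by (simp add: algebra_simps)
    qed
  qed
qed

text \<open>The Newton map \<open>T\<close>, with the slope frozen at its value \<open>c\<close> at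
  the origin, contracts in \<open>y\<close> by 1/2, and its iterates from 0 are analytic in
  \<open>x\<close>. Their uniform limit is a fixed point of \<open>T\<close>, that is a zero of
  \<open>H\<close>.\<close>

lemma implicit_function:
  assumes H: "analytic2 H" and H0: "H 0 = 0" and d: "dsnd H 0 \<noteq> 0"
  shows "\<exists>\<tau>. \<tau> analytic_on {0} \<and> \<tau> 0 = 0 \<and> (\<forall>\<^sub>F x in nhds 0. H (x, \<tau> x) = 0)"
proof -
  define c where "c = dsnd H 0"
  define T where "T = (\<lambda>p. snd p - H p / c)"
  have T: "analytic2 T"
  proof -
    have "analytic2 (\<lambda>p. snd p - H p * (1 / c))" by (intro analytic2_intros H)
    then show ?thesis by (simp add: T_def)
  qed
  have "\<forall>\<^sub>F p in nhds 0. norm (1 - dsnd H p / c) < 1/2"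
  proof -
    have "((\<lambda>p. norm (1 - dsnd H p / c)) \<longlongrightarrow> norm (1 - dsnd H 0 / c)) (nhds 0)"
      using d by (intro tendsto_intros analytic2_tendsto analytic2_dsnd H) (auto simp: c_def)
    then show ?thesis using d by (auto simp: c_def dest!: order_tendstoD(2)[of _ _ _ "1/2"])
  qed
  then have "\<forall>\<^sub>F p in nhds 0. norm (1 - dsnd H p / c) < 1/2 \<and> cdiff2 T p \<and> cdiff2 H p"
    using T H unfolding analytic2_iff by eventually_elim auto
  then obtain \<rho> where \<rho>: "\<rho> > 0"
    and \<rho>': "\<And>p. dist p 0 < \<rho> \<Longrightarrow> norm (1 - dsnd H p / c) < 1/2 \<and> cdiff2 T p \<and> cdiff2 H p"
    unfolding eventually_nhds_metric by blast
  define r where "r = \<rho> / 3"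
  have r: "r > 0" using \<rho> by (simp add: r_def)
  have box: "norm (1 - dsnd H (x, y) / c) < 1/2" "cdiff2 T (x, y)" "cdiff2 H (x, y)"
    if "norm x \<le> r" "norm y \<le> r" for x y
  proof -
    have "norm (x, y) \<le> norm x + norm y" by (rule norm_Pair_le)
    then have "dist (x, y) 0 < \<rho>" using that \<rho> by (simp add: r_def)
    from \<rho>'[OF this] show "norm (1 - dsnd H (x, y) / c) < 1/2" "cdiff2 T (x, y)" "cdiff2 H (x, y)"
      by auto
  qed
  have contr: "norm (T (x, y) - T (x, y')) \<le> 1/2 * norm (y - y')"
    if x: "norm x \<le> r" and y: "norm y \<le> r" "norm y' \<le> r" for x y y'
  proof (rule field_differentiable_bound[of "cball 0 r" "\<lambda>v. T (x, v)" "\<lambda>v. 1 - dsnd H (x, v) / c"])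
    fix z :: complex assume z: "z \<in> cball 0 r"
    then have "(\<lambda>v. H (x, v)) field_differentiable at z"
      using box(3)[of x z] x cdiff2_compose_curve[where F = H and u = "\<lambda>_. x" and v = "\<lambda>v. v" and t = z] by auto
    then have "((\<lambda>v. H (x, v)) has_field_derivative dsnd H (x, z)) (at z)"
      by (simp add: dsnd_apply field_differentiable_derivI)
    moreover have "c \<noteq> 0" using d by (simp add: c_def)
    ultimately have "((\<lambda>v. T (x, v)) has_field_derivative 1 - dsnd H (x, z) / c) (at z)"
      unfolding T_def by (auto intro!: derivative_eq_intros)
    then show "((\<lambda>v. T (x, v)) has_field_derivative 1 - dsnd H (x, z) / c) (at z within cball 0 r)"
      by (rule has_field_derivative_at_within)
    show "norm (1 - dsnd H (x, z) / c) \<le> 1/2" using box(1)[of x z] x z by simp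
  qed (use y in auto)
  have T00: "T (0, 0) = 0" using H0 by (simp add: T_def zero_prod_def)
  have "(\<lambda>x. T (x, 0)) analytic_on {0}"
    by (rule analytic_compose_curve[OF T]) (auto intro!: analytic_intros)
  then have "((\<lambda>x. T (x, 0)) \<longlongrightarrow> 0) (nhds 0)" using analytic_tendsto T00 by fastforce
  \<comment> \<open>The margin \<open>r/4\<close> closes the induction for \<open>tb\<close>: an
    iterate of size at most \<open>r/2\<close> is sent to one of size at most
    \<open>r/4 + (r/2)/2\<close>.\<close>
  then have "\<forall>\<^sub>F x in nhds 0. norm (T (x, 0)) < r/4"
    using r tendstoD[of "\<lambda>x. T (x, 0)" 0 "nhds 0" "r/4"] by simp
  then obtain \<delta>0 where \<delta>0: "\<delta>0 > 0" "\<And>x. norm x < \<delta>0 \<Longrightarrow> norm (T (x, 0)) < r/4"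
    unfolding eventually_nhds_metric by auto
  define \<delta> where "\<delta> = min \<delta>0 r"
  have \<delta>: "\<delta> > 0" "\<And>x. norm x < \<delta> \<Longrightarrow> norm (T (x, 0)) < r/4" "\<And>x. norm x < \<delta> \<Longrightarrow> norm x \<le> r"
    using \<delta>0 r by (auto simp: \<delta>_def)
  define t where "t = rec_nat (\<lambda>_. 0) (\<lambda>_ u x. T (x, u x))"
  have t0: "t 0 = (\<lambda>_. 0)" and tS: "t (Suc k) = (\<lambda>x. T (x, t k x))" for k
    by (auto simp: t_def)
  have tb: "norm (t k x) \<le> r/2" if "norm x < \<delta>" for k x
  proof (induction k)
    case (Suc k)
    have "norm (T (x, t k x)) \<le> norm (T (x, 0)) + norm (T (x, t k x) - T (x, 0))"
      using norm_triangle_ineq[of "T (x, 0)" "T (x, t k x) - T (x, 0)"] by simp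
    moreover have "norm (T (x, t k x) - T (x, 0)) \<le> 1/2 * norm (t k x - 0)"
      using Suc r \<delta>(3)[OF that] by (intro contr) auto
    ultimately show ?case using Suc \<delta>(2)[OF that] by (simp add: tS)
  qed (use r in \<open>simp add: t0\<close>)
  have td: "norm (t (Suc k) x - t k x) \<le> r/4 * (1/2) ^ k" if "norm x < \<delta>" for k x
  proof (induction k)
    case 0
    then show ?case using \<delta>(2)[OF that] by (simp add: tS t0)
  next
    case (Suc k)
    have "norm (T (x, t (Suc k) x) - T (x, t k x)) \<le> 1/2 * norm (t (Suc k) x - t k x)"
      using tb[OF that, of k] tb[OF that, of "Suc k"] r \<delta>(3)[OF that] by (intro contr) auto
    then show ?case using Suc by (simp add: tS)
  qed
  have th: "t k holomorphic_on ball 0 \<delta>" for k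
  proof (induction k)
    case (Suc k)
    show ?case
      unfolding holomorphic_on_def tS
    proof
      fix x :: complex assume x: "x \<in> ball 0 \<delta>"
      have "cdiff2 T (x, t k x)" using box(2)[of x "t k x"] tb[of x k] x \<delta>(3)[of x] r by auto
      moreover have "t k field_differentiable at x"
        using Suc x by (auto intro: holomorphic_on_imp_differentiable_at)
      ultimately have "(\<lambda>x. T (x, t k x)) field_differentiable at x"
        using cdiff2_compose_curve[where F = T and u = "\<lambda>x. x" and v = "t k" and t = x] by auto
      then show "(\<lambda>x. T (x, t k x)) field_differentiable at x within ball 0 \<delta>"
        by (rule field_differentiable_at_within)
    qed
  qed (simp add: t0)
  \<comment> \<open>Written as a telescoping series, so that the M-test with ratio 1/2 yields
    uniform convergence of the iterates.\<close>
  define \<tau> where "\<tau> = (\<lambda>x. \<Sum>k. t (Suc k) x - t k x)"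
  have "uniform_limit (ball 0 \<delta>) (\<lambda>n x. \<Sum>k<n. t (Suc k) x - t k x) \<tau> sequentially"
    unfolding \<tau>_def
  proof (rule Weierstrass_m_test)
    show "norm (t (Suc k) x - t k x) \<le> r/4 * (1/2) ^ k" if "x \<in> ball 0 \<delta>" for k x
      using td that by auto
    show "summable (\<lambda>k. r/4 * (1/2) ^ k)" by (intro summable_mult summable_geometric) auto
  qed
  moreover have "(\<Sum>k<n. t (Suc k) x - t k x) = t n x" for n x
    using sum_lessThan_telescope[of "\<lambda>k. t k x" n] by (simp add: t0)
  ultimately have ul: "uniform_limit (ball 0 \<delta>) t \<tau> sequentially" by simp
  have "\<tau> holomorphic_on ball 0 \<delta>"
  proof (rule holomorphic_uniform_sequence[of _ t])
    fix x :: complex assume "x \<in> ball 0 \<delta>"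
    then obtain d where "d > 0" "cball x d \<subseteq> ball 0 \<delta>"
      by (meson open_ball open_contains_cball)
    then show "\<exists>d>0. cball x d \<subseteq> ball 0 \<delta> \<and> uniform_limit (cball x d) t \<tau> sequentially"
      using uniform_limit_on_subset[OF ul] by blast
  qed (use th in auto)
  then have 1: "\<tau> analytic_on {0}" using \<delta>(1) by (meson analytic_at_ball)
  have lim: "(\<lambda>n. t n x) \<longlonglongrightarrow> \<tau> x" if "norm x < \<delta>" for x
    by (rule tendsto_uniform_limitI[OF ul]) (use that in auto)
  have "t k 0 = 0" for k by (induction k) (auto simp: t0 tS T00)
  then have 2: "\<tau> 0 = 0" using lim[of 0] \<delta>(1) by (simp add: LIMSEQ_const_iff)
  have "H (x, \<tau> x) = 0" if x: "norm x < \<delta>" for x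
  proof -
    have "norm (\<tau> x) \<le> r/2"
      using lim[OF x] tb[OF x] by (intro LIMSEQ_le_const2[OF tendsto_norm]) auto
    then have "isCont T (x, \<tau> x)" using box(2)[of x "\<tau> x"] \<delta>(3)[OF x] r by (auto intro: cdiff2_isCont)
    then have "(\<lambda>n. T (x, t n x)) \<longlonglongrightarrow> T (x, \<tau> x)"
      by (rule isCont_tendsto_compose) (intro tendsto_Pair tendsto_const lim[OF x])
    moreover have "(\<lambda>n. T (x, t n x)) \<longlonglongrightarrow> \<tau> x"
      using LIMSEQ_Suc[OF lim[OF x]] by (simp add: tS)
    ultimately have "T (x, \<tau> x) = \<tau> x" by (rule LIMSEQ_unique)
    then show ?thesis using d by (simp add: T_def c_def)
  qed
  then have "\<forall>\<^sub>F x in nhds 0. H (x, \<tau> x) = 0"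
    using \<delta>(1) unfolding eventually_nhds_metric by auto
  then show ?thesis using 1 2 by blast
qed

section \<open>Regular order and the Newton-Puiseux theorem\<close>

lemma analytic_compose11:
  "h analytic_on {u z} \<Longrightarrow> u analytic_on {z} \<Longrightarrow> (\<lambda>t. h (u t)) analytic_on {z}"
  using analytic_on_compose[of u "{z}" h] by (simp add: o_def)

lemma order_factor:
  fixes h :: "complex \<Rightarrow> complex"
  assumes h: "h analytic_on {0}" and nz: "\<not> (\<forall>\<^sub>F x in nhds 0. h x = 0)"
  obtains r b where "b analytic_on {0}" "b 0 \<noteq> 0" "\<forall>\<^sub>F x in nhds 0. h x = x ^ r * b x"
proof -
  obtain H where H: "h has_fps_expansion H" using h analytic_at_imp_has_fps_expansion_0 by blast
  have "H \<noteq> 0" using nz H has_fps_expansion_0_iff by metis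
  define r where "r = subdegree H"
  define b where "b = (\<lambda>x. if x = 0 then fps_nth H r else h x / x ^ r)"
  have b: "b has_fps_expansion fps_shift r H"
    unfolding b_def by (rule has_fps_expansion_shift[OF H]) (auto simp: r_def)
  have ev: "\<forall>\<^sub>F x in nhds 0. h x = x ^ r * b x"
  proof -
    have h0: "h 0 = fps_nth H 0" using has_fps_expansion_imp_0_eq_fps_nth_0[OF H] by simp
    have b0: "b 0 = fps_nth H r" by (simp add: b_def)
    have "h 0 = 0 ^ r * b 0"
    proof (cases "r = 0")
      case False
      then have "fps_nth H 0 = 0" unfolding r_def by (intro nth_less_subdegree_zero) simp
      then show ?thesis using False h0 by (simp add: power_0_left)
    qed (simp add: h0 b0)
    then have "h x = x ^ r * b x" for x by (cases "x = 0") (auto simp: b_def)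
    then show ?thesis by simp
  qed
  show ?thesis
  proof
    show "b analytic_on {0}" using b by (rule has_fps_expansion_imp_analytic_0)
    show "b 0 \<noteq> 0" using \<open>H \<noteq> 0\<close> by (simp add: b_def r_def)
  qed (rule ev)
qed

lemma coeff_linear_power_pred:
  fixes c :: "'a :: comm_ring_1"
  shows "coeff ([:- c, 1:] ^ Suc m) m = - of_nat (Suc m) * c"
  using coeff_linear_poly_power[of m "Suc m" "- c" 1]
  by (simp del: power_Suc of_nat_Suc)

text \<open>A root of multiplicity \<open>m\<close> would force \<open>P = q * (X - c) ^ m\<close>,
  whose coefficient at \<open>m - 1\<close> is \<open>- q * m * c\<close>. Its vanishing gives
  \<open>c = 0\<close>, so \<open>P\<close> is a monomial, against the nonzero coefficient at
  \<open>j\<close>. This makes the regular order drop in the Newton-Puiseux induction.\<close>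

lemma order_less_degree:
  fixes P :: "complex poly"
  assumes deg: "degree P = m" and m: "2 \<le> m" and z: "coeff P (m - 1) = 0"
    and j: "j < m" "coeff P j \<noteq> 0"
  shows "order c P < m"
proof (rule ccontr)
  assume "\<not> order c P < m"
  moreover have "P \<noteq> 0" using j by auto
  moreover from this have "order c P \<le> m" using order_degree deg by metis
  ultimately have "order c P = m" by simp
  then obtain Q where Q: "P = [:- c, 1:] ^ m * Q"
    using order_1[of c P] by (auto elim: dvdE)
  have "Q \<noteq> 0" using \<open>P \<noteq> 0\<close> Q by auto
  then have "degree P = m + degree Q"
    unfolding Q by (subst degree_mult_eq) (auto simp: degree_linear_power)
  then have "degree Q = 0" using deg by simp
  then obtain q where q: "Q = [:q:]" by (auto elim: degree_eq_zeroE)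
  then have "q \<noteq> 0" using \<open>Q \<noteq> 0\<close> by auto
  have P: "P = smult q ([:- c, 1:] ^ m)" by (simp add: Q q)
  obtain k where k: "m = Suc k" using m by (cases m) auto
  have "coeff P (m - 1) = - q * of_nat m * c"
    using coeff_linear_power_pred[of c k] unfolding P k by (simp del: power_Suc of_nat_Suc)
  then have "c = 0" using z \<open>q \<noteq> 0\<close> m by simp
  then have "P = monom q m" by (simp add: P monom_altdef)
  then show False using j by simp
qed

text \<open>Compactness makes the neighbourhoods found at the single points \<open>z0\<close>
  uniform in \<open>z\<close>. This is how solutions near finitely many roots, obtained one root at
  a time, come to account for all bounded \<open>z\<close>.\<close>

lemma tube_eventually:
  fixes K :: "complex set"
  assumes K: "compact K"
    and A: "\<And>z0. z0 \<in> K \<Longrightarrow> \<forall>\<^sub>F p in nhds (0 :: complex \<times> complex). A (fst p) (z0 + snd p)"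
  shows "\<forall>\<^sub>F s in nhds 0. \<forall>z\<in>K. A s z"
proof -
  have "\<exists>d>0. \<forall>s z. norm s < d \<and> norm (z - z0) < d \<longrightarrow> A s z" if z0: "z0 \<in> K" for z0
  proof -
    obtain e where e: "e > 0" "\<And>p. dist p (0 :: complex \<times> complex) < e \<Longrightarrow> A (fst p) (z0 + snd p)"
      using A[OF z0] unfolding eventually_nhds_metric by blast
    have "A s z" if "norm s < e/2" "norm (z - z0) < e/2" for s z
    proof -
      have "norm (s, z - z0) \<le> norm s + norm (z - z0)" by (rule norm_Pair_le)
      then show ?thesis using e(2)[of "(s, z - z0)"] that by simp
    qed
    then show ?thesis using e(1) by (intro exI[of _ "e/2"]) auto
  qed
  then obtain d where d: "\<And>z0. z0 \<in> K \<Longrightarrow> d z0 > 0"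
    "\<And>z0 s z. z0 \<in> K \<Longrightarrow> norm s < d z0 \<Longrightarrow> norm (z - z0) < d z0 \<Longrightarrow> A s z" by metis
  have "K \<subseteq> (\<Union>z0\<in>K. ball z0 (d z0))" using d(1) by auto
  then obtain C where C: "C \<subseteq> K" "finite C" "K \<subseteq> (\<Union>z0\<in>C. ball z0 (d z0))"
    using compactE_image[OF K, of K "\<lambda>z0. ball z0 (d z0)"] by auto
  have "\<forall>\<^sub>F s in nhds 0. \<forall>z0\<in>C. norm (s :: complex) < d z0"
  proof (intro eventually_ball_finite C ballI)
    fix z0 assume "z0 \<in> C"
    then have "d z0 > 0" using C d by auto
    then show "\<forall>\<^sub>F s in nhds 0. norm (s :: complex) < d z0"
      unfolding eventually_nhds_metric by (intro exI[of _ "d z0"]) simp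
  qed
  then show ?thesis
  proof eventually_elim
    case (elim s)
    show ?case
    proof
      fix z assume "z \<in> K"
      then obtain z0 where "z0 \<in> C" "z \<in> ball z0 (d z0)" using C by blast
      then show "A s z" using elim d(2)[of z0 s z] C by (auto simp: dist_norm norm_minus_commute)
    qed
  qed
qed

lemma higher_deriv_shift: "(deriv ^^ j) (\<lambda>v. f (v + c)) z = (deriv ^^ j) f (z + (c :: complex))"
proof (induction j arbitrary: z)
  case (Suc j)
  have "(deriv ^^ j) (\<lambda>v. f (v + c)) = (\<lambda>z. (deriv ^^ j) f (z + c))" using Suc by auto
  moreover have "deriv (\<lambda>z. g (z + c)) z = deriv g (z + c)" for g
    by (simp add: deriv_def DERIV_shift)
  ultimately show ?case by simp
qed simp

lemma taylor_fps_nth: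
  assumes ev: "\<forall>\<^sub>F v in nhds 0. f v = (\<Sum>j<m. a j * v ^ j) + v ^ m * U v"
    and U: "U analytic_on {0}"
  shows "k < m \<Longrightarrow> (deriv ^^ k) f 0 = fact k * a k"
    and "(deriv ^^ m) f 0 = fact m * U 0"
proof -
  obtain V where V: "U has_fps_expansion V" using U analytic_at_imp_has_fps_expansion_0 by blast
  have "(\<lambda>v. (\<Sum>j<m. a j * v ^ j) + v ^ m * U v) has_fps_expansion
        (\<Sum>j<m. fps_const (a j) * fps_X ^ j) + fps_X ^ m * V"
    by (intro fps_expansion_intros V)
  then have f: "f has_fps_expansion (\<Sum>j<m. fps_const (a j) * fps_X ^ j) + fps_X ^ m * V"
    using has_fps_expansion_cong[OF ev refl] by blast
  have nth: "fps_nth ((\<Sum>j<m. fps_const (a j) * fps_X ^ j) + fps_X ^ m * V) k =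
      (if k < m then a k else fps_nth V (k - m))" for k
  proof -
    have "(\<Sum>j<m. a j * (if k = j then 1 else 0)) = (if k < m then a k else 0)"
      by (simp add: if_distrib[of "\<lambda>x. _ * x"] cong: if_cong)
    then show ?thesis by (auto simp: fps_sum_nth fps_X_power_mult_nth)
  qed
  show "(deriv ^^ k) f 0 = fact k * a k" if "k < m"
    using fps_nth_fps_expansion[OF f, of k] that unfolding nth by (simp add: field_simps)
  show "(deriv ^^ m) f 0 = fact m * U 0"
    using fps_nth_fps_expansion[OF f, of m] has_fps_expansion_imp_0_eq_fps_nth_0[OF V]
    unfolding nth by (simp add: field_simps)
qed

definition regular_order :: "(complex \<times> complex \<Rightarrow> complex) \<Rightarrow> nat \<Rightarrow> bool" where
  "regular_order F m \<longleftrightarrow>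
     (\<exists>u. u analytic_on {0} \<and> u 0 \<noteq> 0 \<and> (\<forall>\<^sub>F y in nhds 0. F (0, y) = y ^ m * u y))"

lemma regular_order_derivs:
  assumes "regular_order F m"
  shows "k < m \<Longrightarrow> (deriv ^^ k) (\<lambda>v. F (0, v)) 0 = 0" and "(deriv ^^ m) (\<lambda>v. F (0, v)) 0 \<noteq> 0"
proof -
  obtain u where u: "u analytic_on {0}" "u 0 \<noteq> 0" "\<forall>\<^sub>F y in nhds 0. F (0, y) = y ^ m * u y"
    using assms by (auto simp: regular_order_def)
  have "\<forall>\<^sub>F v in nhds 0. F (0, v) = (\<Sum>j<m. 0 * v ^ j) + v ^ m * u v" using u(3) by simp
  from taylor_fps_nth[OF this u(1)] u(2)
  show "k < m \<Longrightarrow> (deriv ^^ k) (\<lambda>v. F (0, v)) 0 = 0" and "(deriv ^^ m) (\<lambda>v. F (0, v)) 0 \<noteq> 0"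
    by auto
qed

lemma analytic_slice0: "analytic2 F \<Longrightarrow> (\<lambda>y. F (0, y)) analytic_on {0}"
  by (rule analytic_compose_curve) (auto intro!: analytic_intros)

text \<open>The Tschirnhaus transformation for analytic functions: the \<open>(m - 1)\<close>-st
  \<open>y\<close>-derivative of \<open>F\<close> has a nonzero \<open>y\<close>-derivative at 0, so
  it vanishes along a graph \<open>\<tau>\<close>, and recentring \<open>y\<close> on that graph
  kills the coefficient of \<open>y ^ (m - 1)\<close>.\<close>

lemma tschirnhaus:
  assumes F: "analytic2 F" and reg: "regular_order F m" and m: "1 \<le> m"
  shows "\<exists>\<tau> a U. \<tau> analytic_on {0} \<and> \<tau> 0 = 0 \<and> (\<forall>j. a j analytic_on {0}) \<and> (\<forall>j<m. a j 0 = 0) \<and>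
    (\<forall>\<^sub>F x in nhds 0. a (m - 1) x = 0) \<and> analytic2 U \<and> U 0 \<noteq> 0 \<and>
    (\<forall>\<^sub>F p in nhds 0. F (fst p, snd p + \<tau> (fst p)) = (\<Sum>j<m. a j (fst p) * snd p ^ j) + snd p ^ m * U p)"
proof -
  define H where "H = (dsnd ^^ (m - 1)) F"
  have H: "analytic2 H" unfolding H_def by (rule analytic2_dsnd_funpow[OF F])
  have "H 0 = 0"
    using regular_order_derivs(1)[OF reg, of "m - 1"] m by (simp add: H_def zero_prod_def dsnd_funpow)
  moreover have "dsnd H 0 \<noteq> 0"
  proof -
    have "dsnd H = (dsnd ^^ m) F" using m by (cases m) (auto simp: H_def)
    then show ?thesis using regular_order_derivs(2)[OF reg] by (simp add: zero_prod_def dsnd_funpow)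
  qed
  ultimately obtain \<tau> where \<tau>: "\<tau> analytic_on {0}" "\<tau> 0 = 0" "\<forall>\<^sub>F x in nhds 0. H (x, \<tau> x) = 0"
    using implicit_function[OF H] by blast
  define F' where "F' = (\<lambda>p. F (fst p, snd p + \<tau> (fst p)))"
  have F': "analytic2 F'"
    unfolding F'_def using \<tau>(2)
    by (intro analytic2_compose[OF F analytic2_fst analytic2_add[OF analytic2_snd analytic2_compose_fst[OF \<tau>(1)]]]) auto
  obtain a U where a: "\<And>j. a j analytic_on {0}" and U: "analytic2 U"
    and eq: "\<forall>\<^sub>F p in nhds 0. F' p = (\<Sum>j<m. a j (fst p) * snd p ^ j) + snd p ^ m * U p"
    using analytic2_taylor[OF F', of m] by blast
  have "\<forall>\<^sub>F p in nhds 0. cdiff2 U p" using U by (simp add: analytic2_iff)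
  from eventually_slice[OF this] eventually_slice[OF eq]
  have co: "\<forall>\<^sub>F x in nhds 0. (\<forall>k<m. (deriv ^^ k) (\<lambda>v. F' (x, v)) 0 = fact k * a k x) \<and>
      (deriv ^^ m) (\<lambda>v. F' (x, v)) 0 = fact m * U (x, 0)"
  proof eventually_elim
    case (elim x)
    have U: "(\<lambda>v. U (x, v)) analytic_on {0}"
      unfolding analytic_at_iff_eventually using elim(1)
      by eventually_elim (use cdiff2_compose_curve[where F = U and u = "\<lambda>_. x" and v = "\<lambda>v. v"] in auto)
    show ?case using taylor_fps_nth[where f = "\<lambda>v. F' (x, v)" and m = m and a = "\<lambda>j. a j x" and U = "\<lambda>v. U (x, v)"] elim(2) U by simp
  qed
  have F'0: "(\<lambda>v. F' (0, v)) = (\<lambda>v. F (0, v))" using \<tau>(2) by (simp add: F'_def)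
  have co0: "(\<forall>k<m. (deriv ^^ k) (\<lambda>v. F' (0, v)) 0 = fact k * a k 0) \<and>
      (deriv ^^ m) (\<lambda>v. F' (0, v)) 0 = fact m * U (0, 0)"
    using eventually_nhds_x_imp_x[OF co] .
  show ?thesis
  proof (intro exI conjI allI impI)
    show "\<tau> analytic_on {0}" "\<tau> 0 = 0" "\<And>j. a j analytic_on {0}" "analytic2 U" by fact+
    show "a j 0 = 0" if "j < m" for j
      using co0 regular_order_derivs(1)[OF reg that] that by (auto simp: F'0)
    show "U 0 \<noteq> 0" using co0 regular_order_derivs(2)[OF reg] by (auto simp: F'0 zero_prod_def)
    show "\<forall>\<^sub>F x in nhds 0. a (m - 1) x = 0"
      using co \<tau>(3)
    proof eventually_elim
      case (elim x)
      have "(deriv ^^ (m - 1)) (\<lambda>v. F' (x, v)) 0 = (deriv ^^ (m - 1)) (\<lambda>v. F (x, v)) (0 + \<tau> x)"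
        unfolding F'_def fst_conv snd_conv by (rule higher_deriv_shift)
      also have "\<dots> = 0" using elim(2) by (simp add: H_def dsnd_funpow)
      finally show ?case using elim(1) m by auto
    qed
    show "\<forall>\<^sub>F p in nhds 0. F (fst p, snd p + \<tau> (fst p)) = (\<Sum>j<m. a j (fst p) * snd p ^ j) + snd p ^ m * U p"
      using eq by (simp add: F'_def)
  qed
qed

text \<open>The slope is the minimum of \<open>r j / (m - j)\<close>, belonging to the edge through
  the vertex of \<open>y ^ m\<close>; \<open>p\<close> and \<open>q\<close> are its numerator and
  denominator at a minimizing \<open>j0\<close>, left unreduced.\<close>

lemma newton_polygon:
  fixes r :: "nat \<Rightarrow> nat"
  assumes "finite J" "J \<noteq> {}" "\<And>j. j \<in> J \<Longrightarrow> j < m \<and> 1 \<le> r j"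
  obtains p q j0 where "1 \<le> p" "1 \<le> q" "j0 \<in> J" "q * r j0 = p * (m - j0)"
    "\<And>j. j \<in> J \<Longrightarrow> p * (m - j) \<le> q * r j"
proof -
  define \<mu> where "\<mu> = (\<lambda>j. real (r j) / real (m - j))"
  obtain j0 where j0: "j0 \<in> J" "\<And>j. j \<in> J \<Longrightarrow> \<mu> j0 \<le> \<mu> j"
    using ex_min_if_finite[of "\<mu> ` J"] assms by (force simp: not_less)
  have "r j0 * (m - j) \<le> (m - j0) * r j" if "j \<in> J" for j
  proof -
    have "real (r j0) * real (m - j) \<le> real (m - j0) * real (r j)"
      using j0(2)[OF that] assms(3)[OF that] assms(3)[OF j0(1)]
      by (simp add: \<mu>_def field_simps)
    then show ?thesis by (metis of_nat_le_iff of_nat_mult)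
  qed
  then show ?thesis using that[of "r j0" "m - j0" j0] j0 assms(3)[OF j0(1)] by (auto simp: mult.commute)
qed

lemma eventually_nhds_small:
  assumes "u analytic_on {0}" "u 0 = 0" "0 < d"
  shows "\<forall>\<^sub>F t in nhds 0. norm (u t :: complex) < d"
  using tendstoD[OF analytic_tendsto[OF assms(1)] assms(3)] assms(2) by simp

lemma eventually_nhds_small2:
  assumes "analytic2 P" "P 0 = 0" "0 < d"
  shows "\<forall>\<^sub>F p in nhds 0. norm (P p) < d"
  using tendstoD[OF analytic2_tendsto[OF assms(1)] assms(3)] assms(2) by simp

lemma eventually_box:
  assumes "\<forall>\<^sub>F p in nhds (0 :: complex \<times> complex). A p"
  obtains d where "0 < d" "\<And>x y. norm x < d \<Longrightarrow> norm y < d \<Longrightarrow> A (x, y)"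
proof -
  obtain e where e: "e > 0" "\<And>p. dist p (0 :: complex \<times> complex) < e \<Longrightarrow> A p"
    using assms unfolding eventually_nhds_metric by blast
  have "A (x, y)" if "norm x < e/2" "norm y < e/2" for x y
  proof -
    have "norm (x, y) \<le> norm x + norm y" by (rule norm_Pair_le)
    then show ?thesis using e(2)[of "(x, y)"] that by simp
  qed
  then show ?thesis using that[of "e/2"] e(1) by simp
qed

text \<open>Induction on the regular order. After \<open>tschirnhaus\<close>, the substitution
  \<open>x = t ^ q\<close>, \<open>y = t ^ P * z + \<tau> x\<close> makes \<open>F\<close> divisible
  by \<open>t ^ (P * m)\<close>. At \<open>t = 0\<close> the quotient \<open>G\<close> is a
  polynomial of degree \<open>m\<close> in \<open>z\<close> without a root of multiplicity
  \<open>m\<close>, so at each of its roots \<open>G\<close> has smaller regular order.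
  \<open>S\<close> collects the solutions over all roots with one common ramification.\<close>

theorem newton_puiseux:
  assumes "analytic2 F" "regular_order F m"
  shows "\<exists>N\<ge>1. \<exists>S. finite S \<and>
    (\<forall>\<eta>\<in>S. \<eta> analytic_on {0} \<and> \<eta> 0 = 0 \<and> (\<forall>\<^sub>F t in nhds 0. F (t ^ N, \<eta> t) = 0)) \<and>
    (\<forall>\<^sub>F p in nhds 0. F (fst p ^ N, snd p) = 0 \<longrightarrow> (\<exists>\<eta>\<in>S. snd p = \<eta> (fst p)))"
  using assms
proof (induction m arbitrary: F rule: less_induct)
  case (less m)
  note F = less.prems(1) and reg = less.prems(2)
  show ?case
  proof (cases "m = 0")
    case True
    then have "F 0 \<noteq> 0" using regular_order_derivs(2)[OF reg] by (simp add: zero_prod_def)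
    then have "\<forall>\<^sub>F p in nhds 0. F p \<noteq> 0"
      by (rule tendsto_imp_eventually_ne[OF analytic2_tendsto[OF F]])
    then show ?thesis by (intro exI[of _ 1] conjI exI[of _ "{}"]) auto
  next
    case False
    then have m1: "1 \<le> m" by simp
    obtain \<tau> a U where \<tau>: "\<tau> analytic_on {0}" "\<tau> 0 = 0" and a: "\<And>j. a j analytic_on {0}"
      and a0: "\<And>j. j < m \<Longrightarrow> a j 0 = 0" and apred: "\<forall>\<^sub>F x in nhds 0. a (m - 1) x = 0"
      and U: "analytic2 U" and U0: "U 0 \<noteq> 0"
      and eq: "\<forall>\<^sub>F p in nhds 0. F (fst p, snd p + \<tau> (fst p)) = (\<Sum>j<m. a j (fst p) * snd p ^ j) + snd p ^ m * U p"
      using tschirnhaus[OF F reg m1] by blast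
    define J where "J = {j. j < m \<and> \<not> (\<forall>\<^sub>F x in nhds 0. a j x = 0)}"
    have finJ: "finite J" by (simp add: J_def)
    have Jm: "j < m - 1" if "j \<in> J" for j
    proof -
      have "j \<noteq> m - 1" using that apred by (auto simp: J_def)
      then show ?thesis using that by (auto simp: J_def)
    qed
    have "\<forall>\<^sub>F p in nhds (0 :: complex \<times> complex). \<forall>j\<in>{..<m} - J. a j (fst p) = 0"
    proof (intro eventually_ball_finite ballI)
      fix j assume "j \<in> {..<m} - J"
      then have "\<forall>\<^sub>F x in nhds (fst (0 :: complex \<times> complex)). a j x = 0" by (auto simp: J_def)
      then show "\<forall>\<^sub>F p in nhds (0 :: complex \<times> complex). a j (fst p) = 0"
        by (rule eventually_compose21) (rule analytic2_fst)
    qed simp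
    with eq have eqJ: "\<forall>\<^sub>F p in nhds 0. F (fst p, snd p + \<tau> (fst p)) = (\<Sum>j\<in>J. a j (fst p) * snd p ^ j) + snd p ^ m * U p"
    proof eventually_elim
      case (elim p)
      have "(\<Sum>j<m. a j (fst p) * snd p ^ j) = (\<Sum>j\<in>J. a j (fst p) * snd p ^ j)"
        using elim(2) by (intro sum.mono_neutral_right) (auto simp: J_def)
      then show ?case using elim(1) by simp
    qed
    have Une: "\<forall>\<^sub>F p in nhds 0. U p \<noteq> 0"
      using U0 by (rule tendsto_imp_eventually_ne[OF analytic2_tendsto[OF U]])
    show ?thesis
    proof (cases "J = {}")
      \<comment> \<open>Without lower coefficients \<open>F\<close> is the \<open>m\<close>-th power
        of \<open>y - \<tau> x\<close> times a unit, so \<open>\<tau>\<close> is the only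
        solution.\<close>
      case True
      from eqJ Une have "\<forall>\<^sub>F p in nhds 0. F (fst p, snd p + \<tau> (fst p)) = snd p ^ m * U p \<and> U p \<noteq> 0"
        by eventually_elim (simp add: True)
      note ev = this
      have 1: "\<forall>\<^sub>F p in nhds 0. F (fst p ^ 1, snd p) = 0 \<longrightarrow> (\<exists>\<eta>\<in>{\<tau>}. snd p = \<eta> (fst p))"
        using eventually_compose2[OF ev analytic2_fst analytic2_diff[OF analytic2_snd analytic2_compose_fst[OF \<tau>(1)]]] \<tau>(2)
        by (simp, elim eventually_mono) auto
      have "\<forall>\<^sub>F t in nhds 0. F (t, 0 + \<tau> t) = 0"
        using eventually_compose_curve[OF ev, of "\<lambda>t. t" "\<lambda>_. 0"] m1
        by (auto intro!: analytic_intros elim!: eventually_mono)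
      then have 2: "\<forall>\<^sub>F t in nhds 0. F (t ^ 1, \<tau> t) = 0" by simp
      show ?thesis
        by (intro exI[of _ 1] conjI exI[of _ "{\<tau>}"] ballI 1) (use \<tau> 2 in auto)
    next
      case False
      have "\<exists>r b. b analytic_on {0} \<and> b 0 \<noteq> 0 \<and> (\<forall>\<^sub>F x in nhds 0. a j x = x ^ r * b x)" if "j \<in> J" for j
      proof -
        have "\<not> (\<forall>\<^sub>F x in nhds 0. a j x = 0)" using that by (simp add: J_def)
        then show ?thesis by (rule order_factor[OF a]) blast
      qed
      then obtain r b where b: "\<And>j. j \<in> J \<Longrightarrow> b j analytic_on {0}" "\<And>j. j \<in> J \<Longrightarrow> b j 0 \<noteq> 0"
        "\<And>j. j \<in> J \<Longrightarrow> \<forall>\<^sub>F x in nhds 0. a j x = x ^ r j * b j x" by metis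
      have r1: "1 \<le> r j" if "j \<in> J" for j
      proof (rule ccontr)
        assume "\<not> 1 \<le> r j"
        then have "r j = 0" by simp
        then have "a j 0 = b j 0" using eventually_nhds_x_imp_x[OF b(3)[OF that]] by simp
        then show False using a0[of j] b(2)[OF that] Jm[OF that] by auto
      qed
      obtain P q j0 where P1: "1 \<le> P" and q1: "1 \<le> q" and j0: "j0 \<in> J" "q * r j0 = P * (m - j0)"
        and np: "\<And>j. j \<in> J \<Longrightarrow> P * (m - j) \<le> q * r j"
        
      proof (rule newton_polygon[OF finJ False, of m r])
        show "j < m \<and> 1 \<le> r j" if "j \<in> J" for j using Jm[OF that] r1[OF that] by simp
      qed (rule that)
      \<comment> \<open>The power of \<open>t\<close> left at the \<open>j\<close>-th term after
        division by \<open>t ^ (P * m)\<close>. By the choice of the slope the subtraction is never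
        truncated, and it gives 0 at \<open>j0\<close>.\<close>
      define e where "e = (\<lambda>j. q * r j - P * (m - j))"
      have e: "q * r j + P * j = e j + P * m" if "j \<in> J" for j
      proof -
        have "P * (m - j) + P * j = P * m" using Jm[OF that] by (simp add: add_mult_distrib2[symmetric])
        then show ?thesis using np[OF that] by (simp add: e_def)
      qed
      define G where "G = (\<lambda>p. (\<Sum>j\<in>J. fst p ^ e j * b j (fst p ^ q) * snd p ^ j) +
           snd p ^ m * U (fst p ^ q, fst p ^ P * snd p))"
      have bq: "analytic2 (\<lambda>p. b j (fst p ^ q))" if "j \<in> J" for j
        by (rule analytic2_compose1) (use b(1)[OF that] q1 in \<open>auto intro!: analytic2_intros simp: power_0_left\<close>)
      have Gc: "analytic2 (\<lambda>p. G (fst p, c + snd p))" for c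
        unfolding G_def fst_conv snd_conv
        by (intro analytic2_intros bq analytic2_compose[OF U]) (use q1 P1 in auto)
      define u0 where "u0 = norm (U 0) / 2"
      have u0: "u0 > 0" using U0 by (simp add: u0_def)
      have evU: "\<forall>\<^sub>F p in nhds 0. u0 < norm (U p)"
        using order_tendstoD(1)[OF tendsto_norm[OF analytic2_tendsto[OF U]], of u0] U0 by (simp add: u0_def)
      define B where "B = (\<Sum>j\<in>J. norm (b j 0) + 1)"
      have evb: "\<forall>\<^sub>F p in nhds (0 :: complex \<times> complex). \<forall>j\<in>J. norm (b j (fst p)) \<le> B \<and> a j (fst p) = fst p ^ r j * b j (fst p)"
      proof (intro eventually_ball_finite finJ ballI)
        fix j assume j: "j \<in> J"
        have "norm (b j 0) + 1 \<le> B" unfolding B_def using j finJ by (intro member_le_sum) auto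
        moreover have "\<forall>\<^sub>F x in nhds 0. norm (b j x) < norm (b j 0) + 1"
          using order_tendstoD(2)[OF tendsto_norm[OF analytic_tendsto[OF b(1)[OF j]]], of "norm (b j 0) + 1"] by simp
        ultimately have "\<forall>\<^sub>F x in nhds 0. norm (b j x) \<le> B" by (elim eventually_mono) auto
        with b(3)[OF j] have "\<forall>\<^sub>F x in nhds 0. norm (b j x) \<le> B \<and> a j x = x ^ r j * b j x"
          by eventually_elim auto
        then have "\<forall>\<^sub>F x in nhds (fst (0 :: complex \<times> complex)). norm (b j x) \<le> B \<and> a j x = x ^ r j * b j x"
          by simp
        then show "\<forall>\<^sub>F p in nhds (0 :: complex \<times> complex). norm (b j (fst p)) \<le> B \<and> a j (fst p) = fst p ^ r j * b j (fst p)"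
          by (rule eventually_compose21) (rule analytic2_fst)
      qed
      obtain d where d: "0 < d" and box: "\<And>x w. norm x < d \<Longrightarrow> norm w < d \<Longrightarrow>
          F (x, w + \<tau> x) = (\<Sum>j\<in>J. x ^ r j * b j x * w ^ j) + w ^ m * U (x, w) \<and>
          u0 < norm (U (x, w)) \<and> (\<forall>j\<in>J. norm (b j x) \<le> B)"
      proof -
        from eqJ evU evb have "\<forall>\<^sub>F p in nhds 0.
          F (fst p, snd p + \<tau> (fst p)) = (\<Sum>j\<in>J. fst p ^ r j * b j (fst p) * snd p ^ j) + snd p ^ m * U p \<and>
          u0 < norm (U p) \<and> (\<forall>j\<in>J. norm (b j (fst p)) \<le> B)"
          by eventually_elim (auto intro!: sum.cong)
        then show ?thesis using that by (rule eventually_box) auto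
      qed
      have scale: "F (t ^ q, t ^ P * z + \<tau> (t ^ q)) = t ^ (P * m) * G (t, z)"
        if "norm (t ^ q) < d" "norm (t ^ P * z) < d" for t z
      proof -
        have "(t ^ q) ^ r j * b j (t ^ q) * (t ^ P * z) ^ j = t ^ (P * m) * (t ^ e j * b j (t ^ q) * z ^ j)"
          if "j \<in> J" for j
        proof -
          have "(t ^ q) ^ r j * (t ^ P) ^ j = t ^ (P * m) * t ^ e j"
            using e[OF that] by (simp add: power_mult[symmetric] power_add[symmetric] add.commute)
          then show ?thesis by (simp add: power_mult_distrib algebra_simps)
        qed
        then have "(\<Sum>j\<in>J. (t ^ q) ^ r j * b j (t ^ q) * (t ^ P * z) ^ j) =
            t ^ (P * m) * (\<Sum>j\<in>J. t ^ e j * b j (t ^ q) * z ^ j)"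
          unfolding sum_distrib_left by (rule sum.cong[OF refl])
        moreover have "(t ^ P * z) ^ m = t ^ (P * m) * z ^ m" by (simp add: power_mult_distrib power_mult)
        ultimately show ?thesis
          using box[OF that] by (simp add: G_def distrib_left)
      qed
      \<comment> \<open>A bound for the zeros of \<open>G\<close> in \<open>z\<close>: if
        \<open>norm z > 1\<close>, the leading term has norm at least
        \<open>u0 * norm z ^ m\<close>, and the others sum to at most
        \<open>card J * B * norm z ^ (m - 1)\<close>.\<close>
      define R0 where "R0 = max 1 (real (card J) * B / u0)"
      have bound: "norm z \<le> R0"
        if G0: "G (t, z) = 0" and t: "norm t \<le> 1" "norm (t ^ q) < d" "norm (t ^ P * z) < d" for t z
      proof (cases "norm z \<le> 1")
        case False
        have "norm z ^ m * u0 \<le> norm (z ^ m * U (t ^ q, t ^ P * z))"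
          using box[OF t(2,3)] by (simp add: norm_mult norm_power mult_left_mono)
        also have "z ^ m * U (t ^ q, t ^ P * z) = - (\<Sum>j\<in>J. t ^ e j * b j (t ^ q) * z ^ j)"
          using G0 by (simp add: G_def eq_neg_iff_add_eq_0 add.commute)
        also have "norm \<dots> \<le> (\<Sum>j\<in>J. norm (t ^ e j * b j (t ^ q) * z ^ j))"
          by (simp add: norm_sum)
        also have "\<dots> \<le> (\<Sum>j\<in>J. 1 * B * norm z ^ (m - 1))"
        proof (rule sum_mono)
          fix j assume j: "j \<in> J"
          have "norm z ^ j \<le> norm z ^ (m - 1)" using False Jm[OF j] by (intro power_increasing) auto
          moreover have "norm t ^ e j \<le> 1" using t(1) by (intro power_le_one) auto
          moreover have "norm (b j (t ^ q)) \<le> B" using box[OF t(2,3)] j by auto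
          ultimately show "norm (t ^ e j * b j (t ^ q) * z ^ j) \<le> 1 * B * norm z ^ (m - 1)"
            unfolding norm_mult norm_power by (intro mult_mono) (auto intro: order_trans[OF norm_ge_zero])
        qed
        finally have "norm z ^ (m - 1) * (norm z * u0) \<le> norm z ^ (m - 1) * (real (card J) * B)"
          using m1 by (cases m) (auto simp: mult_ac)
        moreover have "norm z ^ (m - 1) > 0" using False by (intro zero_less_power) linarith
        ultimately have "norm z * u0 \<le> real (card J) * B" by (simp only: mult_le_cancel_left_pos)
        then have "norm z \<le> real (card J) * B / u0" using u0 by (simp add: field_simps)
        then show ?thesis by (simp add: R0_def)
      qed (simp add: R0_def)
      \<comment> \<open>The edge polynomial: besides the leading term only those with
        \<open>e j = 0\<close> survive at \<open>t = 0\<close>.\<close>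
      define P0 where "P0 = (\<Sum>j\<in>J. if e j = 0 then monom (b j 0) j else 0) + monom (U 0) m"
      have GP0: "G (0, z) = poly P0 z" for z
      proof -
        have "(\<Sum>j\<in>J. 0 ^ e j * b j (0 ^ q) * z ^ j) = poly (\<Sum>j\<in>J. if e j = 0 then monom (b j 0) j else 0) z"
          unfolding poly_sum by (rule sum.cong) (use q1 in \<open>auto simp: poly_monom power_0_left\<close>)
        then show ?thesis using q1 P1 by (simp add: G_def P0_def poly_monom power_0_left zero_prod_def mult.commute)
      qed
      have coeffP0: "coeff P0 k = (if k \<in> J \<and> e k = 0 then b k 0 else 0) + (if k = m then U 0 else 0)" for k
      proof -
        have "coeff (\<Sum>j\<in>J. if e j = 0 then monom (b j 0) j else 0) k = (\<Sum>j\<in>J. if j = k then (if e k = 0 then b k 0 else 0) else 0)"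
          unfolding coeff_sum by (rule sum.cong) auto
        then show ?thesis using finJ by (simp add: P0_def)
      qed
      have m2: "2 \<le> m" using Jm[OF j0(1)] by simp
      have degP0: "degree P0 = m"
      proof (rule antisym)
        show "degree P0 \<le> m" using Jm by (intro degree_le) (force simp: coeffP0)
        show "m \<le> degree P0" using Jm[of m] U0 by (intro le_degree) (auto simp: coeffP0)
      qed
      have ordP0: "order c P0 < m" for c
      proof (rule order_less_degree[OF degP0 m2])
        show "coeff P0 (m - 1) = 0" using Jm[of "m - 1"] m1 by (auto simp: coeffP0)
        show "j0 < m" using Jm[OF j0(1)] by simp
        show "coeff P0 j0 \<noteq> 0" using j0 Jm[OF j0(1)] b(2) by (simp add: coeffP0 e_def)
      qed
      have P0ne: "P0 \<noteq> 0" using degP0 m1 by auto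
      define R where "R = {c. poly P0 c = 0}"
      have finR: "finite R" unfolding R_def using P0ne by (rule poly_roots_finite)
      have Rne: "R \<noteq> {}"
      proof -
        have "coeff P0 m \<noteq> 0" using degP0 P0ne leading_coeff_neq_0[of P0] by simp
        then have "coeff P0 0 = 0 \<or> (\<exists>i\<in>{1..m}. coeff P0 i \<noteq> 0)" using m1 by (intro disjI2 bexI[of _ m]) auto
        then obtain z where "(\<Sum>i\<le>m. coeff P0 i * z ^ i) = 0"
          by (rule fundamental_theorem_of_algebra)
        then show ?thesis using degP0 by (auto simp: R_def poly_altdef)
      qed
      have regc: "regular_order (\<lambda>p. G (fst p, c + snd p)) (order c P0)" for c
      proof -
        obtain Q where Q: "P0 = [:- c, 1:] ^ order c P0 * Q" "\<not> [:- c, 1:] dvd Q"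
          using order_decomp[OF P0ne, of c] by blast
        define u where "u = (\<lambda>y. poly Q (c + y))"
        have "u analytic_on {0}" unfolding u_def poly_altdef by (intro analytic_intros)
        moreover have "u 0 \<noteq> 0" using Q(2) by (simp add: u_def poly_eq_0_iff_dvd)
        moreover have "G (0, c + y) = y ^ order c P0 * u y" for y
          unfolding GP0 by (subst Q(1)) (simp add: u_def)
        ultimately show ?thesis unfolding regular_order_def by auto
      qed
      define Q where "Q = (\<lambda>c N S. 1 \<le> N \<and> finite S \<and>
          (\<forall>\<theta>\<in>S. \<theta> analytic_on {0} \<and> \<theta> 0 = 0 \<and> (\<forall>\<^sub>F t in nhds 0. G (t ^ N, c + \<theta> t) = 0)) \<and>
          (\<forall>\<^sub>F p in nhds 0. G (fst p ^ N, c + snd p) = 0 \<longrightarrow> (\<exists>\<theta>\<in>S. snd p = \<theta> (fst p))))"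
      have "\<exists>N S. Q c N S" for c
        unfolding Q_def
        using less.IH[OF ordP0[of c] Gc[of c] regc[of c]] by (simp only: fst_conv snd_conv) blast
      then obtain Nf Sf where Q: "\<And>c. Q c (Nf c) (Sf c)" by metis
      have Nf: "1 \<le> Nf c" and Sf: "finite (Sf c)" for c using Q[of c] by (auto simp: Q_def)
      have \<theta>: "\<theta> analytic_on {0} \<and> \<theta> 0 = 0 \<and> (\<forall>\<^sub>F t in nhds 0. G (t ^ Nf c, c + \<theta> t) = 0)"
        if "\<theta> \<in> Sf c" for c \<theta> using Q[of c] that unfolding Q_def by blast
      have IH2: "\<forall>\<^sub>F p in nhds 0. G (fst p ^ Nf c, c + snd p) = 0 \<longrightarrow> (\<exists>\<theta>\<in>Sf c. snd p = \<theta> (fst p))" for c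
        using Q[of c] unfolding Q_def by blast
      \<comment> \<open>A common multiple of the ramifications found at the roots, so that all
        solutions can be written in one parameter \<open>s\<close> with
        \<open>t = s ^ N\<close>.\<close>
      define N where "N = (\<Prod>c\<in>R. Nf c)"
      define M where "M = (\<lambda>c. N div Nf c)"
      have N1: "1 \<le> N" unfolding N_def using Nf by (metis One_nat_def Suc_leI less_eq_Suc_le prod_pos)
      have NM: "N = M c * Nf c" and M1: "1 \<le> M c" if "c \<in> R" for c
      proof -
        have "Nf c dvd N" unfolding N_def using that finR by (rule dvd_prodI[rotated])
        then show "N = M c * Nf c" by (simp add: M_def)
        then show "1 \<le> M c" using N1 by (cases "M c") auto
      qed
      define \<eta> where "\<eta> = (\<lambda>c \<theta> s. \<tau> ((s ^ N) ^ q) + (s ^ N) ^ P * (c + \<theta> (s ^ M c)))"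
      define S where "S = (\<Union>c\<in>R. \<eta> c ` Sf c)"
      have \<tau>s: "(\<lambda>s. \<tau> ((s ^ N) ^ q)) analytic_on {0}"
        by (rule analytic_compose11) (use \<tau>(1) N1 q1 in \<open>auto intro!: analytic_intros simp: power_0_left\<close>)
      have \<theta>s: "(\<lambda>s. \<theta> (s ^ M c)) analytic_on {0}" if "c \<in> R" "\<theta> \<in> Sf c" for c \<theta>
        by (rule analytic_compose11)
           (use \<theta>[OF that(2)] M1[OF that(1)] in \<open>auto intro!: analytic_intros simp: power_0_left\<close>)
      have S1: "\<eta>' analytic_on {0} \<and> \<eta>' 0 = 0 \<and> (\<forall>\<^sub>F s in nhds 0. F (s ^ (N * q), \<eta>' s) = 0)" if S: "\<eta>' \<in> S" for \<eta>'
      proof -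
        obtain c \<theta>' where c: "c \<in> R" "\<theta>' \<in> Sf c" "\<eta>' = \<eta> c \<theta>'" using S by (auto simp: S_def)
        note \<theta>' = \<theta>[OF c(2)]
        have z: "(\<lambda>s. (s ^ N) ^ P * (c + \<theta>' (s ^ M c))) analytic_on {0}"
          by (intro analytic_intros \<theta>s c)
        have an: "\<eta>' analytic_on {0}"
          unfolding c(3) \<eta>_def by (intro analytic_on_add \<tau>s z)
        have z0: "\<eta>' 0 = 0" unfolding c(3) \<eta>_def using N1 P1 q1 \<tau>(2) by (simp add: power_0_left)
        have "\<forall>\<^sub>F s in nhds 0. G ((s ^ M c) ^ Nf c, c + \<theta>' (s ^ M c)) = 0"
          using \<theta>' M1[OF c(1)] by (intro eventually_compose11[where u = "\<lambda>s. s ^ M c" and z = 0])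
            (auto intro!: analytic_intros simp: power_0_left)
        moreover have "\<forall>\<^sub>F s in nhds 0. norm ((s ^ N) ^ q :: complex) < d"
          using N1 q1 d by (intro eventually_nhds_small) (auto intro!: analytic_intros simp: power_0_left)
        moreover have "\<forall>\<^sub>F s in nhds 0. norm ((s ^ N) ^ P * (c + \<theta>' (s ^ M c))) < d"
          using N1 P1 d by (intro eventually_nhds_small z) (auto simp: power_0_left)
        ultimately have "\<forall>\<^sub>F s in nhds 0. F (s ^ (N * q), \<eta>' s) = 0"
        proof eventually_elim
          case (elim s)
          have "(s ^ M c) ^ Nf c = s ^ N" using NM[OF c(1)] by (simp add: power_mult[symmetric])
          then show ?case
            using scale[OF elim(2,3)] elim(1) by (simp add: c(3) \<eta>_def power_mult add.commute)
        qed
        with an z0 show ?thesis by blast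
      qed
      \<comment> \<open>Near a root \<open>c\<close> the zeros are those of the induction
        hypothesis; near any other \<open>z0\<close> the function \<open>G\<close> has none.\<close>
      have tube: "\<forall>\<^sub>F s in nhds 0. \<forall>z\<in>cball 0 R0. G (s ^ N, z) = 0 \<longrightarrow> (\<exists>c\<in>R. \<exists>\<theta>\<in>Sf c. z = c + \<theta> (s ^ M c))"
      proof (rule tube_eventually[OF compact_cball])
        fix z0 :: complex
        show "\<forall>\<^sub>F p in nhds (0 :: complex \<times> complex). G (fst p ^ N, z0 + snd p) = 0 \<longrightarrow> (\<exists>c\<in>R. \<exists>\<theta>\<in>Sf c. z0 + snd p = c + \<theta> (fst p ^ M c))"
        proof (cases "z0 \<in> R")
          case True
          have "\<forall>\<^sub>F p in nhds 0. G (fst (fst p ^ M z0, snd p) ^ Nf z0, z0 + snd (fst p ^ M z0, snd p)) = 0 \<longrightarrow>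
              (\<exists>\<theta>\<in>Sf z0. snd (fst p ^ M z0, snd p) = \<theta> (fst (fst p ^ M z0, snd p)))"
            using M1[OF True] by (intro eventually_compose2[OF IH2]) (auto intro!: analytic2_intros simp: power_0_left)
          then show ?thesis
          proof eventually_elim
            case (elim p)
            have "(fst p ^ M z0) ^ Nf z0 = fst p ^ N" using NM[OF True] by (simp add: power_mult[symmetric])
            then show ?case using elim True by (auto intro!: bexI[of _ z0])
          qed
        next
          case False
          have "G (fst (0 :: complex \<times> complex), z0 + snd (0 :: complex \<times> complex)) \<noteq> 0" using False by (simp add: GP0 R_def)
          then have nz: "\<forall>\<^sub>F p in nhds 0. G (fst p, z0 + snd p) \<noteq> 0"
            by (rule tendsto_imp_eventually_ne[OF analytic2_tendsto[OF Gc]])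
          have "\<forall>\<^sub>F p in nhds 0. G (fst (fst p ^ N, snd p), z0 + snd (fst p ^ N, snd p)) \<noteq> 0"
            by (rule eventually_compose2[OF nz]) (use N1 in \<open>auto intro!: analytic2_intros simp: power_0_left\<close>)
          then show ?thesis by eventually_elim auto
        qed
      qed
      have Sne: "S \<noteq> {}"
      proof -
        obtain c where c: "c \<in> R" using Rne by blast
        have "G (0, c) = 0" using c by (simp add: GP0 R_def)
        then have "\<exists>\<theta>\<in>Sf c. snd (0 :: complex \<times> complex) = \<theta> (fst (0 :: complex \<times> complex))"
          using eventually_nhds_x_imp_x[OF IH2[of c]] Nf[of c] by (simp add: power_0_left)
        then show ?thesis using c by (auto simp: S_def)
      qed
      have "\<forall>\<^sub>F p in nhds (0 :: complex \<times> complex). \<forall>z\<in>cball 0 R0. G (fst p ^ N, z) = 0 \<longrightarrow> (\<exists>c\<in>R. \<exists>\<theta>\<in>Sf c. z = c + \<theta> (fst p ^ M c))"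
        using tube by (intro eventually_compose21[OF _ analytic2_fst]) simp
      moreover have "\<forall>\<^sub>F p in nhds (0 :: complex \<times> complex). norm ((fst p ^ N) ^ q) < d"
        using N1 q1 d by (intro eventually_nhds_small2 analytic2_intros) (auto simp: power_0_left)
      moreover have "\<forall>\<^sub>F p in nhds (0 :: complex \<times> complex). norm (fst p ^ N) < 1"
        using N1 by (intro eventually_nhds_small2 analytic2_intros) (auto simp: power_0_left)
      moreover have "\<forall>\<^sub>F p in nhds (0 :: complex \<times> complex). norm (snd p - \<tau> ((fst p ^ N) ^ q)) < d"
        using N1 q1 d \<tau>(2) by (intro eventually_nhds_small2 analytic2_diff analytic2_snd analytic2_compose_fst[OF \<tau>s])
          (auto simp: power_0_left)
      ultimately have S2: "\<forall>\<^sub>F p in nhds 0. F (fst p ^ (N * q), snd p) = 0 \<longrightarrow> (\<exists>\<eta>\<in>S. snd p = \<eta> (fst p))"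
      proof eventually_elim
        case (elim p)
        define s y w where "s = fst p" and "y = snd p" and "w = y - \<tau> ((s ^ N) ^ q)"
        show ?case
        proof
          assume "F (fst p ^ (N * q), snd p) = 0"
          then have F0: "F ((s ^ N) ^ q, w + \<tau> ((s ^ N) ^ q)) = 0" by (simp add: s_def y_def w_def power_mult)
          show "\<exists>\<eta>\<in>S. snd p = \<eta> (fst p)"
          proof (cases "s = 0")
            case True
            then have "w = y" using N1 q1 \<tau>(2) by (simp add: w_def power_0_left)
            moreover have "(\<Sum>j\<in>J. 0 ^ r j * b j 0 * w ^ j) = 0"
            proof (rule sum.neutral, rule ballI)
              fix j assume "j \<in> J"
              then have "0 < r j" using r1[of j] by simp
              then show "0 ^ r j * b j 0 * w ^ j = 0" by simp
            qed
            ultimately have "y ^ m * U (0, y) = 0" "u0 < norm (U (0, y))"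
              using box[of 0 y] elim(4) F0 True N1 q1 d by (auto simp: power_0_left w_def s_def y_def)
            then have "y = 0" using u0 by auto
            then show ?thesis using Sne S1 True by (auto simp: s_def y_def)
          next
            case False
            define t where "t = s ^ N"
            have t: "t \<noteq> 0" using False by (simp add: t_def)
            define z where "z = w / t ^ P"
            have w: "w = t ^ P * z" using t by (simp add: z_def)
            have ts: "norm (t ^ q) < d" "norm (t ^ P * z) < d" "norm t \<le> 1"
              unfolding w[symmetric] using elim(2-4) by (auto simp: t_def s_def w_def y_def)
            have G0: "G (t, z) = 0" using scale[OF ts(1,2)] F0 t unfolding w t_def[symmetric] by simp
            have "z \<in> cball 0 R0" using bound[OF G0 ts(3,1,2)] by simp
            then obtain c \<theta>' where "c \<in> R" "\<theta>' \<in> Sf c" "z = c + \<theta>' (s ^ M c)"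
              using elim(1) G0 by (auto simp: t_def s_def)
            note z = this
            have "\<eta> c \<theta>' \<in> S" using z unfolding S_def by blast
            moreover have "y = \<eta> c \<theta>' s"
              using w z(3) by (simp add: \<eta>_def w_def t_def algebra_simps)
            ultimately show ?thesis by (auto simp: s_def y_def)
          qed
        qed
      qed
      have "finite S" unfolding S_def using finR Sf by auto
      then show ?thesis
        using S1 S2 N1 q1 by (intro exI[of _ "N * q"] conjI exI[of _ S] ballI) (simp_all add: Suc_le_eq)
    qed
  qed
qed

section \<open>Roots of unity and growth orders\<close>

definition rt :: "nat \<Rightarrow> complex" where
  "rt n = cis (2 * pi / real n)"

lemma rt_power: "rt n ^ k = cis (2 * pi * real k / real n)"
  unfolding rt_def Complex.DeMoivre by (rule arg_cong[of _ _ cis]) (simp add: divide_inverse mult_ac)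

lemma norm_rt [simp]: "norm (rt n) = 1"
  by (simp add: rt_def)

lemma rt_nonzero [simp]: "rt n \<noteq> 0"
  by (simp add: rt_def)

lemma rt_power_self: "rt n ^ n = 1"
  by (cases "n = 0") (simp_all add: rt_power)

lemma rt_inj:
  assumes "j < n" "k < n" "rt n ^ j = rt n ^ k"
  shows "j = k"
  using Complex.bij_betw_roots_unity[of n] assms by (auto simp: bij_betw_def inj_on_def rt_power)

lemma rt_power_eq_1_iff:
  assumes "0 < n"
  shows "rt n ^ k = 1 \<longleftrightarrow> n dvd k"
proof -
  have "rt n ^ k = rt n ^ (n * (k div n) + k mod n)" by simp
  also have "\<dots> = rt n ^ (k mod n)"
    by (simp only: power_add power_mult rt_power_self power_one mult_1)
  finally have "rt n ^ k = rt n ^ (k mod n)" .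
  moreover have "rt n ^ (k mod n) = 1 \<longleftrightarrow> k mod n = 0"
    using rt_inj[of "k mod n" n 0] assms by auto
  ultimately show ?thesis by (simp add: dvd_eq_mod_eq_0)
qed

lemma power_eq_rt:
  assumes "0 < n" "z ^ n = w ^ n"
  obtains k where "k < n" "z = rt n ^ k * w"
proof (cases "w = 0")
  case True
  then have "z = 0" using assms by (simp add: power_0_left)
  then show ?thesis using that[of 0] True assms by simp
next
  case False
  then have "(z / w) ^ n = 1" using assms by (simp add: power_divide)
  then obtain k where "k < n" "z / w = rt n ^ k"
    using Complex.bij_betw_roots_unity[OF assms(1)] by (force simp: bij_betw_def rt_power)
  then show ?thesis using that[of k] False by (simp add: field_simps)
qed

lemma rt_power_mult_power: "(rt n ^ k * s) ^ n = s ^ n"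
  by (metis mult_1 power_commutes power_mult power_mult_distrib power_one rt_power_self mult.commute)

lemma exists_root:
  assumes "0 < n"
  obtains s :: complex where "s ^ n = x" "norm s ^ n = norm x"
proof (cases "x = 0")
  case True
  then show ?thesis using that[of 0] assms by (simp add: power_0_left)
next
  case False
  have "exp (Ln x / of_nat n) ^ n = x"
    using False assms by (simp flip: exp_of_nat_mult)
  then show ?thesis using that[of "exp (Ln x / of_nat n)"] by (metis norm_power)
qed

lemma root_small:
  fixes s :: complex
  assumes "norm (s ^ n) < d ^ n" "0 < d"
  shows "norm s < d"
  using assms by (metis less_eq_real_def norm_power power_less_imp_less_base)

lemma eventually_box_ex:
  assumes "\<forall>\<^sub>F p in nhds (0 :: complex \<times> complex). A p"
  shows "\<exists>d>0. \<forall>x y. norm x < d \<and> norm y < d \<longrightarrow> A (x, y)"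
  by (rule eventually_box[OF assms]) blast

text \<open>Every \<open>x\<close> near 0 is \<open>s ^ n\<close> for some \<open>s\<close> near 0,
  so a statement about the points \<open>(s ^ n, y)\<close> covers a full neighbourhood.\<close>

lemma eventually_from_power:
  assumes n: "0 < n" and A: "\<forall>\<^sub>F p in nhds (0 :: complex \<times> complex). A (fst p ^ n, snd p)"
  shows "\<forall>\<^sub>F p in nhds 0. A p"
proof -
  obtain d where d: "0 < d" "\<forall>x y. norm x < d \<and> norm y < d \<longrightarrow> A (x ^ n, y)"
    using eventually_box_ex[OF A] by auto
  have "\<forall>\<^sub>F p in nhds (0 :: complex \<times> complex). norm (fst p) < d ^ n" "\<forall>\<^sub>F p in nhds (0 :: complex \<times> complex). norm (snd p) < d"
    using d by (auto intro!: eventually_nhds_small2 analytic2_intros)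
  then show ?thesis
  proof eventually_elim
    case (elim p)
    obtain s where s: "s ^ n = fst p" using exists_root[OF n] by metis
    then have "norm s < d" using root_small[of s n d] elim d by simp
    then have "A (s ^ n, snd p)" using d(2) elim by blast
    then show ?case using s by simp
  qed
qed

lemma eventually_all_roots:
  assumes n: "0 < n" and A: "\<forall>\<^sub>F t in nhds (0 :: complex). A t"
  shows "\<forall>\<^sub>F p in nhds (0 :: complex \<times> complex). \<forall>t. t ^ n = fst p \<longrightarrow> A t"
proof -
  obtain d where d: "0 < d" "\<And>t. norm t < d \<Longrightarrow> A t"
    using A unfolding eventually_nhds_metric by auto
  have "\<forall>\<^sub>F p in nhds (0 :: complex \<times> complex). norm (fst p) < d ^ n"
    using d by (auto intro!: eventually_nhds_small2 analytic2_intros)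
  then show ?thesis
    by (rule eventually_mono) (metis d root_small)
qed

lemma sum_rt:
  assumes "0 < n"
  shows "(\<Sum>k<n. (rt n ^ k) ^ i) = (if n dvd i then of_nat n else 0)"
proof -
  have "(\<Sum>k<n. (rt n ^ k) ^ i) = (\<Sum>k<n. (rt n ^ i) ^ k)"
    by (simp add: power_mult[symmetric] mult.commute)
  also have "\<dots> = (if n dvd i then of_nat n else 0)"
  proof (cases "n dvd i")
    case True
    then have "rt n ^ i = 1" using assms by (simp add: rt_power_eq_1_iff)
    then show ?thesis using True by simp
  next
    case False
    then have "rt n ^ i \<noteq> 1" using assms by (simp add: rt_power_eq_1_iff)
    moreover have "(rt n ^ i) ^ n = 1" by (metis mult.commute power_mult power_one rt_power_self)
    ultimately show ?thesis using False geometric_sum[of "rt n ^ i" n] by simp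
  qed
  finally show ?thesis .
qed

lemma has_sum_sum_fin:
  fixes n :: nat and f :: "nat \<Rightarrow> 'b \<Rightarrow> complex"
  assumes "\<And>k. k < n \<Longrightarrow> (f k has_sum S k) A"
  shows "((\<lambda>x. \<Sum>k<n. f k x) has_sum (\<Sum>k<n. S k)) A"
  using assms by (induction n) (auto intro!: has_sum_add)

text \<open>Averaging over the rotations \<open>rt n ^ k\<close> removes from the expansion all
  powers of \<open>x\<close> not divisible by \<open>n\<close>, and the rest is an expansion in
  \<open>x ^ n\<close>. This is how rotation-invariant functions of the parameter, and quotients
  computed there, come back to the plane.\<close>

lemma descent:
  assumes H: "analytic2 H" and n: "0 < n"
  shows "\<exists>h. analytic2 h \<and>
    (\<forall>\<^sub>F p in nhds 0. (\<Sum>k<n. H (rt n ^ k * fst p, snd p)) / of_nat n = h (fst p ^ n, snd p))"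
proof -
  obtain a \<rho> where \<rho>: "\<rho> > 0"
    and e: "\<And>x y. norm x < \<rho> \<Longrightarrow> norm y < \<rho> \<Longrightarrow> ((\<lambda>(i, j). a i j * x ^ i * y ^ j) has_sum H (x, y)) UNIV"
    using H unfolding analytic2_def has_expansion2_def by blast
  define h where "h = (\<lambda>p. \<Sum>\<^sub>\<infinity>(i, j). a (n * i) j * fst p ^ i * snd p ^ j)"
  have key: "((\<lambda>(i, j). a (n * i) j * (s ^ n) ^ i * y ^ j) has_sum
        ((\<Sum>k<n. H (rt n ^ k * s, y)) / of_nat n)) UNIV"
    if s: "norm s < \<rho>" and y: "norm y < \<rho>" for s y
  proof -
    have "((\<lambda>(i, j). a i j * (rt n ^ k * s) ^ i * y ^ j) has_sum H (rt n ^ k * s, y)) UNIV" for k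
      by (rule e) (use s y in \<open>auto simp: norm_mult norm_power\<close>)
    then have "((\<lambda>q. \<Sum>k<n. (case q of (i, j) \<Rightarrow> a i j * (rt n ^ k * s) ^ i * y ^ j)) has_sum
        (\<Sum>k<n. H (rt n ^ k * s, y))) UNIV"
      by (intro has_sum_sum_fin)
    then have "((\<lambda>q. (1 / of_nat n) * (\<Sum>k<n. (case q of (i, j) \<Rightarrow> a i j * (rt n ^ k * s) ^ i * y ^ j))) has_sum
        ((1 / of_nat n) * (\<Sum>k<n. H (rt n ^ k * s, y)))) UNIV"
      by (rule has_sum_cmult_right)
    moreover have "(1 / of_nat n) * (\<Sum>k<n. (case q of (i, j) \<Rightarrow> a i j * (rt n ^ k * s) ^ i * y ^ j)) =
        (if n dvd fst q then a (fst q) (snd q) * s ^ fst q * y ^ snd q else 0)" for q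
    proof -
      have "(\<Sum>k<n. a (fst q) (snd q) * (rt n ^ k * s) ^ fst q * y ^ snd q) =
          a (fst q) (snd q) * s ^ fst q * y ^ snd q * (\<Sum>k<n. (rt n ^ k) ^ fst q)"
        by (simp add: power_mult_distrib sum_distrib_left mult_ac)
      then show ?thesis using n by (simp add: sum_rt case_prod_unfold)
    qed
    ultimately have "((\<lambda>q. if n dvd fst q then a (fst q) (snd q) * s ^ fst q * y ^ snd q else 0) has_sum
        ((\<Sum>k<n. H (rt n ^ k * s, y)) / of_nat n)) UNIV" by simp
    also have "?this \<longleftrightarrow> ((\<lambda>q. a (fst q) (snd q) * s ^ fst q * y ^ snd q) has_sum
        ((\<Sum>k<n. H (rt n ^ k * s, y)) / of_nat n)) ((\<lambda>(i, j). (n * i, j)) ` UNIV)"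
      by (rule has_sum_cong_neutral) (auto simp: image_iff elim!: dvdE)
    also have "\<dots> \<longleftrightarrow> (((\<lambda>q. a (fst q) (snd q) * s ^ fst q * y ^ snd q) \<circ> (\<lambda>(i, j). (n * i, j))) has_sum
        ((\<Sum>k<n. H (rt n ^ k * s, y)) / of_nat n)) UNIV"
      by (rule has_sum_reindex) (use n in \<open>auto simp: inj_on_def\<close>)
    finally show ?thesis by (simp add: o_def case_prod_unfold power_mult)
  qed
  have h: "h (s ^ n, y) = (\<Sum>k<n. H (rt n ^ k * s, y)) / of_nat n" if "norm s < \<rho>" "norm y < \<rho>" for s y
    using key[OF that] by (simp add: h_def infsumI case_prod_unfold)
  \<comment> \<open>If \<open>norm x < \<rho> ^ n\<close>, the \<open>n\<close>-th roots of
    \<open>x\<close> lie within the radius \<open>\<rho>\<close> of the expansion of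
    \<open>H\<close>.\<close>
  define \<rho>' where "\<rho>' = min \<rho> (\<rho> ^ n)"
  have "has_expansion2 h (\<lambda>i. a (n * i))"
    unfolding has_expansion2_def
  proof (intro exI conjI allI impI)
    show "0 < \<rho>'" using \<rho> by (simp add: \<rho>'_def)
    fix x y :: complex assume xy: "norm x < \<rho>' \<and> norm y < \<rho>'"
    obtain s where s: "s ^ n = x" using exists_root[OF n] by metis
    then have "norm s < \<rho>" using root_small[of s n \<rho>] xy \<rho> by (simp add: \<rho>'_def)
    then show "((\<lambda>(i, j). a (n * i) j * x ^ i * y ^ j) has_sum h (x, y)) UNIV"
      using key[of s y] h[of s y] s xy by (simp add: \<rho>'_def)
  qed
  then have "analytic2 h" by (auto simp: analytic2_def)
  moreover have "\<forall>\<^sub>F p in nhds (0 :: complex \<times> complex). norm (fst p) < \<rho>" "\<forall>\<^sub>F p in nhds (0 :: complex \<times> complex). norm (snd p) < \<rho>"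
    using \<rho> by (auto intro!: eventually_nhds_small2 analytic2_intros)
  then have "\<forall>\<^sub>F p in nhds 0. (\<Sum>k<n. H (rt n ^ k * fst p, snd p)) / of_nat n = h (fst p ^ n, snd p)"
    by eventually_elim (simp add: h)
  ultimately show ?thesis by blast
qed

section \<open>Lowest-order terms of a double series\<close>

lemma has_sum_norm_bound_aux:
  fixes f :: "'a \<Rightarrow> complex"
  assumes f: "(f has_sum s) A" and g: "(g has_sum t) A" and le: "\<And>q. q \<in> A \<Longrightarrow> norm (f q) \<le> g q"
  shows "norm s \<le> t"
proof -
  have "(\<lambda>q. norm (f q)) summable_on A"
    using has_sum_imp_summable[OF g] le by (rule Infinite_Sum.abs_summable_on_comparison_test')
  then obtain n where n: "((\<lambda>q. norm (f q)) has_sum n) A" using has_sum_infsum by blast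
  have "norm s \<le> n" using n f by (rule norm_has_sum_bound)
  also have "n \<le> t" using n g le by (rule has_sum_mono)
  finally show ?thesis .
qed

text \<open>Scaling both variables by \<open>r\<close> gains a factor \<open>r ^ N\<close> on every
  term of degree at least \<open>N\<close>; \<open>S\<close> is the absolute tail at radius
  \<open>R\<close>.\<close>

lemma expansion_tail:
  fixes a :: "nat \<Rightarrow> nat \<Rightarrow> complex"
  assumes e: "\<And>x y. norm x < \<rho> \<Longrightarrow> norm y < \<rho> \<Longrightarrow> ((\<lambda>(i, j). a i j * x ^ i * y ^ j) has_sum f (x, y)) UNIV"
    and R: "0 < R" "R < \<rho>"
  obtains S where "0 \<le> S" "\<And>r x y. \<lbrakk>0 \<le> r; r \<le> 1; norm x \<le> r * R; norm y \<le> r * R\<rbrakk> \<Longrightarrow>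
    norm (f (x, y) - (\<Sum>(i, j) \<in> {(i, j). i + j < N}. a i j * x ^ i * y ^ j)) \<le> S * r ^ N"
proof -
  define I where "I = {(i, j). i + j < N}"
  have finI: "finite I"
    by (rule finite_subset[of _ "{..<N} \<times> {..<N}"]) (auto simp: I_def)
  have sm: "(\<lambda>(i, j). norm (a i j) * R ^ i * R ^ j) summable_on UNIV"
    using expansion_abs_summable[OF e] R by auto
  define S where "S = (\<Sum>\<^sub>\<infinity>(i, j)\<in>UNIV - I. norm (a i j) * R ^ i * R ^ j)"
  have smI: "(\<lambda>(i, j). norm (a i j) * R ^ i * R ^ j) summable_on (UNIV - I)"
    using sm by (rule summable_on_subset_banach) auto
  show ?thesis
  proof
    show "0 \<le> S" unfolding S_def using R by (intro infsum_nonneg) auto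
    fix r :: real and x y :: complex assume r: "0 \<le> r" "r \<le> 1" and x: "norm x \<le> r * R" and y: "norm y \<le> r * R"
    have rR: "r * R \<le> R" using r R by (simp add: mult_le_cancel_right1)
    have "norm x < \<rho>" "norm y < \<rho>" using x y R rR by linarith+
    then have "((\<lambda>(i, j). a i j * x ^ i * y ^ j) has_sum f (x, y)) UNIV" by (rule e)
    then have hs: "((\<lambda>(i, j). a i j * x ^ i * y ^ j) has_sum
        (f (x, y) - (\<Sum>(i, j)\<in>I. a i j * x ^ i * y ^ j))) (UNIV - I)"
      using finI by (intro has_sum_Diff has_sum_finite) auto
    have le: "norm (case q of (i, j) \<Rightarrow> a i j * x ^ i * y ^ j) \<le> r ^ N * (case q of (i, j) \<Rightarrow> norm (a i j) * R ^ i * R ^ j)"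
      if "q \<in> UNIV - I" for q
    proof -
      obtain i j where q: "q = (i, j)" by (cases q)
      have ij: "N \<le> i + j" using that by (simp add: q I_def)
      have "norm (a i j * x ^ i * y ^ j) \<le> norm (a i j) * (r * R) ^ i * (r * R) ^ j"
        unfolding norm_mult norm_power using x y r R by (intro mult_mono power_mono) auto
      also have "\<dots> = r ^ (i + j) * (norm (a i j) * R ^ i * R ^ j)"
        by (simp add: power_mult_distrib power_add mult_ac)
      also have "\<dots> \<le> r ^ N * (norm (a i j) * R ^ i * R ^ j)"
        using r R ij by (intro mult_right_mono power_decreasing) auto
      finally show ?thesis by (simp add: q)
    qed
    have "((\<lambda>q. r ^ N * (case q of (i, j) \<Rightarrow> norm (a i j) * R ^ i * R ^ j)) has_sum (r ^ N * S)) (UNIV - I)"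
      unfolding S_def using smI by (intro has_sum_cmult_right has_sum_infsum)
    then have "norm (f (x, y) - (\<Sum>(i, j)\<in>I. a i j * x ^ i * y ^ j)) \<le> r ^ N * S"
      using le by (rule has_sum_norm_bound_aux[OF hs])
    then show "norm (f (x, y) - (\<Sum>(i, j)\<in>{(i, j). i + j < N}. a i j * x ^ i * y ^ j)) \<le> S * r ^ N"
      by (simp add: I_def mult.commute)
  qed
qed

lemma nonpos_if_le_small:
  fixes x K \<delta> :: real
  assumes "0 < \<delta>" "\<And>R. 0 < R \<Longrightarrow> R < \<delta> \<Longrightarrow> x \<le> K * R"
  shows "x \<le> 0"
proof -
  have "((\<lambda>R. K * R) \<longlongrightarrow> K * 0) (at_right 0)" by (intro tendsto_intros)
  moreover have "\<forall>\<^sub>F R in at_right 0. x \<le> K * R"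
    using eventually_at_right_field[of _ "0::real"] assms by auto
  ultimately have "x \<le> K * 0" by (rule tendsto_lowerbound) simp
  then show ?thesis by simp
qed

lemma analytic2_expansion:
  assumes "analytic2 f"
  shows "\<exists>a \<rho>. 0 < \<rho> \<and> has_expansion2 f a \<and>
    (\<forall>R M i j. 0 < R \<and> R < \<rho> \<and> (\<forall>x y. norm x \<le> R \<and> norm y \<le> R \<longrightarrow> norm (f (x, y)) \<le> M) \<longrightarrow>
       norm (a i j) \<le> M / R ^ (i + j))"
proof -
  obtain U where U: "sholo f U" "0 \<in> U" using assms by (rule analytic2_sholo)
  show ?thesis by (rule sholo_expansion[OF U]) blast
qed

lemma expansion_tail_ex:
  fixes a :: "nat \<Rightarrow> nat \<Rightarrow> complex"
  assumes e: "\<And>x y. norm x < \<rho> \<Longrightarrow> norm y < \<rho> \<Longrightarrow> ((\<lambda>(i, j). a i j * x ^ i * y ^ j) has_sum f (x, y)) UNIV"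
    and R: "0 < R" "R < \<rho>"
  shows "\<exists>S\<ge>0. \<forall>r x y. 0 \<le> r \<and> r \<le> 1 \<and> norm x \<le> r * R \<and> norm y \<le> r * R \<longrightarrow>
    norm (f (x, y) - (\<Sum>(i, j) \<in> {(i, j). i + j < N}. a i j * x ^ i * y ^ j)) \<le> S * r ^ N"
  by (rule expansion_tail[OF e R, of N]) blast+

text \<open>The upper bound kills all coefficients of degree below \<open>n\<close>, by the Cauchy
  estimate on shrinking bidiscs. If degree \<open>n\<close> vanished as well,
  \<open>f (c * v, v)\<close> would be at most a multiple of \<open>norm v ^ (n + 1)\<close>,
  against its exact value \<open>v ^ n\<close>.\<close>

lemma order_criterion:
  assumes f: "analytic2 f" and ub: "\<forall>\<^sub>F p in nhds 0. norm (f p) \<le> C * norm p ^ n"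
    and lb: "\<forall>\<^sub>F v in nhds 0. f (c * v, v) = v ^ n"
  shows "has_order2 f n"
proof -
  obtain a \<rho> where \<rho>: "0 < \<rho>" and ex: "has_expansion2 f a"
    and ab: "\<forall>R M i j. 0 < R \<and> R < \<rho> \<and> (\<forall>x y. norm x \<le> R \<and> norm y \<le> R \<longrightarrow> norm (f (x, y)) \<le> M) \<longrightarrow>
       norm (a i j) \<le> M / R ^ (i + j)"
    using analytic2_expansion[OF f] by blast
  obtain d where d: "0 < d" "\<forall>x y. norm x < d \<and> norm y < d \<longrightarrow> norm (f (x, y)) \<le> C * norm (x, y) ^ n"
    using eventually_box_ex[OF ub] by blast
  have zero: "a i j = 0" if ij: "i + j < n" for i j
  proof -
    have "norm (a i j) \<le> (\<bar>C\<bar> * 2 ^ n) * R" if R: "0 < R" "R < min (min \<rho> d) 1" for R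
    proof -
      have "norm (f (x, y)) \<le> \<bar>C\<bar> * (2 * R) ^ n" if "norm x \<le> R" "norm y \<le> R" for x y
      proof -
        have "norm (x, y) \<le> 2 * R" using norm_Pair_le[of x y] that by simp
        then have "norm (x, y) ^ n \<le> (2 * R) ^ n" by (intro power_mono) auto
        moreover have "norm (f (x, y)) \<le> C * norm (x, y) ^ n" using d that R by auto
        moreover have "C * norm (x, y) ^ n \<le> \<bar>C\<bar> * norm (x, y) ^ n" by (intro mult_right_mono) auto
        ultimately show ?thesis by (smt (verit) abs_ge_zero mult_left_mono)
      qed
      then have "norm (a i j) \<le> \<bar>C\<bar> * (2 * R) ^ n / R ^ (i + j)" using ab R by auto
      also have "\<dots> = \<bar>C\<bar> * 2 ^ n * R ^ (n - (i + j))"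
        using R ij by (simp add: power_mult_distrib power_diff)
      also have "\<dots> \<le> \<bar>C\<bar> * 2 ^ n * R"
        using R ij power_decreasing[of 1 "n - (i + j)" R] by (intro mult_left_mono) auto
      finally show ?thesis .
    qed
    then have "norm (a i j) \<le> 0" using \<rho> d by (intro nonpos_if_le_small[of "min (min \<rho> d) 1"]) auto
    then show ?thesis by simp
  qed
  have "\<exists>i j. i + j = n \<and> a i j \<noteq> 0"
  proof (rule ccontr)
    assume "\<nexists>i j. i + j = n \<and> a i j \<noteq> 0"
    then have z: "a i j = 0" if "i + j < n + 1" for i j using zero[of i j] that by (cases "i + j = n") auto
    obtain \<rho>' where \<rho>': "\<rho>' > 0"
      and e: "\<And>x y. norm x < \<rho>' \<Longrightarrow> norm y < \<rho>' \<Longrightarrow> ((\<lambda>(i, j). a i j * x ^ i * y ^ j) has_sum f (x, y)) UNIV"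
      using ex unfolding has_expansion2_def by blast
    define R0 where "R0 = \<rho>' / 2"
    have R0: "0 < R0" "R0 < \<rho>'" using \<rho>' by (auto simp: R0_def)
    obtain S where S1: "0 \<le> S" and S2: "\<forall>r x y. 0 \<le> r \<and> r \<le> 1 \<and> norm x \<le> r * R0 \<and> norm y \<le> r * R0 \<longrightarrow>
        norm (f (x, y) - (\<Sum>(i, j) \<in> {(i, j). i + j < n + 1}. a i j * x ^ i * y ^ j)) \<le> S * r ^ (n + 1)"
      using expansion_tail_ex[OF e R0, of "n + 1"] by blast
    have S: "0 \<le> S" "\<And>r x y. \<lbrakk>0 \<le> r; r \<le> 1; norm x \<le> r * R0; norm y \<le> r * R0\<rbrakk> \<Longrightarrow>
        norm (f (x, y) - (\<Sum>(i, j) \<in> {(i, j). i + j < n + 1}. a i j * x ^ i * y ^ j)) \<le> S * r ^ (n + 1)"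
      using S1 S2 by simp_all
    have s0: "(\<Sum>(i, j) \<in> {(i, j). i + j < n + 1}. a i j * x ^ i * y ^ j) = 0" for x y
      by (rule sum.neutral) (use z in auto)
    obtain d1 where d1: "d1 > 0" "\<And>v. norm v < d1 \<Longrightarrow> f (c * v, v) = v ^ n"
      using lb unfolding eventually_nhds_metric by auto
    define A where "A = 1 + norm c"
    have A: "A > 0" "1 \<le> A" "norm c \<le> A" using norm_ge_zero[of c] unfolding A_def by linarith+
    have "1 \<le> (S * (A / R0) ^ (n + 1)) * t" if t: "0 < t" "t < min d1 (R0 / A)" for t
    proof -
      define v where "v = complex_of_real t"
      have v: "norm v = t" using t by (simp add: v_def)
      define r where "r = A * t / R0"
      have r: "0 \<le> r" "r \<le> 1" "r * R0 = A * t" using t A R0 by (auto simp: r_def field_simps)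
      have nv: "norm v \<le> A * t" using A t by (simp add: v)
      have "norm (c * v) \<le> A * t" unfolding norm_mult v using A t by (intro mult_right_mono) auto
      then have "norm (f (c * v, v)) \<le> S * r ^ (n + 1)"
        using S(2)[OF r(1,2), of "c * v" v] nv unfolding r(3) s0 by simp
      moreover have "f (c * v, v) = v ^ n" using d1(2)[of v] v t by simp
      ultimately have "t ^ n \<le> S * r ^ (n + 1)" using v by (simp add: norm_power)
      also have "\<dots> = ((S * (A / R0) ^ (n + 1)) * t) * t ^ n"
        by (simp add: r_def power_mult_distrib power_divide)
      finally have "1 * t ^ n \<le> ((S * (A / R0) ^ (n + 1)) * t) * t ^ n" by simp
      then show ?thesis using t by (simp only: mult_le_cancel_right_pos zero_less_power)
    qed
    note small = this
    have "(1::real) \<le> 0"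
    proof (rule nonpos_if_le_small)
      show "0 < min d1 (R0 / A)" using d1 R0 A by simp
    qed (rule small)
    then show False by simp
  qed
  then show ?thesis unfolding has_order2_def using ex zero by blast
qed

text \<open>Where the lowest homogeneous part of \<open>f\<close>, written
  \<open>y ^ N * Q (x / y)\<close>, is nonzero in the direction \<open>c\<close>, \<open>f\<close>
  has no zeros off 0 in a thin cone around that direction. The shear moves this cone to the line
  \<open>x = 0\<close>, so zeros satisfy \<open>norm y \<le> K * norm x\<close>. Applied to an
  equation of the whole curve, a single \<open>c\<close> serves all branches.\<close>

lemma good_direction:
  assumes f: "analytic2 f" and nz: "\<not> (\<forall>\<^sub>F p in nhds 0. f p = 0)"
  shows "\<exists>c K. 0 < K \<and> (\<forall>\<^sub>F p in nhds 0. f (fst p + c * snd p, snd p) = 0 \<longrightarrow> norm (snd p) \<le> K * norm (fst p))"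
proof -
  obtain a \<rho> where \<rho>: "\<rho> > 0"
    and e: "\<And>x y. norm x < \<rho> \<Longrightarrow> norm y < \<rho> \<Longrightarrow> ((\<lambda>(i, j). a i j * x ^ i * y ^ j) has_sum f (x, y)) UNIV"
    using f unfolding analytic2_def has_expansion2_def by blast
  have "\<exists>m i j. i + j = m \<and> a i j \<noteq> 0"
  proof (rule ccontr)
    assume "\<not> ?thesis"
    then have a0: "a i j = 0" for i j by blast
    have "f (x, y) = 0" if "norm x < \<rho>" "norm y < \<rho>" for x y
    proof -
      have "((\<lambda>_ :: nat \<times> nat. 0) has_sum f (x, y)) UNIV" using e[OF that] by (simp add: a0 case_prod_unfold)
      then show ?thesis using has_sum_unique[OF _ has_sum_0_simp] by blast
    qed
    note f0 = this
    have "\<forall>\<^sub>F p in nhds (0 :: complex \<times> complex). norm (fst p) < \<rho>" "\<forall>\<^sub>F p in nhds (0 :: complex \<times> complex). norm (snd p) < \<rho>"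
      using \<rho> by (auto intro!: eventually_nhds_small2 analytic2_intros)
    then have "\<forall>\<^sub>F p in nhds 0. f p = 0"
    proof eventually_elim
      case (elim p)
      then show ?case using f0[of "fst p" "snd p"] by simp
    qed
    then show False using nz by blast
  qed
  define N where "N = (LEAST m. \<exists>i j. i + j = m \<and> a i j \<noteq> 0)"
  have N1: "\<exists>i j. i + j = N \<and> a i j \<noteq> 0"
    unfolding N_def by (rule LeastI_ex) fact
  have N2: "a i j = 0" if "i + j < N" for i j
    using not_less_Least[of "i + j" "\<lambda>m. \<exists>i j. i + j = m \<and> a i j \<noteq> 0"] that unfolding N_def by blast
  define Q where "Q = (\<Sum>i\<le>N. monom (a i (N - i)) i)"
  have "Q \<noteq> 0"
  proof -
    obtain i j where ij: "i + j = N" "a i j \<noteq> 0" using N1 by blast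
    have "coeff Q i = (\<Sum>k\<le>N. if k = i then a k (N - k) else 0)"
      unfolding Q_def coeff_sum by (rule sum.cong) auto
    also have "\<dots> = a i (N - i)" using ij by simp
    finally have "coeff Q i \<noteq> 0" using ij by (metis add_diff_cancel_left')
    then show ?thesis by auto
  qed
  then obtain c where c: "poly Q c \<noteq> 0" using poly_all_0_iff_0 by blast
  define q0 where "q0 = norm (poly Q c) / 2"
  have q0: "q0 > 0" using c by (simp add: q0_def)
  have "isCont (poly Q) c" by simp
  then obtain \<delta> where \<delta>: "\<delta> > 0" "\<And>z. dist z c < \<delta> \<Longrightarrow> dist (poly Q z) (poly Q c) < q0"
    using q0 unfolding continuous_at_eps_delta by blast
  have Qlow: "q0 \<le> norm (poly Q (c + w))" if "norm w < \<delta>" for w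
  proof -
    have "norm (poly Q c - poly Q (c + w)) < q0" using \<delta>(2)[of "c + w"] that by (simp add: dist_norm norm_minus_commute)
    moreover have "norm (poly Q c) - norm (poly Q (c + w)) \<le> norm (poly Q c - poly Q (c + w))"
      by (rule norm_triangle_ineq2)
    ultimately show ?thesis by (simp add: q0_def)
  qed
  define R0 where "R0 = \<rho> / 2"
  have R0: "0 < R0" "R0 < \<rho>" using \<rho> by (auto simp: R0_def)
    obtain S where S1: "0 \<le> S" and S2: "\<forall>r x y. 0 \<le> r \<and> r \<le> 1 \<and> norm x \<le> r * R0 \<and> norm y \<le> r * R0 \<longrightarrow>
        norm (f (x, y) - (\<Sum>(i, j) \<in> {(i, j). i + j < N + 1}. a i j * x ^ i * y ^ j)) \<le> S * r ^ (N + 1)"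
      using expansion_tail_ex[OF e R0, of "N + 1"] by blast
    have S: "0 \<le> S" "\<And>r x y. \<lbrakk>0 \<le> r; r \<le> 1; norm x \<le> r * R0; norm y \<le> r * R0\<rbrakk> \<Longrightarrow>
        norm (f (x, y) - (\<Sum>(i, j) \<in> {(i, j). i + j < N + 1}. a i j * x ^ i * y ^ j)) \<le> S * r ^ (N + 1)"
      using S1 S2 by simp_all
  have hom: "(\<Sum>(i, j) \<in> {(i, j). i + j < N + 1}. a i j * u ^ i * v ^ j) = v ^ N * poly Q (u / v)"
    if v: "v \<noteq> 0" for u v
  proof -
    have fin: "finite {(i, j). i + j < N + 1}"
      by (rule finite_subset[of _ "{..<N + 1} \<times> {..<N + 1}"]) auto
    have "(\<Sum>(i, j) \<in> {(i, j). i + j < N + 1}. a i j * u ^ i * v ^ j) =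
        (\<Sum>(i, j) \<in> (\<lambda>i. (i, N - i)) ` {..N}. a i j * u ^ i * v ^ j)"
    proof (rule sum.mono_neutral_right[OF fin])
      show "\<forall>q\<in>{(i, j). i + j < N + 1} - (\<lambda>i. (i, N - i)) ` {..N}. (case q of (i, j) \<Rightarrow> a i j * u ^ i * v ^ j) = 0"
      proof
        fix q assume q: "q \<in> {(i, j). i + j < N + 1} - (\<lambda>i. (i, N - i)) ` {..N}"
        obtain i j where ij: "q = (i, j)" by (cases q)
        have "i + j < N" using q by (auto simp: ij image_iff)
        then show "(case q of (i, j) \<Rightarrow> a i j * u ^ i * v ^ j) = 0" by (simp add: ij N2)
      qed
    qed auto
    also have "\<dots> = (\<Sum>i\<le>N. a i (N - i) * u ^ i * v ^ (N - i))"
      by (subst sum.reindex) (auto simp: inj_on_def)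
    also have "\<dots> = (\<Sum>i\<le>N. v ^ N * (a i (N - i) * (u / v) ^ i))"
    proof (rule sum.cong)
      fix i assume "i \<in> {..N}"
      then have "v ^ N = v ^ (N - i) * v ^ i" by (simp flip: power_add)
      then show "a i (N - i) * u ^ i * v ^ (N - i) = v ^ N * (a i (N - i) * (u / v) ^ i)"
        using v by (simp add: power_divide)
    qed simp
    finally show ?thesis by (simp add: Q_def poly_sum poly_monom sum_distrib_left)
  qed
  \<comment> \<open>Bounds \<open>norm (x + c * y) / norm y\<close> in the cone
    \<open>norm x < \<delta> * norm y\<close>; being at least 1, it serves for \<open>y\<close>
    itself too.\<close>
  define A where "A = 1 + \<delta> + norm c"
  have A: "A > 0" "1 \<le> A" "\<delta> + norm c \<le> A" using \<delta>(1) norm_ge_zero[of c] unfolding A_def by linarith+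
  define B where "B = S * (A / R0) ^ (N + 1)"
  have B: "B \<ge> 0" using S A R0 by (simp add: B_def)
  \<comment> \<open>The first entry keeps the point where the tail estimate holds; the second makes
    the tail \<open>B * norm y ^ (N + 1)\<close> smaller than the lower bound
    \<open>q0 * norm y ^ N\<close> of the lowest part.\<close>
  define y0 where "y0 = min (R0 / A) (q0 / (B + 1))"
  have y0: "y0 > 0" using R0 A q0 B by (simp add: y0_def)
  have main: "norm y \<le> 2 / \<delta> * norm x" if fz: "f (x + c * y, y) = 0" and y: "norm y < y0" for x y
  proof (rule ccontr)
    assume "\<not> norm y \<le> 2 / \<delta> * norm x"
    then have xy: "2 / \<delta> * norm x < norm y" by simp
    then have yn: "norm y > 0" using \<delta>(1) by (smt (verit) divide_nonneg_pos mult_nonneg_nonneg norm_ge_zero)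
    have xy': "norm x < \<delta> * norm y"
    proof -
      have "norm x * 2 < norm y * \<delta>" using xy \<delta>(1) by (simp add: field_simps)
      moreover have "norm x \<le> norm x * 2" by simp
      ultimately show ?thesis using le_less_trans[OF \<open>norm x \<le> norm x * 2\<close>, of "norm y * \<delta>"] by (simp add: mult.commute)
    qed
    have "norm (x / y) < \<delta>" using xy' yn by (simp add: norm_divide divide_less_eq)
    then have "q0 \<le> norm (poly Q (c + x / y))" by (rule Qlow)
    moreover have "(x + c * y) / y = c + x / y" using yn by (simp add: field_simps)
    ultimately have 1: "q0 \<le> norm (poly Q ((x + c * y) / y))" by simp
    define r where "r = A * norm y / R0"
    have r: "0 \<le> r" "r \<le> 1" "r * R0 = A * norm y" using y A R0 by (auto simp: r_def y0_def field_simps)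
    have "norm (x + c * y) \<le> norm x + norm c * norm y" using norm_triangle_ineq[of x "c * y"] by (simp add: norm_mult)
    also have "\<dots> \<le> (\<delta> + norm c) * norm y" using xy' by (simp add: distrib_right)
    also have "\<dots> \<le> A * norm y" using A by (intro mult_right_mono) auto
    finally have nu: "norm (x + c * y) \<le> A * norm y" .
    have ny: "norm y \<le> A * norm y" using A yn by simp
    have "norm (y ^ N * poly Q ((x + c * y) / y)) \<le> S * r ^ (N + 1)"
      using S(2)[OF r(1,2), of "x + c * y" y] nu ny r(3) hom[of y "x + c * y"] yn fz by simp
    then have "norm y ^ N * q0 \<le> S * r ^ (N + 1)"
      using 1 mult_left_mono[of q0 "norm (poly Q ((x + c * y) / y))" "norm y ^ N"]
      by (simp add: norm_mult norm_power)
    also have "S * r ^ (N + 1) = norm y ^ N * (B * norm y)"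
      by (simp add: r_def B_def power_mult_distrib power_divide)
    finally have "q0 \<le> B * norm y" using yn by (simp only: mult_le_cancel_left_pos zero_less_power)
    also have "\<dots> \<le> (B + 1) * norm y" by (simp add: distrib_right)
    also have "\<dots> < (B + 1) * (q0 / (B + 1))" using y B by (intro mult_strict_left_mono) (auto simp: y0_def)
    also have "\<dots> = q0" using B by simp
    finally show False by simp
  qed
  have "\<forall>\<^sub>F p in nhds (0 :: complex \<times> complex). norm (snd p) < y0"
    using y0 by (intro eventually_nhds_small2 analytic2_intros) auto
  then have "\<forall>\<^sub>F p in nhds 0. f (fst p + c * snd p, snd p) = 0 \<longrightarrow> norm (snd p) \<le> 2 / \<delta> * norm (fst p)"
    by eventually_elim (use main in blast)
  then show ?thesis using \<delta>(1) by (intro exI[of _ c] exI[of _ "2 / \<delta>"]) auto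
qed

section \<open>Orders of vanishing as two-sided bounds\<close>

definition growth :: "(complex \<Rightarrow> complex) \<Rightarrow> nat \<Rightarrow> bool" where
  "growth h k \<longleftrightarrow> (\<exists>c>0. \<exists>C>0. \<forall>\<^sub>F t in nhds 0.
      c * norm t ^ k \<le> norm (h t) \<and> norm (h t) \<le> C * norm t ^ k)"

lemma growth_power_mult:
  assumes b: "b analytic_on {0}" "b 0 \<noteq> 0" and h: "\<forall>\<^sub>F t in nhds 0. h t = t ^ k * b t"
  shows "growth h k"
proof -
  have lim: "((\<lambda>t. norm (b t)) \<longlongrightarrow> norm (b 0)) (nhds 0)"
    by (intro tendsto_norm analytic_tendsto b)
  have "\<forall>\<^sub>F t in nhds 0. norm (b 0) / 2 < norm (b t)" "\<forall>\<^sub>F t in nhds 0. norm (b t) < 2 * norm (b 0)"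
    using order_tendstoD(1)[OF lim, of "norm (b 0) / 2"] order_tendstoD(2)[OF lim, of "2 * norm (b 0)"] b(2)
    by simp_all
  with h have "\<forall>\<^sub>F t in nhds 0. (norm (b 0) / 2) * norm t ^ k \<le> norm (h t) \<and> norm (h t) \<le> (2 * norm (b 0)) * norm t ^ k"
  proof eventually_elim
    case (elim t)
    have "(norm (b 0) / 2) * norm t ^ k \<le> norm (b t) * norm t ^ k" using elim by (intro mult_right_mono) auto
    moreover have "norm (b t) * norm t ^ k \<le> (2 * norm (b 0)) * norm t ^ k" using elim by (intro mult_right_mono) auto
    ultimately show ?case using elim by (simp add: norm_mult norm_power mult.commute)
  qed
  then show ?thesis unfolding growth_def using b(2)
    by (intro exI[of _ "norm (b 0) / 2"] conjI exI[of _ "2 * norm (b 0)"]) auto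
qed

lemma growth_fps:
  assumes H: "h has_fps_expansion H" "H \<noteq> 0"
  shows "growth h (subdegree H)"
proof -
  define r where "r = subdegree H"
  define b where "b = (\<lambda>x. if x = 0 then fps_nth H r else h x / x ^ r)"
  have b: "b has_fps_expansion fps_shift r H"
    unfolding b_def by (rule has_fps_expansion_shift[OF H(1)]) (auto simp: r_def)
  have h0: "h 0 = fps_nth H 0" using has_fps_expansion_imp_0_eq_fps_nth_0[OF H(1)] by simp
  have b0: "b 0 = fps_nth H r" by (simp add: b_def)
  have "h 0 = 0 ^ r * b 0"
  proof (cases "r = 0")
    case False
    then have "fps_nth H 0 = 0" unfolding r_def by (intro nth_less_subdegree_zero) simp
    then show ?thesis using False h0 by (simp add: power_0_left)
  qed (simp add: h0 b0)
  then have "h x = x ^ r * b x" for x by (cases "x = 0") (auto simp: b_def)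
  then have "growth h r"
    using H(2) by (intro growth_power_mult[OF has_fps_expansion_imp_analytic_0[OF b]]) (auto simp: b0 r_def)
  then show ?thesis by (simp add: r_def)
qed

lemma powr_compare:
  fixes c C a b :: real
  assumes c: "0 < c" and ev: "\<forall>\<^sub>F s in at_right 0. c * s powr a \<le> C * s powr b"
  shows "b \<le> a"
proof (rule ccontr)
  assume "\<not> b \<le> a"
  then have ba: "0 < b - a" by simp
  have "\<forall>\<^sub>F s in at_right (0::real). 0 \<le> s"
    using eventually_at_right_less[of "0::real"] by eventually_elim simp
  then have "((\<lambda>s::real. s powr (b - a)) \<longlongrightarrow> 0) (at_right 0)"
    by (rule tendsto_zero_powrI[OF tendsto_ident_at tendsto_const _ ba])
  then have "((\<lambda>s. C * s powr (b - a)) \<longlongrightarrow> C * 0) (at_right 0)" by (intro tendsto_intros)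
  moreover have "\<forall>\<^sub>F s in at_right (0::real). c \<le> C * s powr (b - a)"
    using ev eventually_at_right_less[of "0::real"]
  proof eventually_elim
    case (elim s)
    have "s powr b = s powr a * s powr (b - a)" by (simp flip: powr_add)
    then have "s powr a * c \<le> s powr a * (C * s powr (b - a))" using elim by (simp add: mult_ac)
    then show ?case using elim by simp
  qed
  ultimately have "c \<le> C * 0" by (rule tendsto_lowerbound) simp
  then show False using c by simp
qed

lemma eventually_of_real:
  assumes "\<forall>\<^sub>F t in nhds (0 :: complex). A t"
  shows "\<forall>\<^sub>F s in at_right (0 :: real). A (of_real s)"
proof (rule eventually_compose_filterlim[OF assms])
  have "(complex_of_real \<longlongrightarrow> of_real 0) (at_right 0)" by (intro tendsto_intros)
  then show "filterlim complex_of_real (nhds 0) (at_right 0)" by simp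
qed

lemma power_compare:
  assumes c: "0 < c" and ev: "\<forall>\<^sub>F t in nhds (0 :: complex). c * norm t ^ k \<le> C * norm t ^ l"
  shows "l \<le> k"
proof -
  have "\<forall>\<^sub>F s in at_right 0. c * s powr real k \<le> C * s powr real l"
    using eventually_of_real[OF ev] eventually_at_right_less[of "0::real"]
    by eventually_elim (simp add: powr_realpow)
  then show ?thesis using powr_compare[OF c] by fastforce
qed

lemma growth_unique:
  assumes "growth h k" "growth h l"
  shows "k = l"
proof -
  obtain c C where c: "c > 0" "C > 0" and 1: "\<forall>\<^sub>F t in nhds 0. c * norm t ^ k \<le> norm (h t) \<and> norm (h t) \<le> C * norm t ^ k"
    using assms(1) unfolding growth_def by blast
  obtain d D where d: "d > 0" "D > 0" and 2: "\<forall>\<^sub>F t in nhds 0. d * norm t ^ l \<le> norm (h t) \<and> norm (h t) \<le> D * norm t ^ l"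
    using assms(2) unfolding growth_def by blast
  have "\<forall>\<^sub>F t in nhds (0 :: complex). c * norm t ^ k \<le> D * norm t ^ l" using 1 2 by eventually_elim linarith
  then have "l \<le> k" by (rule power_compare[OF c(1)])
  moreover have "\<forall>\<^sub>F t in nhds (0 :: complex). d * norm t ^ l \<le> C * norm t ^ k" using 1 2 by eventually_elim linarith
  then have "k \<le> l" by (rule power_compare[OF d(1)])
  ultimately show ?thesis by simp
qed

lemma analytic_zero_or_nonzero:
  assumes "h analytic_on {0}"
  shows "(\<forall>\<^sub>F t in nhds 0. h t = 0) \<or> (\<forall>\<^sub>F t in at 0. h t \<noteq> (0 :: complex))"
proof (cases "\<forall>\<^sub>F t in nhds 0. h t = 0")
  case False
  obtain r b where b: "b analytic_on {0}" "b 0 \<noteq> 0" "\<forall>\<^sub>F x in nhds 0. h x = x ^ r * b x"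
    by (rule order_factor[OF assms False])
  have "\<forall>\<^sub>F x in nhds 0. b x \<noteq> 0"
    using b(2) by (rule tendsto_imp_eventually_ne[OF analytic_tendsto[OF b(1)]])
  with b(3) have "\<forall>\<^sub>F t in nhds 0. t \<noteq> 0 \<longrightarrow> h t \<noteq> 0" by eventually_elim simp
  then show ?thesis by (simp add: eventually_at_filter)
qed simp

section \<open>Puiseux parametrizations of branches\<close>

text \<open>Says that \<open>n\<close> and the exponents occurring in \<open>Y\<close> have no
  common divisor above 1. It is stated divisor by divisor because a failing \<open>e\<close>
  directly provides a root of unity \<open>rt e\<close> that fixes the function.\<close>

definition primitive_series :: "nat \<Rightarrow> complex fps \<Rightarrow> bool" where
  "primitive_series n Y \<longleftrightarrow> (\<forall>e>1. e dvd n \<longrightarrow> (\<exists>i. fps_nth Y i \<noteq> 0 \<and> \<not> e dvd i))"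

lemma has_fps_expansion_rotate:
  fixes a :: complex
  assumes "y has_fps_expansion Y"
  shows "(\<lambda>t. y (a * t)) has_fps_expansion Abs_fps (\<lambda>i. a ^ i * fps_nth Y i)"
proof -
  have "(y \<circ> (\<lambda>t. a * t)) has_fps_expansion fps_compose Y (fps_const a * fps_X)"
    by (rule has_fps_expansion_compose[OF assms]) (auto intro!: fps_expansion_intros)
  then show ?thesis by (simp add: o_def fps_compose_linear)
qed

lemma not_primitive_invariant:
  assumes n: "0 < n" and y: "y has_fps_expansion Y" and np: "\<not> primitive_series n Y"
  obtains e where "1 < e" "e dvd n" "\<forall>\<^sub>F t in nhds 0. y (rt e * t) = y t"
proof -
  obtain e where e: "1 < e" "e dvd n" "\<And>i. fps_nth Y i \<noteq> 0 \<Longrightarrow> e dvd i"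
    using np unfolding primitive_series_def by blast
  have "rt e ^ i * fps_nth Y i = fps_nth Y i" for i
    using e(1) e(3)[of i] rt_power_eq_1_iff[of e i] by (cases "fps_nth Y i = 0") auto
  then have "Abs_fps (\<lambda>i. rt e ^ i * fps_nth Y i) = Y" by (simp add: fps_eq_iff)
  then have "(\<lambda>t. y (rt e * t)) has_fps_expansion Y" using has_fps_expansion_rotate[OF y, of "rt e"] by simp
  then have "(\<lambda>t. y (rt e * t) - y t) has_fps_expansion Y - Y" by (intro has_fps_expansion_diff y)
  then have "\<forall>\<^sub>F t in nhds 0. y (rt e * t) - y t = 0" by (simp add: has_fps_expansion_0_iff)
  then have "\<forall>\<^sub>F t in nhds 0. y (rt e * t) = y t" by eventually_elim simp
  then show ?thesis using that e by blast
qed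

text \<open>If some \<open>rt e\<close> fixes \<open>\<eta>\<close>, then \<open>\<eta>\<close>
  equals its own average and descends to a function of \<open>t ^ e\<close>. This divides
  \<open>N\<close> by \<open>e\<close>, so the process ends with a primitive series.\<close>

lemma primitive_reduction:
  assumes "0 < N" "\<eta> analytic_on {0}"
  shows "\<exists>n d y Y. 0 < n \<and> 0 < d \<and> N = n * d \<and> y has_fps_expansion Y \<and> primitive_series n Y \<and>
    (\<forall>\<^sub>F t in nhds 0. \<eta> t = y (t ^ d))"
  using assms
proof (induction N arbitrary: \<eta> rule: less_induct)
  case (less N)
  obtain Y where Y: "\<eta> has_fps_expansion Y" using less.prems(2) analytic_at_imp_has_fps_expansion_0 by blast
  show ?case
  proof (cases "primitive_series N Y")
    case True
    then show ?thesis
      using less.prems(1) Y by (intro exI[of _ N] exI[of _ 1] exI[of _ \<eta>] exI[of _ Y]) simp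
  next
    case False
    obtain e where e: "1 < e" "e dvd N" and inv: "\<forall>\<^sub>F t in nhds 0. \<eta> (rt e * t) = \<eta> t"
      by (rule not_primitive_invariant[OF less.prems(1) Y False])
    have inv': "\<forall>\<^sub>F t in nhds 0. \<eta> (rt e ^ k * t) = \<eta> t" for k
    proof (induction k)
      case (Suc k)
      have "\<forall>\<^sub>F t in nhds 0. \<eta> (rt e * (rt e ^ k * t)) = \<eta> (rt e ^ k * t)"
        using inv by (intro eventually_compose11[where u = "\<lambda>t. rt e ^ k * t" and z = 0]) (auto intro!: analytic_intros)
      with Suc show ?case by eventually_elim (simp add: mult.assoc)
    qed simp
    have "analytic2 (\<lambda>p. \<eta> (fst p))" using less.prems(2) by (rule analytic2_compose_fst)
    then obtain h where h: "analytic2 h"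
      "\<forall>\<^sub>F p in nhds 0. (\<Sum>k<e. \<eta> (rt e ^ k * fst p)) / of_nat e = h (fst p ^ e, snd p)"
      using descent[of "\<lambda>p. \<eta> (fst p)" e] e by auto
    define \<theta> where "\<theta> = (\<lambda>x. h (x, 0))"
    have \<theta>: "\<theta> analytic_on {0}"
      unfolding \<theta>_def by (rule analytic_compose_curve[OF h(1)]) (auto intro!: analytic_intros)
    have "\<forall>\<^sub>F t in nhds 0. (\<Sum>k<e. \<eta> (rt e ^ k * t)) / of_nat e = h (t ^ e, 0)"
      using eventually_compose_curve[OF h(2), of "\<lambda>t. t" "\<lambda>_. 0"] by (simp add: analytic_intros)
    moreover have "\<forall>\<^sub>F t in nhds 0. \<forall>k\<in>{..<e}. \<eta> (rt e ^ k * t) = \<eta> t"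
      by (intro eventually_ball_finite) (use inv' in auto)
    ultimately have \<eta>\<theta>: "\<forall>\<^sub>F t in nhds 0. \<eta> t = \<theta> (t ^ e)"
    proof eventually_elim
      case (elim t)
      have "(\<Sum>k<e. \<eta> (rt e ^ k * t)) = (\<Sum>k<e. \<eta> t)" using elim(2) by (intro sum.cong) auto
      then show ?case using elim(1) e(1) by (simp add: \<theta>_def)
    qed
    obtain N' where N': "N = e * N'" using e(2) by (elim dvdE)
    have "N' < N" "0 < N'" using N' e(1) less.prems(1) by (auto simp: zero_less_mult_iff)
    from less.IH[OF this \<theta>] obtain n d y Y' where IH: "0 < n" "0 < d" "N' = n * d" "y has_fps_expansion Y'" "primitive_series n Y'"
      "\<forall>\<^sub>F t in nhds 0. \<theta> t = y (t ^ d)" by blast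
    have "\<forall>\<^sub>F t in nhds 0. \<theta> (t ^ e) = y ((t ^ e) ^ d)"
      using IH(6) e(1) by (intro eventually_compose11[where u = "\<lambda>t. t ^ e" and z = 0])
        (auto intro!: analytic_intros simp: power_0_left)
    with \<eta>\<theta> have "\<forall>\<^sub>F t in nhds 0. \<eta> t = y (t ^ (e * d))"
      by eventually_elim (simp add: power_mult)
    then show ?thesis using IH N' e(1)
      by (intro exI[of _ n] exI[of _ "e * d"] exI[of _ y] exI[of _ Y']) simp
  qed
qed

lemma prod_rotate:
  fixes g :: "complex \<Rightarrow> 'a :: comm_monoid_mult"
  assumes "0 < n"
  shows "(\<Prod>k<n. g (rt n ^ k * (rt n ^ j * s))) = (\<Prod>k<n. g (rt n ^ k * s))"
proof (induction j)
  case (Suc j)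
  obtain m where m: "n = Suc m" using assms by (cases n) auto
  define w where "w = rt n ^ j * s"
  have "(\<Prod>k<n. g (rt n ^ k * (rt n ^ Suc j * s))) = (\<Prod>k<n. g (rt n ^ Suc k * w))"
    by (rule prod.cong) (simp_all add: w_def mult_ac)
  also have "\<dots> = (\<Prod>k<m. g (rt n ^ Suc k * w)) * g (rt n ^ n * w)"
    unfolding m by (subst prod.lessThan_Suc) simp
  also have "g (rt n ^ n * w) = g (rt n ^ 0 * w)" by (simp add: rt_power_self)
  also have "(\<Prod>k<m. g (rt n ^ Suc k * w)) * g (rt n ^ 0 * w) = (\<Prod>k<n. g (rt n ^ k * w))"
    unfolding m by (subst prod.lessThan_Suc_shift) (simp add: mult.commute)
  finally show ?case using Suc by (simp add: w_def)
qed simp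

lemma analytic2_rotate_fst:
  assumes "y analytic_on {0}"
  shows "analytic2 (\<lambda>p. y (a * fst p))"
  by (rule analytic2_compose1) (use assms in \<open>auto intro!: analytic2_intros\<close>)

text \<open>The product over the conjugates is invariant under rotation, hence equal to its average,
  hence by \<open>descent\<close> a function of \<open>x = t ^ n\<close>.\<close>

lemma branch_polynomial:
  assumes n: "0 < n" and y: "y analytic_on {0}"
  shows "\<exists>P. analytic2 P \<and> (\<forall>\<^sub>F p in nhds 0. P (fst p ^ n, snd p) = (\<Prod>k<n. snd p - y (rt n ^ k * fst p)))"
proof -
  define H where "H = (\<lambda>p. \<Prod>k<n. snd p - y (rt n ^ k * fst p))"
  have H: "analytic2 H" unfolding H_def by (intro analytic2_intros analytic2_rotate_fst y)
  obtain P where P: "analytic2 P"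
    "\<forall>\<^sub>F p in nhds 0. (\<Sum>k<n. H (rt n ^ k * fst p, snd p)) / of_nat n = P (fst p ^ n, snd p)"
    using descent[OF H n] by blast
  have inv: "H (rt n ^ j * s, w) = H (s, w)" for j s w
    unfolding H_def using prod_rotate[OF n, of "\<lambda>u. w - y u" j s] by simp
  have "(\<Sum>k<n. H (rt n ^ k * fst p, snd p)) / of_nat n = H p" for p
    using n by (simp add: inv)
  then have "\<forall>\<^sub>F p in nhds 0. H p = P (fst p ^ n, snd p)" using P(2) by simp
  then have "\<forall>\<^sub>F p in nhds 0. P (fst p ^ n, snd p) = H p" by eventually_elim simp
  then show ?thesis using P(1) unfolding H_def by blast
qed

lemma branch_polynomial_zeros:
  fixes P :: "complex \<times> complex \<Rightarrow> complex"
  assumes n: "0 < n" and P: "\<forall>\<^sub>F p in nhds 0. P (fst p ^ n, snd p) = (\<Prod>k<n. snd p - y (rt n ^ k * fst p))"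
  shows "\<forall>\<^sub>F p in nhds 0. P p = 0 \<longleftrightarrow> (\<exists>t. t ^ n = fst p \<and> snd p = y t)"
proof (rule eventually_from_power[OF n])
  show "\<forall>\<^sub>F p in nhds 0. P (fst p ^ n, snd p) = 0 \<longleftrightarrow>
      (\<exists>t. t ^ n = fst (fst p ^ n, snd p) \<and> snd (fst p ^ n, snd p) = y t)"
    using P
  proof eventually_elim
    case (elim p)
    have "P (fst p ^ n, snd p) = 0 \<longleftrightarrow> (\<exists>k<n. snd p = y (rt n ^ k * fst p))"
      unfolding elim by (auto simp: prod_zero_iff)
    also have "\<dots> \<longleftrightarrow> (\<exists>t. t ^ n = fst p ^ n \<and> snd p = y t)"
    proof
      assume "\<exists>k<n. snd p = y (rt n ^ k * fst p)"
      then show "\<exists>t. t ^ n = fst p ^ n \<and> snd p = y t" using rt_power_mult_power by blast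
    next
      assume "\<exists>t. t ^ n = fst p ^ n \<and> snd p = y t"
      then obtain t where "t ^ n = fst p ^ n" "snd p = y t" by blast
      then show "\<exists>k<n. snd p = y (rt n ^ k * fst p)" using power_eq_rt[OF n] by metis
    qed
    finally show ?case by simp
  qed
qed

text \<open>Irreducibility splits off one zero set at a time, the others being joined in a product;
  the empty union is excluded since an irreducible germ is nonempty.\<close>

lemma irreducible_zero_sets:
  assumes D: "irreducible_germ D" and I: "finite I" and g: "\<And>i. i \<in> I \<Longrightarrow> analytic2 (g i)"
    and eq: "germ_eq D {p. \<exists>i\<in>I. g i p = 0}"
  shows "\<exists>i\<in>I. germ_eq D {p. g i p = 0}"
  using I g eq
proof (induction I)
  case empty
  then show ?case using D by (simp add: irreducible_germ_def)
next
  case (insert i I)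
  have ag: "analytic_germ {p. h p = 0}" if "analytic2 h" for h
    unfolding analytic_germ_def using that by (intro exI[of _ "{h}"]) (simp add: germ_eq_def)
  have "analytic2 (\<lambda>p. \<Prod>j\<in>I. g j p)" using insert.prems(1) by (intro analytic2_prod) auto
  moreover have "{p. \<exists>j\<in>insert i I. g j p = 0} = {p. g i p = 0} \<union> {p. (\<Prod>j\<in>I. g j p) = 0}"
    using insert.hyps by (auto simp: prod_zero_iff)
  moreover have "analytic2 (g i)" using insert.prems(1) by simp
  ultimately have "germ_eq D {p. g i p = 0} \<or> germ_eq D {p. (\<Prod>j\<in>I. g j p) = 0}"
    using D insert.prems(2) ag unfolding irreducible_germ_def by metis
  then show ?case
  proof
    assume "germ_eq D {p. (\<Prod>j\<in>I. g j p) = 0}"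
    moreover have "{p. (\<Prod>j\<in>I. g j p) = 0} = {p. \<exists>j\<in>I. g j p = 0}"
      using insert.hyps by (auto simp: prod_zero_iff)
    ultimately have "\<exists>j\<in>I. germ_eq D {p. g j p = 0}" using insert by auto
    then show ?case by blast
  qed blast
qed

text \<open>
  The shear \<open>(x, y) \<mapsto> (x + c * y, y)\<close> moves the tangent line away from \<open>x = 0\<close>, so that \<open>n\<close> is the
  multiplicity and \<open>y\<close> vanishes at 0 to order at least \<open>n\<close>.
\<close>

definition puiseux :: "complex \<Rightarrow> nat \<Rightarrow> (complex \<Rightarrow> complex) \<Rightarrow> complex fps \<Rightarrow> (complex \<times> complex) set \<Rightarrow> bool" where
  "puiseux c n y Y D \<longleftrightarrow> 0 < n \<and> y has_fps_expansion Y \<and> primitive_series n Y \<and> (\<forall>k<n. fps_nth Y k = 0) \<and>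
     (\<forall>\<^sub>F p in nhds 0. (fst p + c * snd p, snd p) \<in> D \<longleftrightarrow> (\<exists>t. t ^ n = fst p \<and> snd p = y t))"

lemma analytic2_shear: "analytic2 (\<lambda>p. fst p + c * snd p)"
  by (intro analytic2_intros)

lemma eventually_shear:
  assumes "\<forall>\<^sub>F p in nhds (0 :: complex \<times> complex). A p"
  shows "\<forall>\<^sub>F p in nhds 0. A (fst p + c * snd p, snd p)"
  using assms by (intro eventually_compose2 analytic2_shear analytic2_snd) auto

lemma eventually_unshear:
  assumes "\<forall>\<^sub>F p in nhds (0 :: complex \<times> complex). A (fst p + c * snd p, snd p)"
  shows "\<forall>\<^sub>F p in nhds 0. A p"
  using eventually_shear[OF assms, of "- c"] by simp

lemma order_le_bound:
  fixes y :: "complex \<Rightarrow> complex"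
  assumes y: "y has_fps_expansion Y" and b: "\<forall>\<^sub>F t in nhds 0. norm (y t) \<le> K * norm t ^ n"
  shows "\<forall>k<n. fps_nth Y k = 0"
proof (cases "Y = 0")
  case False
  have "growth y (subdegree Y)" using y False by (rule growth_fps)
  then obtain c C where c: "c > 0" and 1: "\<forall>\<^sub>F t in nhds 0. c * norm t ^ subdegree Y \<le> norm (y t) \<and> norm (y t) \<le> C * norm t ^ subdegree Y"
    unfolding growth_def by blast
  from 1 b have "\<forall>\<^sub>F t in nhds (0 :: complex). c * norm t ^ subdegree Y \<le> K * norm t ^ n" by eventually_elim linarith
  then have "n \<le> subdegree Y" by (rule power_compare[OF c])
  then show ?thesis using nth_less_subdegree_zero by (metis less_le_trans)
qed simp

lemma bound_le_order:
  fixes y :: "complex \<Rightarrow> complex"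
  assumes y: "y has_fps_expansion Y" and n: "\<forall>k<n. fps_nth Y k = 0"
  obtains K where "0 < K" "\<forall>\<^sub>F t in nhds 0. norm (y t) \<le> K * norm t ^ n"
proof (cases "Y = 0")
  case True
  then have "\<forall>\<^sub>F t in nhds 0. y t = 0" using y by (simp add: has_fps_expansion_0_iff)
  then have "\<forall>\<^sub>F t in nhds 0. norm (y t) \<le> 1 * norm t ^ n" by eventually_elim simp
  then show ?thesis using that[of 1] by simp
next
  case False
  have "growth y (subdegree Y)" using y False by (rule growth_fps)
  then obtain c C where C: "C > 0" and 0: "\<forall>\<^sub>F t in nhds 0. c * norm t ^ subdegree Y \<le> norm (y t) \<and> norm (y t) \<le> C * norm t ^ subdegree Y"
    unfolding growth_def by blast
  have 1: "\<forall>\<^sub>F t in nhds 0. norm (y t) \<le> C * norm t ^ subdegree Y" using 0 by eventually_elim simp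
  have "n \<le> subdegree Y" using False n by (metis nth_subdegree_nonzero not_le)
  have "\<forall>\<^sub>F t in nhds 0. norm (t :: complex) < 1" by (rule eventually_nhds_small) (auto intro!: analytic_intros)
  with 1 have "\<forall>\<^sub>F t in nhds 0. norm (y t) \<le> C * norm t ^ n"
  proof eventually_elim
    case (elim t)
    have "norm t ^ subdegree Y \<le> norm t ^ n" using elim \<open>n \<le> subdegree Y\<close> by (intro power_decreasing) auto
    then have "C * norm t ^ subdegree Y \<le> C * norm t ^ n" using C by simp
    then show ?case using elim by linarith
  qed
  then show ?thesis using that C by blast
qed

text \<open>The cone condition acts twice: it makes the sheared equation regular in
  \<open>y\<close>, so that \<open>newton_puiseux\<close> applies, and it forces
  \<open>norm (y t)\<close> to be at most a multiple of \<open>norm t ^ n\<close>. Each solution is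
  reduced to a primitive one with its own equation, and irreducibility of \<open>D\<close> selects
  one of these equations.\<close>

theorem branch_puiseux:
  assumes D: "irreducible_germ D" and f: "analytic2 f" and f0: "f 0 = 0" and Df: "germ_eq D {p. f p = 0}"
    and cone: "\<forall>\<^sub>F p in nhds 0. (fst p + c * snd p, snd p) \<in> D \<longrightarrow> norm (snd p) \<le> K * norm (fst p)"
  shows "\<exists>n y Y. puiseux c n y Y D"
proof -
  define F where "F = (\<lambda>p. f (fst p + c * snd p, snd p))"
  have F: "analytic2 F" unfolding F_def by (intro analytic2_compose[OF f] analytic2_shear analytic2_snd) auto
  have DF: "\<forall>\<^sub>F p in nhds 0. (fst p + c * snd p, snd p) \<in> D \<longleftrightarrow> F p = 0"
    using eventually_shear[of "\<lambda>p. p \<in> D \<longleftrightarrow> p \<in> {p. f p = 0}" c] Df by (simp add: germ_eq_def F_def)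
  have cone': "\<forall>\<^sub>F p in nhds 0. F p = 0 \<longrightarrow> norm (snd p) \<le> K * norm (fst p)"
    using cone DF by eventually_elim simp
  \<comment> \<open>On the line \<open>x = 0\<close> the cone leaves only the origin, so the
    restriction of \<open>F\<close> does not vanish identically and has a finite order.\<close>
  have ev0: "\<forall>\<^sub>F y in nhds 0. F (0, y) = 0 \<longrightarrow> y = 0"
    using eventually_compose_curve[OF cone', of "\<lambda>_. 0" "\<lambda>y. y"] by (simp add: analytic_intros)
  have nz: "\<not> (\<forall>\<^sub>F y in nhds 0. F (0, y) = 0)"
  proof
    assume "\<forall>\<^sub>F y in nhds 0. F (0, y) = 0"
    with ev0 have "\<forall>\<^sub>F y in nhds 0. y = (0 :: complex)" by eventually_elim simp
    then have "\<forall>\<^sub>F y in at (0 :: complex). False" by (simp add: eventually_at_filter)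
    then show False by simp
  qed
  obtain m u where "u analytic_on {0}" "u 0 \<noteq> 0" "\<forall>\<^sub>F y in nhds 0. F (0, y) = y ^ m * u y"
    using order_factor[OF analytic_slice0[OF F] nz] by metis
  then have "regular_order F m" by (auto simp: regular_order_def)
  from newton_puiseux[OF F this] obtain N S where N: "1 \<le> N" and S: "finite S"
    and S1: "\<And>\<eta>. \<eta> \<in> S \<Longrightarrow> \<eta> analytic_on {0} \<and> \<eta> 0 = 0 \<and> (\<forall>\<^sub>F t in nhds 0. F (t ^ N, \<eta> t) = 0)"
    and S2: "\<forall>\<^sub>F p in nhds 0. F (fst p ^ N, snd p) = 0 \<longrightarrow> (\<exists>\<eta>\<in>S. snd p = \<eta> (fst p))" by blast
  define R where "R = (\<lambda>\<eta> n d y Y. 0 < n \<and> 0 < d \<and> N = n * d \<and> y has_fps_expansion Y \<and> primitive_series n Y \<and>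
    (\<forall>\<^sub>F t in nhds 0. \<eta> t = y (t ^ d)))"
  have "\<forall>\<eta>\<in>S. \<exists>n d y Y. R \<eta> n d y Y"
    unfolding R_def using S1 N by (intro ballI primitive_reduction) auto
  then obtain n where "\<forall>\<eta>\<in>S. \<exists>d y Y. R \<eta> (n \<eta>) d y Y" by metis
  then obtain d where "\<forall>\<eta>\<in>S. \<exists>y Y. R \<eta> (n \<eta>) (d \<eta>) y Y" by metis
  then obtain y where "\<forall>\<eta>\<in>S. \<exists>Y. R \<eta> (n \<eta>) (d \<eta>) (y \<eta>) Y" by metis
  then obtain Y where R: "\<forall>\<eta>\<in>S. R \<eta> (n \<eta>) (d \<eta>) (y \<eta>) (Y \<eta>)" by metis
  have R': "0 < n \<eta>" "0 < d \<eta>" "N = n \<eta> * d \<eta>" "y \<eta> has_fps_expansion Y \<eta>" "primitive_series (n \<eta>) (Y \<eta>)"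
    "\<forall>\<^sub>F t in nhds 0. \<eta> t = y \<eta> (t ^ d \<eta>)" if "\<eta> \<in> S" for \<eta>
    using R that unfolding R_def by blast+
  have "\<exists>P. \<forall>\<eta>\<in>S. analytic2 (P \<eta>) \<and>
      (\<forall>\<^sub>F p in nhds 0. P \<eta> (fst p ^ n \<eta>, snd p) = (\<Prod>k<n \<eta>. snd p - y \<eta> (rt (n \<eta>) ^ k * fst p)))"
    by (intro bchoice ballI branch_polynomial) (use R' has_fps_expansion_imp_analytic_0 in blast)+
  then obtain P where P: "\<And>\<eta>. \<eta> \<in> S \<Longrightarrow> analytic2 (P \<eta>)"
    "\<And>\<eta>. \<eta> \<in> S \<Longrightarrow> \<forall>\<^sub>F p in nhds 0. P \<eta> (fst p ^ n \<eta>, snd p) = (\<Prod>k<n \<eta>. snd p - y \<eta> (rt (n \<eta>) ^ k * fst p))"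
    by blast
  have PZ: "\<forall>\<^sub>F p in nhds 0. P \<eta> p = 0 \<longleftrightarrow> (\<exists>t. t ^ n \<eta> = fst p \<and> snd p = y \<eta> t)" if "\<eta> \<in> S" for \<eta>
    by (rule branch_polynomial_zeros[OF R'(1)[OF that] P(2)[OF that]])
  \<comment> \<open>The reduced solutions describe the same zeros: a \<open>t\<close> with
    \<open>t ^ n \<eta> = x\<close> is \<open>s ^ d \<eta>\<close> for some \<open>s\<close>, and
    this \<open>s\<close> satisfies \<open>s ^ N = x\<close>.\<close>
  have FZ: "\<forall>\<^sub>F p in nhds 0. F p = 0 \<longleftrightarrow> (\<exists>\<eta>\<in>S. \<exists>t. t ^ n \<eta> = fst p \<and> snd p = y \<eta> t)"
  proof -
    have "\<forall>\<^sub>F t in nhds (0 :: complex). \<forall>\<eta>\<in>S. F (t ^ N, \<eta> t) = 0 \<and> \<eta> t = y \<eta> (t ^ d \<eta>)"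
      by (intro eventually_ball_finite S ballI eventually_conj) (use S1 R'(6) in blast)+
    from eventually_all_roots[OF _ this, of N] N
    have ev: "\<forall>\<^sub>F p in nhds (0 :: complex \<times> complex). \<forall>t. t ^ N = fst p \<longrightarrow> (\<forall>\<eta>\<in>S. F (t ^ N, \<eta> t) = 0 \<and> \<eta> t = y \<eta> (t ^ d \<eta>))"
      by simp
    have "\<forall>\<^sub>F p in nhds 0. F p = 0 \<longrightarrow> (\<exists>t. t ^ N = fst p \<and> (\<exists>\<eta>\<in>S. snd p = \<eta> t))"
    proof (rule eventually_from_power[of N])
      show "0 < N" using N by simp
      show "\<forall>\<^sub>F p in nhds 0. F (fst p ^ N, snd p) = 0 \<longrightarrow>
        (\<exists>t. t ^ N = fst (fst p ^ N, snd p) \<and> (\<exists>\<eta>\<in>S. snd (fst p ^ N, snd p) = \<eta> t))"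
        using S2 by eventually_elim auto
    qed
    with ev show ?thesis
    proof eventually_elim
      case (elim p)
      show ?case
      proof
        assume "F p = 0"
        then obtain t \<eta> where t: "t ^ N = fst p" "\<eta> \<in> S" "snd p = \<eta> t" using elim(2) by blast
        then have "snd p = y \<eta> (t ^ d \<eta>)" "(t ^ d \<eta>) ^ n \<eta> = fst p"
          using elim(1) R'(3)[OF t(2)] by (auto simp: power_mult[symmetric] mult.commute)
        then show "\<exists>\<eta>\<in>S. \<exists>t. t ^ n \<eta> = fst p \<and> snd p = y \<eta> t" using t(2) by blast
      next
        assume "\<exists>\<eta>\<in>S. \<exists>t. t ^ n \<eta> = fst p \<and> snd p = y \<eta> t"
        then obtain \<eta> t where t: "\<eta> \<in> S" "t ^ n \<eta> = fst p" "snd p = y \<eta> t" by blast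
        obtain s where s: "s ^ d \<eta> = t" using exists_root[OF R'(2)[OF t(1)]] by metis
        then have sN: "s ^ N = fst p" using R'(3)[OF t(1)] t(2) by (metis mult.commute power_mult)
        then have "F (s ^ N, \<eta> s) = 0" "\<eta> s = y \<eta> t" using elim(1) t(1) s by auto
        then have "F (fst p, snd p) = 0" using sN t(3) by simp
        then show "F p = 0" by simp
      qed
    qed
  qed
  define Q where "Q = (\<lambda>\<eta> p. P \<eta> (fst p - c * snd p, snd p))"
  have aQ: "analytic2 (Q \<eta>)" if "\<eta> \<in> S" for \<eta>
    unfolding Q_def by (intro analytic2_compose[OF P(1)[OF that]] analytic2_intros) auto
  have "\<forall>\<^sub>F p in nhds 0. \<forall>\<eta>\<in>S. P \<eta> p = 0 \<longleftrightarrow> (\<exists>t. t ^ n \<eta> = fst p \<and> snd p = y \<eta> t)"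
    by (intro eventually_ball_finite S ballI PZ)
  with FZ DF have "\<forall>\<^sub>F p in nhds 0. (fst p + c * snd p, snd p) \<in> D \<longleftrightarrow> (fst p + c * snd p, snd p) \<in> {p. \<exists>\<eta>\<in>S. Q \<eta> p = 0}"
    by eventually_elim (simp add: Q_def)
  then have "germ_eq D {p. \<exists>\<eta>\<in>S. Q \<eta> p = 0}"
    unfolding germ_eq_def by (rule eventually_unshear)
  from irreducible_zero_sets[OF D S aQ this] obtain \<eta> where \<eta>: "\<eta> \<in> S" and DQ: "germ_eq D {p. Q \<eta> p = 0}" by blast
  note r = R'[OF \<eta>]
  have "\<forall>\<^sub>F p in nhds 0. (fst p + c * snd p, snd p) \<in> D \<longleftrightarrow> P \<eta> p = 0"
    using eventually_shear[of "\<lambda>p. p \<in> D \<longleftrightarrow> p \<in> {p. Q \<eta> p = 0}" c] DQ by (simp add: germ_eq_def Q_def)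
  with PZ[OF \<eta>] have DZ: "\<forall>\<^sub>F p in nhds 0. (fst p + c * snd p, snd p) \<in> D \<longleftrightarrow> (\<exists>t. t ^ n \<eta> = fst p \<and> snd p = y \<eta> t)"
    by eventually_elim simp
  have an: "y \<eta> analytic_on {0}" using r(4) by (rule has_fps_expansion_imp_analytic_0)
  have y0: "y \<eta> 0 = 0"
  proof -
    have "\<eta> 0 = y \<eta> (0 ^ d \<eta>)" using eventually_nhds_x_imp_x[OF r(6)] .
    then show ?thesis using r(2) S1[OF \<eta>] by (simp add: power_0_left)
  qed
  from cone DZ have "\<forall>\<^sub>F p in nhds 0. (\<exists>t. t ^ n \<eta> = fst p \<and> snd p = y \<eta> t) \<longrightarrow> norm (snd p) \<le> K * norm (fst p)"
    by eventually_elim simp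
  from eventually_compose_curve[OF this, of "\<lambda>t. t ^ n \<eta>" "y \<eta>"] an y0 r(1)
  have "\<forall>\<^sub>F t in nhds 0. (\<exists>t'. t' ^ n \<eta> = t ^ n \<eta> \<and> y \<eta> t = y \<eta> t') \<longrightarrow> norm (y \<eta> t) \<le> K * norm (t ^ n \<eta>)"
    by (simp add: analytic_intros power_0_left)
  then have "\<forall>\<^sub>F t in nhds 0. norm (y \<eta> t) \<le> K * norm t ^ n \<eta>"
    by eventually_elim (auto simp: norm_power)
  then have "\<forall>k<n \<eta>. fps_nth (Y \<eta>) k = 0" by (rule order_le_bound[OF r(4)])
  then have "puiseux c (n \<eta>) (y \<eta>) (Y \<eta>) D" unfolding puiseux_def using r(1,4,5) DZ by blast
  then show ?thesis by blast
qed

text \<open>When \<open>e\<close> is the gcd of the characteristic exponents already found, this is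
  the next one. Primitivity of the series guarantees that such an exponent exists for every divisor
  \<open>e > 1\<close> of \<open>n\<close>.\<close>

definition min_exponent :: "complex fps \<Rightarrow> nat \<Rightarrow> nat" where
  "min_exponent Y e = (LEAST i. fps_nth Y i \<noteq> 0 \<and> \<not> e dvd i)"

text \<open>
  The order at 0 of \<open>y (z * t) - y t\<close> for the root of unity \<open>z = rt n ^ k\<close>.
\<close>

definition conjugate_order :: "nat \<Rightarrow> complex fps \<Rightarrow> nat \<Rightarrow> nat" where
  "conjugate_order n Y k = min_exponent Y (n div gcd n k)"

lemma min_exponent_props:
  assumes "primitive_series n Y" "1 < e" "e dvd n"
  shows "fps_nth Y (min_exponent Y e) \<noteq> 0" "\<not> e dvd min_exponent Y e" "\<And>k. fps_nth Y k \<noteq> 0 \<Longrightarrow> \<not> e dvd k \<Longrightarrow> min_exponent Y e \<le> k"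
proof -
  have "\<exists>i. fps_nth Y i \<noteq> 0 \<and> \<not> e dvd i" using assms unfolding primitive_series_def by blast
  from LeastI_ex[OF this] show "fps_nth Y (min_exponent Y e) \<noteq> 0" "\<not> e dvd min_exponent Y e" unfolding min_exponent_def by blast+
  show "min_exponent Y e \<le> k" if "fps_nth Y k \<noteq> 0" "\<not> e dvd k" for k
    unfolding min_exponent_def using that by (intro Least_le) blast
qed

lemma dvd_mult_gcd_iff:
  fixes n k i :: nat
  assumes "0 < n"
  shows "n dvd k * i \<longleftrightarrow> n div gcd n k dvd i"
proof -
  define g where "g = gcd n k"
  define e where "e = n div g"
  define l where "l = k div g"
  have g: "0 < g" using assms by (simp add: g_def)
  have "g dvd n" "g dvd k" by (auto simp: g_def)
  then have e: "n = g * e" and l: "k = g * l" by (auto simp: e_def l_def)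
  have cop: "coprime e l" unfolding e_def l_def g_def using assms by (intro div_gcd_coprime) auto
  have "n dvd k * i \<longleftrightarrow> g * e dvd g * (l * i)" unfolding e l by (simp only: mult.assoc)
  also have "\<dots> \<longleftrightarrow> e dvd l * i" using g by (simp only: nat_mult_dvd_cancel_disj) auto
  also have "\<dots> \<longleftrightarrow> e dvd i" using cop by (rule coprime_dvd_mult_right_iff)
  finally show ?thesis by (simp only: e_def g_def)
qed

lemma conjugate_index_props:
  fixes n k :: nat
  assumes "0 < k" "k < n"
  shows "1 < n div gcd n k" "n div gcd n k dvd n"
proof -
  have "gcd n k \<le> k" using assms by (intro dvd_imp_le) auto
  then have "n \<noteq> gcd n k" using assms by linarith
  moreover have "n = gcd n k * (n div gcd n k)" by simp
  ultimately show "1 < n div gcd n k" using assms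
    by (metis One_nat_def Suc_lessI gr0I less_nat_zero_code mult.right_neutral mult_0_right)
  show "n div gcd n k dvd n" by (metis \<open>n = gcd n k * (n div gcd n k)\<close> dvd_triv_right)
qed

text \<open>The root of unity \<open>rt n ^ (n div e)\<close> has order exactly \<open>e\<close>;
  hence the conjugate orders determine \<open>min_exponent Y e\<close> for all divisors
  \<open>e > 1\<close> of \<open>n\<close>.\<close>

lemma conjugate_order_div:
  assumes "1 < e" "e dvd n" "0 < n"
  shows "0 < n div e" "n div e < n" "conjugate_order n Y (n div e) = min_exponent Y e"
proof -
  obtain d where d: "n = e * d" using assms by (elim dvdE)
  then have d0: "0 < d" using assms by (cases d) auto
  have nd: "n div e = d" using d assms by simp
  show "0 < n div e" "n div e < n" using nd d d0 assms(1) by auto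
  have "gcd n d = d" using d by (simp add: gcd.commute)
  then show "conjugate_order n Y (n div e) = min_exponent Y e" using d d0 by (simp add: conjugate_order_def nd)
qed

lemma growth_rotate:
  assumes "growth h k" "norm a = 1"
  shows "growth (\<lambda>t. h (a * t)) k"
proof -
  obtain c C where c: "c > 0" "C > 0" and 1: "\<forall>\<^sub>F t in nhds 0. c * norm t ^ k \<le> norm (h t) \<and> norm (h t) \<le> C * norm t ^ k"
    using assms(1) unfolding growth_def by blast
  have "\<forall>\<^sub>F t in nhds 0. c * norm (a * t) ^ k \<le> norm (h (a * t)) \<and> norm (h (a * t)) \<le> C * norm (a * t) ^ k"
    using 1 by (intro eventually_compose11[where u = "\<lambda>t. a * t" and z = 0]) (auto intro!: analytic_intros)
  then show ?thesis unfolding growth_def using c assms(2) by (auto simp: norm_mult)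
qed

lemma growth_nonzero:
  assumes "growth h k"
  shows "\<forall>\<^sub>F t in nhds 0. t \<noteq> 0 \<longrightarrow> h t \<noteq> 0"
proof -
  obtain c C where c: "c > 0" and 1: "\<forall>\<^sub>F t in nhds 0. c * norm t ^ k \<le> norm (h t) \<and> norm (h t) \<le> C * norm t ^ k"
    using assms unfolding growth_def by blast
  from 1 show ?thesis
  proof eventually_elim
    case (elim t)
    show ?case
    proof
      assume "t \<noteq> 0"
      then have "0 < c * norm t ^ k" using c by simp
      then show "h t \<noteq> 0" using elim by auto
    qed
  qed
qed

text \<open>With \<open>z = rt n ^ k\<close>, the coefficient of the difference at exponent
  \<open>i\<close> is \<open>z ^ i - 1\<close> times that of \<open>Y\<close>, and
  \<open>z ^ i = 1\<close> exactly when the order \<open>n div gcd n k\<close> of \<open>z\<close>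
  divides \<open>i\<close>.\<close>

lemma rot_growth:
  assumes y: "y has_fps_expansion Y" and p: "primitive_series n Y" and k: "0 < k" "k < n"
  shows "growth (\<lambda>t. y (rt n ^ k * t) - y t) (conjugate_order n Y k)"
proof -
  define H where "H = Abs_fps (\<lambda>i. (rt n ^ k) ^ i * fps_nth Y i) - Y"
  have H: "(\<lambda>t. y (rt n ^ k * t) - y t) has_fps_expansion H"
    unfolding H_def by (intro has_fps_expansion_diff has_fps_expansion_rotate y)
  define e where "e = n div gcd n k"
  have e: "1 < e" "e dvd n" unfolding e_def using conjugate_index_props[OF k] by auto
  have root: "(rt n ^ k) ^ i = 1 \<longleftrightarrow> e dvd i" for i
    using rt_power_eq_1_iff[of n "k * i"] dvd_mult_gcd_iff[of n k i] k by (simp add: power_mult e_def)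
  have nz: "fps_nth H i \<noteq> 0 \<longleftrightarrow> fps_nth Y i \<noteq> 0 \<and> \<not> e dvd i" for i
    using root[of i] by (auto simp: H_def)
  have "subdegree H = min_exponent Y e"
  proof (rule subdegreeI)
    show "fps_nth H (min_exponent Y e) \<noteq> 0" using min_exponent_props[OF p e] by (simp add: nz)
    show "fps_nth H i = 0" if "i < min_exponent Y e" for i
      using min_exponent_props(3)[OF p e, of i] that nz[of i] by force
  qed
  moreover have "H \<noteq> 0" using min_exponent_props[OF p e] nz by (metis fps_zero_nth)
  ultimately show ?thesis using growth_fps[OF H] by (simp add: conjugate_order_def e_def)
qed

lemma distinct_conjugates:
  assumes y: "y has_fps_expansion Y" and p: "primitive_series n Y" and jk: "j < n" "k < n" "j \<noteq> k"
  shows "\<forall>\<^sub>F t in nhds 0. t \<noteq> 0 \<longrightarrow> y (rt n ^ j * t) \<noteq> y (rt n ^ k * t)"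
proof -
  have *: "\<forall>\<^sub>F t in nhds 0. t \<noteq> 0 \<longrightarrow> y (rt n ^ k * t) \<noteq> y (rt n ^ j * t)" if "j < k" "k < n" for j k
  proof -
    have "growth (\<lambda>t. y (rt n ^ (k - j) * (rt n ^ j * t)) - y (rt n ^ j * t)) (conjugate_order n Y (k - j))"
      using growth_rotate[OF rot_growth[OF y p, of "k - j"], of "rt n ^ j"] that by (simp add: norm_power)
    from growth_nonzero[OF this] show ?thesis
    proof eventually_elim
      case (elim t)
      have eq: "rt n ^ (k - j) * (rt n ^ j * t) = rt n ^ k * t" using that by (simp flip: power_add mult.assoc)
      show ?case using elim unfolding eq by auto
    qed
  qed
  show ?thesis
  proof (cases "j < k")
    case True
    from *[OF this jk(2)] show ?thesis by eventually_elim metis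
  next
    case False
    then have "k < j" using jk by simp
    from *[OF this jk(1)] show ?thesis by eventually_elim metis
  qed
qed

section \<open>Reduced equation and primitive parametrization of a branch\<close>

lemma puiseux_analytic:
  assumes "puiseux c n y Y D"
  shows "y analytic_on {0}" "y 0 = 0"
proof -
  have y: "y has_fps_expansion Y" using assms by (simp add: puiseux_def)
  then show "y analytic_on {0}" by (rule has_fps_expansion_imp_analytic_0)
  show "y 0 = 0" using has_fps_expansion_imp_0_eq_fps_nth_0[OF y] assms by (simp add: puiseux_def)
qed

text \<open>Divides by one conjugate factor after another. The quotient still vanishes on the next
  conjugate graph, because on that graph the factors already removed are nonzero off the
  origin.\<close>

lemma conjugate_division:
  assumes y: "y analytic_on {0}" "y 0 = 0"
    and dist: "\<And>j k. j < n \<Longrightarrow> k < n \<Longrightarrow> j \<noteq> k \<Longrightarrow> \<forall>\<^sub>F t in nhds 0. t \<noteq> 0 \<longrightarrow> y (rt n ^ j * t) \<noteq> y (rt n ^ k * t)"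
    and G: "analytic2 G" and G0: "\<And>k. k < n \<Longrightarrow> \<forall>\<^sub>F t in nhds 0. G (t, y (rt n ^ k * t)) = 0"
    and j: "j \<le> n"
  shows "\<exists>H. analytic2 H \<and> (\<forall>\<^sub>F p in nhds 0. G p = H p * (\<Prod>k<j. snd p - y (rt n ^ k * fst p)))"
  using j
proof (induction j)
  case 0
  then show ?case using G by (intro exI[of _ G]) simp
next
  case (Suc j)
  then obtain H where H: "analytic2 H" "\<forall>\<^sub>F p in nhds 0. G p = H p * (\<Prod>k<j. snd p - y (rt n ^ k * fst p))"
    by auto
  have an: "(\<lambda>t. y (rt n ^ j * t)) analytic_on {0}"
    by (rule analytic_compose11) (use y in \<open>auto intro!: analytic_intros\<close>)
  have "(\<lambda>t. H (t, y (rt n ^ j * t))) analytic_on {0}"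
    by (rule analytic_compose_curve[OF H(1) _ an]) (use y in \<open>auto intro!: analytic_intros\<close>)
  moreover have "\<not> (\<forall>\<^sub>F t in at 0. H (t, y (rt n ^ j * t)) \<noteq> 0)"
  proof
    assume "\<forall>\<^sub>F t in at 0. H (t, y (rt n ^ j * t)) \<noteq> 0"
    then have "\<forall>\<^sub>F t in nhds 0. t \<noteq> 0 \<longrightarrow> H (t, y (rt n ^ j * t)) \<noteq> 0" by (simp add: eventually_at_filter)
    moreover have "\<forall>\<^sub>F t in nhds 0. \<forall>k\<in>{..<j}. t \<noteq> 0 \<longrightarrow> y (rt n ^ j * t) \<noteq> y (rt n ^ k * t)"
      using Suc.prems by (intro eventually_ball_finite ballI dist) auto
    moreover have "\<forall>\<^sub>F t in nhds 0. G (t, y (rt n ^ j * t)) = H (t, y (rt n ^ j * t)) * (\<Prod>k<j. y (rt n ^ j * t) - y (rt n ^ k * t))"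
      using eventually_compose_curve[OF H(2), of "\<lambda>t. t" "\<lambda>t. y (rt n ^ j * t)"] an y by (simp add: analytic_intros)
    moreover have "\<forall>\<^sub>F t in nhds 0. G (t, y (rt n ^ j * t)) = 0" using Suc.prems by (intro G0) simp
    ultimately have "\<forall>\<^sub>F t in nhds (0 :: complex). t = 0"
    proof eventually_elim
      case (elim t)
      show ?case
      proof (rule ccontr)
        assume t: "t \<noteq> 0"
        then have "(\<Prod>k<j. y (rt n ^ j * t) - y (rt n ^ k * t)) \<noteq> 0" using elim(2) by (auto simp: prod_zero_iff)
        then show False using elim t by auto
      qed
    qed
    then have "\<forall>\<^sub>F t in at (0 :: complex). False" by (simp add: eventually_at_filter)
    then show False by simp
  qed
  ultimately have "\<forall>\<^sub>F t in nhds 0. H (t, y (rt n ^ j * t)) = 0"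
    using analytic_zero_or_nonzero by blast
  then obtain H' where H': "analytic2 H'" "\<forall>\<^sub>F p in nhds 0. H p = (snd p - y (rt n ^ j * fst p)) * H' p"
    using analytic2_divide_graph[OF H(1) an] y by auto
  from H(2) H'(2) have "\<forall>\<^sub>F p in nhds 0. G p = H' p * (\<Prod>k<Suc j. snd p - y (rt n ^ k * fst p))"
    by eventually_elim simp
  then show ?case using H' by blast
qed

text \<open>To divide \<open>g\<close> by the equation, pull it back to the parameter, where it
  vanishes on all conjugate graphs and \<open>conjugate_division\<close> applies; the average of the
  quotient over rotations then descends. The order is \<open>n\<close> because each of the
  \<open>n\<close> factors is bounded by a multiple of the distance from 0, while on the line of
  points \<open>(c * v, v)\<close> the product is \<open>v ^ n\<close>.\<close>

theorem puiseux_equation: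
  assumes D: "puiseux c n y Y D"
  shows "\<exists>P. analytic2 P \<and> (\<forall>\<^sub>F p in nhds 0. P (fst p ^ n, snd p) = (\<Prod>k<n. snd p - y (rt n ^ k * fst p))) \<and>
    reduced_equation D (\<lambda>p. P (fst p - c * snd p, snd p)) \<and> has_order2 (\<lambda>p. P (fst p - c * snd p, snd p)) n"
proof -
  have n: "0 < n" and Y: "y has_fps_expansion Y" "primitive_series n Y" "\<forall>k<n. fps_nth Y k = 0"
    and DZ: "\<forall>\<^sub>F p in nhds 0. (fst p + c * snd p, snd p) \<in> D \<longleftrightarrow> (\<exists>t. t ^ n = fst p \<and> snd p = y t)"
    using D by (auto simp: puiseux_def)
  note y = puiseux_analytic[OF D]
  obtain P where P: "analytic2 P" and PP: "\<forall>\<^sub>F p in nhds 0. P (fst p ^ n, snd p) = (\<Prod>k<n. snd p - y (rt n ^ k * fst p))"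
    using branch_polynomial[OF n y(1)] by blast
  define Q where "Q = (\<lambda>p. P (fst p - c * snd p, snd p))"
  have Q: "analytic2 Q" unfolding Q_def by (intro analytic2_compose[OF P] analytic2_intros) auto
  have PD: "\<forall>\<^sub>F p in nhds 0. (fst p + c * snd p, snd p) \<in> D \<longleftrightarrow> P p = 0"
    using branch_polynomial_zeros[OF n PP] DZ by eventually_elim simp
  obtain K where K: "0 < K" "\<forall>\<^sub>F t in nhds 0. norm (y t) \<le> K * norm t ^ n"
    by (rule bound_le_order[OF Y(1,3)])
  have "reduced_equation D Q"
    unfolding reduced_equation_def
  proof (intro conjI allI impI Q)
    have "\<forall>\<^sub>F p in nhds 0. (fst p + c * snd p, snd p) \<in> D \<longrightarrow> Q (fst p + c * snd p, snd p) = 0"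
      using PD by eventually_elim (simp add: Q_def)
    then show "vanishes_on Q D" unfolding vanishes_on_def by (rule eventually_unshear)
  next
    fix g assume g: "analytic2 g \<and> vanishes_on g D"
    define g' where "g' = (\<lambda>p. g (fst p + c * snd p, snd p))"
    have g': "analytic2 g'" unfolding g'_def using g by (intro analytic2_compose analytic2_shear analytic2_snd) auto
    have gD: "\<forall>\<^sub>F p in nhds 0. (fst p + c * snd p, snd p) \<in> D \<longrightarrow> g' p = 0"
      using eventually_shear[of "\<lambda>p. p \<in> D \<longrightarrow> g p = 0" c] g by (simp add: vanishes_on_def g'_def)
    define G where "G = (\<lambda>p. g' (fst p ^ n, snd p))"
    have G: "analytic2 G" unfolding G_def using n by (intro analytic2_compose[OF g'] analytic2_intros) (auto simp: power_0_left)
    have G0: "\<forall>\<^sub>F t in nhds 0. G (t, y (rt n ^ k * t)) = 0" for k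
    proof -
      have an: "(\<lambda>t. y (rt n ^ k * t)) analytic_on {0}"
        by (rule analytic_compose11) (use y in \<open>auto intro!: analytic_intros\<close>)
      from DZ gD have "\<forall>\<^sub>F p in nhds 0. (\<exists>t. t ^ n = fst p \<and> snd p = y t) \<longrightarrow> g' p = 0" by eventually_elim simp
      from eventually_compose_curve[OF this, of "\<lambda>t. t ^ n" "\<lambda>t. y (rt n ^ k * t)"]
      have "\<forall>\<^sub>F t in nhds 0. (\<exists>t'. t' ^ n = t ^ n \<and> y (rt n ^ k * t) = y t') \<longrightarrow> g' (t ^ n, y (rt n ^ k * t)) = 0"
        using an y n by (simp add: analytic_intros power_0_left)
      then show ?thesis by eventually_elim (use rt_power_mult_power in \<open>auto simp: G_def\<close>)
    qed
    obtain H where H: "analytic2 H" "\<forall>\<^sub>F p in nhds 0. G p = H p * (\<Prod>k<n. snd p - y (rt n ^ k * fst p))"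
      using conjugate_division[OF y distinct_conjugates[OF Y(1,2)] G G0 order_refl] by blast
    obtain h where h: "analytic2 h" "\<forall>\<^sub>F p in nhds 0. (\<Sum>k<n. H (rt n ^ k * fst p, snd p)) / of_nat n = h (fst p ^ n, snd p)"
      using descent[OF H(1) n] by blast
    \<comment> \<open>Both \<open>G\<close> and the product are invariant under rotation, so each
      rotated quotient gives the same factorization; the average of the quotients therefore does
      too.\<close>
    have rot: "\<forall>\<^sub>F p in nhds 0. \<forall>j\<in>{..<n}. G p = H (rt n ^ j * fst p, snd p) * (\<Prod>k<n. snd p - y (rt n ^ k * fst p))"
    proof (intro eventually_ball_finite ballI)
      fix j assume "j \<in> {..<n}"
      have "\<forall>\<^sub>F p in nhds 0. G (rt n ^ j * fst p, snd p) = H (rt n ^ j * fst p, snd p) *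
          (\<Prod>k<n. snd (rt n ^ j * fst p, snd p) - y (rt n ^ k * fst (rt n ^ j * fst p, snd p)))"
        by (rule eventually_compose2[OF H(2)]) (auto intro!: analytic2_intros)
      then show "\<forall>\<^sub>F p in nhds 0. G p = H (rt n ^ j * fst p, snd p) * (\<Prod>k<n. snd p - y (rt n ^ k * fst p))"
      proof eventually_elim
        case (elim p)
        have "G (rt n ^ j * fst p, snd p) = G p" by (simp add: G_def rt_power_mult_power)
        then show ?case using elim prod_rotate[OF n, of "\<lambda>u. snd p - y u" j "fst p"] by simp
      qed
    qed simp
    have "\<forall>\<^sub>F p in nhds 0. g' (fst p ^ n, snd p) = h (fst p ^ n, snd p) * P (fst p ^ n, snd p)"
      using rot h(2) PP
    proof eventually_elim
      case (elim p)
      have "of_nat n * G p = (\<Sum>k<n. G p)" by simp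
      also have "\<dots> = (\<Sum>k<n. H (rt n ^ k * fst p, snd p) * P (fst p ^ n, snd p))"
        unfolding elim(3) using elim(1) by (intro sum.cong) auto
      also have "\<dots> = (\<Sum>k<n. H (rt n ^ k * fst p, snd p)) * P (fst p ^ n, snd p)" by (simp add: sum_distrib_right)
      finally have "G p = (\<Sum>k<n. H (rt n ^ k * fst p, snd p)) / of_nat n * P (fst p ^ n, snd p)"
        using n by (simp add: field_simps)
      then show ?case unfolding elim(2) by (simp add: G_def)
    qed
    then have "\<forall>\<^sub>F p in nhds 0. g' p = h p * P p"
      using eventually_from_power[OF n, of "\<lambda>p. g' p = h p * P p"] by simp
    then have "\<forall>\<^sub>F p in nhds 0. g (fst p + c * snd p, snd p) =
        h (fst (fst p + c * snd p, snd p) - c * snd (fst p + c * snd p, snd p), snd (fst p + c * snd p, snd p)) * Q (fst p + c * snd p, snd p)"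
      by (simp add: g'_def Q_def)
    then have "\<forall>\<^sub>F p in nhds 0. g p = h (fst p - c * snd p, snd p) * Q p"
      by (rule eventually_unshear)
    moreover have "analytic2 (\<lambda>p. h (fst p - c * snd p, snd p))"
      by (intro analytic2_compose[OF h(1)] analytic2_intros) auto
    ultimately show "\<exists>h. analytic2 h \<and> (\<forall>\<^sub>F p in nhds 0. g p = h p * Q p)" by (intro exI[of _ "\<lambda>p. h (fst p - c * snd p, snd p)"]) simp
  qed
  moreover have "has_order2 Q n"
  proof (rule order_criterion[OF Q])
    have "\<forall>\<^sub>F p in nhds 0. norm (P p) \<le> (norm (snd p) + K * norm (fst p)) ^ n"
    proof (rule eventually_from_power[OF n])
      have "\<forall>\<^sub>F p in nhds (0 :: complex \<times> complex). \<forall>k\<in>{..<n}. norm (y (rt n ^ k * fst p)) \<le> K * norm (rt n ^ k * fst p) ^ n"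
        using K(2) by (intro eventually_ball_finite ballI eventually_compose21[where P = "\<lambda>p. rt n ^ _ * fst p"])
          (auto intro!: analytic2_intros)
      with PP show "\<forall>\<^sub>F p in nhds 0. norm (P (fst p ^ n, snd p)) \<le> (norm (snd (fst p ^ n, snd p)) + K * norm (fst (fst p ^ n, snd p))) ^ n"
      proof eventually_elim
        case (elim p)
        have "norm (P (fst p ^ n, snd p)) = (\<Prod>k<n. norm (snd p - y (rt n ^ k * fst p)))"
          unfolding elim(1) by (simp add: prod_norm)
        also have "\<dots> \<le> (\<Prod>k<n. norm (snd p) + K * norm (fst p) ^ n)"
        proof (rule prod_mono)
          fix k assume k: "k \<in> {..<n}"
          have "norm (snd p - y (rt n ^ k * fst p)) \<le> norm (snd p) + norm (y (rt n ^ k * fst p))" by (rule norm_triangle_ineq4)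
          then show "0 \<le> norm (snd p - y (rt n ^ k * fst p)) \<and> norm (snd p - y (rt n ^ k * fst p)) \<le> norm (snd p) + K * norm (fst p) ^ n"
            using elim(2) k by (auto simp: norm_mult norm_power intro: order_trans)
        qed
        finally show ?case by (simp add: norm_power)
      qed
    qed
    from eventually_shear[OF this, of "- c"]
    have "\<forall>\<^sub>F p in nhds 0. norm (Q p) \<le> (norm (snd p) + K * norm (fst p - c * snd p)) ^ n" by (simp add: Q_def)
    then show "\<forall>\<^sub>F p in nhds 0. norm (Q p) \<le> (1 + K * (1 + norm c)) ^ n * norm p ^ n"
    proof eventually_elim
      case (elim p)
      have f: "norm (fst p) \<le> norm p" "norm (snd p) \<le> norm p" by (metis norm_fst_le norm_snd_le prod.collapse)+
      have "norm (fst p - c * snd p) \<le> norm (fst p) + norm c * norm (snd p)" using norm_triangle_ineq4[of "fst p" "c * snd p"] by (simp add: norm_mult)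
      also have "\<dots> \<le> norm p + norm c * norm p" using f by (intro add_mono mult_left_mono) auto
      finally have "K * norm (fst p - c * snd p) \<le> K * (norm p + norm c * norm p)" using K by simp
      then have "norm (snd p) + K * norm (fst p - c * snd p) \<le> (1 + K * (1 + norm c)) * norm p" using f by (simp add: algebra_simps)
      then have "(norm (snd p) + K * norm (fst p - c * snd p)) ^ n \<le> ((1 + K * (1 + norm c)) * norm p) ^ n"
        using K by (intro power_mono) auto
      then show ?case using elim by (simp add: power_mult_distrib)
    qed
    have "\<forall>\<^sub>F v in nhds 0. P (0 ^ n, v) = (\<Prod>k<n. v - y (rt n ^ k * 0))"
      using eventually_compose_curve[OF PP, of "\<lambda>_. 0" "\<lambda>v. v"] by (simp add: analytic_intros)
    then show "\<forall>\<^sub>F v in nhds 0. Q (c * v, v) = v ^ n"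
      by eventually_elim (use n y in \<open>simp add: Q_def power_0_left\<close>)
  qed
  ultimately show ?thesis using P PP unfolding Q_def by blast
qed

text \<open>Parameters of the same point have equal \<open>n\<close>-th powers, so they differ by an
  \<open>n\<close>-th root of unity, and distinct conjugates take distinct values off 0.\<close>

lemma puiseux_parametrizes:
  assumes D: "puiseux c n y Y D"
  shows "parametrizes (\<lambda>t. (t ^ n + c * y t, y t)) D"
proof -
  have n: "0 < n" and Y: "y has_fps_expansion Y" "primitive_series n Y"
    and DZ: "\<forall>\<^sub>F p in nhds 0. (fst p + c * snd p, snd p) \<in> D \<longleftrightarrow> (\<exists>t. t ^ n = fst p \<and> snd p = y t)"
    using D by (auto simp: puiseux_def)
  note y = puiseux_analytic[OF D]
  have "\<forall>\<^sub>F u in nhds 0. \<forall>k\<in>{1..<n}. u \<noteq> 0 \<longrightarrow> y (rt n ^ k * u) \<noteq> y u"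
  proof (intro eventually_ball_finite ballI)
    fix k assume "k \<in> {1..<n}"
    then show "\<forall>\<^sub>F u in nhds 0. u \<noteq> 0 \<longrightarrow> y (rt n ^ k * u) \<noteq> y u"
      using distinct_conjugates[OF Y, of k 0] by simp
  qed simp
  then obtain d where d: "d > 0" "\<And>u k. norm u < d \<Longrightarrow> k \<in> {1..<n} \<Longrightarrow> u \<noteq> 0 \<Longrightarrow> y (rt n ^ k * u) \<noteq> y u"
    unfolding eventually_nhds_metric by auto
  have inj: "t = u" if tu: "t ^ n = u ^ n" "y t = y u" "norm u < d" for t u
  proof -
    obtain k where k: "k < n" "t = rt n ^ k * u" using power_eq_rt[OF n tu(1)] by blast
    show ?thesis
    proof (cases "k = 0 \<or> u = 0")
      case False
      then show ?thesis using d(2)[of u k] k tu by auto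
    qed (use k in auto)
  qed
  have germ: "germ_eq D ((\<lambda>t. (t ^ n + c * y t, y t)) ` ball 0 \<epsilon>)" if "\<epsilon> > 0" for \<epsilon>
  proof -
    have "\<forall>\<^sub>F t in nhds (0 :: complex). t \<in> ball 0 \<epsilon>" using that by (intro eventually_nhds_in_open) auto
    from eventually_all_roots[OF n this] DZ
    have "\<forall>\<^sub>F p in nhds 0. (fst p + c * snd p, snd p) \<in> D \<longleftrightarrow> (fst p + c * snd p, snd p) \<in> (\<lambda>t. (t ^ n + c * y t, y t)) ` ball 0 \<epsilon>"
    proof eventually_elim
      case (elim p)
      have "(fst p + c * snd p, snd p) \<in> (\<lambda>t. (t ^ n + c * y t, y t)) ` ball 0 \<epsilon> \<longleftrightarrow> (\<exists>t\<in>ball 0 \<epsilon>. t ^ n = fst p \<and> snd p = y t)"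
        unfolding image_iff prod.inject by (metis add_right_cancel)
      then show ?case using elim by blast
    qed
    then show ?thesis unfolding germ_eq_def by (rule eventually_unshear)
  qed
  have "\<forall>\<^sub>F \<epsilon> in at_right 0. inj_on (\<lambda>t. (t ^ n + c * y t, y t)) (ball 0 \<epsilon>) \<and> germ_eq D ((\<lambda>t. (t ^ n + c * y t, y t)) ` ball 0 \<epsilon>)"
    unfolding eventually_at_right_field
  proof (intro exI[of _ d] conjI allI impI)
    fix \<epsilon> :: real assume e: "0 < \<epsilon>" "\<epsilon> < d"
    show "inj_on (\<lambda>t. (t ^ n + c * y t, y t)) (ball 0 \<epsilon>)"
    proof (rule inj_onI)
      fix t u assume tu: "t \<in> ball 0 \<epsilon>" "u \<in> ball 0 \<epsilon>" "(t ^ n + c * y t, y t) = (u ^ n + c * y u, y u)"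
      then have "y t = y u" "t ^ n = u ^ n" "norm u < d" using e by auto
      then show "t = u" using inj[of t u] by simp
    qed
    show "germ_eq D ((\<lambda>t. (t ^ n + c * y t, y t)) ` ball 0 \<epsilon>)" using e(1) by (rule germ)
  qed (use d in auto)
  note ev = this
  have "(\<lambda>t. t ^ n + c * y t) analytic_on {0}" by (intro analytic_intros y)
  then show ?thesis
    unfolding parametrizes_def using ev y n by (simp add: zero_prod_def power_0_left)
qed

section \<open>Lifting homeomorphisms of punctured discs\<close>

abbreviation half_plane :: "real \<Rightarrow> complex set" where
  "half_plane \<delta> \<equiv> {w. Re w < ln \<delta>}"

lemma half_plane_exp: "0 < \<delta> \<Longrightarrow> exp w \<in> ball 0 \<delta> \<longleftrightarrow> w \<in> half_plane \<delta>"
proof -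
  assume "0 < \<delta>"
  then have "exp (Re w) < exp (ln \<delta>) \<longleftrightarrow> exp (Re w) < \<delta>" by simp
  then show ?thesis by simp
qed

text \<open>The values lie in a discrete set with gaps at least \<open>2 * pi\<close>, so continuity
  on a connected set makes them constant.\<close>

lemma exp_eq_1_const:
  assumes S: "connected S" and g: "continuous_on S g" and e: "\<And>w. w \<in> S \<Longrightarrow> exp (g w) = (1 :: complex)"
    and ne: "S \<noteq> {}"
  shows "\<exists>m :: int. \<forall>w\<in>S. g w = 2 * of_real pi * \<i> * of_int m"
proof -
  have ex: "\<exists>m :: int. g w = 2 * of_real pi * \<i> * of_int m" if w: "w \<in> S" for w
  proof -
    obtain m :: int where "Re (g w) = 0" "Im (g w) = of_int (2 * m) * pi"
      using e[OF w] unfolding exp_eq_1 by blast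
    then have "g w = 2 * of_real pi * \<i> * of_int m" by (simp add: complex_eq_iff)
    then show ?thesis ..
  qed
  have "g constant_on S"
  proof (rule continuous_discrete_range_constant[OF S g])
    fix x assume x: "x \<in> S"
    show "\<exists>e>0. \<forall>y. y \<in> S \<and> g y \<noteq> g x \<longrightarrow> e \<le> norm (g y - g x)"
    proof (intro exI[of _ "2 * pi"] conjI allI impI)
      fix y assume y: "y \<in> S \<and> g y \<noteq> g x"
      obtain k l :: int where kl: "g x = 2 * of_real pi * \<i> * of_int k" "g y = 2 * of_real pi * \<i> * of_int l"
        using ex[OF x] ex[of y] y by blast
      have "g y - g x = 2 * of_real pi * \<i> * of_int (l - k)" by (simp add: kl algebra_simps)
      then have n: "norm (g y - g x) = 2 * pi * \<bar>of_int (l - k)\<bar>" by (simp add: norm_mult del: of_int_diff)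
      have "l \<noteq> k" using y kl by auto
      then have "(1::real) \<le> \<bar>of_int (l - k)\<bar>" by linarith
      then have "2 * pi * 1 \<le> 2 * pi * \<bar>of_int (l - k)\<bar>" by (intro mult_left_mono) auto
      then show "2 * pi \<le> norm (g y - g x)" using n by simp
    qed simp
  qed
  then obtain c where c: "\<And>w. w \<in> S \<Longrightarrow> g w = c" unfolding constant_on_def by blast
  obtain w0 where w0: "w0 \<in> S" using ne by blast
  obtain m :: int where "g w0 = 2 * of_real pi * \<i> * of_int m" using ex[OF w0] by blast
  then show ?thesis using c w0 by metis
qed

lemma log_lift:
  assumes "0 < \<delta>" "continuous_on (ball 0 \<delta>) \<phi>" "\<And>t. t \<in> ball 0 \<delta> \<Longrightarrow> t \<noteq> 0 \<Longrightarrow> \<phi> t \<noteq> (0 :: complex)"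
  shows "\<exists>\<Phi>. continuous_on (half_plane \<delta>) \<Phi> \<and> (\<forall>w\<in>half_plane \<delta>. \<phi> (exp w) = exp (\<Phi> w))"
proof -
  have H: "exp w \<in> ball 0 \<delta>" if "w \<in> half_plane \<delta>" for w using that half_plane_exp[OF assms(1)] by blast
  have "continuous_on (half_plane \<delta>) (\<lambda>w. \<phi> (exp w))"
    by (rule continuous_on_compose2[OF assms(2)]) (use H in \<open>auto intro!: continuous_intros\<close>)
  moreover have "contractible (half_plane \<delta>)" by (intro convex_imp_contractible convex_halfspace_Re_lt)
  moreover have "\<phi> (exp w) \<noteq> 0" if "w \<in> half_plane \<delta>" for w using assms(3)[OF H[OF that]] by simp
  ultimately show ?thesis
    by (rule continuous_logarithm_on_contractible) blast+
qed

lemma half_plane_connected: "connected (half_plane \<delta>)"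
  by (intro convex_connected convex_halfspace_Re_lt)

lemma half_plane_nonempty: "half_plane \<delta> \<noteq> {}"
proof -
  have "of_real (ln \<delta> - 1) \<in> half_plane \<delta>" by simp
  then show ?thesis by blast
qed

lemma periodic_iterate:
  assumes per: "\<And>w. w \<in> half_plane \<delta> \<Longrightarrow> \<Psi> (w + 2 * of_real pi * \<i>) = \<Psi> w + 2 * of_real pi * \<i> * of_int D"
    and w: "w \<in> half_plane \<delta>"
  shows "\<Psi> (w + 2 * of_real pi * \<i> * of_int k) = \<Psi> w + 2 * of_real pi * \<i> * of_int (D * k)"
proof (induction k rule: int_induct[where k = 0])
  case base
  show ?case by simp
next
  case (step1 i)
  have "w + 2 * of_real pi * \<i> * of_int i \<in> half_plane \<delta>" using w by simp
  from per[OF this] step1 show ?case by (simp add: algebra_simps)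
next
  case (step2 i)
  have "w + 2 * of_real pi * \<i> * of_int (i - 1) \<in> half_plane \<delta>" using w by simp
  from per[OF this] step2 show ?case by (simp add: algebra_simps)
qed

text \<open>
  A homeomorphism of punctured discs lifts through the exponential to a map commuting with the
  deck transformations up to a degree \<open>D = \<plusminus>1\<close>.
\<close>

lemma lift_degree:
  assumes d: "0 < \<delta>" "0 < \<delta>'"
    and \<phi>: "continuous_on (ball 0 \<delta>) \<phi>" "\<And>t. t \<in> ball 0 \<delta> \<Longrightarrow> \<phi> t \<in> ball 0 \<delta>'"
      "\<And>t. t \<in> ball 0 \<delta> \<Longrightarrow> t \<noteq> 0 \<Longrightarrow> \<phi> t \<noteq> (0 :: complex)"
    and \<psi>: "continuous_on (ball 0 \<delta>') \<psi>" "\<And>t. t \<in> ball 0 \<delta>' \<Longrightarrow> t \<noteq> 0 \<Longrightarrow> \<psi> t \<noteq> (0 :: complex)"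
    and inv: "\<And>t. t \<in> ball 0 \<delta> \<Longrightarrow> \<psi> (\<phi> t) = t"
  shows "\<exists>\<Phi>. \<exists>D :: int. continuous_on (half_plane \<delta>) \<Phi> \<and> (\<forall>w\<in>half_plane \<delta>. \<phi> (exp w) = exp (\<Phi> w)) \<and>
    (D = 1 \<or> D = -1) \<and> (\<forall>w\<in>half_plane \<delta>. \<Phi> (w + 2 * of_real pi * \<i>) = \<Phi> w + 2 * of_real pi * \<i> * of_int D)"
proof -
  obtain \<Phi> where \<Phi>: "continuous_on (half_plane \<delta>) \<Phi>" "\<And>w. w \<in> half_plane \<delta> \<Longrightarrow> \<phi> (exp w) = exp (\<Phi> w)"
    using log_lift[OF d(1) \<phi>(1,3)] by blast
  obtain \<Psi> where \<Psi>: "continuous_on (half_plane \<delta>') \<Psi>" "\<And>w. w \<in> half_plane \<delta>' \<Longrightarrow> \<psi> (exp w) = exp (\<Psi> w)"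
    using log_lift[OF d(2) \<psi>(1,2)] by blast
  have eb: "exp w \<in> ball 0 \<delta>" if "w \<in> half_plane \<delta>" for w using that half_plane_exp[OF d(1)] by blast
  have m: "\<Phi> w \<in> half_plane \<delta>'" if "w \<in> half_plane \<delta>" for w
    using \<phi>(2)[OF eb[OF that]] \<Phi>(2)[OF that] half_plane_exp[OF d(2)] by simp
  have shift: "continuous_on (half_plane e) (\<lambda>w. \<Theta> (w + 2 * of_real pi * \<i>))" if "continuous_on (half_plane e) \<Theta>" for e \<Theta>
    by (rule continuous_on_compose2[OF that]) (auto intro!: continuous_intros)
  have e1: "exp (\<Phi> (w + 2 * of_real pi * \<i>) - \<Phi> w) = 1" if "w \<in> half_plane \<delta>" for w
  proof -
    have "exp (\<Phi> (w + 2 * of_real pi * \<i>)) = exp (\<Phi> w)"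
      using \<Phi>(2)[OF that] \<Phi>(2)[of "w + 2 * of_real pi * \<i>"] that by (simp add: exp_add)
    then show ?thesis by (simp add: exp_diff)
  qed
  obtain D :: int where D: "\<And>w. w \<in> half_plane \<delta> \<Longrightarrow> \<Phi> (w + 2 * of_real pi * \<i>) - \<Phi> w = 2 * of_real pi * \<i> * of_int D"
    using exp_eq_1_const[OF half_plane_connected continuous_on_diff[OF shift[OF \<Phi>(1)] \<Phi>(1)] e1 half_plane_nonempty] by blast
  have e2: "exp (\<Psi> (w + 2 * of_real pi * \<i>) - \<Psi> w) = 1" if "w \<in> half_plane \<delta>'" for w
  proof -
    have "exp (\<Psi> (w + 2 * of_real pi * \<i>)) = exp (\<Psi> w)"
      using \<Psi>(2)[OF that] \<Psi>(2)[of "w + 2 * of_real pi * \<i>"] that by (simp add: exp_add)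
    then show ?thesis by (simp add: exp_diff)
  qed
  obtain D' :: int where D': "\<And>w. w \<in> half_plane \<delta>' \<Longrightarrow> \<Psi> (w + 2 * of_real pi * \<i>) - \<Psi> w = 2 * of_real pi * \<i> * of_int D'"
    using exp_eq_1_const[OF half_plane_connected continuous_on_diff[OF shift[OF \<Psi>(1)] \<Psi>(1)] e2 half_plane_nonempty] by blast
  have e3: "exp (\<Psi> (\<Phi> w) - w) = 1" if "w \<in> half_plane \<delta>" for w
  proof -
    have "exp (\<Psi> (\<Phi> w)) = \<psi> (\<phi> (exp w))" using \<Psi>(2)[OF m[OF that]] \<Phi>(2)[OF that] by simp
    then show ?thesis using inv[OF eb[OF that]] by (simp add: exp_diff)
  qed
  have c3: "continuous_on (half_plane \<delta>) (\<lambda>w. \<Psi> (\<Phi> w) - w)"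
    by (intro continuous_intros continuous_on_compose2[OF \<Psi>(1) \<Phi>(1)]) (use m in auto)
  obtain m1 :: int where m1: "\<And>w. w \<in> half_plane \<delta> \<Longrightarrow> \<Psi> (\<Phi> w) - w = 2 * of_real pi * \<i> * of_int m1"
    using exp_eq_1_const[OF half_plane_connected c3 _ half_plane_nonempty] e3 by blast
  obtain w where w: "w \<in> half_plane \<delta>" using half_plane_nonempty by blast
  have w2: "w + 2 * of_real pi * \<i> \<in> half_plane \<delta>" using w by simp
  have per: "\<Psi> (z + 2 * of_real pi * \<i>) = \<Psi> z + 2 * of_real pi * \<i> * of_int D'" if "z \<in> half_plane \<delta>'" for z
    using D'[OF that] by (simp add: algebra_simps)
  have "\<Psi> (\<Phi> (w + 2 * of_real pi * \<i>)) = \<Psi> (\<Phi> w + 2 * of_real pi * \<i> * of_int D)"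
    using D[OF w] by (simp add: algebra_simps)
  also have "\<dots> = \<Psi> (\<Phi> w) + 2 * of_real pi * \<i> * of_int (D' * D)"
    by (rule periodic_iterate[where \<Psi> = \<Psi> and \<delta> = \<delta>' and D = D']) (use per m[OF w] in auto)
  \<comment> \<open>The composite of the two lifts is the identity up to a constant, so it shifts by
    exactly one period.\<close>
  finally have "2 * of_real pi * \<i> * of_int (D' * D) = 2 * of_real pi * (\<i> :: complex)"
    using m1[OF w] m1[OF w2] by (simp add: algebra_simps)
  then have "of_int (D' * D) = (1 :: complex)" by simp
  then have "D' * D = 1" by (simp only: of_int_eq_1_iff)
  then have "D = 1 \<or> D = -1" by (auto simp: zmult_eq_1_iff)
  moreover have "\<forall>w\<in>half_plane \<delta>. \<Phi> (w + 2 * of_real pi * \<i>) = \<Phi> w + 2 * of_real pi * \<i> * of_int D"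
    using D by (simp add: algebra_simps)
  ultimately show ?thesis using \<Phi> by blast
qed

text \<open>Let \<open>\<Delta>\<close> be the logarithm of the ratio. By hypothesis
  \<open>m * \<Delta>\<close> is a fixed integer multiple \<open>b\<close> of
  \<open>2 * pi * \<i>\<close> plus an error tending to 0. Over \<open>n\<close> steps by
  \<open>\<theta>\<close>, where \<open>z = exp \<theta>\<close>, the values of
  \<open>\<Delta>\<close> add up to exactly \<open>2 * pi * \<i> * D * a\<close>. So the integer
  \<open>m * D * a - n * b\<close> is arbitrarily small, hence 0, and the limit is
  \<open>exp (D * \<theta>)\<close>, that is \<open>z\<close> or its inverse.\<close>

theorem rotation_limit:
  assumes d: "0 < \<delta>" "0 < \<delta>'"
    and \<phi>: "continuous_on (ball 0 \<delta>) \<phi>" "\<And>t. t \<in> ball 0 \<delta> \<Longrightarrow> \<phi> t \<in> ball 0 \<delta>'"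
      "\<And>t. t \<in> ball 0 \<delta> \<Longrightarrow> t \<noteq> 0 \<Longrightarrow> \<phi> t \<noteq> (0 :: complex)"
    and \<psi>: "continuous_on (ball 0 \<delta>') \<psi>" "\<And>t. t \<in> ball 0 \<delta>' \<Longrightarrow> t \<noteq> 0 \<Longrightarrow> \<psi> t \<noteq> (0 :: complex)"
    and inv: "\<And>t. t \<in> ball 0 \<delta> \<Longrightarrow> \<psi> (\<phi> t) = t"
    and n: "0 < n" and m: "0 < m" and z: "z = rt n ^ a"
    and lim: "((\<lambda>t. (\<phi> (z * t) / \<phi> t) ^ m) \<longlongrightarrow> 1) (at 0)"
  shows "\<exists>L. (L = z \<or> L = inverse z) \<and> ((\<lambda>t. \<phi> (z * t) / \<phi> t) \<longlongrightarrow> L) (at 0)"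
proof -
  obtain \<Phi> and D :: int where \<Phi>: "continuous_on (half_plane \<delta>) \<Phi>" "\<And>w. w \<in> half_plane \<delta> \<Longrightarrow> \<phi> (exp w) = exp (\<Phi> w)"
    and D: "D = 1 \<or> D = -1"
    and per: "\<And>w. w \<in> half_plane \<delta> \<Longrightarrow> \<Phi> (w + 2 * of_real pi * \<i>) = \<Phi> w + 2 * of_real pi * \<i> * of_int D"
    using lift_degree[OF d \<phi> \<psi> inv] by blast
  define \<theta> where "\<theta> = \<i> * of_real (2 * pi * real a / real n)"
  have ez: "exp \<theta> = z" unfolding z rt_power cis_conv_exp \<theta>_def ..
  have n\<theta>: "of_nat n * \<theta> = 2 * of_real pi * \<i> * of_int (int a)" using n by (simp add: \<theta>_def)
  have Re\<theta>: "Re \<theta> = 0" by (simp add: \<theta>_def)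
  define f where "f = (\<lambda>t. (\<phi> (z * t) / \<phi> t) ^ m)"
  have flim: "(f \<longlongrightarrow> 1) (at 0)" using lim by (simp add: f_def)
  \<comment> \<open>Within distance 1 of 1 the real part is positive, so the principal logarithm is
    continuous there.\<close>
  have "\<forall>\<^sub>F t in at 0. norm (f t - 1) < 1" using tendstoD[OF flim, of 1] by (simp add: dist_norm)
  then obtain \<delta>0 where \<delta>0: "\<delta>0 > 0" "\<And>t. t \<noteq> 0 \<Longrightarrow> norm t < \<delta>0 \<Longrightarrow> norm (f t - 1) < 1"
    unfolding eventually_at by auto
  define \<delta>1 where "\<delta>1 = min \<delta> \<delta>0"
  have \<delta>1: "0 < \<delta>1" "\<delta>1 \<le> \<delta>" "\<delta>1 \<le> \<delta>0" using d \<delta>0 by (auto simp: \<delta>1_def)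
  have HPs: "w \<in> half_plane \<delta>" if "w \<in> half_plane \<delta>1" for w
    using that \<delta>1 half_plane_exp[OF \<delta>1(1), of w] half_plane_exp[OF d(1), of w] by auto
  have sh: "w + of_nat k * \<theta> \<in> half_plane e" if "w \<in> half_plane e" for w k e using that Re\<theta> by simp
  have sh1: "w + \<theta> \<in> half_plane e" if "w \<in> half_plane e" for w e using sh[OF that, of 1] by simp
  define \<Delta> where "\<Delta> = (\<lambda>w. \<Phi> (w + \<theta>) - \<Phi> w)"
  have e\<Delta>: "exp (\<Delta> w) = \<phi> (z * exp w) / \<phi> (exp w)" if "w \<in> half_plane \<delta>" for w
    using \<Phi>(2)[OF that] \<Phi>(2)[OF sh1[OF that]] by (simp add: \<Delta>_def exp_diff exp_add ez mult.commute)
  have fe: "exp (of_nat m * \<Delta> w) = f (exp w)" if "w \<in> half_plane \<delta>" for w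
    using e\<Delta>[OF that] by (simp add: exp_of_nat_mult f_def)
  have near1: "norm (f (exp w) - 1) < 1" if "w \<in> half_plane \<delta>1" for w
  proof -
    have "norm (exp w) < \<delta>1" using half_plane_exp[OF \<delta>1(1), of w] that by simp
    then show ?thesis using \<delta>0(2)[of "exp w"] \<delta>1 by simp
  qed
  define u where "u = (\<lambda>w. Ln (f (exp w)))"
  have cont\<Delta>: "continuous_on (half_plane \<delta>1) \<Delta>"
    unfolding \<Delta>_def
    by (intro continuous_on_diff continuous_on_compose2[OF \<Phi>(1)] continuous_on_subset[OF \<Phi>(1)] continuous_intros)
       (use HPs sh1 in blast)+
  have "continuous_on (half_plane \<delta>1) (\<lambda>w. Ln (exp (of_nat m * \<Delta> w)))"
  proof (intro continuous_on_Ln' continuous_on_exp continuous_on_mult continuous_on_const cont\<Delta>)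
    fix w assume w: "w \<in> half_plane \<delta>1"
    have "norm (exp (of_nat m * \<Delta> w) - 1) < 1" using near1[OF w] fe[OF HPs[OF w]] by simp
    then have "0 < Re (exp (of_nat m * \<Delta> w))"
      using abs_Re_le_cmod[of "exp (of_nat m * \<Delta> w) - 1"] by (simp only: minus_complex.sel one_complex.sel)
    then show "exp (of_nat m * \<Delta> w) \<notin> \<real>\<^sub>\<le>\<^sub>0" by (simp add: complex_nonpos_Reals_iff)
  qed
  moreover have "Ln (exp (of_nat m * \<Delta> w)) = u w" if "w \<in> half_plane \<delta>1" for w using fe[OF HPs[OF that]] by (simp add: u_def)
  ultimately have contu: "continuous_on (half_plane \<delta>1) u" by (rule continuous_on_eq)
  have "exp (of_nat m * \<Delta> w - u w) = 1" if "w \<in> half_plane \<delta>1" for w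
  proof -
    have "f (exp w) \<noteq> 0" using near1[OF that] by auto
    then show ?thesis using fe[OF HPs[OF that]] by (simp add: exp_diff u_def)
  qed
  then obtain b :: int where b: "\<And>w. w \<in> half_plane \<delta>1 \<Longrightarrow> of_nat m * \<Delta> w - u w = 2 * of_real pi * \<i> * of_int b"
    using exp_eq_1_const[OF half_plane_connected _ _ half_plane_nonempty, of \<delta>1 "\<lambda>w. of_nat m * \<Delta> w - u w"]
      continuous_on_diff[OF continuous_on_mult[OF continuous_on_const cont\<Delta>] contu] by blast
  \<comment> \<open>\<open>E\<close> does not depend on \<open>w\<close>, while the orbit sum of the
    errors \<open>u\<close> that it equals tends to 0 as \<open>exp w\<close> does.\<close>
  define E where "E = 2 * of_real pi * \<i> * (of_nat m * of_int D * of_nat a - of_nat n * of_int b)"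
  have E: "E = (\<Sum>k<n. u (w + of_nat k * \<theta>))" if w: "w \<in> half_plane \<delta>1" for w
  proof -
    have "(\<Sum>k<n. \<Delta> (w + of_nat k * \<theta>)) = (\<Sum>k<n. \<Phi> (w + of_nat (Suc k) * \<theta>) - \<Phi> (w + of_nat k * \<theta>))"
      by (rule sum.cong) (auto simp: \<Delta>_def algebra_simps)
    also have "\<dots> = \<Phi> (w + of_nat n * \<theta>) - \<Phi> w" by (subst sum_lessThan_telescope) simp
    also have "\<dots> = 2 * of_real pi * \<i> * of_int (D * int a)"
      unfolding n\<theta> using periodic_iterate[where \<Psi> = \<Phi> and \<delta> = \<delta> and D = D and w = w and k = "int a"] per HPs[OF w]
      by simp
    finally have t: "(\<Sum>k<n. \<Delta> (w + of_nat k * \<theta>)) = 2 * of_real pi * \<i> * of_int (D * int a)" .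
    have "(\<Sum>k<n. u (w + of_nat k * \<theta>)) = (\<Sum>k<n. of_nat m * \<Delta> (w + of_nat k * \<theta>) - 2 * of_real pi * \<i> * of_int b)"
    proof (rule sum.cong)
      fix k assume "k \<in> {..<n}"
      show "u (w + of_nat k * \<theta>) = of_nat m * \<Delta> (w + of_nat k * \<theta>) - 2 * of_real pi * \<i> * of_int b"
        using b[OF sh[OF w, of k]] by (simp add: algebra_simps)
    qed simp
    also have "\<dots> = of_nat m * (\<Sum>k<n. \<Delta> (w + of_nat k * \<theta>)) - of_nat n * (2 * of_real pi * \<i> * of_int b)"
      by (simp add: sum_subtractf sum_distrib_left)
    finally show ?thesis unfolding t E_def by (simp add: algebra_simps)
  qed
  have Lnlim: "((\<lambda>t. Ln (f t)) \<longlongrightarrow> 0) (at 0)"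
    using tendsto_Ln[OF flim] by (simp add: complex_nonpos_Reals_iff)
  have "E = 0"
  proof -
    have "norm E \<le> real n * \<epsilon>" if \<epsilon>: "\<epsilon> > 0" for \<epsilon>
    proof -
      obtain \<delta>2 where \<delta>2: "\<delta>2 > 0" "\<And>t. t \<noteq> 0 \<Longrightarrow> norm t < \<delta>2 \<Longrightarrow> norm (Ln (f t)) < \<epsilon>"
        using tendstoD[OF Lnlim \<epsilon>] unfolding eventually_at by auto
      define \<delta>3 where "\<delta>3 = min \<delta>1 \<delta>2"
      have \<delta>3: "0 < \<delta>3" "\<delta>3 \<le> \<delta>1" "\<delta>3 \<le> \<delta>2" using \<delta>1 \<delta>2 by (auto simp: \<delta>3_def)
      obtain w where w: "w \<in> half_plane \<delta>3" using half_plane_nonempty by blast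
      then have "w \<in> half_plane \<delta>1" using \<delta>3 half_plane_exp[OF \<delta>1(1), of w] half_plane_exp[OF \<delta>3(1), of w] by auto
      then have "norm E \<le> (\<Sum>k<n. norm (u (w + of_nat k * \<theta>)))" using E by (simp add: norm_sum)
      also have "\<dots> \<le> (\<Sum>k<n. \<epsilon>)"
      proof (rule sum_mono)
        fix k
        have "norm (exp (w + of_nat k * \<theta>)) < \<delta>3" using half_plane_exp[OF \<delta>3(1), of "w + of_nat k * \<theta>"] sh[OF w, of k] by (metis dist_0_norm mem_ball)
        then show "norm (u (w + of_nat k * \<theta>)) \<le> \<epsilon>"
          using \<delta>2(2)[of "exp (w + of_nat k * \<theta>)"] \<delta>3 by (simp add: u_def)
      qed
      finally show ?thesis by simp
    qed
    then have "norm E \<le> 0" by (intro nonpos_if_le_small[of 1 _ "real n"]) auto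
    then show ?thesis by simp
  qed
  then have mb: "of_nat n * of_int b = of_nat m * of_int D * (of_nat a :: complex)" by (simp add: E_def)
  define L where "L = exp (of_int D * \<theta>)"
  have L: "L = z \<or> L = inverse z" using D by (auto simp: L_def ez exp_minus)
  have ratio: "\<phi> (z * t) / \<phi> t = L * exp (Ln (f t) / of_nat m)" if t: "t \<noteq> 0" "norm t < \<delta>1" for t
  proof -
    define w where "w = Ln t"
    have ew: "exp w = t" using t by (simp add: w_def)
    have w: "w \<in> half_plane \<delta>1" using half_plane_exp[OF \<delta>1(1), of w] t ew by simp
    have "of_nat n * (of_nat m * \<Delta> w) = of_nat n * (2 * of_real pi * \<i> * of_int b + u w)"
      using b[OF w] by (simp add: algebra_simps)
    also have "\<dots> = 2 * of_real pi * \<i> * (of_nat m * of_int D * of_nat a) + of_nat n * u w"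
      unfolding mb[symmetric] by (simp add: algebra_simps)
    also have "\<dots> = of_nat m * of_int D * (of_nat n * \<theta>) + of_nat n * u w" unfolding n\<theta> by simp
    finally have "of_nat n * (of_nat m * \<Delta> w) = of_nat n * (of_nat m * (of_int D * \<theta>) + u w)" by (simp add: algebra_simps)
    then have "of_nat m * \<Delta> w = of_nat m * (of_int D * \<theta>) + u w" using n by simp
    then have "\<Delta> w = of_int D * \<theta> + u w / of_nat m" using m by (simp add: field_simps)
    then have "exp (\<Delta> w) = L * exp (u w / of_nat m)" by (simp add: exp_add L_def)
    then show ?thesis using e\<Delta>[OF HPs[OF w]] by (simp add: ew u_def)
  qed
  have "((\<lambda>t. L * exp (Ln (f t) / of_nat m)) \<longlongrightarrow> L * exp (0 / of_nat m)) (at 0)"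
    using m by (intro tendsto_intros Lnlim) auto
  moreover have "\<forall>\<^sub>F t in at 0. L * exp (Ln (f t) / of_nat m) = \<phi> (z * t) / \<phi> t"
    unfolding eventually_at using \<delta>1(1) ratio by (intro exI[of _ \<delta>1]) auto
  ultimately have "((\<lambda>t. \<phi> (z * t) / \<phi> t) \<longlongrightarrow> L) (at 0)"
    by (simp add: Lim_transform_eventually)
  then show ?thesis using L by blast
qed

section \<open>Correspondence of branches\<close>

text \<open>Closed discs make the images of the branches compact: this gives closed sets for the
  connectedness argument and continuity of the inverse parametrizations. The alternative
  \<open>t = 0 \<and> u = 0\<close> allows for the common point of all branches.\<close>

definition chart :: "(complex \<times> complex) set \<Rightarrow> nat \<Rightarrow> (nat \<Rightarrow> complex \<Rightarrow> complex \<times> complex) \<Rightarrow> real \<Rightarrow> bool" where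
  "chart C r \<gamma> \<delta> \<longleftrightarrow> 0 < \<delta> \<and>
     (\<forall>i\<in>{1..r}. continuous_on (cball 0 \<delta>) (\<gamma> i) \<and> \<gamma> i 0 = 0 \<and> \<gamma> i ` cball 0 \<delta> \<subseteq> C) \<and>
     (\<forall>i\<in>{1..r}. \<forall>j\<in>{1..r}. \<forall>t\<in>cball 0 \<delta>. \<forall>u\<in>cball 0 \<delta>.
        \<gamma> i t = \<gamma> j u \<longrightarrow> i = j \<and> t = u \<or> t = 0 \<and> u = 0) \<and>
     (\<exists>\<rho>>0. C \<inter> ball 0 \<rho> \<subseteq> (\<Union>i\<in>{1..r}. \<gamma> i ` ball 0 \<delta>))"

text \<open>The image of a small punctured disc under \<open>f\<close> after
  \<open>\<gamma> i\<close> is connected and avoids 0. The branches of the other curve that cover it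
  are finitely many, disjoint off 0 and relatively closed, so it stays on one of them. Inverting
  \<open>\<gamma>' k\<close> on its compact disc yields the lifted parameter.\<close>

lemma chart_map:
  assumes C: "chart C r \<gamma> \<delta>" and C': "chart C' s \<gamma>' \<delta>'"
    and hom: "homeomorphism (C \<inter> U) (C' \<inter> V) f g" and U: "open U" "0 \<in> U"
    and f0: "f 0 = 0" and i: "i \<in> {1..r}"
  shows "\<exists>k\<in>{1..s}. \<exists>d \<phi>. 0 < d \<and> d \<le> \<delta> \<and> continuous_on (ball 0 d) \<phi> \<and> \<phi> 0 = 0 \<and>
    (\<forall>t\<in>ball 0 d. \<phi> t \<in> ball 0 \<delta>' \<and> \<gamma> i t \<in> C \<inter> U \<and> f (\<gamma> i t) = \<gamma>' k (\<phi> t) \<and> (t \<noteq> 0 \<longrightarrow> \<phi> t \<noteq> 0))"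
proof -
  have \<delta>: "0 < \<delta>" "0 < \<delta>'" using C C' by (auto simp: chart_def)
  have \<gamma>: "continuous_on (cball 0 \<delta>) (\<gamma> i)" "\<gamma> i 0 = 0" "\<gamma> i ` cball 0 \<delta> \<subseteq> C"
    using C i unfolding chart_def by blast+
  have inj\<gamma>: "t = u" if "t \<in> cball 0 \<delta>" "u \<in> cball 0 \<delta>" "\<gamma> i t = \<gamma> i u" for t u
    using C i that unfolding chart_def by blast
  have \<gamma>': "continuous_on (cball 0 \<delta>') (\<gamma>' k)" "\<gamma>' k 0 = 0" if "k \<in> {1..s}" for k
    using C' that unfolding chart_def by blast+
  have inj\<gamma>': "k = l \<and> t = u \<or> t = 0 \<and> u = 0"
    if "k \<in> {1..s}" "l \<in> {1..s}" "t \<in> cball 0 \<delta>'" "u \<in> cball 0 \<delta>'" "\<gamma>' k t = \<gamma>' l u" for k l t u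
    using C' that unfolding chart_def by blast
  obtain \<rho> where \<rho>: "\<rho> > 0" "C' \<inter> ball 0 \<rho> \<subseteq> (\<Union>k\<in>{1..s}. \<gamma>' k ` ball 0 \<delta>')"
    using C' unfolding chart_def by blast
  have cf: "continuous_on (C \<inter> U) f" and fim: "f ` (C \<inter> U) = C' \<inter> V" and gf: "\<And>p. p \<in> C \<inter> U \<Longrightarrow> g (f p) = p"
    using hom by (auto simp: homeomorphism_def)
  have z: "0 \<in> C \<inter> U"
  proof -
    have "\<gamma> i 0 \<in> C" using \<gamma>(3) \<delta>(1) by (metis centre_in_cball image_subset_iff less_imp_le)
    then show ?thesis using \<gamma>(2) U by simp
  qed
  obtain e where e: "e > 0" "\<And>p. p \<in> C \<inter> U \<Longrightarrow> dist p 0 < e \<Longrightarrow> dist (f p) 0 < \<rho>"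
    using cf z \<rho>(1) f0 unfolding continuous_on_iff by metis
  obtain e2 where e2: "e2 > 0" "ball 0 e2 \<subseteq> U" using U open_contains_ball by blast
  have "\<exists>d>0. \<forall>t\<in>cball 0 \<delta>. dist t 0 < d \<longrightarrow> dist (\<gamma> i t) (\<gamma> i 0) < min e e2"
    using \<gamma>(1) \<delta>(1) e(1) e2(1) unfolding continuous_on_iff by (metis centre_in_cball less_imp_le min_less_iff_conj)
  then obtain d0 where d0: "d0 > 0" "\<And>t. t \<in> cball 0 \<delta> \<Longrightarrow> dist t 0 < d0 \<Longrightarrow> dist (\<gamma> i t) 0 < min e e2"
    using \<gamma>(2) by metis
  define d where "d = min d0 \<delta>"
  have d: "0 < d" "d \<le> \<delta>" "d \<le> d0" using d0 \<delta> by (auto simp: d_def)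
  have inC: "\<gamma> i t \<in> C \<inter> U" "dist (f (\<gamma> i t)) 0 < \<rho>" if t: "t \<in> ball 0 d" for t
  proof -
    have tc: "t \<in> cball 0 \<delta>" and "dist t 0 < d0" using t d by auto
    then have "dist (\<gamma> i t) 0 < min e e2" by (rule d0(2))
    then show 1: "\<gamma> i t \<in> C \<inter> U" using \<gamma>(3) tc e2(2) by (auto simp: dist_commute)
    show "dist (f (\<gamma> i t)) 0 < \<rho>" using e(2)[OF 1] \<open>dist (\<gamma> i t) 0 < min e e2\<close> by simp
  qed
  define h where "h = (\<lambda>t. f (\<gamma> i t))"
  have hcont: "continuous_on (ball 0 d) h"
    unfolding h_def
    by (rule continuous_on_compose2[OF cf continuous_on_subset[OF \<gamma>(1)]]) (use inC d in auto)
  have hcov: "\<exists>k\<in>{1..s}. h t \<in> \<gamma>' k ` ball 0 \<delta>'" if "t \<in> ball 0 d" for t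
  proof -
    have "h t \<in> C' \<inter> V" using inC(1)[OF that] fim by (auto simp: h_def)
    then have "h t \<in> C' \<inter> ball 0 \<rho>" using inC(2)[OF that] by (simp add: h_def dist_commute)
    then show ?thesis using \<rho>(2) by blast
  qed
  have hnz: "h t \<noteq> 0" if "t \<in> ball 0 d" "t \<noteq> 0" for t
  proof
    assume "h t = 0"
    then have "g (h t) = g (f 0)" using f0 by simp
    then have "\<gamma> i t = \<gamma> i 0" using gf[OF inC(1)[OF that(1)]] gf[OF z] \<gamma>(2) by (simp add: h_def)
    then show False using inj\<gamma>[of t 0] that d by auto
  qed
  define T where "T = ball (0::complex) d - {0}"
  have conT: "connected T" unfolding T_def by (intro connected_punctured_ball) simp
  define K where "K = (\<lambda>k. {t \<in> T. h t \<in> \<gamma>' k ` cball 0 \<delta>'})"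
  have clK: "closedin (top_of_set T) (K k)" if "k \<in> {1..s}" for k
  proof -
    have "compact (\<gamma>' k ` cball 0 \<delta>')" by (intro compact_continuous_image \<gamma>'(1)[OF that] compact_cball)
    then have "closedin (top_of_set T) (T \<inter> h -` (\<gamma>' k ` cball 0 \<delta>'))"
      by (intro continuous_closedin_preimage continuous_on_subset[OF hcont] compact_imp_closed) (auto simp: T_def)
    moreover have "T \<inter> h -` (\<gamma>' k ` cball 0 \<delta>') = K k" by (auto simp: K_def)
    ultimately show ?thesis by simp
  qed
  have covK: "T = (\<Union>k\<in>{1..s}. K k)"
  proof -
    have "t \<in> (\<Union>k\<in>{1..s}. K k)" if "t \<in> T" for t
    proof -
      have "t \<in> ball 0 d" using that by (simp add: T_def)
      then obtain k where "k \<in> {1..s}" "h t \<in> \<gamma>' k ` ball 0 \<delta>'" using hcov by blast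
      then have "t \<in> K k" using that ball_subset_cball unfolding K_def by blast
      then show ?thesis using \<open>k \<in> {1..s}\<close> by blast
    qed
    then show ?thesis by (auto simp: K_def)
  qed
  have disK: "k = l" if kl: "k \<in> {1..s}" "l \<in> {1..s}" "t \<in> K k" "t \<in> K l" for k l t
  proof -
    obtain a where a: "a \<in> cball 0 \<delta>'" "h t = \<gamma>' k a" using kl(3) by (auto simp: K_def)
    obtain b where b: "b \<in> cball 0 \<delta>'" "h t = \<gamma>' l b" using kl(4) by (auto simp: K_def)
    have "k = l \<and> a = b \<or> a = 0 \<and> b = 0" using a b kl by (intro inj\<gamma>') auto
    moreover have "h t \<noteq> 0" using hnz[of t] kl(3) by (simp add: K_def T_def)
    ultimately show ?thesis using a \<gamma>'(2)[OF kl(1)] by auto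
  qed
  have "of_real (d/2) \<in> T" using d by (simp add: T_def)
  then obtain k t0 where k: "k \<in> {1..s}" "t0 \<in> K k" using covK by blast
  \<comment> \<open>\<open>K k\<close> is closed in \<open>T\<close>, and open as the complement of
    the finitely many other closed pieces.\<close>
  have TK: "T = K k"
  proof -
    have c2: "closedin (top_of_set T) (\<Union>l\<in>{1..s} - {k}. K l)"
      by (intro closedin_Union) (use clK in auto)
    have "T - (\<Union>l\<in>{1..s} - {k}. K l) = K k"
      using covK disK k(1) by blast
    moreover have "openin (top_of_set T) (T - (\<Union>l\<in>{1..s} - {k}. K l))"
      using c2 by (simp add: openin_diff)
    ultimately have "openin (top_of_set T) (K k)" by simp
    then show ?thesis using conT clK[OF k(1)] k(2) unfolding connected_clopen by blast
  qed
  define \<kappa> where "\<kappa> = inv_into (cball 0 \<delta>') (\<gamma>' k)"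
  have inj: "inj_on (\<gamma>' k) (cball 0 \<delta>')"
  proof (rule inj_onI)
    fix t u assume "t \<in> cball 0 \<delta>'" "u \<in> cball 0 \<delta>'" "\<gamma>' k t = \<gamma>' k u"
    from inj\<gamma>'[OF k(1) k(1) this] show "t = u" by auto
  qed
  have \<kappa>: "\<kappa> (\<gamma>' k a) = a" if "a \<in> cball 0 \<delta>'" for a unfolding \<kappa>_def using inj that by (rule inv_into_f_f)
  have c\<kappa>: "continuous_on (\<gamma>' k ` cball 0 \<delta>') \<kappa>"
    by (rule continuous_on_inv[OF \<gamma>'(1)[OF k(1)] compact_cball]) (use \<kappa> in blast)
  define \<phi> where "\<phi> = (\<lambda>t. \<kappa> (h t))"
  have h0: "h 0 = 0" using \<gamma>(2) f0 by (simp add: h_def)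
  have hk: "\<exists>a\<in>ball 0 \<delta>'. h t = \<gamma>' k a" if t: "t \<in> ball 0 d" for t
  proof (cases "t = 0")
    case True
    then show ?thesis using h0 \<gamma>'(2)[OF k(1)] \<delta> by (intro bexI[of _ 0]) auto
  next
    case False
    obtain l a where l: "l \<in> {1..s}" "a \<in> ball 0 \<delta>'" "h t = \<gamma>' l a" using hcov[OF t] by blast
    have "t \<in> T" using t False by (simp add: T_def)
    then have "t \<in> K k" using TK by simp
    moreover have "t \<in> K l" using l \<open>t \<in> T\<close> by (auto simp: K_def)
    ultimately have "k = l" using disK k(1) l(1) by blast
    then show ?thesis using l by blast
  qed
  show ?thesis
  proof (intro bexI[OF _ k(1)] exI[of _ d] exI[of _ \<phi>] conjI ballI impI)
    show "0 < d" "d \<le> \<delta>" by fact+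
    show "continuous_on (ball 0 d) \<phi>"
      unfolding \<phi>_def
    proof (rule continuous_on_compose2[OF c\<kappa> hcont])
      show "h ` ball 0 d \<subseteq> \<gamma>' k ` cball 0 \<delta>'" using hk by fastforce
    qed
    show "\<phi> 0 = 0" using \<kappa>[of 0] \<gamma>'(2)[OF k(1)] \<delta> h0 by (simp add: \<phi>_def)
    fix t assume t: "t \<in> ball (0::complex) d"
    obtain a where a: "a \<in> ball 0 \<delta>'" "h t = \<gamma>' k a" using hk[OF t] by blast
    have \<phi>a: "\<phi> t = a" using \<kappa>[of a] a by (simp add: \<phi>_def)
    show "\<phi> t \<in> ball 0 \<delta>'" using \<phi>a a by simp
    show "\<gamma> i t \<in> C \<inter> U" by (rule inC(1)[OF t])
    show "f (\<gamma> i t) = \<gamma>' k (\<phi> t)" using a \<phi>a by (simp add: h_def)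
    show "\<phi> t \<noteq> 0" if "t \<noteq> 0" using hnz[OF t that] a \<phi>a \<gamma>'(2)[OF k(1)] by auto
  qed
qed

text \<open>Going forth and back returns to the same point of the curve. For a nonzero parameter the
  injectivity built into \<open>chart\<close> then makes the two assignments of branches mutually
  inverse, and \<open>\<psi> i\<close> a left inverse of \<open>\<phi> i\<close>.\<close>

theorem chart_correspondence:
  assumes C: "chart C r \<gamma> \<delta>" and C': "chart C' s \<gamma>' \<delta>'"
    and hom: "homeomorphism (C \<inter> U) (C' \<inter> V) f g" and U: "open U" "0 \<in> U" and V: "open V" "0 \<in> V"
    and f0: "f 0 = 0" and r: "1 \<le> r"
  shows "\<exists>\<sigma> \<phi> \<psi> d d'. bij_betw \<sigma> {1..r} {1..s} \<and> (\<forall>i\<in>{1..r}.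
    0 < d i \<and> 0 < d' i \<and> d i \<le> \<delta> \<and> d' i \<le> \<delta>' \<and>
    continuous_on (ball 0 (d i)) (\<phi> i) \<and> \<phi> i 0 = 0 \<and> continuous_on (ball 0 (d' i)) (\<psi> i) \<and>
    (\<forall>t\<in>ball 0 (d i). \<phi> i t \<in> ball 0 (d' i) \<and> \<psi> i (\<phi> i t) = t \<and> (t \<noteq> 0 \<longrightarrow> \<phi> i t \<noteq> 0) \<and>
       \<gamma> i t \<in> C \<inter> U \<and> f (\<gamma> i t) = \<gamma>' (\<sigma> i) (\<phi> i t)) \<and>
    (\<forall>t\<in>ball 0 (d' i). t \<noteq> 0 \<longrightarrow> \<psi> i t \<noteq> (0 :: complex)))"
proof -
  have fgs: "homeomorphism (C' \<inter> V) (C \<inter> U) g f" using hom by (rule homeomorphism_symD)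
  have gf: "\<And>p. p \<in> C \<inter> U \<Longrightarrow> g (f p) = p" and fg: "\<And>p. p \<in> C' \<inter> V \<Longrightarrow> f (g p) = p"
    and fim: "\<And>p. p \<in> C \<inter> U \<Longrightarrow> f p \<in> C' \<inter> V"
    using hom by (auto simp: homeomorphism_def)
  have \<delta>: "0 < \<delta>" "0 < \<delta>'" using C C' by (auto simp: chart_def)
  have "0 \<in> C \<inter> U"
  proof -
    have "\<gamma> 1 0 = 0" "\<gamma> 1 ` cball 0 \<delta> \<subseteq> C" using C r unfolding chart_def by auto
    then show ?thesis using \<delta> U by (metis IntI centre_in_cball image_subset_iff less_imp_le)
  qed
  then have g0: "g 0 = 0" using gf[of 0] f0 by simp
  define A where "A = (\<lambda>i k d \<phi>. 0 < d \<and> d \<le> \<delta> \<and> continuous_on (ball 0 d) \<phi> \<and> \<phi> 0 = 0 \<and>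
    (\<forall>t\<in>ball 0 d. \<phi> t \<in> ball 0 \<delta>' \<and> \<gamma> i t \<in> C \<inter> U \<and> f (\<gamma> i t) = \<gamma>' k (\<phi> t) \<and> (t \<noteq> 0 \<longrightarrow> \<phi> t \<noteq> (0::complex))))"
  define B where "B = (\<lambda>i k d \<phi>. 0 < d \<and> d \<le> \<delta>' \<and> continuous_on (ball 0 d) \<phi> \<and> \<phi> 0 = 0 \<and>
    (\<forall>t\<in>ball 0 d. \<phi> t \<in> ball 0 \<delta> \<and> \<gamma>' i t \<in> C' \<inter> V \<and> g (\<gamma>' i t) = \<gamma> k (\<phi> t) \<and> (t \<noteq> 0 \<longrightarrow> \<phi> t \<noteq> (0::complex))))"
  have "\<forall>i\<in>{1..r}. \<exists>k. k \<in> {1..s} \<and> (\<exists>d \<phi>. A i k d \<phi>)"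
    using chart_map[OF C C' hom U f0] unfolding A_def by blast
  then obtain \<sigma> where \<sigma>: "\<forall>i\<in>{1..r}. \<sigma> i \<in> {1..s} \<and> (\<exists>d \<phi>. A i (\<sigma> i) d \<phi>)" by metis
  then obtain d1 where "\<forall>i\<in>{1..r}. \<exists>\<phi>. A i (\<sigma> i) (d1 i) \<phi>" by metis
  then obtain \<phi> where A: "\<forall>i\<in>{1..r}. A i (\<sigma> i) (d1 i) (\<phi> i)" by metis
  have "\<forall>i\<in>{1..s}. \<exists>k. k \<in> {1..r} \<and> (\<exists>d \<phi>. B i k d \<phi>)"
    using chart_map[OF C' C fgs V g0] unfolding B_def by blast
  then obtain \<tau> where \<tau>: "\<forall>i\<in>{1..s}. \<tau> i \<in> {1..r} \<and> (\<exists>d \<phi>. B i (\<tau> i) d \<phi>)" by metis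
  then obtain d2 where "\<forall>i\<in>{1..s}. \<exists>\<phi>. B i (\<tau> i) (d2 i) \<phi>" by metis
  then obtain \<psi> where B: "\<forall>i\<in>{1..s}. B i (\<tau> i) (d2 i) (\<psi> i)" by metis
  have small: "\<exists>d. 0 < d \<and> d \<le> e \<and> (\<forall>t\<in>ball 0 d. \<theta> t \<in> ball (0::complex) e')"
    if c: "continuous_on (ball 0 e) \<theta>" "\<theta> 0 = 0" "0 < e" "0 < e'" for e e' and \<theta> :: "complex \<Rightarrow> complex"
  proof -
    have "isCont \<theta> 0" using c by (simp add: continuous_on_eq_continuous_at)
    then obtain d where "d > 0" "\<And>t. dist t 0 < d \<Longrightarrow> dist (\<theta> t) (\<theta> 0) < e'"
      using c(4) unfolding continuous_at_eps_delta by blast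
    then show ?thesis using c by (intro exI[of _ "min d e"]) auto
  qed
  have main1: "\<tau> (\<sigma> i) = i \<and> (\<exists>d. 0 < d \<and> d \<le> d1 i \<and> (\<forall>t\<in>ball 0 d. \<phi> i t \<in> ball 0 (d2 (\<sigma> i)) \<and> \<psi> (\<sigma> i) (\<phi> i t) = t))"
    if i: "i \<in> {1..r}" for i
  proof -
    define k where "k = \<sigma> i"
    have k: "k \<in> {1..s}" using \<sigma> i by (simp add: k_def)
    have Ai: "A i k (d1 i) (\<phi> i)" and Bk: "B k (\<tau> k) (d2 k) (\<psi> k)" using A B i k by (auto simp: k_def)
    have tk: "\<tau> k \<in> {1..r}" using \<tau> k by blast
    obtain d where d: "0 < d" "d \<le> d1 i" "\<forall>t\<in>ball 0 d. \<phi> i t \<in> ball 0 (d2 k)"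
      using small[of "d1 i" "\<phi> i" "d2 k"] Ai Bk unfolding A_def B_def by blast
    have e: "\<tau> k = i \<and> \<psi> k (\<phi> i t) = t \<or> \<psi> k (\<phi> i t) = 0 \<and> t = 0" if t: "t \<in> ball 0 d" for t
    proof -
      have t1: "t \<in> ball 0 (d1 i)" using t d(2) by auto
      have "\<gamma> (\<tau> k) (\<psi> k (\<phi> i t)) = g (\<gamma>' k (\<phi> i t))" using Bk d(3) t unfolding B_def by auto
      also have "\<dots> = g (f (\<gamma> i t))" using Ai t1 unfolding A_def by auto
      also have "\<dots> = \<gamma> i t" using Ai t1 unfolding A_def by (intro gf) blast
      finally have eq: "\<gamma> (\<tau> k) (\<psi> k (\<phi> i t)) = \<gamma> i t" .
      have "\<psi> k (\<phi> i t) \<in> ball 0 \<delta>" using Bk d(3) t unfolding B_def by blast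
      moreover have "t \<in> ball 0 \<delta>" using t1 Ai unfolding A_def by auto
      ultimately show ?thesis using C eq tk i unfolding chart_def by (meson ball_subset_cball subsetD)
    qed
    have "of_real (d/2) \<in> ball (0::complex) d" "of_real (d/2) \<noteq> (0::complex)" using d(1) by auto
    then have "\<tau> k = i" using e by blast
    moreover have "\<psi> k (\<phi> i t) = t" if "t \<in> ball 0 d" for t using e[OF that] by auto
    ultimately show ?thesis using d unfolding k_def by blast
  qed
  have main2: "\<sigma> (\<tau> k) = k" if k: "k \<in> {1..s}" for k
  proof -
    define i where "i = \<tau> k"
    have i: "i \<in> {1..r}" using \<tau> k by (simp add: i_def)
    have Bk: "B k i (d2 k) (\<psi> k)" and Ai: "A i (\<sigma> i) (d1 i) (\<phi> i)" using A B i k by (auto simp: i_def)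
    have sk: "\<sigma> i \<in> {1..s}" using \<sigma> i by blast
    obtain d where d: "0 < d" "d \<le> d2 k" "\<forall>t\<in>ball 0 d. \<psi> k t \<in> ball 0 (d1 i)"
      using small[of "d2 k" "\<psi> k" "d1 i"] Ai Bk unfolding A_def B_def by blast
    define t where "t = complex_of_real (d/2)"
    have t: "t \<in> ball 0 d" "t \<noteq> 0" using d(1) by (auto simp: t_def)
    have t1: "t \<in> ball 0 (d2 k)" using t d(2) by auto
    have "\<gamma>' (\<sigma> i) (\<phi> i (\<psi> k t)) = f (\<gamma> i (\<psi> k t))" using Ai d(3) t unfolding A_def by auto
    also have "\<dots> = f (g (\<gamma>' k t))" using Bk t1 unfolding B_def by auto
    also have "\<dots> = \<gamma>' k t" using Bk t1 unfolding B_def by (intro fg) blast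
    finally have eq: "\<gamma>' (\<sigma> i) (\<phi> i (\<psi> k t)) = \<gamma>' k t" .
    have "\<phi> i (\<psi> k t) \<in> ball 0 \<delta>'" using Ai d(3) t unfolding A_def by blast
    moreover have "t \<in> ball 0 \<delta>'" using t1 Bk unfolding B_def by auto
    ultimately have "\<sigma> i = k" using C' eq sk k t(2) unfolding chart_def by (meson ball_subset_cball subsetD)
    then show ?thesis by (simp add: i_def)
  qed
  have bij: "bij_betw \<sigma> {1..r} {1..s}"
    by (rule bij_betwI[of _ _ _ \<tau>]) (use \<sigma> \<tau> main1 main2 in auto)
  have "\<forall>i\<in>{1..r}. \<exists>d. 0 < d \<and> d \<le> d1 i \<and> (\<forall>t\<in>ball 0 d. \<phi> i t \<in> ball 0 (d2 (\<sigma> i)) \<and> \<psi> (\<sigma> i) (\<phi> i t) = t)"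
    using main1 by blast
  then obtain d where d: "\<forall>i\<in>{1..r}. 0 < d i \<and> d i \<le> d1 i \<and>
      (\<forall>t\<in>ball 0 (d i). \<phi> i t \<in> ball 0 (d2 (\<sigma> i)) \<and> \<psi> (\<sigma> i) (\<phi> i t) = t)" by metis
  have "0 < d i \<and> 0 < d2 (\<sigma> i) \<and> d i \<le> \<delta> \<and> d2 (\<sigma> i) \<le> \<delta>' \<and>
    continuous_on (ball 0 (d i)) (\<phi> i) \<and> \<phi> i 0 = 0 \<and> continuous_on (ball 0 (d2 (\<sigma> i))) (\<psi> (\<sigma> i)) \<and>
    (\<forall>t\<in>ball 0 (d i). \<phi> i t \<in> ball 0 (d2 (\<sigma> i)) \<and> \<psi> (\<sigma> i) (\<phi> i t) = t \<and> (t \<noteq> 0 \<longrightarrow> \<phi> i t \<noteq> 0) \<and>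
       \<gamma> i t \<in> C \<inter> U \<and> f (\<gamma> i t) = \<gamma>' (\<sigma> i) (\<phi> i t)) \<and>
    (\<forall>t\<in>ball 0 (d2 (\<sigma> i)). t \<noteq> 0 \<longrightarrow> \<psi> (\<sigma> i) t \<noteq> 0)" if i: "i \<in> {1..r}" for i
  proof -
    have Ai: "A i (\<sigma> i) (d1 i) (\<phi> i)" and Bk: "B (\<sigma> i) (\<tau> (\<sigma> i)) (d2 (\<sigma> i)) (\<psi> (\<sigma> i))"
      using A B i \<sigma> by auto
    have di: "0 < d i" "d i \<le> d1 i" and dt: "\<And>t. t \<in> ball 0 (d i) \<Longrightarrow> \<phi> i t \<in> ball 0 (d2 (\<sigma> i)) \<and> \<psi> (\<sigma> i) (\<phi> i t) = t"
      using d i by blast+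
    have sub: "ball 0 (d i) \<subseteq> ball (0::complex) (d1 i)" using di by auto
    have 1: "d i \<le> \<delta>" using Ai di unfolding A_def by linarith
    have 2: "0 < d2 (\<sigma> i)" "d2 (\<sigma> i) \<le> \<delta>'" "continuous_on (ball 0 (d2 (\<sigma> i))) (\<psi> (\<sigma> i))"
      "\<forall>t\<in>ball 0 (d2 (\<sigma> i)). t \<noteq> 0 \<longrightarrow> \<psi> (\<sigma> i) t \<noteq> 0" using Bk unfolding B_def by blast+
    have 3: "continuous_on (ball 0 (d i)) (\<phi> i)" "\<phi> i 0 = 0" using Ai sub continuous_on_subset unfolding A_def by blast+
    have 4: "\<forall>t\<in>ball 0 (d i). \<phi> i t \<in> ball 0 (d2 (\<sigma> i)) \<and> \<psi> (\<sigma> i) (\<phi> i t) = t \<and> (t \<noteq> 0 \<longrightarrow> \<phi> i t \<noteq> 0) \<and>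
       \<gamma> i t \<in> C \<inter> U \<and> f (\<gamma> i t) = \<gamma>' (\<sigma> i) (\<phi> i t)"
    proof
      fix t :: complex assume t: "t \<in> ball 0 (d i)"
      then have "t \<in> ball 0 (d1 i)" using sub by blast
      then show "\<phi> i t \<in> ball 0 (d2 (\<sigma> i)) \<and> \<psi> (\<sigma> i) (\<phi> i t) = t \<and> (t \<noteq> 0 \<longrightarrow> \<phi> i t \<noteq> 0) \<and>
       \<gamma> i t \<in> C \<inter> U \<and> f (\<gamma> i t) = \<gamma>' (\<sigma> i) (\<phi> i t)"
        using Ai dt[OF t] unfolding A_def by blast
    qed
    show ?thesis using di(1) 1 2 3 4 by blast
  qed
  then show ?thesis using bij
    by - (rule exI[of _ \<sigma>], rule exI[of _ \<phi>], rule exI[of _ "\<lambda>i. \<psi> (\<sigma> i)"], rule exI[of _ d],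
      rule exI[of _ "\<lambda>i. d2 (\<sigma> i)"], blast)
qed

section \<open>Hoelder invariants\<close>

lemma exp_minus_1_bound:
  fixes q :: complex
  assumes "norm q \<le> 1"
  shows "norm (exp q - 1) \<le> 3 * norm q"
proof -
  have "norm (exp q - exp 0) \<le> 3 * norm (q - 0)"
  proof (rule field_differentiable_bound[of "cball 0 1" exp exp])
    fix z :: complex assume z: "z \<in> cball 0 1"
    show "(exp has_field_derivative exp z) (at z within cball 0 1)"
      by (auto intro!: derivative_eq_intros)
    have "exp (Re z) \<le> exp 1" using z complex_Re_le_cmod[of z] by (simp add: order_trans)
    also have "\<dots> \<le> (3::real)" by (rule exp_le)
    finally show "norm (exp z) \<le> 3" by simp
  qed (use assms in auto)
  then show ?thesis by simp
qed

text \<open>The root is \<open>v * exp (Ln (1 + w) / n)\<close>, with \<open>w\<close> the relative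
  error of \<open>x\<close>. The constant 6 is the product of the factor 2 in the bound for
  \<open>Ln (1 + w)\<close> and the factor 3 in that for \<open>exp q - 1\<close>.\<close>

lemma nearest_root:
  fixes v x :: complex
  assumes n: "0 < n" and v: "v \<noteq> 0" and x: "3 * norm (x - v ^ n) \<le> norm v ^ n"
  obtains v' where "v' ^ n = x" "norm (v' - v) * norm v ^ (n - 1) \<le> 6 * norm (x - v ^ n)"
proof -
  define w where "w = (x - v ^ n) / v ^ n"
  have vn: "norm v ^ n > 0" using v by simp
  have w: "norm w \<le> 1/3" using x vn by (simp add: w_def norm_divide norm_power divide_le_eq)
  have L: "norm (Ln (1 + w)) \<le> 2 * norm w" by (rule norm_Ln_le) (use w in simp)
  define q where "q = Ln (1 + w) / of_nat n"
  have "norm q \<le> norm (Ln (1 + w))" using n by (simp add: q_def norm_divide divide_le_eq mult_le_cancel_left1)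
  then have q: "norm q \<le> 2 * norm w" using L by linarith
  have w1: "1 + w \<noteq> 0"
  proof
    assume "1 + w = 0"
    then have "w = -1" by (simp add: add_eq_0_iff)
    then show False using w by simp
  qed
  have "exp q ^ n = exp (of_nat n * q)" by (simp add: exp_of_nat_mult)
  also have "of_nat n * q = Ln (1 + w)" using n by (simp add: q_def)
  finally have eq: "exp q ^ n = 1 + w" using w1 by simp
  have "(v * exp q) ^ n = v ^ n * (1 + w)" by (simp add: power_mult_distrib eq)
  also have "\<dots> = x" using v by (simp add: w_def field_simps)
  finally have 1: "(v * exp q) ^ n = x" .
  have "norm (exp q - 1) \<le> 3 * norm q" by (rule exp_minus_1_bound) (use q w in linarith)
  then have e: "norm (exp q - 1) \<le> 6 * norm w" using q by linarith
  have "v * exp q - v = v * (exp q - 1)" by (simp add: algebra_simps)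
  then have "norm (v * exp q - v) * norm v ^ (n - 1) = norm v ^ n * norm (exp q - 1)"
    using n by (cases n) (auto simp: norm_mult)
  also have "\<dots> \<le> norm v ^ n * (6 * norm w)" using e by (intro mult_left_mono) auto
  also have "\<dots> = 6 * norm (x - v ^ n)" using v by (simp add: w_def norm_divide norm_power)
  finally show ?thesis using that 1 by blast
qed

lemma puiseux_deriv_bound:
  assumes D: "puiseux c n y Y D"
  obtains K d where "0 < K" "0 < d"
    "\<And>t. norm t < d \<Longrightarrow> (y has_field_derivative deriv y t) (at t) \<and> norm (deriv y t) \<le> K * norm t ^ (n - 1) \<and> norm (y t) \<le> K * norm t ^ n"
proof -
  have Y: "y has_fps_expansion Y" and low: "\<forall>k<n. fps_nth Y k = 0" using D by (auto simp: puiseux_def)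
  obtain K1 where K1: "0 < K1" "\<forall>\<^sub>F t in nhds 0. norm (y t) \<le> K1 * norm t ^ n"
    by (rule bound_le_order[OF Y low])
  have "\<forall>k<n - 1. fps_nth (fps_deriv Y) k = 0" using low by auto
  from bound_le_order[OF has_fps_expansion_deriv[OF Y] this]
  obtain K2 where K2: "0 < K2" "\<forall>\<^sub>F t in nhds 0. norm (deriv y t) \<le> K2 * norm t ^ (n - 1)" by blast
  have "\<forall>\<^sub>F t in nhds 0. y field_differentiable at t"
    using puiseux_analytic(1)[OF D] by (simp add: analytic_at_iff_eventually)
  with K1(2) K2(2) have "\<forall>\<^sub>F t in nhds 0. (y has_field_derivative deriv y t) (at t) \<and>
      norm (deriv y t) \<le> (K1 + K2) * norm t ^ (n - 1) \<and> norm (y t) \<le> (K1 + K2) * norm t ^ n"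
  proof eventually_elim
    case (elim t)
    have "K2 * norm t ^ (n - 1) \<le> (K1 + K2) * norm t ^ (n - 1)" "K1 * norm t ^ n \<le> (K1 + K2) * norm t ^ n"
      using K1 K2 by (intro mult_right_mono; simp)+
    then show ?case using elim by (auto simp: field_differentiable_derivI)
  qed
  then obtain d where "d > 0" "\<And>t. norm t < d \<Longrightarrow> (y has_field_derivative deriv y t) (at t) \<and>
      norm (deriv y t) \<le> (K1 + K2) * norm t ^ (n - 1) \<and> norm (y t) \<le> (K1 + K2) * norm t ^ n"
    unfolding eventually_nhds_metric by auto
  then show ?thesis using that[of "K1 + K2" d] K1 K2 by auto
qed

text \<open>Off the origin \<open>y\<close> is locally a Lipschitz function of
  \<open>x = t ^ n\<close>, with a uniform constant: \<open>deriv y t\<close> is bounded by a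
  multiple of \<open>norm t ^ (n - 1)\<close>, the size of the derivative of \<open>t ^ n\<close>.
  This is where order at least \<open>n\<close> of \<open>y\<close> enters. The tolerance 1/6 keeps
  the nearby root within \<open>2 * norm v\<close>.\<close>

lemma puiseux_near:
  assumes D: "puiseux c n y Y D"
  shows "\<exists>C>0. \<exists>\<kappa>>0. \<exists>d>0. \<forall>v x. v \<noteq> 0 \<and> norm v < d \<and> norm (x - v ^ n) \<le> \<kappa> * norm v ^ n \<longrightarrow>
    (\<exists>v'. v' ^ n = x \<and> norm (v' - v) * norm v ^ (n - 1) \<le> C * norm (x - v ^ n) \<and>
          norm (y v' - y v) \<le> C * norm (x - v ^ n))"
proof -
  have n: "0 < n" using D by (simp add: puiseux_def)
  obtain K d where K: "0 < K" "0 < d"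
    and Kd: "\<And>t. norm t < d \<Longrightarrow> (y has_field_derivative deriv y t) (at t) \<and> norm (deriv y t) \<le> K * norm t ^ (n - 1) \<and> norm (y t) \<le> K * norm t ^ n"
    using puiseux_deriv_bound[OF D] by metis
  define C where "C = 6 + 6 * K * 2 ^ (n - 1)"
  have C: "6 \<le> C" "C > 0" using K by (auto simp: C_def add_pos_pos)
  have main: "\<exists>v'. v' ^ n = x \<and> norm (v' - v) * norm v ^ (n - 1) \<le> C * norm (x - v ^ n) \<and>
          norm (y v' - y v) \<le> C * norm (x - v ^ n)"
    if v: "v \<noteq> 0" "norm v < d/3" and x: "norm (x - v ^ n) \<le> 1/6 * norm v ^ n" for v x
  proof -
    have "3 * norm (x - v ^ n) \<le> norm v ^ n" using x zero_le_power[OF norm_ge_zero, of v n] by linarith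
    then obtain v' where v': "v' ^ n = x" "norm (v' - v) * norm v ^ (n - 1) \<le> 6 * norm (x - v ^ n)"
      by (rule nearest_root[OF n v(1)])
    have "norm (v' - v) * norm v ^ (n - 1) \<le> norm v * norm v ^ (n - 1)"
      using v'(2) x n by (cases n) auto
    then have "norm (v' - v) \<le> norm v" using v(1) by simp
    then have nv': "norm v' \<le> 2 * norm v" using norm_triangle_sub[of v' v] by simp
    have "norm (y v' - y v) \<le> (K * (2 * norm v) ^ (n - 1)) * norm (v' - v)"
    proof (rule field_differentiable_bound[of "cball 0 (2 * norm v)" y "deriv y"])
      fix z :: complex assume "z \<in> cball 0 (2 * norm v)"
      then have z: "norm z \<le> 2 * norm v" by simp
      then have zd: "norm z < d" using v norm_ge_zero[of v] by linarith
      show "(y has_field_derivative deriv y z) (at z within cball 0 (2 * norm v))"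
        using Kd[OF zd] by (simp add: has_field_derivative_at_within)
      have "K * norm z ^ (n - 1) \<le> K * (2 * norm v) ^ (n - 1)" using z K by (intro mult_left_mono power_mono) auto
      then show "norm (deriv y z) \<le> K * (2 * norm v) ^ (n - 1)" using Kd[OF zd] by linarith
    qed (use nv' in auto)
    also have "\<dots> = K * 2 ^ (n - 1) * (norm (v' - v) * norm v ^ (n - 1))" by (simp add: power_mult_distrib)
    also have "\<dots> \<le> K * 2 ^ (n - 1) * (6 * norm (x - v ^ n))" using v'(2) K by (intro mult_left_mono) auto
    also have "\<dots> \<le> C * norm (x - v ^ n)"
      using mult_right_mono[of "6 * K * 2 ^ (n - 1)" C "norm (x - v ^ n)"] by (simp add: C_def algebra_simps)
    finally have 1: "norm (y v' - y v) \<le> C * norm (x - v ^ n)" .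
    have "6 * norm (x - v ^ n) \<le> C * norm (x - v ^ n)" using C by (intro mult_right_mono) auto
    then show ?thesis using v' 1 by (intro exI[of _ v']) auto
  qed
  have "0 < (1/6 :: real)" "0 < d/3" using K by auto
  then show ?thesis using main C(2) by blast
qed

definition puiseux_curve :: "complex \<Rightarrow> nat \<Rightarrow> (complex \<Rightarrow> complex) \<Rightarrow> complex \<Rightarrow> complex \<times> complex" where
  "puiseux_curve c n y t = (t ^ n + c * y t, y t)"

lemma puiseux_curve_dist_fst: "norm (t ^ n - u ^ m) \<le> (1 + norm c) * norm (puiseux_curve c n y t - puiseux_curve c m z u)"
  and puiseux_curve_dist_snd: "norm (y t - z u) \<le> norm (puiseux_curve c n y t - puiseux_curve c m z u)"
  and puiseux_curve_dist_le: "norm (puiseux_curve c n y t - puiseux_curve c m z u) \<le> norm (t ^ n - u ^ m) + (1 + norm c) * norm (y t - z u)"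
proof -
  define p where "p = puiseux_curve c n y t - puiseux_curve c m z u"
  have p: "fst p = t ^ n - u ^ m + c * (y t - z u)" "snd p = y t - z u"
    by (auto simp: p_def puiseux_curve_def algebra_simps)
  have f: "norm (fst p) \<le> norm p" "norm (snd p) \<le> norm p" by (metis norm_fst_le norm_snd_le prod.collapse)+
  show 2: "norm (y t - z u) \<le> norm (puiseux_curve c n y t - puiseux_curve c m z u)" using f(2) by (simp add: p p_def[symmetric])
  have "t ^ n - u ^ m = fst p - c * snd p" by (simp add: p)
  then have "norm (t ^ n - u ^ m) \<le> norm (fst p) + norm c * norm (snd p)"
    using norm_triangle_ineq4[of "fst p" "c * snd p"] by (simp add: norm_mult)
  also have "\<dots> \<le> norm p + norm c * norm p" using f by (intro add_mono mult_left_mono) auto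
  finally show "norm (t ^ n - u ^ m) \<le> (1 + norm c) * norm (puiseux_curve c n y t - puiseux_curve c m z u)"
    by (simp add: p_def[symmetric] algebra_simps)
  have "norm p \<le> norm (fst p) + norm (snd p)" using norm_Pair_le[of "fst p" "snd p"] by simp
  also have "norm (fst p) \<le> norm (t ^ n - u ^ m) + norm c * norm (y t - z u)"
    unfolding p using norm_triangle_ineq[of "t ^ n - u ^ m" "c * (y t - z u)"] by (simp add: norm_mult)
  finally show "norm (puiseux_curve c n y t - puiseux_curve c m z u) \<le> norm (t ^ n - u ^ m) + (1 + norm c) * norm (y t - z u)"
    unfolding p_def[symmetric] p by (simp add: algebra_simps)
qed

text \<open>Makes \<open>norm t ^ n\<close> interchangeable with the distance from 0 in the plane,
  so that Hoelder bounds at 0 become bounds between parameters.\<close>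

lemma puiseux_curve_norm:
  assumes D: "puiseux c n y Y D"
  shows "\<exists>a>0. \<exists>A>0. \<exists>d>0. \<forall>t. norm t < d \<longrightarrow> a * norm t ^ n \<le> norm (puiseux_curve c n y t) \<and> norm (puiseux_curve c n y t) \<le> A * norm t ^ n"
proof -
  have n: "0 < n" using D by (simp add: puiseux_def)
  note y0 = puiseux_analytic(2)[OF D]
  have pc0: "puiseux_curve c n y 0 = 0" using n y0 by (simp add: puiseux_curve_def zero_prod_def power_0_left)
  obtain K d where K: "0 < K" "0 < d"
    and Kd: "\<And>t. norm t < d \<Longrightarrow> (y has_field_derivative deriv y t) (at t) \<and> norm (deriv y t) \<le> K * norm t ^ (n - 1) \<and> norm (y t) \<le> K * norm t ^ n"
    using puiseux_deriv_bound[OF D] by metis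
  have c1: "0 < 1 + norm c" using norm_ge_zero[of c] by linarith
  have "1 / (1 + norm c) * norm t ^ n \<le> norm (puiseux_curve c n y t) \<and> norm (puiseux_curve c n y t) \<le> (1 + (1 + norm c) * K) * norm t ^ n"
    if t: "norm t < d" for t
  proof
    have "norm t ^ n \<le> (1 + norm c) * norm (puiseux_curve c n y t)"
      using puiseux_curve_dist_fst[of t n 0 n c y y] n by (simp add: pc0 norm_power power_0_left)
    then show "1 / (1 + norm c) * norm t ^ n \<le> norm (puiseux_curve c n y t)" using c1 by (simp add: field_simps)
    have "norm (puiseux_curve c n y t) \<le> norm t ^ n + (1 + norm c) * norm (y t)"
      using puiseux_curve_dist_le[of c n y t n y 0] n y0 by (simp add: pc0 norm_power power_0_left)
    also have "\<dots> \<le> norm t ^ n + (1 + norm c) * (K * norm t ^ n)" using Kd[OF t] c1 by (intro add_mono mult_left_mono) auto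
    finally show "norm (puiseux_curve c n y t) \<le> (1 + (1 + norm c) * K) * norm t ^ n" by (simp add: algebra_simps)
  qed
  moreover have "0 < 1 / (1 + norm c)" "0 < 1 + (1 + norm c) * K" using c1 K by (auto intro: add_pos_pos)
  ultimately show ?thesis using K(2) by blast
qed

text \<open>Close points may lie on different sheets and then have distant parameters. Replacing
  \<open>s'\<close> by a conjugate \<open>rt n ^ j * s'\<close> brings the parameters together; the
  second bound records that this conjugation hardly changes \<open>y\<close>, which later bounds a
  conjugate order.\<close>

lemma puiseux_curve_near:
  assumes D: "puiseux c n y Y D"
  shows "\<exists>C>0. \<exists>\<kappa>>0. \<exists>d>0. \<forall>s s'. s \<noteq> 0 \<and> norm s < d \<and> norm (puiseux_curve c n y s' - puiseux_curve c n y s) \<le> \<kappa> * norm s ^ n \<longrightarrow>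
    (\<exists>j<n. norm (rt n ^ j * s' - s) * norm s ^ (n - 1) \<le> C * norm (puiseux_curve c n y s' - puiseux_curve c n y s) \<and>
          norm (y (rt n ^ j * s') - y s') \<le> C * norm (puiseux_curve c n y s' - puiseux_curve c n y s))"
proof -
  have n: "0 < n" using D by (simp add: puiseux_def)
  obtain C \<kappa> d where C: "C > 0" "\<kappa> > 0" "d > 0"
    and near: "\<forall>v x. v \<noteq> 0 \<and> norm v < d \<and> norm (x - v ^ n) \<le> \<kappa> * norm v ^ n \<longrightarrow>
    (\<exists>v'. v' ^ n = x \<and> norm (v' - v) * norm v ^ (n - 1) \<le> C * norm (x - v ^ n) \<and>
          norm (y v' - y v) \<le> C * norm (x - v ^ n))"
    using puiseux_near[OF D] by blast
  define c1 where "c1 = 1 + norm c"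
  have c1: "0 < c1" using norm_ge_zero[of c] unfolding c1_def by linarith
  define C' where "C' = C * c1 + 1"
  have C': "C' > 0" "C * c1 \<le> C'" using C c1 by (auto simp: C'_def add_pos_pos)
  have "\<exists>j<n. norm (rt n ^ j * s' - s) * norm s ^ (n - 1) \<le> C' * norm (puiseux_curve c n y s' - puiseux_curve c n y s) \<and>
          norm (y (rt n ^ j * s') - y s') \<le> C' * norm (puiseux_curve c n y s' - puiseux_curve c n y s)"
    if s: "s \<noteq> 0" "norm s < d" and X: "norm (puiseux_curve c n y s' - puiseux_curve c n y s) \<le> \<kappa> / c1 * norm s ^ n" for s s'
  proof -
    define X where "X = norm (puiseux_curve c n y s' - puiseux_curve c n y s)"
    have x: "norm (s' ^ n - s ^ n) \<le> c1 * X" unfolding X_def c1_def by (rule puiseux_curve_dist_fst)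
    have "c1 * X \<le> \<kappa> * norm s ^ n" using X c1 by (simp add: X_def field_simps)
    then have "norm (s' ^ n - s ^ n) \<le> \<kappa> * norm s ^ n" using x by linarith
    then obtain v' where v': "v' ^ n = s' ^ n" "norm (v' - s) * norm s ^ (n - 1) \<le> C * norm (s' ^ n - s ^ n)"
      "norm (y v' - y s) \<le> C * norm (s' ^ n - s ^ n)" using near s by blast
    obtain j where j: "j < n" "v' = rt n ^ j * s'" using power_eq_rt[OF n v'(1)] by blast
    have CX: "C * norm (s' ^ n - s ^ n) \<le> C * c1 * X" using x C by simp
    have X0: "0 \<le> X" by (simp add: X_def)
    have 1: "norm (v' - s) * norm s ^ (n - 1) \<le> C' * X"
      using v'(2) CX mult_right_mono[OF C'(2) X0] by linarith
    have "norm (y v' - y s') \<le> norm (y v' - y s) + norm (y s' - y s)"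
      using norm_triangle_ineq4[of "y v' - y s" "y s' - y s"] by simp
    also have "norm (y s' - y s) \<le> X" unfolding X_def by (rule puiseux_curve_dist_snd)
    finally have 2: "norm (y v' - y s') \<le> C' * X" using v'(3) CX by (simp add: C'_def algebra_simps)
    show ?thesis using 1 2 j unfolding X_def by blast
  qed
  moreover have "0 < \<kappa> / c1" using C c1 by simp
  ultimately show ?thesis using C(3) C'(1) by blast
qed

section \<open>Radii and rotations under a Hoelder map\<close>

lemma powr_compare_filter:
  fixes c C a b :: real
  assumes F: "F \<noteq> bot" and g: "filterlim g (at_right 0) F"
    and c: "0 < c" and ev: "\<forall>\<^sub>F x in F. c * g x powr a \<le> C * g x powr b"
  shows "b \<le> a"
proof (rule ccontr)
  assume "\<not> b \<le> a"
  then have ba: "0 < b - a" by simp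
  have pos: "\<forall>\<^sub>F s in at_right (0::real). 0 < s" by (rule eventually_at_right_less)
  then have "\<forall>\<^sub>F s in at_right (0::real). 0 \<le> s" by eventually_elim simp
  then have "((\<lambda>s::real. s powr (b - a)) \<longlongrightarrow> 0) (at_right 0)"
    by (rule tendsto_zero_powrI[OF tendsto_ident_at tendsto_const _ ba])
  from filterlim_compose[OF this g] have "((\<lambda>x. C * g x powr (b - a)) \<longlongrightarrow> C * 0) F" by (intro tendsto_intros)
  moreover have "\<forall>\<^sub>F x in F. c \<le> C * g x powr (b - a)"
    using ev eventually_compose_filterlim[OF pos g]
  proof eventually_elim
    case (elim x)
    have "g x powr b = g x powr (b - a) * g x powr a" by (simp flip: powr_add)
    then have "c * g x powr a \<le> (C * g x powr (b - a)) * g x powr a" using elim(1) by (simp only: mult.assoc)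
    moreover have "0 < g x powr a" using elim by simp
    ultimately show ?case by (rule mult_right_le_imp_le)
  qed
  ultimately have "c \<le> C * 0" using F by (intro tendsto_lowerbound)
  then show False using c by simp
qed

lemma filterlim_norm_at_right:
  fixes \<phi> :: "'a \<Rightarrow> complex"
  assumes "(\<phi> \<longlongrightarrow> 0) F" "\<forall>\<^sub>F t in F. \<phi> t \<noteq> 0"
  shows "filterlim (\<lambda>t. norm (\<phi> t)) (at_right 0) F"
proof -
  have "((\<lambda>t. norm (\<phi> t)) \<longlongrightarrow> 0) F" using assms(1) by (rule tendsto_norm_zero)
  moreover have "\<forall>\<^sub>F t in F. norm (\<phi> t) \<in> {0<..}" using assms(2) by eventually_elim simp
  ultimately show ?thesis by (simp add: filterlim_at eventually_conj_iff)
qed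

text \<open>On the two curves \<open>norm t ^ n\<close> and \<open>norm (\<phi> t) ^ m\<close> are
  comparable to the distance from 0, so a Hoelder bound at 0 gives the exponent
  \<open>m * \<alpha> / n\<close>.\<close>

lemma radius_bound:
  fixes \<alpha> k :: real
  assumes D: "puiseux c n y Y D" and D': "puiseux c' m y' Y' D'"
    and F: "F \<le> at 0"
    and \<phi>: "(\<phi> \<longlongrightarrow> 0) F"
    and \<alpha>: "0 < \<alpha>" "0 < k"
    and h: "\<forall>\<^sub>F t in F. norm (puiseux_curve c n y t) \<le> k * norm (puiseux_curve c' m y' (\<phi> t)) powr \<alpha>"
  shows "\<exists>C>0. \<forall>\<^sub>F t in F. norm t \<le> C * norm (\<phi> t) powr (m * \<alpha> / n)"
proof -
  have n: "0 < n" using D by (simp add: puiseux_def)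
  obtain a d where a: "a > 0" "d > 0" "\<And>t. norm t < d \<Longrightarrow> a * norm t ^ n \<le> norm (puiseux_curve c n y t)"
    using puiseux_curve_norm[OF D] by metis
  obtain A d' where A: "A > 0" "d' > 0" "\<And>t. norm t < d' \<Longrightarrow> norm (puiseux_curve c' m y' t) \<le> A * norm t ^ m"
    using puiseux_curve_norm[OF D'] by metis
  have e1: "\<forall>\<^sub>F t in F. norm t < d"
    using a(2) by (intro filter_leD[OF F]) (auto simp: eventually_at intro!: exI[of _ d])
  have e2: "\<forall>\<^sub>F t in F. norm (\<phi> t) < d'" using tendstoD[OF \<phi> A(2)] by simp
  define E where "E = k * A powr \<alpha> / a"
  have E: "E > 0" using a A \<alpha> by (simp add: E_def)
  have "\<forall>\<^sub>F t in F. norm t \<le> E powr (1/n) * norm (\<phi> t) powr (m * \<alpha> / n)"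
    using e1 e2 h
  proof eventually_elim
    case (elim t)
    have "a * norm t ^ n \<le> k * norm (puiseux_curve c' m y' (\<phi> t)) powr \<alpha>" using a(3)[OF elim(1)] elim(3) by linarith
    also have "\<dots> \<le> k * (A * norm (\<phi> t) ^ m) powr \<alpha>"
      using A(3)[OF elim(2)] \<alpha> by (intro mult_left_mono powr_mono2) auto
    also have "(A * norm (\<phi> t) ^ m) powr \<alpha> = A powr \<alpha> * norm (\<phi> t) powr (m * \<alpha>)"
    proof (cases "m = 0")
      case True
      then show ?thesis using D' by (simp add: puiseux_def)
    next
      case False
      then have "norm (\<phi> t) ^ m = norm (\<phi> t) powr m" by (simp add: powr_realpow')
      then show ?thesis using A by (simp add: powr_mult powr_powr)
    qed
    finally have "norm t ^ n \<le> E * norm (\<phi> t) powr (m * \<alpha>)"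
      using a(1) by (simp add: E_def field_simps)
    then have "(norm t ^ n) powr (1/n) \<le> (E * norm (\<phi> t) powr (m * \<alpha>)) powr (1/n)"
      by (intro powr_mono2) auto
    moreover have "(norm t ^ n) powr (1/n) = norm t"
    proof -
      have "norm t ^ n = norm t powr n" using n by (simp add: powr_realpow')
      then show ?thesis using n by (simp add: powr_powr)
    qed
    ultimately show ?case using E by (simp add: powr_mult powr_powr)
  qed
  then show ?thesis using E by (intro exI[of _ "E powr (1/n)"]) auto
qed

text \<open>The \<open>m\<close>-th roots of unity are finitely many, so convergence to one of them
  is eventually equality.\<close>

lemma root_unity_tendsto:
  assumes j: "\<forall>\<^sub>F t in F. j t < m" and l: "l < m" and lim: "((\<lambda>t. rt m ^ j t) \<longlongrightarrow> rt m ^ l) F"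
  shows "\<forall>\<^sub>F t in F. j t = l"
proof -
  define S where "S = (\<lambda>i. rt m ^ i) ` ({..<m} - {l})"
  have "open (- S)" by (simp add: S_def finite_imp_closed open_Compl)
  moreover have "rt m ^ l \<in> - S" using rt_inj[OF _ l] by (auto simp: S_def)
  ultimately have "\<forall>\<^sub>F t in F. rt m ^ j t \<in> - S" using lim topological_tendstoD by blast
  with j show ?thesis by eventually_elim (auto simp: S_def)
qed

lemma rotation_tendsto:
  fixes z :: complex
  assumes "norm z = 1" "(\<phi> \<longlongrightarrow> L) (at 0)"
  shows "((\<lambda>t. \<phi> (z * t)) \<longlongrightarrow> L) (at (0 :: complex))"
proof -
  have "filterlim (\<lambda>t. z * t) (at 0) (at 0)"
    unfolding filterlim_at using assms(1)
    by (auto intro!: tendsto_eq_intros simp: eventually_at_filter)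
  from filterlim_compose[OF assms(2) this] show ?thesis .
qed

text \<open>With \<open>z = rt n ^ k\<close>, the points with parameters \<open>z * t\<close> and
  \<open>t\<close> have the same sheared \<open>x\<close>, so their distance is governed by the
  conjugate order. Expressed through \<open>norm (\<phi> t)\<close> and pushed through the map, it
  is at most a multiple of \<open>norm (\<phi> t) powr \<mu>\<close>. The hypothesis
  \<open>big\<close> means \<open>m < \<mu>\<close>, so some conjugate of
  \<open>\<phi> (z * t)\<close> is asymptotic to \<open>\<phi> t\<close>.
  \<open>rotation_limit\<close> identifies this conjugate, and its distance bounds the conjugate
  order of the target from below.\<close>

theorem rotation_transfer:
  fixes \<alpha> k1 k2 :: real
  assumes D: "puiseux c n y Y D" and D': "puiseux c' m y' Y' D'"
    and d: "0 < \<delta>" "0 < \<delta>'"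
    and \<phi>: "continuous_on (ball 0 \<delta>) \<phi>" "\<And>t. t \<in> ball 0 \<delta> \<Longrightarrow> \<phi> t \<in> ball 0 \<delta>'"
      "\<And>t. t \<in> ball 0 \<delta> \<Longrightarrow> t \<noteq> 0 \<Longrightarrow> \<phi> t \<noteq> (0 :: complex)" "\<phi> 0 = 0"
    and \<psi>: "continuous_on (ball 0 \<delta>') \<psi>" "\<And>t. t \<in> ball 0 \<delta>' \<Longrightarrow> t \<noteq> 0 \<Longrightarrow> \<psi> t \<noteq> (0 :: complex)"
    and inv: "\<And>t. t \<in> ball 0 \<delta> \<Longrightarrow> \<psi> (\<phi> t) = t"
    and \<alpha>: "0 < \<alpha>" "0 < k1" "0 < k2"
    and h1: "\<And>t u. t \<in> ball 0 \<delta> \<Longrightarrow> u \<in> ball 0 \<delta> \<Longrightarrow>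
      norm (puiseux_curve c' m y' (\<phi> t) - puiseux_curve c' m y' (\<phi> u)) \<le> k1 * norm (puiseux_curve c n y t - puiseux_curve c n y u) powr \<alpha>"
    and h2: "\<And>t. t \<in> ball 0 \<delta> \<Longrightarrow> norm (puiseux_curve c n y t) \<le> k2 * norm (puiseux_curve c' m y' (\<phi> t)) powr \<alpha>"
    and k: "0 < k" "k < n" and big: "n < \<alpha>\<^sup>2 * conjugate_order n Y k"
  shows "\<exists>l. 0 < l \<and> l < m \<and> (rt m ^ l = rt n ^ k \<or> rt m ^ l = inverse (rt n ^ k)) \<and>
    m * conjugate_order n Y k * \<alpha>\<^sup>2 \<le> n * conjugate_order m Y' l"
proof -
  have n: "0 < n" and m: "0 < m" and Y: "y has_fps_expansion Y" "primitive_series n Y" and Y': "y' has_fps_expansion Y'" "primitive_series m Y'"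
    using D D' by (auto simp: puiseux_def)
  define z where "z = rt n ^ k"
  have nz: "norm z = 1" by (simp add: z_def norm_power)
  define o' where "o' = conjugate_order n Y k"
  \<comment> \<open>One factor \<alpha> comes from \<open>radius_bound\<close>, together with
    \<open>m / n\<close>, and the other from the Hoelder bound \<open>h1\<close>.\<close>
  define \<mu> where "\<mu> = m * real o' * \<alpha>\<^sup>2 / n"
  have "real m * real n < real m * (\<alpha>\<^sup>2 * real o')" using big m by (simp add: o'_def)
  then have \<mu>m: "m < \<mu>" using n by (simp add: \<mu>_def field_simps)
  have inball: "\<forall>\<^sub>F t in at 0. t \<in> ball 0 \<delta> \<and> z * t \<in> ball 0 \<delta> \<and> t \<noteq> (0::complex)"
    unfolding eventually_at using d by (intro exI[of _ \<delta>]) (auto simp: norm_mult nz)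
  have "isCont \<phi> 0" using \<phi>(1) d by (simp add: continuous_on_eq_continuous_at)
  then have lim: "(\<phi> \<longlongrightarrow> 0) (at 0)" using \<phi>(4) by (simp add: isCont_def)
  have limz: "((\<lambda>t. \<phi> (z * t)) \<longlongrightarrow> 0) (at 0)" by (rule rotation_tendsto[OF nz lim])
  have h2e: "\<forall>\<^sub>F t in at 0. norm (puiseux_curve c n y t) \<le> k2 * norm (puiseux_curve c' m y' (\<phi> t)) powr \<alpha>"
    using inball by eventually_elim (use h2 in auto)
  obtain C2 where C2: "C2 > 0" "\<forall>\<^sub>F t in at 0. norm t \<le> C2 * norm (\<phi> t) powr (m * \<alpha> / n)"
    using radius_bound[OF D D' order_refl lim \<alpha>(1) \<alpha>(3) h2e] by blast
  obtain C1 where C1: "C1 > 0" "\<forall>\<^sub>F t in nhds 0. norm (y (z * t) - y t) \<le> C1 * norm t ^ o'"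
    using rot_growth[OF Y k] unfolding growth_def z_def o'_def eventually_conj_iff by blast
  have C1e: "\<forall>\<^sub>F t in at 0. norm (y (z * t) - y t) \<le> C1 * norm t ^ o'"
    using C1(2) by (simp add: eventually_at_filter eventually_mono)
  define C3 where "C3 = k1 * ((1 + norm c) * C1 * C2 ^ o') powr \<alpha>"
  have c1: "0 < 1 + norm c" using norm_ge_zero[of c] by linarith
  have C3: "0 < C3" using \<alpha> c1 C1 C2 by (simp add: C3_def)
  have X: "\<forall>\<^sub>F t in at 0. norm (puiseux_curve c' m y' (\<phi> (z * t)) - puiseux_curve c' m y' (\<phi> t)) \<le> C3 * norm (\<phi> t) powr \<mu>"
    using inball C2(2) C1e
  proof eventually_elim
    case (elim t)
    have s: "norm (\<phi> t) > 0" using \<phi>(3) elim(1) by simp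
    have zt: "(z * t) ^ n = t ^ n" unfolding z_def by (rule rt_power_mult_power)
    have "norm (puiseux_curve c n y (z * t) - puiseux_curve c n y t) \<le> norm ((z * t) ^ n - t ^ n) + (1 + norm c) * norm (y (z * t) - y t)"
      by (rule puiseux_curve_dist_le)
    also have "\<dots> \<le> (1 + norm c) * (C1 * norm t ^ o')" using elim(3) c1 by (simp add: zt mult_left_mono)
    also have "\<dots> \<le> (1 + norm c) * (C1 * (C2 * norm (\<phi> t) powr (m * \<alpha> / n)) ^ o')"
      using elim(2) c1 C1 by (intro mult_left_mono power_mono) auto
    also have "\<dots> = ((1 + norm c) * C1 * C2 ^ o') * norm (\<phi> t) powr (m * \<alpha> / n * o')"
      using s by (simp add: power_mult_distrib powr_power mult_ac)
    finally have e: "norm (puiseux_curve c n y (z * t) - puiseux_curve c n y t) \<le> ((1 + norm c) * C1 * C2 ^ o') * norm (\<phi> t) powr (m * \<alpha> / n * o')" .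
    have "norm (puiseux_curve c' m y' (\<phi> (z * t)) - puiseux_curve c' m y' (\<phi> t)) \<le> k1 * norm (puiseux_curve c n y (z * t) - puiseux_curve c n y t) powr \<alpha>"
      using elim(1) by (intro h1) auto
    also have "\<dots> \<le> k1 * (((1 + norm c) * C1 * C2 ^ o') * norm (\<phi> t) powr (m * \<alpha> / n * o')) powr \<alpha>"
      using e \<alpha> by (intro mult_left_mono powr_mono2) auto
    also have "\<dots> = C3 * norm (\<phi> t) powr (m * \<alpha> / n * o' * \<alpha>)"
      using c1 C1 C2 by (simp add: C3_def powr_mult powr_powr)
    also have "m * \<alpha> / n * o' * \<alpha> = \<mu>" by (simp add: \<mu>_def power2_eq_square)
    finally show ?case .
  qed
  obtain Cn \<kappa> dn where Cn: "Cn > 0" "\<kappa> > 0" "dn > 0"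
    and near: "\<And>s s'. s \<noteq> 0 \<Longrightarrow> norm s < dn \<Longrightarrow> norm (puiseux_curve c' m y' s' - puiseux_curve c' m y' s) \<le> \<kappa> * norm s ^ m \<Longrightarrow>
      \<exists>j<m. norm (rt m ^ j * s' - s) * norm s ^ (m - 1) \<le> Cn * norm (puiseux_curve c' m y' s' - puiseux_curve c' m y' s) \<and>
          norm (y' (rt m ^ j * s') - y' s') \<le> Cn * norm (puiseux_curve c' m y' s' - puiseux_curve c' m y' s)"
    using puiseux_curve_near[OF D', of] by metis
  have powlim: "((\<lambda>t. norm (\<phi> t) powr (\<mu> - m)) \<longlongrightarrow> 0) (at 0)"
    by (rule tendsto_zero_powrI[OF tendsto_norm_zero[OF lim] tendsto_const]) (use \<mu>m in auto)
  then have "((\<lambda>t. C3 * norm (\<phi> t) powr (\<mu> - m)) \<longlongrightarrow> C3 * 0) (at 0)" by (rule tendsto_mult_left)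
  then have "\<forall>\<^sub>F t in at 0. C3 * norm (\<phi> t) powr (\<mu> - m) < \<kappa>" using Cn(2) by (intro order_tendstoD) auto
  moreover have "\<forall>\<^sub>F t in at 0. norm (\<phi> t) < dn" using tendstoD[OF lim Cn(3)] by simp
  ultimately have "\<forall>\<^sub>F t in at 0. \<exists>j<m. norm (rt m ^ j * \<phi> (z * t) / \<phi> t - 1) \<le> Cn * C3 * norm (\<phi> t) powr (\<mu> - m) \<and>
        norm (y' (rt m ^ j * \<phi> (z * t)) - y' (\<phi> (z * t))) \<le> Cn * C3 * norm (\<phi> t) powr \<mu>"
    using X inball
  proof eventually_elim
    case (elim t)
    define s where "s = \<phi> t"
    define s' where "s' = \<phi> (z * t)"
    have s: "s \<noteq> 0" using \<phi>(3) elim(4) by (simp add: s_def)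
    then have sp: "norm s > 0" by simp
    have split: "norm s powr \<mu> = norm s powr (\<mu> - m) * norm s ^ m"
      using sp powr_add[of "norm s" "\<mu> - m" m] by (simp add: powr_realpow)
    have X1: "norm (puiseux_curve c' m y' s' - puiseux_curve c' m y' s) \<le> C3 * norm s powr \<mu>" using elim(3) by (simp add: s_def s'_def)
    also have "\<dots> = (C3 * norm s powr (\<mu> - m)) * norm s ^ m" by (simp add: split)
    also have "\<dots> \<le> \<kappa> * norm s ^ m" using elim(1) by (intro mult_right_mono) (auto simp: s_def)
    finally obtain j where j: "j < m" "norm (rt m ^ j * s' - s) * norm s ^ (m - 1) \<le> Cn * norm (puiseux_curve c' m y' s' - puiseux_curve c' m y' s)"
      "norm (y' (rt m ^ j * s') - y' s') \<le> Cn * norm (puiseux_curve c' m y' s' - puiseux_curve c' m y' s)"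
      using near[OF s] elim(2) unfolding s_def by metis
    have X2: "Cn * norm (puiseux_curve c' m y' s' - puiseux_curve c' m y' s) \<le> Cn * (C3 * norm s powr \<mu>)" using X1 Cn by (intro mult_left_mono) auto
    have "norm (rt m ^ j * s' / s - 1) * norm s ^ m = norm (rt m ^ j * s' - s) * norm s ^ (m - 1)"
    proof -
      have "rt m ^ j * s' / s - 1 = (rt m ^ j * s' - s) / s" using s by (simp add: diff_divide_distrib)
      moreover have "norm s ^ m = norm s * norm s ^ (m - 1)" using m by (cases m) auto
      ultimately show ?thesis using s by (simp add: norm_divide)
    qed
    also have "\<dots> \<le> (Cn * C3 * norm s powr (\<mu> - m)) * norm s ^ m" using j(2) X2 by (simp add: split mult_ac)
    finally have "norm (rt m ^ j * s' / s - 1) \<le> Cn * C3 * norm s powr (\<mu> - m)" using sp by simp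
    moreover have "norm (y' (rt m ^ j * s') - y' s') \<le> Cn * C3 * norm s powr \<mu>" using j(3) X2 by (simp add: mult_ac)
    ultimately show ?case using j(1) unfolding s_def s'_def by blast
  qed
  \<comment> \<open>The index may jump with \<open>t\<close>; only the convergence of
    \<open>rt m ^ j t\<close>, obtained further down, makes it eventually constant.\<close>
  then obtain j where j: "\<forall>\<^sub>F t in at 0. j t < m \<and> norm (rt m ^ j t * \<phi> (z * t) / \<phi> t - 1) \<le> Cn * C3 * norm (\<phi> t) powr (\<mu> - m) \<and>
        norm (y' (rt m ^ j t * \<phi> (z * t)) - y' (\<phi> (z * t))) \<le> Cn * C3 * norm (\<phi> t) powr \<mu>"
    unfolding eventually_ex by blast
  have "((\<lambda>t. Cn * C3 * norm (\<phi> t) powr (\<mu> - m)) \<longlongrightarrow> Cn * C3 * 0) (at 0)" using powlim by (rule tendsto_mult_left)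
  then have g0: "((\<lambda>t. Cn * C3 * norm (\<phi> t) powr (\<mu> - m)) \<longlongrightarrow> 0) (at 0)" by simp
  have "\<forall>\<^sub>F t in at 0. norm (rt m ^ j t * \<phi> (z * t) / \<phi> t - 1) \<le> Cn * C3 * norm (\<phi> t) powr (\<mu> - m)"
    using j by eventually_elim blast
  then have "((\<lambda>t. rt m ^ j t * \<phi> (z * t) / \<phi> t - 1) \<longlongrightarrow> 0) (at 0)"
    using g0 by (rule Lim_null_comparison)
  then have x1: "((\<lambda>t. rt m ^ j t * \<phi> (z * t) / \<phi> t) \<longlongrightarrow> 1) (at 0)" by (simp add: LIM_zero_iff)
  \<comment> \<open>Raising to the power \<open>m\<close> removes the unknown index
    \<open>j t\<close>, which brings the ratio into the form that \<open>rotation_limit\<close>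
    accepts.\<close>
  have xm: "(rt m ^ j t * \<phi> (z * t) / \<phi> t) ^ m = (\<phi> (z * t) / \<phi> t) ^ m" for t
    using rt_power_mult_power[of m "j t" "\<phi> (z * t) / \<phi> t"] by simp
  have "((\<lambda>t. (\<phi> (z * t) / \<phi> t) ^ m) \<longlongrightarrow> 1 ^ m) (at 0)"
    using tendsto_power[OF x1, of m] unfolding xm .
  then have Rm: "((\<lambda>t. (\<phi> (z * t) / \<phi> t) ^ m) \<longlongrightarrow> 1) (at 0)" by simp
  obtain L where L: "L = z \<or> L = inverse z" and RL: "((\<lambda>t. \<phi> (z * t) / \<phi> t) \<longlongrightarrow> L) (at 0)"
    using rotation_limit[OF d \<phi>(1-3) \<psi> inv n m z_def Rm] by blast
  have nL: "norm L = 1" using L nz by (auto simp: norm_inverse)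
  then have L0: "L \<noteq> 0" by auto
  have "L ^ m = 1" using tendsto_unique[OF _ tendsto_power[OF RL, of m] Rm] by simp
  then have "inverse L ^ m = 1 ^ m" by (simp add: power_inverse)
  \<comment> \<open>\<open>rt m ^ j t\<close> compensates the ratio, so in the limit it must be the
    inverse of \<open>L\<close>.\<close>
  then obtain l where l: "l < m" "inverse L = rt m ^ l * 1" by (rule power_eq_rt[OF m])
  have "z \<noteq> 1" using k rt_power_eq_1_iff[OF n, of k] by (auto simp: z_def dest: dvd_imp_le)
  then have "inverse L \<noteq> 1" using L by auto
  then have l0: "0 < l" using l by (cases l) auto
  have "((\<lambda>t. (rt m ^ j t * \<phi> (z * t) / \<phi> t) / (\<phi> (z * t) / \<phi> t)) \<longlongrightarrow> 1 / L) (at 0)"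
    using x1 RL L0 by (intro tendsto_intros)
  moreover have "\<forall>\<^sub>F t in at 0. (rt m ^ j t * \<phi> (z * t) / \<phi> t) / (\<phi> (z * t) / \<phi> t) = rt m ^ j t"
    using inball
  proof eventually_elim
    case (elim t)
    have "z * t \<noteq> 0" using elim nz by auto
    then have "\<phi> t \<noteq> 0" "\<phi> (z * t) \<noteq> 0" using \<phi>(3) elim by blast+
    then show ?case by simp
  qed
  ultimately have "((\<lambda>t. rt m ^ j t) \<longlongrightarrow> 1 / L) (at 0)" by (rule Lim_transform_eventually)
  moreover have "1 / L = rt m ^ l" using l(2) by (simp add: inverse_eq_divide)
  ultimately have jlim: "((\<lambda>t. rt m ^ j t) \<longlongrightarrow> rt m ^ l) (at 0)" by simp
  have "\<forall>\<^sub>F t in at 0. j t < m" using j by eventually_elim blast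
  then have jl: "\<forall>\<^sub>F t in at 0. j t = l" by (rule root_unity_tendsto[OF _ l(1) jlim])
  obtain c4 where c4: "c4 > 0" "\<forall>\<^sub>F t in nhds 0. c4 * norm t ^ conjugate_order m Y' l \<le> norm (y' (rt m ^ l * t) - y' t)"
    using rot_growth[OF Y' l0 l(1)] unfolding growth_def eventually_conj_iff by blast
  have c4e: "\<forall>\<^sub>F t in at 0. c4 * norm (\<phi> (z * t)) ^ conjugate_order m Y' l \<le> norm (y' (rt m ^ l * \<phi> (z * t)) - y' (\<phi> (z * t)))"
    using eventually_compose_filterlim[OF c4(2) limz] .
  \<comment> \<open>Allows replacing \<open>norm (\<phi> t)\<close> by
    \<open>norm (\<phi> (z * t))\<close>, where the lower bound \<open>c4e\<close> lives, at the
    cost of a factor \<open>2 powr \<mu>\<close>.\<close>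
  have "((\<lambda>t. norm (\<phi> (z * t) / \<phi> t)) \<longlongrightarrow> 1) (at 0)" using tendsto_norm[OF RL] nL by simp
  then have half: "\<forall>\<^sub>F t in at 0. 1/2 < norm (\<phi> (z * t) / \<phi> t)" by (rule order_tendstoD) simp
  have "\<forall>\<^sub>F t in at 0. c4 * norm (\<phi> (z * t)) powr conjugate_order m Y' l \<le> (Cn * C3 * 2 powr \<mu>) * norm (\<phi> (z * t)) powr \<mu>"
    using c4e half j jl inball
  proof eventually_elim
    case (elim t)
    have "z * t \<noteq> 0" using elim nz by auto
    then have s: "\<phi> t \<noteq> 0" "\<phi> (z * t) \<noteq> 0" using \<phi>(3) elim by blast+
    then have "norm (\<phi> t) \<le> 2 * norm (\<phi> (z * t))" using elim(2) by (simp add: norm_divide field_simps)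
    then have "norm (\<phi> t) powr \<mu> \<le> (2 * norm (\<phi> (z * t))) powr \<mu>" using \<mu>m by (intro powr_mono2) auto
    then have "Cn * C3 * norm (\<phi> t) powr \<mu> \<le> Cn * C3 * (2 * norm (\<phi> (z * t))) powr \<mu>"
      using Cn C3 by (intro mult_left_mono) auto
    then have "c4 * norm (\<phi> (z * t)) ^ conjugate_order m Y' l \<le> Cn * C3 * (2 * norm (\<phi> (z * t))) powr \<mu>"
      using elim(1,3,4) by auto
    then show ?case using s by (simp add: powr_mult powr_realpow mult_ac)
  qed
  moreover have "filterlim (\<lambda>t. norm (\<phi> (z * t))) (at_right 0) (at 0)"
  proof (rule filterlim_norm_at_right[OF limz])
    show "\<forall>\<^sub>F t in at 0. \<phi> (z * t) \<noteq> 0"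
      using inball by eventually_elim (use \<phi>(3) nz in force)
  qed
  ultimately have "\<mu> \<le> conjugate_order m Y' l" using c4(1) by (intro powr_compare_filter[of "at (0::complex)"]) auto
  then have "m * real o' * \<alpha>\<^sup>2 \<le> n * conjugate_order m Y' l" using n by (simp add: \<mu>_def field_simps)
  moreover have "rt m ^ l = z \<or> rt m ^ l = inverse z" using L l(2) by auto
  ultimately show ?thesis using l(1) l0 by (intro exI[of _ l]) (simp add: z_def o'_def)
qed

section \<open>Sums and products of growth orders; contact of two branches\<close>

lemma growth_add_less:
  assumes f: "growth f p" and g: "growth g q" and pq: "p < q"
  shows "growth (\<lambda>t. f t + g t) p"
proof -
  obtain c C where c: "c > 0" "C > 0" and 1: "\<forall>\<^sub>F t in nhds 0. c * norm t ^ p \<le> norm (f t) \<and> norm (f t) \<le> C * norm t ^ p"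
    using f unfolding growth_def by blast
  obtain d D where d: "d > 0" "D > 0" and 2: "\<forall>\<^sub>F t in nhds 0. d * norm t ^ q \<le> norm (g t) \<and> norm (g t) \<le> D * norm t ^ q"
    using g unfolding growth_def by blast
  have "((\<lambda>t. D * norm (t :: complex)) \<longlongrightarrow> D * norm (0 :: complex)) (nhds 0)" by (intro tendsto_intros filterlim_ident)
  then have "\<forall>\<^sub>F t in nhds (0 :: complex). D * norm t < c / 2" using c by (intro order_tendstoD) auto
  moreover have "\<forall>\<^sub>F t in nhds (0 :: complex). norm t < 1" by (rule eventually_nhds_in_open[of "ball 0 1", THEN eventually_mono]) auto
  ultimately have "\<forall>\<^sub>F t in nhds 0. (c/2) * norm t ^ p \<le> norm (f t + g t) \<and> norm (f t + g t) \<le> (C + c/2) * norm t ^ p"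
    using 1 2
  proof eventually_elim
    case (elim t)
    have "D * norm t ^ q \<le> D * norm t ^ Suc p" using elim(2) pq d by (intro mult_left_mono power_decreasing) auto
    also have "\<dots> = (D * norm t) * norm t ^ p" by simp
    also have "\<dots> \<le> (c / 2) * norm t ^ p" using elim(1) by (intro mult_right_mono) auto
    finally have "norm (g t) \<le> (c / 2) * norm t ^ p" using elim(4) by linarith
    moreover have "norm (f t + g t) \<le> norm (f t) + norm (g t)" by (rule norm_triangle_ineq)
    moreover have "norm (f t) - norm (g t) \<le> norm (f t + g t)" by (rule norm_diff_ineq)
    ultimately show ?case using elim(3) by (simp add: algebra_simps)
  qed
  moreover have "c/2 > 0" "C + c/2 > 0" using c by auto
  ultimately show ?thesis unfolding growth_def by blast
qed

text \<open>Terms of equal order may cancel, so only a lower bound for the order of the sum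
  remains.\<close>

lemma growth_add_eq:
  assumes f: "growth f p" and g: "growth g p" and h: "growth (\<lambda>t. f t + g t) q"
  shows "p \<le> q"
proof -
  obtain C where 1: "\<forall>\<^sub>F t in nhds 0. norm (f t) \<le> C * norm t ^ p"
    using f unfolding growth_def eventually_conj_iff by blast
  obtain D where 2: "\<forall>\<^sub>F t in nhds 0. norm (g t) \<le> D * norm t ^ p"
    using g unfolding growth_def eventually_conj_iff by blast
  obtain c where c: "c > 0" and 3: "\<forall>\<^sub>F t in nhds 0. c * norm t ^ q \<le> norm (f t + g t)"
    using h unfolding growth_def eventually_conj_iff by blast
  from 1 2 3 have "\<forall>\<^sub>F t in nhds (0 :: complex). c * norm t ^ q \<le> (C + D) * norm t ^ p"
  proof eventually_elim
    case (elim t)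
    then show ?case using norm_triangle_ineq[of "f t" "g t"] by (simp add: algebra_simps)
  qed
  then show ?thesis by (rule power_compare[OF c])
qed

lemma growth_cong:
  assumes "\<forall>\<^sub>F t in nhds 0. f t = g t" "growth f k"
  shows "growth g k"
proof -
  obtain c C where c: "c > 0" "C > 0" and 1: "\<forall>\<^sub>F t in nhds 0. c * norm t ^ k \<le> norm (f t) \<and> norm (f t) \<le> C * norm t ^ k"
    using assms(2) unfolding growth_def by blast
  from 1 assms(1) have "\<forall>\<^sub>F t in nhds 0. c * norm t ^ k \<le> norm (g t) \<and> norm (g t) \<le> C * norm t ^ k"
    by eventually_elim simp
  then show ?thesis using c unfolding growth_def by blast
qed

lemma growth_mult:
  assumes f: "growth f p" and g: "growth g q"
  shows "growth (\<lambda>t. f t * g t) (p + q)"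
proof -
  obtain c C where c: "c > 0" "C > 0" and 1: "\<forall>\<^sub>F t in nhds 0. c * norm t ^ p \<le> norm (f t) \<and> norm (f t) \<le> C * norm t ^ p"
    using f unfolding growth_def by blast
  obtain d D where d: "d > 0" "D > 0" and 2: "\<forall>\<^sub>F t in nhds 0. d * norm t ^ q \<le> norm (g t) \<and> norm (g t) \<le> D * norm t ^ q"
    using g unfolding growth_def by blast
  from 1 2 have "\<forall>\<^sub>F t in nhds 0. (c * d) * norm t ^ (p + q) \<le> norm (f t * g t) \<and> norm (f t * g t) \<le> (C * D) * norm t ^ (p + q)"
  proof eventually_elim
    case (elim t)
    have "(c * norm t ^ p) * (d * norm t ^ q) \<le> norm (f t) * norm (g t)" using elim c d by (intro mult_mono) auto
    moreover have "norm (f t) * norm (g t) \<le> (C * norm t ^ p) * (D * norm t ^ q)" using elim c d by (intro mult_mono) auto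
    ultimately show ?case by (simp add: norm_mult power_add mult_ac)
  qed
  moreover have "c * d > 0" "C * D > 0" using c d by auto
  ultimately show ?thesis unfolding growth_def by blast
qed

lemma growth_const_1: "growth (\<lambda>t. 1) 0"
  unfolding growth_def by (rule exI[of _ 1]) (auto intro: exI[of _ 1])

lemma growth_prod:
  assumes "finite A" "\<And>a. a \<in> A \<Longrightarrow> growth (f a) (k a)"
  shows "growth (\<lambda>t. \<Prod>a\<in>A. f a t) (\<Sum>a\<in>A. k a)"
  using assms
proof (induction A)
  case empty
  then show ?case using growth_const_1 by simp
next
  case (insert a A)
  then have "growth (\<lambda>t. f a t * (\<Prod>a\<in>A. f a t)) (k a + (\<Sum>a\<in>A. k a))" by (intro growth_mult) auto
  then show ?case using insert by simp
qed

lemma growth_power_arg: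
  assumes "growth f k" "0 < m" and that: "norm a = 1"
  shows "growth (\<lambda>t. f (a * t ^ m)) (m * k)"
proof -
  obtain c C where c: "c > 0" "C > 0" and 1: "\<forall>\<^sub>F t in nhds 0. c * norm t ^ k \<le> norm (f t) \<and> norm (f t) \<le> C * norm t ^ k"
    using assms(1) unfolding growth_def by blast
  have "((\<lambda>t. a * t ^ m) \<longlongrightarrow> a * 0 ^ m) (nhds (0::complex))" by (intro tendsto_intros filterlim_ident)
  then have "filterlim (\<lambda>t. a * t ^ m) (nhds 0) (nhds (0::complex))" using assms(2) by (simp add: power_0_left)
  from eventually_compose_filterlim[OF 1 this]
  have "\<forall>\<^sub>F t in nhds 0. c * norm t ^ (m * k) \<le> norm (f (a * t ^ m)) \<and> norm (f (a * t ^ m)) \<le> C * norm t ^ (m * k)"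
    by (simp add: norm_mult norm_power that power_mult)
  then show ?thesis using c unfolding growth_def by blast
qed

lemma growth_minus: "growth f k \<Longrightarrow> growth (\<lambda>t. - f t) k"
  unfolding growth_def by simp

text \<open>
  Here \<open>s\<close> is a common parameter of both branches, with \<open>x = s ^ (n * n')\<close>; the contact order \<open>Q\<close> is
  the largest order of a difference of conjugates.
\<close>

definition contact :: "nat \<Rightarrow> (complex \<Rightarrow> complex) \<Rightarrow> nat \<Rightarrow> (complex \<Rightarrow> complex) \<Rightarrow> nat \<Rightarrow> complex \<Rightarrow> bool" where
  "contact n y n' y' Q \<zeta> \<longleftrightarrow> \<zeta> ^ n' = 1 \<and> growth (\<lambda>s. y (s ^ n') - y' (\<zeta> * s ^ n)) Q \<and>
     (\<forall>\<omega>. \<omega> ^ n' = 1 \<longrightarrow> (\<exists>q\<le>Q. growth (\<lambda>s. y (s ^ n') - y' (\<omega> * s ^ n)) q))"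

lemma root_unity_norm:
  fixes z :: complex
  assumes "z ^ n = 1" "0 < n"
  shows "norm z = 1"
  using assms power_eq_1_iff by blast

text \<open>A difference vanishing identically would put every point of \<open>D\<close> near 0 on
  \<open>D'\<close>. So the difference for each of the finitely many roots of unity has a finite
  order, and a largest one exists.\<close>

lemma contact_exists:
  assumes D: "puiseux c n y Y D" and D': "puiseux c n' y' Y' D'" and ne: "\<not> germ_le D D'"
  shows "\<exists>Q \<zeta>. contact n y n' y' Q \<zeta>"
proof -
  have n: "0 < n" "0 < n'" using D D' by (auto simp: puiseux_def)
  note y = puiseux_analytic[OF D] and y' = puiseux_analytic[OF D']
  define f where "f = (\<lambda>\<omega> s. y (s ^ n') - y' (\<omega> * s ^ n))"
  have fan: "f \<omega> analytic_on {0}" for \<omega>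
    unfolding f_def using n y y'
    by (intro analytic_on_diff analytic_compose11[where h = y and u = "\<lambda>s. s ^ n'"]
      analytic_compose11[where h = y' and u = "\<lambda>s. \<omega> * s ^ n"] analytic_intros) (auto simp: power_0_left)
  have ex: "\<exists>q. growth (f \<omega>) q" if \<omega>: "\<omega> ^ n' = 1" for \<omega>
  proof -
    obtain F where F: "f \<omega> has_fps_expansion F" using fan analytic_at_imp_has_fps_expansion_0 by blast
    have "F \<noteq> 0"
    proof
      assume "F = 0"
      then have z: "\<forall>\<^sub>F s in nhds 0. f \<omega> s = 0" using F by (simp add: has_fps_expansion_0_iff)
      then obtain d where d: "d > 0" "\<And>s. norm s < d \<Longrightarrow> f \<omega> s = 0"
        unfolding eventually_nhds_metric by auto
      have ds: "d ^ (n * n') > 0" using d by simp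
      have e0: "\<forall>\<^sub>F p in nhds (0 :: complex \<times> complex). norm (fst p) < d ^ (n * n')"
      proof -
        have "((\<lambda>p :: complex \<times> complex. norm (fst p)) \<longlongrightarrow> norm (fst (0 :: complex \<times> complex))) (nhds 0)" by (intro tendsto_norm tendsto_fst filterlim_ident)
        then show ?thesis using ds by (intro order_tendstoD) auto
      qed
      have e1: "\<forall>\<^sub>F p in nhds (0 :: complex \<times> complex). (fst p + c * snd p, snd p) \<in> D \<longleftrightarrow> (\<exists>t. t ^ n = fst p \<and> snd p = y t)"
        and e2: "\<forall>\<^sub>F p in nhds (0 :: complex \<times> complex). (fst p + c * snd p, snd p) \<in> D' \<longleftrightarrow> (\<exists>t. t ^ n' = fst p \<and> snd p = y' t)"
        using D D' by (auto simp: puiseux_def)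
      have "\<forall>\<^sub>F p in nhds (0 :: complex \<times> complex). (fst p + c * snd p, snd p) \<in> D \<longrightarrow> (fst p + c * snd p, snd p) \<in> D'"
        using e0 e1 e2
      proof eventually_elim
        case (elim p)
        show ?case
        proof
          assume "(fst p + c * snd p, snd p) \<in> D"
          then obtain t where t: "t ^ n = fst p" "snd p = y t" using elim(2) by blast
          obtain s where s: "s ^ n' = t" using exists_root[OF n(2)] by blast
          have sp: "s ^ (n * n') = fst p" using t(1) power_mult[of s n' n] by (simp add: s mult.commute)
          then have "norm (s ^ (n * n')) < d ^ (n * n')" using elim(1) by simp
          then have "norm s < d" by (rule root_small[OF _ d(1)])
          then have "y t = y' (\<omega> * s ^ n)" using d(2)[of s] s by (simp add: f_def)
          moreover have "(\<omega> * s ^ n) ^ n' = fst p"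
            using \<omega> sp by (simp add: power_mult_distrib flip: power_mult)
          ultimately show "(fst p + c * snd p, snd p) \<in> D'" using t(2) elim(3) by metis
        qed
      qed
      then have "germ_le D D'" unfolding germ_le_def by (rule eventually_unshear)
      then show False using ne by blast
    qed
    then show ?thesis using growth_fps[OF F] by blast
  qed
  define q where "q = (\<lambda>\<omega>. SOME q. growth (f \<omega>) q)"
  have q: "growth (f \<omega>) (q \<omega>)" if "\<omega> ^ n' = 1" for \<omega> unfolding q_def using ex[OF that] by (rule someI_ex)
  have fin: "finite {\<omega> :: complex. \<omega> ^ n' = 1}" using n(2) by (intro finite_roots_unity) auto
  define S where "S = {\<omega> :: complex. \<omega> ^ n' = 1}"
  have "1 \<in> S" "finite S" using fin by (auto simp: S_def)
  then have "Max (q ` S) \<in> q ` S" by (intro Max_in) auto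
  then obtain \<zeta> where "\<zeta> \<in> S" "Max (q ` S) = q \<zeta>" by blast
  then have \<zeta>: "\<zeta> ^ n' = 1" "\<And>\<omega>. \<omega> ^ n' = 1 \<Longrightarrow> q \<omega> \<le> q \<zeta>"
    using Max_ge[of "q ` S"] \<open>finite S\<close> by (auto simp: S_def)
  show ?thesis
  proof (intro exI[of _ "q \<zeta>"] exI[of _ \<zeta>])
    show "contact n y n' y' (q \<zeta>) \<zeta>"
      unfolding contact_def using \<zeta> q unfolding f_def by blast
  qed
qed

text \<open>Each series vanishes to at least its own multiplicity, so in the common parameter both
  terms have order at least \<open>n * n'\<close>.\<close>

lemma contact_ge:
  assumes D: "puiseux c n y Y D" and D': "puiseux c n' y' Y' D'" and Q: "contact n y n' y' Q \<zeta>"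
  shows "n * n' \<le> Q"
proof -
  have n: "0 < n" "0 < n'" using D D' by (auto simp: puiseux_def)
  have \<zeta>: "norm \<zeta> = 1" using Q n(2) root_unity_norm unfolding contact_def by blast
  obtain c0 where c0: "c0 > 0" and g: "\<forall>\<^sub>F s in nhds 0. c0 * norm s ^ Q \<le> norm (y (s ^ n') - y' (\<zeta> * s ^ n))"
    using Q unfolding contact_def growth_def eventually_conj_iff by blast
  obtain K where K: "\<forall>\<^sub>F t in nhds 0. norm (y t) \<le> K * norm t ^ n"
    using bound_le_order[of y Y n] D by (auto simp: puiseux_def)
  obtain K' where K': "\<forall>\<^sub>F t in nhds 0. norm (y' t) \<le> K' * norm t ^ n'"
    using bound_le_order[of y' Y' n'] D' by (auto simp: puiseux_def)
  have t: "((\<lambda>s. s ^ n') \<longlongrightarrow> 0 ^ n') (nhds (0::complex))" "((\<lambda>s. \<zeta> * s ^ n) \<longlongrightarrow> \<zeta> * 0 ^ n) (nhds 0)" by (intro tendsto_intros filterlim_ident)+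
  have "filterlim (\<lambda>s. s ^ n') (nhds 0) (nhds (0::complex))" "filterlim (\<lambda>s. \<zeta> * s ^ n) (nhds 0) (nhds 0)"
    using t n by (auto simp: power_0_left)
  from g eventually_compose_filterlim[OF K this(1)] eventually_compose_filterlim[OF K' this(2)]
  have "\<forall>\<^sub>F s in nhds (0::complex). c0 * norm s ^ Q \<le> (K + K') * norm s ^ (n * n')"
  proof eventually_elim
    case (elim s)
    have "norm (y (s ^ n') - y' (\<zeta> * s ^ n)) \<le> norm (y (s ^ n')) + norm (y' (\<zeta> * s ^ n))" by (rule norm_triangle_ineq4)
    then show ?case using elim by (simp add: norm_mult norm_power \<zeta> algebra_simps flip: power_mult)
  qed
  then show ?thesis by (rule power_compare[OF c0])
qed

text \<open>The difference is a term of order \<open>Q\<close> plus one of order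
  \<open>n * conjugate_order n' Y' a\<close>. Different orders give the minimum; equal ones might
  cancel and raise the order, which the maximality of \<open>Q\<close> prevents.\<close>

lemma contact_conjugates:
  assumes D': "puiseux c n' y' Y' D'" and n: "0 < n" and Q: "contact n y n' y' Q \<zeta>" and a: "0 < a" "a < n'"
  shows "growth (\<lambda>s. y (s ^ n') - y' (rt n' ^ a * \<zeta> * s ^ n)) (min Q (n * conjugate_order n' Y' a))"
proof -
  have n': "0 < n'" and Y': "y' has_fps_expansion Y'" "primitive_series n' Y'" using D' by (auto simp: puiseux_def)
  have \<zeta>1: "\<zeta> ^ n' = 1" and f: "growth (\<lambda>s. y (s ^ n') - y' (\<zeta> * s ^ n)) Q" using Q unfolding contact_def by blast+
  have \<zeta>: "norm \<zeta> = 1" using root_unity_norm[OF \<zeta>1 n'] .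
  define g where "g = (\<lambda>s. - (y' (rt n' ^ a * (\<zeta> * s ^ n)) - y' (\<zeta> * s ^ n)))"
  have g: "growth g (n * conjugate_order n' Y' a)"
    unfolding g_def by (intro growth_minus growth_power_arg[where a = \<zeta>, OF rot_growth[OF Y' a] n \<zeta>])
  have "(rt n' ^ a * \<zeta>) ^ n' = 1" using rt_power_mult_power[of n' a \<zeta>] \<zeta>1 by simp
  then obtain q where q: "q \<le> Q" "growth (\<lambda>s. y (s ^ n') - y' (rt n' ^ a * \<zeta> * s ^ n)) q"
    using Q unfolding contact_def by blast
  have eq: "(\<lambda>s. y (s ^ n') - y' (rt n' ^ a * \<zeta> * s ^ n)) = (\<lambda>s. (y (s ^ n') - y' (\<zeta> * s ^ n)) + g s)"
    by (simp add: g_def mult.assoc)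
  have eq2: "(\<lambda>s. y (s ^ n') - y' (rt n' ^ a * \<zeta> * s ^ n)) = (\<lambda>s. g s + (y (s ^ n') - y' (\<zeta> * s ^ n)))"
    by (simp add: g_def mult.assoc)
  consider "Q < n * conjugate_order n' Y' a" | "n * conjugate_order n' Y' a < Q" | "Q = n * conjugate_order n' Y' a" by linarith
  then show ?thesis
  proof cases
    case 1
    then show ?thesis unfolding eq using growth_add_less[OF f g] by simp
  next
    case 2
    then show ?thesis unfolding eq2 using growth_add_less[OF g f] by simp
  next
    case 3
    have "Q \<le> q" using growth_add_eq[OF f g[folded 3]] q(2) unfolding eq by blast
    then show ?thesis using q 3 by simp
  qed
qed

text \<open>A nearby point of the other branch may lie almost over the same \<open>x\<close>; then
  \<open>puiseux_near\<close> moves it to a conjugate exactly over \<open>x\<close>, where the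
  differences in \<open>contact\<close> apply. Otherwise its distance is at least a multiple of
  \<open>norm x = norm s ^ (n * n')\<close>, which dominates \<open>norm s ^ Q\<close> by
  \<open>contact_ge\<close>.\<close>

lemma contact_separation:
  assumes D: "puiseux c n y Y D" and D': "puiseux c n' y' Y' D'" and Q: "contact n y n' y' Q \<zeta>"
  shows "\<exists>c1>0. \<exists>d>0. \<forall>s v. s \<noteq> 0 \<and> norm s < d \<and> norm v < d \<longrightarrow> c1 * norm s ^ Q \<le> norm (puiseux_curve c n y (s ^ n') - puiseux_curve c n' y' v)"
proof -
  have n: "0 < n" "0 < n'" using D D' by (auto simp: puiseux_def)
  have "\<exists>c0>0. \<forall>\<^sub>F s in nhds 0. \<forall>j\<in>{..<n'}. c0 * norm s ^ Q \<le> norm (y (s ^ n') - y' (rt n' ^ j * s ^ n))"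
  proof -
    have "\<exists>c0>0. \<forall>\<^sub>F s in nhds 0. c0 * norm s ^ Q \<le> norm (y (s ^ n') - y' (rt n' ^ j * s ^ n))" if "j < n'" for j
    proof -
      have "(rt n' ^ j) ^ n' = 1" using rt_power_mult_power[of n' j 1] by simp
      then obtain q where q: "q \<le> Q" "growth (\<lambda>s. y (s ^ n') - y' (rt n' ^ j * s ^ n)) q"
        using Q unfolding contact_def by blast
      obtain c0 where c0: "c0 > 0" and g: "\<forall>\<^sub>F s in nhds 0. c0 * norm s ^ q \<le> norm (y (s ^ n') - y' (rt n' ^ j * s ^ n))"
        using q(2) unfolding growth_def eventually_conj_iff by blast
      have "\<forall>\<^sub>F t in nhds (0 :: complex). norm t < 1" by (rule eventually_nhds_in_open[of "ball 0 1", THEN eventually_mono]) auto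
      with g have "\<forall>\<^sub>F s in nhds 0. c0 * norm s ^ Q \<le> norm (y (s ^ n') - y' (rt n' ^ j * s ^ n))"
      proof eventually_elim
        case (elim s)
        have "c0 * norm s ^ Q \<le> c0 * norm s ^ q" using c0 elim q(1) by (intro mult_left_mono power_decreasing) auto
        then show ?case using elim by linarith
      qed
      then show ?thesis using c0 by blast
    qed
    then have "\<forall>j\<in>{..<n'}. \<exists>c0>0. \<forall>\<^sub>F s in nhds 0. c0 * norm s ^ Q \<le> norm (y (s ^ n') - y' (rt n' ^ j * s ^ n))"
      by simp
    from bchoice[OF this[unfolded Bex_def]] obtain c0 where "\<forall>j\<in>{..<n'}. c0 j > 0 \<and>
        (\<forall>\<^sub>F s in nhds 0. c0 j * norm s ^ Q \<le> norm (y (s ^ n') - y' (rt n' ^ j * s ^ n)))" ..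
    then have c0: "c0 j > 0" "\<forall>\<^sub>F s in nhds 0. c0 j * norm s ^ Q \<le> norm (y (s ^ n') - y' (rt n' ^ j * s ^ n))"
      if "j < n'" for j using that by simp_all
    define m where "m = Min (c0 ` {..<n'})"
    have m: "m > 0" "\<And>j. j < n' \<Longrightarrow> m \<le> c0 j"
      unfolding m_def using c0(1) n by (subst Min_gr_iff) auto
    have "\<forall>\<^sub>F s in nhds 0. \<forall>j\<in>{..<n'}. m * norm s ^ Q \<le> norm (y (s ^ n') - y' (rt n' ^ j * s ^ n))"
    proof (intro eventually_ball_finite ballI)
      fix j assume j: "j \<in> {..<n'}"
      then have "\<forall>\<^sub>F s in nhds 0. c0 j * norm s ^ Q \<le> norm (y (s ^ n') - y' (rt n' ^ j * s ^ n))" using c0(2) by simp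
      then show "\<forall>\<^sub>F s in nhds 0. m * norm s ^ Q \<le> norm (y (s ^ n') - y' (rt n' ^ j * s ^ n))"
      proof eventually_elim
        case (elim s)
        have "m * norm s ^ Q \<le> c0 j * norm s ^ Q" using m(2) j by (intro mult_right_mono) auto
        then show ?case using elim by linarith
      qed
    qed simp
    then show ?thesis using m(1) by blast
  qed
  then obtain c0 d0 where c0: "c0 > 0" and d0: "d0 > 0"
    and low: "\<And>s j. norm s < d0 \<Longrightarrow> j < n' \<Longrightarrow> c0 * norm s ^ Q \<le> norm (y (s ^ n') - y' (rt n' ^ j * s ^ n))"
    unfolding eventually_nhds_metric by auto
  obtain C \<kappa> d1 where C: "C > 0" "\<kappa> > 0" "d1 > 0"
    and near: "\<And>v x. v \<noteq> 0 \<Longrightarrow> norm v < d1 \<Longrightarrow> norm (x - v ^ n') \<le> \<kappa> * norm v ^ n' \<Longrightarrow>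
    (\<exists>v'. v' ^ n' = x \<and> norm (v' - v) * norm v ^ (n' - 1) \<le> C * norm (x - v ^ n') \<and>
          norm (y' v' - y' v) \<le> C * norm (x - v ^ n'))"
    using puiseux_near[OF D'] by metis
  define b where "b = 1 + norm c"
  have b: "b > 0" using norm_ge_zero[of c] unfolding b_def by linarith
  define d where "d = min 1 (min d0 d1)"
  \<comment> \<open>The first entry serves points almost over the same \<open>x\<close>, with
    \<open>1 + C * b\<close> absorbing the move to the conjugate; the second serves points over a
    different \<open>x\<close>.\<close>
  define c1 where "c1 = min (c0 / (1 + C * b)) (\<kappa> / (1 + \<kappa>) / b)"
  have Cb: "1 + C * b > 0" using C b by (simp add: add_pos_pos)
  have "c1 \<le> c0 / (1 + C * b)" "c1 \<le> \<kappa> / (1 + \<kappa>) / b" by (simp_all add: c1_def)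
  moreover have "c1 > 0" using c0 C b Cb by (simp add: c1_def)
  ultimately have c1: "c1 > 0" "c1 * (1 + C * b) \<le> c0" "c1 * b \<le> \<kappa> / (1 + \<kappa>)"
    using Cb b by (simp_all only: pos_le_divide_eq)
  have "c1 * norm s ^ Q \<le> norm (puiseux_curve c n y (s ^ n') - puiseux_curve c n' y' v)"
    if s: "s \<noteq> 0" "norm s < d" and v: "norm v < d" for s v
  proof -
    define X where "X = norm (puiseux_curve c n y (s ^ n') - puiseux_curve c n' y' v)"
    define x where "x = s ^ (n * n')"
    have x: "norm (x - v ^ n') \<le> b * X"
      unfolding X_def x_def b_def using puiseux_curve_dist_fst[of "s ^ n'" n v n' c y y'] by (simp add: mult.commute flip: power_mult)
    show ?thesis
    proof (cases "v \<noteq> 0 \<and> norm (x - v ^ n') \<le> \<kappa> * norm v ^ n'")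
      case True
      then obtain w where w: "w ^ n' = x" "norm (y' w - y' v) \<le> C * norm (x - v ^ n')"
        using near[of v x] v unfolding d_def by (metis min_less_iff_conj)
      have "w ^ n' = (s ^ n) ^ n'" using w(1) by (simp add: x_def power_mult)
      then obtain j where j: "j < n'" "w = rt n' ^ j * s ^ n" by (rule power_eq_rt[OF n(2)])
      have "c0 * norm s ^ Q \<le> norm (y (s ^ n') - y' w)" using low[of s j] j s by (simp add: d_def)
      also have "\<dots> \<le> norm (y (s ^ n') - y' v) + norm (y' w - y' v)"
        using norm_triangle_ineq4[of "y (s ^ n') - y' v" "y' w - y' v"] by simp
      also have "norm (y (s ^ n') - y' v) \<le> X" unfolding X_def by (rule puiseux_curve_dist_snd)
      also have "norm (y' w - y' v) \<le> C * (b * X)" using w(2) mult_left_mono[OF x, of C] C by linarith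
      finally have "c0 * norm s ^ Q \<le> (1 + C * b) * X" by (simp add: algebra_simps)
      moreover have "c1 * (1 + C * b) * norm s ^ Q \<le> c0 * norm s ^ Q" using c1 by (intro mult_right_mono) auto
      ultimately have "(1 + C * b) * (c1 * norm s ^ Q) \<le> (1 + C * b) * X" by (simp add: mult_ac)
      then show ?thesis using Cb by (simp add: X_def)
    next
      case False
      have "\<kappa> * norm v ^ n' \<le> norm (x - v ^ n')"
      proof (cases "v = 0")
        case True
        then show ?thesis using n by (simp add: power_0_left)
      qed (use False in auto)
      moreover have "norm x \<le> norm (x - v ^ n') + norm v ^ n'"
        using norm_triangle_ineq2[of x "v ^ n'"] by (simp add: norm_power)
      ultimately have "\<kappa> * norm x \<le> (1 + \<kappa>) * norm (x - v ^ n')"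
        using mult_left_mono[of "norm x" "norm (x - v ^ n') + norm v ^ n'" \<kappa>] C by (simp add: algebra_simps)
      moreover have "(1 + \<kappa>) * norm (x - v ^ n') \<le> (1 + \<kappa>) * (b * X)" using x C by (intro mult_left_mono) auto
      ultimately have "\<kappa> * norm x \<le> (1 + \<kappa>) * (b * X)" by (rule order_trans)
      then have e: "\<kappa> / (1 + \<kappa>) * norm x \<le> b * X" using C by (simp add: pos_divide_le_eq mult.commute[of "1 + \<kappa>"])
      have "norm s ^ Q \<le> norm x"
        unfolding x_def norm_power using s contact_ge[OF D D' Q] by (intro power_decreasing) (auto simp: d_def)
      then have "c1 * b * norm s ^ Q \<le> \<kappa> / (1 + \<kappa>) * norm x" using c1 C b by (intro mult_mono) auto
      then have "b * (c1 * norm s ^ Q) \<le> b * X" using e by (simp add: mult_ac)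
      then show ?thesis using b by (simp add: X_def)
    qed
  qed
  moreover have "d > 0" using d0 C by (simp add: d_def)
  ultimately show ?thesis using c1(1) by blast
qed

text \<open>Over a common \<open>x\<close> take the two points that realize the contact order; their
  distance is at most a multiple of \<open>norm s ^ Q\<close>. Their images are separated by at
  least a multiple of \<open>norm w ^ Q'\<close>, where \<open>w\<close> is an \<open>n'\<close>-th
  root of the image parameter of the first, and \<open>norm s\<close> is at most a multiple of
  \<open>norm w powr \<alpha>\<close>. Comparing exponents gives
  \<open>\<alpha>\<^sup>2\<close>.\<close>

theorem contact_transfer:
  fixes \<alpha> k1 k2 :: real
  assumes D1: "puiseux c n y1 Y1 D1" and D2: "puiseux c n' y2 Y2 D2" and Q: "contact n y1 n' y2 Q \<zeta>"
    and D1': "puiseux c' n z1 Z1 D1'" and D2': "puiseux c' n' z2 Z2 D2'" and Q': "contact n z1 n' z2 Q' \<zeta>'"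
    and d: "0 < d1" "0 < d2"
    and \<phi>: "continuous_on (ball 0 d1) \<phi>1" "\<phi>1 0 = 0" "\<And>t. t \<in> ball 0 d1 \<Longrightarrow> t \<noteq> 0 \<Longrightarrow> \<phi>1 t \<noteq> (0 :: complex)"
      "continuous_on (ball 0 d2) \<phi>2" "\<phi>2 0 = 0"
    and \<alpha>: "0 < \<alpha>" "0 < k1" "0 < k2"
    and h1: "\<And>t u. t \<in> ball 0 d1 \<Longrightarrow> u \<in> ball 0 d2 \<Longrightarrow>
      norm (puiseux_curve c' n z1 (\<phi>1 t) - puiseux_curve c' n' z2 (\<phi>2 u)) \<le> k1 * norm (puiseux_curve c n y1 t - puiseux_curve c n' y2 u) powr \<alpha>"
    and h2: "\<And>t. t \<in> ball 0 d1 \<Longrightarrow> norm (puiseux_curve c n y1 t) \<le> k2 * norm (puiseux_curve c' n z1 (\<phi>1 t)) powr \<alpha>"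
  shows "\<alpha>\<^sup>2 * Q \<le> Q'"
proof -
  have n: "0 < n" "0 < n'" using D1 D2 by (auto simp: puiseux_def)
  have \<zeta>1: "\<zeta> ^ n' = 1" using Q unfolding contact_def by blast
  have \<zeta>: "norm \<zeta> = 1" using root_unity_norm[OF \<zeta>1 n(2)] .
  obtain C where C: "C > 0" and up: "\<forall>\<^sub>F s in nhds 0. norm (y1 (s ^ n') - y2 (\<zeta> * s ^ n)) \<le> C * norm s ^ Q"
    using Q unfolding contact_def growth_def eventually_conj_iff by blast
  obtain c1 d where c1: "c1 > 0" "d > 0"
    and sep: "\<And>s v. s \<noteq> 0 \<Longrightarrow> norm s < d \<Longrightarrow> norm v < d \<Longrightarrow> c1 * norm s ^ Q' \<le> norm (puiseux_curve c' n z1 (s ^ n') - puiseux_curve c' n' z2 v)"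
    using contact_separation[OF D1' D2' Q'] by metis
  have cont: "(\<phi>1 \<longlongrightarrow> 0) (at 0)" "(\<phi>2 \<longlongrightarrow> 0) (at 0)"
    using \<phi> assms(7,8) by (auto simp: continuous_on_eq_continuous_at isCont_def dest!: bspec[where x = 0])
  have at1: "filterlim (\<lambda>s::complex. s ^ n') (at 0) (at 0)"
    unfolding filterlim_at using n by (auto intro!: tendsto_eq_intros simp: eventually_at_filter power_0_left)
  have at2: "filterlim (\<lambda>s::complex. \<zeta> * s ^ n) (at 0) (at 0)"
    unfolding filterlim_at using n \<zeta> by (auto intro!: tendsto_eq_intros simp: eventually_at_filter power_0_left)
  have in0: "\<forall>\<^sub>F t in at 0. t \<in> ball 0 e \<and> t \<noteq> (0::complex)" if "e > 0" for e
    unfolding eventually_at using that by (intro exI[of _ e]) (auto simp: dist_commute)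
  note in1 = in0[OF assms(7)] and in2 = in0[OF assms(8)]
  have h2e: "\<forall>\<^sub>F t in at 0. norm (puiseux_curve c n y1 t) \<le> k2 * norm (puiseux_curve c' n z1 (\<phi>1 t)) powr \<alpha>"
    using in1 by eventually_elim (use h2 in auto)
  obtain R where R: "R > 0" "\<forall>\<^sub>F t in at 0. norm t \<le> R * norm (\<phi>1 t) powr (n * \<alpha> / n)"
    using radius_bound[OF D1 D1' order_refl cont(1) \<alpha>(1) \<alpha>(3) h2e] by blast
  \<comment> \<open>A discontinuous choice of root does no harm, because only the norm and the
    \<open>n'\<close>-th power of \<open>w s\<close> enter the estimates.\<close>
  define w where "w = (\<lambda>s. SOME w. w ^ n' = \<phi>1 (s ^ n'))"
  have w: "w s ^ n' = \<phi>1 (s ^ n')" for s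
    unfolding w_def by (rule someI_ex) (use exists_root[OF n(2)] in blast)
  have wlim: "(w \<longlongrightarrow> 0) (at 0)"
  proof (rule tendstoI)
    fix e :: real assume e: "e > 0"
    have "\<forall>\<^sub>F s in at 0. norm (\<phi>1 (s ^ n')) < e ^ n'"
      using tendstoD[OF filterlim_compose[OF cont(1) at1], of "e ^ n'"] e by simp
    then show "\<forall>\<^sub>F s in at 0. dist (w s) 0 < e"
    proof eventually_elim
      case (elim s)
      then show ?case using root_small[of "w s" n' e] e by (simp add: w)
    qed
  qed
  define b where "b = 1 + norm c"
  have b: "b > 0" using norm_ge_zero[of c] unfolding b_def by linarith
  define E where "E = k1 * (b * C * (R powr (1/n')) ^ Q) powr \<alpha>"
  have upe: "\<forall>\<^sub>F s in at 0. norm (y1 (s ^ n') - y2 (\<zeta> * s ^ n)) \<le> C * norm s ^ Q"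
    using up by (simp add: eventually_at_filter eventually_mono)
  have wn0: "\<forall>\<^sub>F s in at 0. w s \<noteq> 0"
    using eventually_compose_filterlim[OF in1 at1]
  proof eventually_elim
    case (elim s)
    then have "\<phi>1 (s ^ n') \<noteq> 0" using \<phi>(3) by blast
    then show ?case using w[of s] n by (auto simp: power_0_left)
  qed
  have wd: "\<forall>\<^sub>F s in at 0. norm (w s) < d" using tendstoD[OF wlim c1(2)] by simp
  have vd: "\<forall>\<^sub>F s in at 0. norm (\<phi>2 (\<zeta> * s ^ n)) < d"
    using tendstoD[OF filterlim_compose[OF cont(2) at2] c1(2)] by simp
  have "\<forall>\<^sub>F s in at 0. c1 * norm (w s) powr Q' \<le> E * norm (w s) powr (\<alpha>\<^sup>2 * Q)"
    using upe wn0 wd vd eventually_compose_filterlim[OF in1 at1] eventually_compose_filterlim[OF in2 at2]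
      eventually_compose_filterlim[OF R(2) at1]
  proof eventually_elim
    case (elim s)
    have ws: "norm (w s) > 0" using elim(2) by simp
    have ww: "norm (\<phi>1 (s ^ n')) = norm (w s) powr n'" using ws by (simp add: powr_realpow norm_power flip: w)
    have "norm s ^ n' \<le> R * norm (w s) powr (n' * \<alpha>)" using elim(7) n by (simp add: norm_power ww powr_powr)
    then have "(norm s ^ n') powr (1/n') \<le> (R * norm (w s) powr (n' * \<alpha>)) powr (1/n')" by (intro powr_mono2) auto
    moreover have "(norm s ^ n') powr (1/n') = norm s"
    proof -
      have "norm s ^ n' = norm s powr n'" using n by (simp add: powr_realpow')
      then show ?thesis using n by (simp add: powr_powr)
    qed
    ultimately have sR: "norm s \<le> R powr (1/n') * norm (w s) powr \<alpha>" using R(1) n by (simp add: powr_mult powr_powr)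
    have root: "(\<zeta> * s ^ n) ^ n' = (s ^ n') ^ n" using \<zeta>1 by (simp add: power_mult_distrib mult.commute flip: power_mult)
    have "norm (puiseux_curve c n y1 (s ^ n') - puiseux_curve c n' y2 (\<zeta> * s ^ n)) \<le> norm ((s ^ n') ^ n - (\<zeta> * s ^ n) ^ n') + b * norm (y1 (s ^ n') - y2 (\<zeta> * s ^ n))"
      unfolding b_def by (rule puiseux_curve_dist_le)
    also have "\<dots> \<le> b * (C * norm s ^ Q)" using elim(1) b by (simp add: root)
    also have "\<dots> \<le> b * (C * (R powr (1/n') * norm (w s) powr \<alpha>) ^ Q)" using sR b C by (intro mult_left_mono power_mono) auto
    also have "\<dots> = (b * C * (R powr (1/n')) ^ Q) * norm (w s) powr (\<alpha> * Q)"
      using ws by (simp add: power_mult_distrib powr_power mult_ac)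
    finally have e: "norm (puiseux_curve c n y1 (s ^ n') - puiseux_curve c n' y2 (\<zeta> * s ^ n)) \<le> (b * C * (R powr (1/n')) ^ Q) * norm (w s) powr (\<alpha> * Q)" .
    have "c1 * norm (w s) ^ Q' \<le> norm (puiseux_curve c' n z1 (w s ^ n') - puiseux_curve c' n' z2 (\<phi>2 (\<zeta> * s ^ n)))"
      using elim(2-4) by (intro sep) auto
    also have "\<dots> \<le> k1 * norm (puiseux_curve c n y1 (s ^ n') - puiseux_curve c n' y2 (\<zeta> * s ^ n)) powr \<alpha>"
      unfolding w using elim(5,6) by (intro h1) auto
    also have "\<dots> \<le> k1 * ((b * C * (R powr (1/n')) ^ Q) * norm (w s) powr (\<alpha> * Q)) powr \<alpha>"
      using e \<alpha> by (intro mult_left_mono powr_mono2) auto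
    also have "\<dots> = E * norm (w s) powr (\<alpha> * Q * \<alpha>)"
      using b C R by (simp add: E_def powr_mult powr_powr)
    also have "\<alpha> * Q * \<alpha> = \<alpha>\<^sup>2 * Q" by (simp add: power2_eq_square)
    finally show ?case using ws by (simp add: powr_realpow)
  qed
  then show ?thesis
    using c1(1) filterlim_norm_at_right[OF wlim wn0] by (intro powr_compare_filter[of "at (0::complex)"]) auto
qed

section \<open>Characteristic exponents and intersection multiplicities\<close>

text \<open>The next entry is \<open>M e\<close> for the current gcd \<open>e\<close>. Since
  \<open>e\<close> does not divide it, the gcd drops strictly and the list ends at gcd 1. All is
  expressed through \<open>n\<close> and \<open>M\<close>, so branches with equal \<open>n\<close>
  and \<open>min_exponent\<close> can share one list.\<close>

lemma exponent_list_exists: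
  fixes M :: "nat \<Rightarrow> nat"
  assumes n: "1 < n" and M: "\<And>e. 1 < e \<Longrightarrow> e dvd n \<Longrightarrow> \<not> e dvd M e"
  shows "\<exists>g\<ge>1. \<exists>\<beta>. length \<beta> = Suc g \<and> \<beta> ! 0 = n \<and> \<beta> ! 1 = M n \<and>
    (\<forall>i\<in>{1..<g}. 1 < exponent_gcd \<beta> i \<and> exponent_gcd \<beta> i dvd n \<and> \<beta> ! Suc i = M (exponent_gcd \<beta> i)) \<and>
    exponent_gcd \<beta> g = 1"
proof -
  define P where "P = (\<lambda>\<beta> g. 1 \<le> g \<and> length \<beta> = Suc g \<and> \<beta> ! 0 = n \<and> \<beta> ! 1 = M n \<and>
    (\<forall>i\<in>{1..<g}. 1 < exponent_gcd \<beta> i \<and> exponent_gcd \<beta> i dvd n \<and> \<beta> ! Suc i = M (exponent_gcd \<beta> i)))"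
  have step: "\<exists>g \<beta>. P \<beta> g \<and> exponent_gcd \<beta> g = 1" if "P \<beta> g" for \<beta> g
    using that
  proof (induction "exponent_gcd \<beta> g" arbitrary: \<beta> g rule: less_induct)
    case less
    define e where "e = exponent_gcd \<beta> g"
    have len: "length \<beta> = Suc g" and b0: "\<beta> ! 0 = n" and g: "1 \<le> g" using less.prems by (auto simp: P_def)
    have eG: "e = Gcd (set \<beta>)" using len by (simp add: e_def exponent_gcd_def)
    have "n \<in> set \<beta>" using b0 len by (metis nth_mem zero_less_Suc)
    then have en: "e dvd n" unfolding eG by (rule Gcd_dvd)
    show ?case
    proof (cases "e = 1")
      case True
      then show ?thesis using less.prems e_def by metis
    next
      case False
      have "e \<noteq> 0" using en n by (metis dvd_0_left_iff not_less_zero)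
      then have e1: "1 < e" using False by linarith
      define \<gamma> where "\<gamma> = \<beta> @ [M e]"
      have take: "take (Suc i) \<gamma> = take (Suc i) \<beta>" if "i \<le> g" for i using that len by (simp add: \<gamma>_def)
      have eg: "exponent_gcd \<gamma> i = exponent_gcd \<beta> i" if "i \<le> g" for i using take[OF that] by (simp add: exponent_gcd_def)
      have nth: "\<gamma> ! i = \<beta> ! i" if "i \<le> g" for i using that len by (simp add: \<gamma>_def nth_append)
      have last: "\<gamma> ! Suc g = M e" using len by (simp add: \<gamma>_def nth_append)
      have "exponent_gcd \<gamma> (Suc g) = gcd (M e) e" using len by (simp add: exponent_gcd_def \<gamma>_def eG)
      moreover have "gcd (M e) e \<noteq> e" using M[OF e1 en] by (metis gcd_dvd1)
      moreover have "gcd (M e) e \<le> e" using e1 by (intro dvd_imp_le) auto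
      ultimately have lt: "exponent_gcd \<gamma> (Suc g) < exponent_gcd \<beta> g" unfolding e_def[symmetric] by linarith
      have "P \<gamma> (Suc g)"
        unfolding P_def
      proof (intro conjI ballI)
        show "1 \<le> Suc g" "length \<gamma> = Suc (Suc g)" using len by (auto simp: \<gamma>_def)
        show "\<gamma> ! 0 = n" using nth[of 0] b0 by simp
        show "\<gamma> ! 1 = M n" using nth[of 1] g less.prems by (simp add: P_def)
        fix i assume i: "i \<in> {1..<Suc g}"
        have *: "1 < exponent_gcd \<beta> i \<and> exponent_gcd \<beta> i dvd n \<and> \<gamma> ! Suc i = M (exponent_gcd \<beta> i)"
        proof (cases "i = g")
          case True
          then show ?thesis using e1 en last by (simp add: e_def)
        next
          case False
          then have "i \<in> {1..<g}" using i by auto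
          then show ?thesis using less.prems nth[of "Suc i"] by (simp add: P_def)
        qed
        show "1 < exponent_gcd \<gamma> i" "exponent_gcd \<gamma> i dvd n" "\<gamma> ! Suc i = M (exponent_gcd \<gamma> i)"
          using * eg[of i] i by auto
      qed
      from less.hyps[OF lt this] show ?thesis .
    qed
  qed
  have "P [n, M n] 1" by (simp add: P_def)
  from step[OF this] obtain g \<beta> where "P \<beta> g" "exponent_gcd \<beta> g = 1" by blast
  then show ?thesis unfolding P_def by blast
qed

lemma parametrizes_cong:
  assumes p: "parametrizes \<gamma> D" and eq: "\<forall>\<^sub>F t in nhds 0. \<gamma> t = \<gamma>' t"
  shows "parametrizes \<gamma>' D"
proof -
  obtain d where d: "d > 0" "\<And>t. norm t < d \<Longrightarrow> \<gamma> t = \<gamma>' t"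
    using eq unfolding eventually_nhds_metric by auto
  have 0: "\<gamma>' 0 = 0" using p d(2)[of 0] d(1) by (simp add: parametrizes_def)
  have "\<forall>\<^sub>F t in nhds 0. fst (\<gamma> t) = fst (\<gamma>' t)" "\<forall>\<^sub>F t in nhds 0. snd (\<gamma> t) = snd (\<gamma>' t)"
    using eq by (eventually_elim, simp)+
  then have a: "(\<lambda>t. fst (\<gamma>' t)) analytic_on {0}" "(\<lambda>t. snd (\<gamma>' t)) analytic_on {0}"
    using p unfolding parametrizes_def by (auto simp: analytic_at_cong)
  have "\<forall>\<^sub>F \<epsilon> in at_right (0::real). \<epsilon> < d" using d(1) by (rule eventually_at_right_real[THEN eventually_mono]) auto
  moreover have "\<forall>\<^sub>F \<epsilon> in at_right 0. inj_on \<gamma> (ball 0 \<epsilon>) \<and> germ_eq D (\<gamma> ` ball 0 \<epsilon>)"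
    using p by (simp add: parametrizes_def)
  ultimately have "\<forall>\<^sub>F \<epsilon> in at_right 0. inj_on \<gamma>' (ball 0 \<epsilon>) \<and> germ_eq D (\<gamma>' ` ball 0 \<epsilon>)"
  proof eventually_elim
    case (elim \<epsilon>)
    have e: "\<gamma> t = \<gamma>' t" if "t \<in> ball 0 \<epsilon>" for t using d(2)[of t] that elim(1) by simp
    have "inj_on \<gamma>' (ball 0 \<epsilon>)" using elim(2) e by (metis inj_on_cong)
    moreover have "\<gamma> ` ball 0 \<epsilon> = \<gamma>' ` ball 0 \<epsilon>" using e by (rule image_cong[OF refl])
    ultimately show ?case using elim(2) by simp
  qed
  then show ?thesis using 0 a by (simp add: parametrizes_def)
qed

text \<open>The terms of \<open>Y\<close> with exponent divisible by \<open>n\<close> and below the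
  first exponent that is not form a polynomial \<open>q\<close> in \<open>x\<close>. Subtracting it,
  combined with the shear, is a coordinate change after which the leading exponent is not divisible
  by \<open>n\<close>.\<close>

lemma puiseux_normal_form:
  assumes D: "puiseux c n y Y D" and n: "1 < n"
  shows "\<exists>\<psi> Z. coordinate_change \<psi> \<and> fps_conv_radius Z > 0 \<and> subdegree Z = min_exponent Y n \<and> Z \<noteq> 0 \<and>
    (\<forall>k. \<not> n dvd k \<longrightarrow> fps_nth Z k = fps_nth Y k) \<and>
    (\<forall>k. fps_nth Z k \<noteq> 0 \<longrightarrow> fps_nth Y k \<noteq> 0) \<and>
    parametrizes (\<lambda>t. \<psi> (t ^ n, eval_fps Z t)) D"
proof -
  have Y: "y has_fps_expansion Y" "primitive_series n Y" and low: "\<forall>k<n. fps_nth Y k = 0" using D by (auto simp: puiseux_def)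
  define m where "m = min_exponent Y n"
  note m = min_exponent_props[OF Y(2) n dvd_refl, folded m_def]
  \<comment> \<open>Cut off at the first exponent \<open>m\<close> not divisible by
    \<open>n\<close>; later multiples of \<open>n\<close> stay in \<open>Z\<close>. In
    \<open>q\<close> the index starts at 1 because \<open>Y\<close> has no constant term.\<close>
  define a where "a = (\<lambda>j. if n * j < m then fps_nth Y (n * j) else 0)"
  define q where "q = (\<lambda>x. \<Sum>j\<in>{1..<m}. a j * x ^ j)"
  have q0: "q 0 = 0" unfolding q_def by (intro sum.neutral) auto
  define Q where "Q = (\<Sum>j\<in>{1..<m}. fps_const (a j) * fps_X ^ (n * j))"
  have Qx: "(\<lambda>t. q (t ^ n)) has_fps_expansion Q"
    unfolding q_def Q_def power_mult[symmetric]
    by (intro has_fps_expansion_sum has_fps_expansion_mult has_fps_expansion_const has_fps_expansion_power has_fps_expansion_fps_X)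
  have Qn: "fps_nth Q k = (if n dvd k \<and> k < m then fps_nth Y k else 0)" for k
  proof -
    have Qk: "fps_nth Q k = (\<Sum>j\<in>{1..<m}. if k = n * j then a j else 0)"
      unfolding Q_def fps_sum_nth by (intro sum.cong) (auto simp: fps_X_power_iff)
    show ?thesis
    proof (cases "n dvd k \<and> k < m \<and> 0 < k")
      case True
      then obtain j where j: "k = n * j" by (elim conjE dvdE)
      have "0 < j" using True j by (cases j) auto
      moreover have "j < m"
      proof (rule le_less_trans)
        show "j \<le> n * j" using n by simp
        show "n * j < m" using True j by simp
      qed
      ultimately have jm: "j \<in> {1..<m}" by simp
      have "(\<Sum>i\<in>{1..<m}. if k = n * i then a i else 0) = (\<Sum>i\<in>{1..<m}. if j = i then a i else 0)"
        using j n by (intro sum.cong) auto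
      also have "\<dots> = a j" using jm by simp
      finally show ?thesis using Qk True j by (simp add: a_def)
    next
      case False
      have "(\<Sum>j\<in>{1..<m}. if k = n * j then a j else 0) = 0"
        using False n by (intro sum.neutral) (auto simp: a_def)
      moreover have "fps_nth Y 0 = 0" using low n by simp
      ultimately show ?thesis using Qk False by auto
    qed
  qed
  define Z where "Z = Y - Q"
  have Zx: "(\<lambda>t. y t - q (t ^ n)) has_fps_expansion Z"
    unfolding Z_def by (intro has_fps_expansion_diff Y Qx)
  have Zn: "fps_nth Z k = (if n dvd k \<and> k < m then 0 else fps_nth Y k)" for k by (simp add: Z_def Qn)
  have sub: "subdegree Z = m"
  proof (rule subdegreeI)
    show "fps_nth Z m \<noteq> 0" using m(1) by (simp add: Zn)
    show "fps_nth Z i = 0" if "i < m" for i using m(3)[of i] that by (auto simp: Zn)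
  qed
  have Znz: "Z \<noteq> 0" using m(1) Zn[of m] by auto
  define \<psi> where "\<psi> = (\<lambda>p. (fst p + c * (snd p + q (fst p)), snd p + q (fst p)))"
  define \<phi> where "\<phi> = (\<lambda>p. (fst p - c * snd p, snd p - q (fst p - c * snd p)))"
  have anq: "analytic2 (\<lambda>p. q (u p))" if "analytic2 u" for u
    unfolding q_def by (intro analytic2_intros that)
  have cc: "coordinate_change \<psi>"
    unfolding coordinate_change_def
  proof (intro conjI exI[of _ \<phi>])
    show "\<psi> 0 = 0" "\<phi> 0 = 0" by (auto simp: \<psi>_def \<phi>_def q0 zero_prod_def)
    show "analytic2 (\<lambda>p. fst (\<psi> p))" "analytic2 (\<lambda>p. snd (\<psi> p))" "analytic2 (\<lambda>p. fst (\<phi> p))" "analytic2 (\<lambda>p. snd (\<phi> p))"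
      unfolding \<psi>_def \<phi>_def fst_conv snd_conv by (intro analytic2_intros anq)+
    show "\<forall>\<^sub>F p in nhds 0. \<phi> (\<psi> p) = p \<and> \<psi> (\<phi> p) = p"
      by (intro always_eventually) (auto simp: \<psi>_def \<phi>_def algebra_simps)
  qed
  have rad: "fps_conv_radius Z > 0" and ev: "\<forall>\<^sub>F t in nhds 0. eval_fps Z t = y t - q (t ^ n)"
    using Zx by (auto simp: has_fps_expansion_def)
  have par: "parametrizes (\<lambda>t. \<psi> (t ^ n, eval_fps Z t)) D"
  proof (rule parametrizes_cong[OF puiseux_parametrizes[OF D]])
    show "\<forall>\<^sub>F t in nhds 0. (t ^ n + c * y t, y t) = \<psi> (t ^ n, eval_fps Z t)"
      using ev by eventually_elim (simp add: \<psi>_def)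
  qed
  have k: "\<forall>k. \<not> n dvd k \<longrightarrow> fps_nth Z k = fps_nth Y k" "\<forall>k. fps_nth Z k \<noteq> 0 \<longrightarrow> fps_nth Y k \<noteq> 0"
    by (auto simp: Zn)
  show ?thesis
  proof (rule exI[of _ \<psi>], rule exI[of _ Z], intro conjI)
    show "subdegree Z = min_exponent Y n" using sub by (simp add: m_def)
  qed (fact cc rad Znz k par)+
qed

text \<open>For a divisor \<open>e\<close> of \<open>n\<close>, an exponent not divisible by
  \<open>e\<close> is not divisible by \<open>n\<close> either, so its coefficient is unchanged in
  the normal form. Hence the exponents read off from \<open>Y\<close> are those of the normal
  form.\<close>

lemma puiseux_characteristic_exponents:
  assumes D: "puiseux c n y Y D" and n: "1 < n"
    and \<beta>: "1 \<le> g" "length \<beta> = Suc g" "\<beta> ! 0 = n" "\<beta> ! 1 = min_exponent Y n"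
      "\<And>i. i \<in> {1..<g} \<Longrightarrow> 1 < exponent_gcd \<beta> i \<and> exponent_gcd \<beta> i dvd n \<and> \<beta> ! Suc i = min_exponent Y (exponent_gcd \<beta> i)"
      "exponent_gcd \<beta> g = 1"
  shows "has_characteristic_exponents D \<beta>"
proof -
  have Y: "primitive_series n Y" using D by (auto simp: puiseux_def)
  obtain \<psi> Z where Z: "coordinate_change \<psi>" "fps_conv_radius Z > 0" "subdegree Z = min_exponent Y n" "Z \<noteq> 0"
    "\<forall>k. \<not> n dvd k \<longrightarrow> fps_nth Z k = fps_nth Y k" "\<forall>k. fps_nth Z k \<noteq> 0 \<longrightarrow> fps_nth Y k \<noteq> 0"
    "parametrizes (\<lambda>t. \<psi> (t ^ n, eval_fps Z t)) D"
    using puiseux_normal_form[OF D n] by (elim exE conjE) (rule that)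
  have cs0: "characteristic_sequence n Z \<beta>"
    unfolding characteristic_sequence_def
  proof (intro exI[of _ g] conjI ballI)
    fix i assume i: "i \<in> {1..<g}"
    define e where "e = exponent_gcd \<beta> i"
    have e: "1 < e" "e dvd n" "\<beta> ! Suc i = min_exponent Y e" using \<beta>(5)[OF i] by (auto simp: e_def)
    note min_exponent = min_exponent_props[OF Y e(1,2)]
    show "1 < exponent_gcd \<beta> i" using e by (simp add: e_def)
    show "\<not> exponent_gcd \<beta> i dvd \<beta> ! Suc i" using min_exponent(2) e(3) by (simp add: e_def)
    have "\<not> n dvd min_exponent Y e" using min_exponent(2) e(2) dvd_trans by blast
    then show "fps_nth Z (\<beta> ! Suc i) \<noteq> 0" using min_exponent(1) Z(5) e(3) by simp
    show "\<forall>k. fps_nth Z k \<noteq> 0 \<and> \<not> exponent_gcd \<beta> i dvd k \<longrightarrow> \<beta> ! Suc i \<le> k"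
      using min_exponent(3) Z(6) unfolding e(3) e_def[symmetric] by blast
  qed (use \<beta> Z(3) in auto)
  have cs: "\<exists>\<psi> Y. coordinate_change \<psi> \<and> fps_conv_radius Y > 0 \<and> Y \<noteq> 0 \<and> \<not> n dvd subdegree Y \<and>
           parametrizes (\<lambda>t. \<psi> (t ^ n, eval_fps Y t)) D \<and> characteristic_sequence n Y \<beta>"
    if "\<not> n dvd subdegree Z"
  proof (rule exI[of _ \<psi>], rule exI[of _ Z], intro conjI)
  qed (fact Z that cs0)+
  have nd: "\<not> n dvd subdegree Z" unfolding Z(3) using min_exponent_props(2)[OF Y n] by simp
  have mult: "has_multiplicity D n" using puiseux_equation[OF D] unfolding has_multiplicity_def by blast
  show ?thesis
    unfolding has_characteristic_exponents_def
  proof (rule disjI2, rule exI[of _ n], intro conjI)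
  qed (fact n mult cs[OF nd])+
qed

theorem same_characteristic_exponents:
  assumes D: "puiseux c n y Y D" and D': "puiseux c' n y' Y' D'"
    and min_exponent: "\<And>e. 1 < e \<Longrightarrow> e dvd n \<Longrightarrow> min_exponent Y e = min_exponent Y' e"
  shows "\<exists>\<beta>. has_characteristic_exponents D \<beta> \<and> has_characteristic_exponents D' \<beta>"
proof (cases "n = 1")
  case True
  have "has_multiplicity D 1" "has_multiplicity D' 1"
    using puiseux_equation[OF D] puiseux_equation[OF D'] True unfolding has_multiplicity_def by blast+
  then show ?thesis unfolding has_characteristic_exponents_def by blast
next
  case False
  then have n: "1 < n" using D by (auto simp: puiseux_def)
  have Y: "primitive_series n Y" using D by (auto simp: puiseux_def)
  obtain g \<beta> where g: "1 \<le> g" and \<beta>: "length \<beta> = Suc g" "\<beta> ! 0 = n" "\<beta> ! 1 = min_exponent Y n"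
      "\<forall>i\<in>{1..<g}. 1 < exponent_gcd \<beta> i \<and> exponent_gcd \<beta> i dvd n \<and> \<beta> ! Suc i = min_exponent Y (exponent_gcd \<beta> i)"
      "exponent_gcd \<beta> g = 1"
    using exponent_list_exists[OF n, of "min_exponent Y"] min_exponent_props(2)[OF Y] by blast
  have "has_characteristic_exponents D \<beta>"
    by (rule puiseux_characteristic_exponents[OF D n g \<beta>(1-3) _ \<beta>(5)]) (use \<beta>(4) in blast)
  moreover have "has_characteristic_exponents D' \<beta>"
  proof (rule puiseux_characteristic_exponents[OF D' n g \<beta>(1,2) _ _ \<beta>(5)])
    show "\<beta> ! 1 = min_exponent Y' n" using \<beta>(3) min_exponent[OF n] by simp
    show "1 < exponent_gcd \<beta> i \<and> exponent_gcd \<beta> i dvd n \<and> \<beta> ! Suc i = min_exponent Y' (exponent_gcd \<beta> i)" if "i \<in> {1..<g}" for i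
    proof -
      have *: "1 < exponent_gcd \<beta> i" "exponent_gcd \<beta> i dvd n" "\<beta> ! Suc i = min_exponent Y (exponent_gcd \<beta> i)"
        using \<beta>(4) that by blast+
      show ?thesis using * min_exponent[OF *(1,2)] by simp
    qed
  qed
  ultimately show ?thesis by blast
qed

text \<open>Insert the parametrization of \<open>D\<close> into the product over the conjugates of
  \<open>D'\<close> and put \<open>t = s ^ n'\<close>: every factor becomes a difference of known
  order, and the substitution accounts for the factor \<open>n'\<close> of \<open>k\<close>. Thus
  the multiplicity is determined by \<open>n\<close>, \<open>n'\<close>, \<open>Q\<close> and the
  conjugate orders.\<close>

theorem contact_intersection_multiplicity:
  assumes D: "puiseux c n y Y D" and D': "puiseux c n' y' Y' D'" and Q: "contact n y n' y' Q \<zeta>"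
  shows "\<exists>k. has_intersection_multiplicity D D' k \<and>
    n' * k = (\<Sum>a<n'. if a = 0 then Q else min Q (n * conjugate_order n' Y' a))"
proof -
  have n: "0 < n" "0 < n'" using D D' by (auto simp: puiseux_def)
  have \<zeta>1: "\<zeta> ^ n' = 1" and f0: "growth (\<lambda>s. y (s ^ n') - y' (\<zeta> * s ^ n)) Q" using Q unfolding contact_def by blast+
  note y = puiseux_analytic[OF D]
  obtain P where P: "analytic2 P" and PP: "\<forall>\<^sub>F p in nhds 0. P (fst p ^ n', snd p) = (\<Prod>k<n'. snd p - y' (rt n' ^ k * fst p))"
    and red: "reduced_equation D' (\<lambda>p. P (fst p - c * snd p, snd p))"
    using puiseux_equation[OF D'] by (elim exE conjE) (rule that)
  define h where "h = (\<lambda>t. P (t ^ n, y t))"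
  have "(\<lambda>t. t ^ n) analytic_on {0}" by (intro analytic_intros)
  then have han: "h analytic_on {0}"
    unfolding h_def using n y P by (intro analytic_compose_curve) (auto simp: power_0_left)
  then obtain H where H: "h has_fps_expansion H" using analytic_at_imp_has_fps_expansion_0 by blast
  define K where "K = (\<Sum>a<n'. if a = 0 then Q else min Q (n * conjugate_order n' Y' a))"
  have gp: "growth (\<lambda>s. \<Prod>a<n'. y (s ^ n') - y' (rt n' ^ a * \<zeta> * s ^ n)) K"
    unfolding K_def
  proof (rule growth_prod)
    fix a assume "a \<in> {..<n'}"
    then show "growth (\<lambda>s. y (s ^ n') - y' (rt n' ^ a * \<zeta> * s ^ n)) (if a = 0 then Q else min Q (n * conjugate_order n' Y' a))"
      using f0 contact_conjugates[OF D' n(1) Q, of a] by auto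
  qed simp
  \<comment> \<open>The \<open>n'\<close>-th root \<open>\<zeta> * s ^ n\<close> of \<open>x\<close>
    is taken as base point, so that index 0 is the conjugate realizing the contact order.\<close>
  have lim: "((\<lambda>s. (\<zeta> * s ^ n, y (s ^ n'))) \<longlongrightarrow> (0 :: complex \<times> complex)) (nhds 0)"
  proof -
    have "((\<lambda>s::complex. s ^ n') \<longlongrightarrow> 0 ^ n') (nhds 0)" by (intro tendsto_intros filterlim_ident)
    then have "((\<lambda>s::complex. s ^ n') \<longlongrightarrow> 0) (nhds 0)" using n by (simp add: power_0_left)
    from filterlim_compose[OF analytic_tendsto[OF y(1)] this] have "((\<lambda>s. y (s ^ n')) \<longlongrightarrow> 0) (nhds 0)" using y(2) by simp
    moreover have "((\<lambda>s. \<zeta> * s ^ n) \<longlongrightarrow> \<zeta> * 0 ^ n) (nhds 0)" by (intro tendsto_intros filterlim_ident)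
    then have "((\<lambda>s. \<zeta> * s ^ n) \<longlongrightarrow> 0) (nhds 0)" using n by (simp add: power_0_left)
    ultimately show ?thesis unfolding zero_prod_def by (intro tendsto_Pair)
  qed
  have "\<forall>\<^sub>F s in nhds 0. (\<Prod>a<n'. y (s ^ n') - y' (rt n' ^ a * \<zeta> * s ^ n)) = h (s ^ n')"
    using eventually_compose_filterlim[OF PP lim]
  proof eventually_elim
    case (elim s)
    have "(\<zeta> * s ^ n) ^ n' = (s ^ n') ^ n" using \<zeta>1 by (simp add: power_mult_distrib mult.commute flip: power_mult)
    then show ?case using elim by (simp add: h_def mult.assoc)
  qed
  from growth_cong[OF this gp] have hs: "growth (\<lambda>s. h (s ^ n')) K" .
  have Hnz: "H \<noteq> 0"
  proof
    assume "H = 0"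
    then have "\<forall>\<^sub>F t in nhds 0. h t = 0" using H by (simp add: has_fps_expansion_0_iff)
    moreover have "((\<lambda>s::complex. s ^ n') \<longlongrightarrow> 0 ^ n') (nhds 0)" by (intro tendsto_intros filterlim_ident)
    then have "((\<lambda>s::complex. s ^ n') \<longlongrightarrow> 0) (nhds 0)" using n by (simp add: power_0_left)
    ultimately have "\<forall>\<^sub>F s in nhds 0. h (s ^ n') = 0" by (rule eventually_compose_filterlim)
    with growth_nonzero[OF hs] have "\<forall>\<^sub>F s in nhds (0::complex). s = 0" by eventually_elim blast
    then have "\<forall>\<^sub>F s in at (0::complex). False" by (simp add: eventually_at_filter)
    then show False by simp
  qed
  have "growth (\<lambda>s. h (1 * s ^ n')) (n' * subdegree H)"
    by (rule growth_power_arg[OF growth_fps[OF H Hnz] n(2)]) simp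
  then have "n' * subdegree H = K" using growth_unique[OF _ hs] by simp
  moreover have "has_intersection_multiplicity D D' (subdegree H)"
    unfolding has_intersection_multiplicity_def
  proof (intro exI conjI)
    show "parametrizes (\<lambda>t. (t ^ n + c * y t, y t)) D" by (rule puiseux_parametrizes[OF D])
    show "reduced_equation D' (\<lambda>p. P (fst p - c * snd p, snd p))" by (rule red)
    show "(\<lambda>t. P (fst (t ^ n + c * y t, y t) - c * snd (t ^ n + c * y t, y t), snd (t ^ n + c * y t, y t))) has_fps_expansion H"
      using H by (simp add: h_def)
  qed (use Hnz in auto)
  ultimately show ?thesis unfolding K_def by blast
qed

text \<open>No exponent below \<open>n\<close> occurs, and the minimal exponent is not divisible by
  the divisor \<open>e\<close> of \<open>n\<close>, so it is not \<open>n\<close> itself. The strict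
  gap is what makes \<open>n < \<alpha>\<^sup>2 * conjugate_order n Y k\<close> hold for \<alpha>
  near 1.\<close>

lemma conjugate_order_gt:
  assumes D: "puiseux c n y Y D" and k: "0 < k" "k < n"
  shows "n < conjugate_order n Y k"
proof -
  have Y: "primitive_series n Y" and low: "\<forall>k<n. fps_nth Y k = 0" using D by (auto simp: puiseux_def)
  define e where "e = n div gcd n k"
  have e: "1 < e" "e dvd n" unfolding e_def using conjugate_index_props[OF k] by auto
  note min_exponent = min_exponent_props[OF Y e]
  have "n \<le> min_exponent Y e" using min_exponent(1) low by (meson not_le)
  moreover have "min_exponent Y e \<noteq> n" using min_exponent(2) e(2) by auto
  ultimately show ?thesis by (simp add: conjugate_order_def e_def)
qed

text \<open>For \<open>0 < k\<close>, \<open>rt n ^ (n - k)\<close> is the inverse of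
  \<open>rt n ^ k\<close>; this absorbs the ambiguity between degree 1 and -1.\<close>

lemma conjugate_order_complement:
  assumes "k < n"
  shows "conjugate_order n Y (n - k) = conjugate_order n Y k"
proof -
  have "gcd n (n - k) = gcd n k" using gcd_diff2_nat[of k n] assms by (simp add: gcd.commute)
  then show ?thesis by (simp add: conjugate_order_def)
qed

text \<open>The loss \<open>x / M\<close> is at most 1 and the bound on \<open>\<beta>\<close> is
  strict, so the integer \<open>y\<close> exceeds \<open>x - 1\<close>.\<close>

lemma nat_le_if_almost:
  fixes \<beta> :: real
  assumes "0 < M" "1 - 1 / real M < \<beta>" "x \<le> M" "\<beta> * real x \<le> real y"
  shows "x \<le> y"
proof (cases "x = 0")
  case False
  have "(1 - 1 / real M) * real x < real y" using assms False by (smt (verit) mult_strict_right_mono of_nat_0_less_iff gr0I)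
  moreover have "real x / real M \<le> 1" using assms by simp
  ultimately have "real x - 1 < real y" by (simp add: algebra_simps)
  then show ?thesis by linarith
qed simp

text \<open>The conclusion of \<open>rotation_transfer\<close> as a relation between numerical data
  alone, so that the final comparison can use it in both directions without the maps.\<close>

definition rotates :: "real \<Rightarrow> nat \<Rightarrow> complex fps \<Rightarrow> nat \<Rightarrow> complex fps \<Rightarrow> bool" where
  "rotates \<alpha> n Y m Z \<longleftrightarrow> (\<forall>k. 0 < k \<and> k < n \<and> real n < \<alpha>\<^sup>2 * real (conjugate_order n Y k) \<longrightarrow>
     (\<exists>l. 0 < l \<and> l < m \<and> (rt m ^ l = rt n ^ k \<or> rt m ^ l = inverse (rt n ^ k)) \<and>
       real (m * conjugate_order n Y k) * \<alpha>\<^sup>2 \<le> real (n * conjugate_order m Z l)))"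

text \<open>For \<open>k = 1\<close>, \<open>rt n\<close> or its inverse is found among the
  \<open>m\<close>-th roots of unity, whence \<open>n dvd m\<close>. If \<open>m = n\<close>, the
  index \<open>l\<close> can only be \<open>k\<close> or \<open>n - k\<close>, which have equal
  conjugate orders, and \<open>nat_le_if_almost\<close> removes the factor
  \<open>\<alpha>\<^sup>2\<close>.\<close>

lemma rotates_dvd:
  assumes D: "puiseux c n y Y D" and M: "0 < M" "1 - 1 / real M < \<alpha>\<^sup>2" "\<And>k. 0 < k \<Longrightarrow> k < n \<Longrightarrow> conjugate_order n Y k \<le> M"
    and R: "rotates \<alpha> n Y m Z" and m: "0 < m"
  shows "n dvd m" "m = n \<Longrightarrow> 0 < k \<Longrightarrow> k < n \<Longrightarrow> conjugate_order n Y k \<le> conjugate_order n Z k"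
proof -
  have n: "0 < n" using D by (simp add: puiseux_def)
  have big: "real n < \<alpha>\<^sup>2 * real (conjugate_order n Y k)" if k: "0 < k" "k < n" for k
  proof (rule ccontr)
    assume "\<not> ?thesis"
    then have "\<alpha>\<^sup>2 * real (conjugate_order n Y k) \<le> real n" by simp
    from nat_le_if_almost[OF M(1,2) M(3)[OF k] this] show False using conjugate_order_gt[OF D k] by simp
  qed
  have ex: "\<exists>l. 0 < l \<and> l < m \<and> (rt m ^ l = rt n ^ k \<or> rt m ^ l = inverse (rt n ^ k)) \<and>
       real (m * conjugate_order n Y k) * \<alpha>\<^sup>2 \<le> real (n * conjugate_order m Z l)" if k: "0 < k" "k < n" for k
    using R k big[OF k] unfolding rotates_def by blast
  show "n dvd m"
  proof (cases "n = 1")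
    case False
    then obtain l where l: "rt m ^ l = rt n ^ 1 \<or> rt m ^ l = inverse (rt n ^ 1)" using ex[of 1] n by auto
    have "(rt m ^ l) ^ m = 1" using rt_power_mult_power[of m l 1] by simp
    then have "rt n ^ m = 1" using l by (auto simp: power_inverse)
    then show ?thesis using rt_power_eq_1_iff[OF n] by blast
  qed simp
  show "conjugate_order n Y k \<le> conjugate_order n Z k" if "m = n" and k: "0 < k" "k < n"
  proof -
    obtain l where l: "0 < l" "l < n" "rt n ^ l = rt n ^ k \<or> rt n ^ l = inverse (rt n ^ k)"
      "real (n * conjugate_order n Y k) * \<alpha>\<^sup>2 \<le> real (n * conjugate_order n Z l)" using ex[OF k] \<open>m = n\<close> by blast
    have "\<alpha>\<^sup>2 * real (conjugate_order n Y k) \<le> real (conjugate_order n Z l)" using l(4) n by (simp add: mult_ac)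
    then have le: "conjugate_order n Y k \<le> conjugate_order n Z l" by (rule nat_le_if_almost[OF M(1,2) M(3)[OF k]])
    have "rt n ^ (n - k) * rt n ^ k = 1" using k rt_power_self[of n] by (simp flip: power_add)
    then have "inverse (rt n ^ k) = rt n ^ (n - k)" by (metis inverse_unique mult.commute)
    then have "l = k \<or> l = n - k" using l(3) rt_inj[of l n k] rt_inj[of l n "n - k"] l k by auto
    then show ?thesis using le conjugate_order_complement[OF k(2), of Z] by auto
  qed
qed

section \<open>Hoelder equivalent curves\<close>

lemma eventually_less_at_right:
  assumes "0 < (d :: real)"
  shows "\<forall>\<^sub>F \<delta> in at_right 0. \<delta> < d"
  using assms by (rule eventually_at_right_real[THEN eventually_mono]) auto

lemma eventually_cball:
  assumes "\<forall>\<^sub>F t in nhds (0 :: complex). A t"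
  shows "\<forall>\<^sub>F \<delta> in at_right (0 :: real). \<forall>t\<in>cball 0 \<delta>. A t"
proof -
  obtain d where d: "d > 0" "\<And>t. norm t < d \<Longrightarrow> A t" using assms unfolding eventually_nhds_metric by auto
  have "\<forall>\<^sub>F \<delta> in at_right (0::real). \<delta> < d" using d(1) by (rule eventually_less_at_right)
  then show ?thesis by eventually_elim (use d(2) in auto)
qed

lemma puiseux_curve_zero:
  assumes "puiseux c n y Y D"
  shows "puiseux_curve c n y 0 = 0"
  using puiseux_analytic(2)[OF assms] assms by (simp add: puiseux_curve_def puiseux_def zero_prod_def power_0_left)

lemma puiseux_member:
  assumes D: "puiseux c n y Y D"
  shows "\<forall>\<^sub>F t in nhds 0. puiseux_curve c n y t \<in> D"
proof -
  have n: "0 < n" and DZ: "\<forall>\<^sub>F p in nhds 0. (fst p + c * snd p, snd p) \<in> D \<longleftrightarrow> (\<exists>t. t ^ n = fst p \<and> snd p = y t)"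
    using D by (auto simp: puiseux_def)
  have "(\<lambda>t. t ^ n) analytic_on {0}" by (intro analytic_intros)
  then have "\<forall>\<^sub>F t in nhds 0. (fst (t ^ n, y t) + c * snd (t ^ n, y t), snd (t ^ n, y t)) \<in> D \<longleftrightarrow>
      (\<exists>u. u ^ n = fst (t ^ n, y t) \<and> snd (t ^ n, y t) = y u)"
    using n puiseux_analytic[OF D] by (intro eventually_compose_curve[OF DZ]) (auto simp: power_0_left)
  then show ?thesis
  proof eventually_elim
    case (elim t)
    then show ?case unfolding puiseux_curve_def fst_conv snd_conv by blast
  qed
qed

lemma puiseux_local:
  assumes D: "puiseux c n y Y D"
  shows "\<forall>\<^sub>F \<delta> in at_right 0. continuous_on (cball 0 \<delta>) (puiseux_curve c n y) \<and> inj_on (puiseux_curve c n y) (cball 0 \<delta>)"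
proof -
  obtain K d where d: "0 < d" and Kd: "\<And>t. norm t < d \<Longrightarrow> (y has_field_derivative deriv y t) (at t)"
    using puiseux_deriv_bound[OF D] by metis
  have g: "puiseux_curve c n y = (\<lambda>t. (t ^ n + c * y t, y t))" by (rule ext) (simp add: puiseux_curve_def)
  have "\<forall>\<^sub>F \<epsilon> in at_right (0::real). inj_on (puiseux_curve c n y) (ball 0 \<epsilon>) \<and> 0 < \<epsilon>"
    using puiseux_parametrizes[OF D] unfolding parametrizes_def g
    by (auto simp: eventually_conj_iff eventually_at_right_less elim: eventually_mono)
  then have "\<exists>\<epsilon>. inj_on (puiseux_curve c n y) (ball 0 \<epsilon>) \<and> 0 < \<epsilon>" by (rule eventually_happens'[rotated]) simp
  then obtain \<epsilon> where \<epsilon>: "inj_on (puiseux_curve c n y) (ball 0 \<epsilon>)" "0 < \<epsilon>" by blast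
  have "\<forall>\<^sub>F \<delta> in at_right (0::real). \<delta> < min d \<epsilon>"
    using d \<epsilon>(2) by (intro eventually_less_at_right) auto
  then show ?thesis
  proof eventually_elim
    case (elim \<delta>)
    have sub: "cball 0 \<delta> \<subseteq> ball (0::complex) \<epsilon>" using elim by auto
    have "continuous_on (cball 0 \<delta>) y"
    proof (rule continuous_at_imp_continuous_on, rule ballI)
      fix t :: complex assume "t \<in> cball 0 \<delta>"
      then have "norm t < d" using elim by auto
      from DERIV_isCont[OF Kd[OF this]] show "isCont y t" .
    qed
    then have "continuous_on (cball 0 \<delta>) (puiseux_curve c n y)" unfolding g by (intro continuous_intros)
    then show ?case using inj_on_subset[OF \<epsilon>(1) sub] by blast
  qed
qed

lemma puiseux_cover:
  assumes D: "puiseux c n y Y D" and \<delta>: "0 < \<delta>"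
  shows "\<forall>\<^sub>F p in nhds 0. p \<in> D \<longrightarrow> p \<in> puiseux_curve c n y ` ball 0 \<delta>"
proof (rule eventually_unshear[where c = c])
  have DZ: "\<forall>\<^sub>F p in nhds 0. (fst p + c * snd p, snd p) \<in> D \<longleftrightarrow> (\<exists>t. t ^ n = fst p \<and> snd p = y t)"
    using D by (auto simp: puiseux_def)
  have "\<forall>\<^sub>F p in nhds (0 :: complex \<times> complex). norm (fst p) < \<delta> ^ n"
    using \<delta> by (intro eventually_nhds_small2 analytic2_intros) auto
  with DZ show "\<forall>\<^sub>F p in nhds 0. (fst p + c * snd p, snd p) \<in> D \<longrightarrow> (fst p + c * snd p, snd p) \<in> puiseux_curve c n y ` ball 0 \<delta>"
  proof eventually_elim
    case (elim p)
    show ?case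
    proof
      assume "(fst p + c * snd p, snd p) \<in> D"
      then obtain t where t: "t ^ n = fst p" "snd p = y t" using elim(1) by blast
      have "norm t < \<delta>" using elim(2) t(1) \<delta> by (intro root_small[of t n]) auto
      moreover have "(fst p + c * snd p, snd p) = puiseux_curve c n y t" using t by (simp add: puiseux_curve_def)
      ultimately show "(fst p + c * snd p, snd p) \<in> puiseux_curve c n y ` ball 0 \<delta>" by simp
    qed
  qed
qed

text \<open>By \<open>contact_separation\<close> a point of one branch off 0 has positive distance
  from the nearby points of the other.\<close>

lemma puiseux_disjoint:
  assumes D: "puiseux c n y Y D" and D': "puiseux c n' y' Y' D'" and ne: "\<not> germ_le D D'"
  shows "\<forall>\<^sub>F \<delta> in at_right 0. \<forall>t\<in>cball 0 \<delta>. \<forall>u\<in>cball 0 \<delta>. puiseux_curve c n y t = puiseux_curve c n' y' u \<longrightarrow> t = 0"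
proof -
  have n': "0 < n'" using D' by (simp add: puiseux_def)
  obtain Q \<zeta> where Q: "contact n y n' y' Q \<zeta>" using contact_exists[OF D D' ne] by blast
  obtain c1 d where c1: "c1 > 0" "d > 0"
    and sep: "\<And>s v. s \<noteq> 0 \<Longrightarrow> norm s < d \<Longrightarrow> norm v < d \<Longrightarrow> c1 * norm s ^ Q \<le> norm (puiseux_curve c n y (s ^ n') - puiseux_curve c n' y' v)"
    using contact_separation[OF D D' Q] by metis
  have "\<forall>\<^sub>F \<delta> in at_right (0::real). \<delta> < min (d ^ n') d"
    using c1(2) by (intro eventually_less_at_right) auto
  then show ?thesis
  proof eventually_elim
    case (elim \<delta>)
    show ?case
    proof (intro ballI impI)
      fix t u assume t: "t \<in> cball 0 \<delta>" and u: "u \<in> cball 0 \<delta>" and eq: "puiseux_curve c n y t = puiseux_curve c n' y' u"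
      obtain s where s: "s ^ n' = t" using exists_root[OF n'] by blast
      have "norm (s ^ n') < d ^ n'" using elim t s by simp
      then have sd: "norm s < d" using c1(2) by (rule root_small)
      have "norm u < d" using u elim by simp
      show "t = 0"
      proof (rule ccontr)
        assume "t \<noteq> 0"
        then have s0: "s \<noteq> 0" using s n' by (auto simp: power_0_left)
        have "c1 * norm s ^ Q \<le> 0" using sep[OF s0 sd \<open>norm u < d\<close>] by (simp add: s eq)
        moreover have "0 < c1 * norm s ^ Q" using c1(1) s0 by simp
        ultimately show False by simp
      qed
    qed
  qed
qed

text \<open>The shear comes from an equation of the whole curve, and every branch inherits the cone
  condition from it. A common radius exists because each requirement holds for all small radii and
  there are finitely many branches.\<close>

lemma curve_chart:
  assumes C: "plane_curve_germ C" and B: "branches C r B"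
  shows "1 \<le> r \<and> (\<exists>c n y Y \<delta>. (\<forall>i\<in>{1..r}. puiseux c (n i) (y i) (Y i) (B i)) \<and> chart C r (\<lambda>i. puiseux_curve c (n i) (y i)) \<delta>)"
proof -
  obtain f where f: "analytic2 f" "f 0 = 0" "\<not> (\<forall>\<^sub>F p in nhds 0. f p = 0)" "germ_eq C {p. f p = 0}"
    using C unfolding plane_curve_germ_def by blast
  have br: "\<And>i. i \<in> {1..r} \<Longrightarrow> branch (B i)" and CB: "\<forall>\<^sub>F p in nhds 0. p \<in> C \<longleftrightarrow> p \<in> (\<Union>i\<in>{1..r}. B i)"
    and dist: "\<And>i j. i \<in> {1..r} \<Longrightarrow> j \<in> {1..r} \<Longrightarrow> i \<noteq> j \<Longrightarrow> \<not> germ_le (B i) (B j)"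
    using B unfolding branches_def germ_eq_def by blast+
  have Cf: "\<forall>\<^sub>F p in nhds 0. p \<in> C \<longleftrightarrow> f p = 0" using f(4) by (simp add: germ_eq_def)
  have "0 \<in> C" using eventually_nhds_x_imp_x[OF Cf] f(2) by blast
  then have "0 \<in> (\<Union>i\<in>{1..r}. B i)" using eventually_nhds_x_imp_x[OF CB] by blast
  then have r: "1 \<le> r" by auto
  obtain c K where cone: "\<forall>\<^sub>F p in nhds 0. f (fst p + c * snd p, snd p) = 0 \<longrightarrow> norm (snd p) \<le> K * norm (fst p)"
    using good_direction[OF f(1,3)] by blast
  have Bf: "\<forall>\<^sub>F p in nhds 0. p \<in> B i \<longrightarrow> f p = 0" if "i \<in> {1..r}" for i
    using CB Cf by eventually_elim (use that in blast)
  have "\<forall>i\<in>{1..r}. \<exists>x. puiseux c (fst x) (fst (snd x)) (snd (snd x)) (B i)"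
  proof
    fix i assume i: "i \<in> {1..r}"
    obtain h where h: "analytic2 h" "h 0 = 0" "germ_eq (B i) {p. h p = 0}"
      using br[OF i] unfolding branch_def plane_curve_germ_def by blast
    have irr: "irreducible_germ (B i)" using br[OF i] by (simp add: branch_def)
    have "\<forall>\<^sub>F p in nhds 0. (fst p + c * snd p, snd p) \<in> B i \<longrightarrow> norm (snd p) \<le> K * norm (fst p)"
      using eventually_shear[OF Bf[OF i], of c] cone by eventually_elim blast
    from branch_puiseux[OF irr h this] obtain n y Y where "puiseux c n y Y (B i)" by blast
    then show "\<exists>x. puiseux c (fst x) (fst (snd x)) (snd (snd x)) (B i)" by (intro exI[of _ "(n, y, Y)"]) simp
  qed
  from bchoice[OF this] obtain x where x: "\<forall>i\<in>{1..r}. puiseux c (fst (x i)) (fst (snd (x i))) (snd (snd (x i))) (B i)" ..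
  define n where "n = (\<lambda>i. fst (x i))"
  define y where "y = (\<lambda>i. fst (snd (x i)))"
  define Y where "Y = (\<lambda>i. snd (snd (x i)))"
  have P: "puiseux c (n i) (y i) (Y i) (B i)" if "i \<in> {1..r}" for i using x that by (simp add: n_def y_def Y_def)
  define \<gamma> where "\<gamma> = (\<lambda>i. puiseux_curve c (n i) (y i))"
  have E1: "\<forall>\<^sub>F \<delta> in at_right 0. \<forall>i\<in>{1..r}. continuous_on (cball 0 \<delta>) (\<gamma> i) \<and> inj_on (\<gamma> i) (cball 0 \<delta>)"
    unfolding \<gamma>_def by (intro eventually_ball_finite ballI puiseux_local[OF P]) auto
  have E2: "\<forall>\<^sub>F \<delta> in at_right 0. \<forall>i\<in>{1..r}. \<forall>t\<in>cball 0 \<delta>. \<gamma> i t \<in> C"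
  proof (intro eventually_ball_finite ballI eventually_cball)
    fix i assume i: "i \<in> {1..r}"
    note yi = puiseux_analytic[OF P[OF i]]
    have ni: "0 < n i" using P[OF i] by (simp add: puiseux_def)
    have "(\<lambda>t. t ^ n i + c * y i t) analytic_on {0}" by (intro analytic_intros yi(1))
    then have "\<forall>\<^sub>F t in nhds 0. (t ^ n i + c * y i t, y i t) \<in> C \<longleftrightarrow> (t ^ n i + c * y i t, y i t) \<in> (\<Union>i\<in>{1..r}. B i)"
      using ni yi by (intro eventually_compose_curve[OF CB]) (auto simp: power_0_left)
    with puiseux_member[OF P[OF i]] show "\<forall>\<^sub>F t in nhds 0. \<gamma> i t \<in> C"
    proof eventually_elim
      case (elim t)
      then show ?case using i unfolding \<gamma>_def puiseux_curve_def by blast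
    qed
  qed simp
  have E3: "\<forall>\<^sub>F \<delta> in at_right 0. \<forall>i\<in>{1..r}. \<forall>j\<in>{1..r} - {i}. \<forall>t\<in>cball 0 \<delta>. \<forall>u\<in>cball 0 \<delta>. \<gamma> i t = \<gamma> j u \<longrightarrow> t = 0"
  proof (rule eventually_ball_finite, simp, rule ballI, rule eventually_ball_finite, simp, rule ballI)
    fix i j assume "i \<in> {1..r}" "j \<in> {1..r} - {i}"
    then show "\<forall>\<^sub>F \<delta> in at_right 0. \<forall>t\<in>cball 0 \<delta>. \<forall>u\<in>cball 0 \<delta>. \<gamma> i t = \<gamma> j u \<longrightarrow> t = 0"
      unfolding \<gamma>_def by (intro puiseux_disjoint[OF P P dist]) auto
  qed
  have "\<forall>\<^sub>F \<delta> in at_right (0::real). 0 < \<delta>" by (rule eventually_at_right_less)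
  with E1 E2 E3 have "\<forall>\<^sub>F \<delta> in at_right 0. 0 < \<delta> \<and> (\<forall>i\<in>{1..r}. continuous_on (cball 0 \<delta>) (\<gamma> i) \<and> inj_on (\<gamma> i) (cball 0 \<delta>)) \<and>
     (\<forall>i\<in>{1..r}. \<forall>t\<in>cball 0 \<delta>. \<gamma> i t \<in> C) \<and>
     (\<forall>i\<in>{1..r}. \<forall>j\<in>{1..r} - {i}. \<forall>t\<in>cball 0 \<delta>. \<forall>u\<in>cball 0 \<delta>. \<gamma> i t = \<gamma> j u \<longrightarrow> t = 0)"
    by eventually_elim (intro conjI)
  from eventually_happens'[OF _ this] obtain \<delta> where \<delta>: "0 < \<delta>"
    and c1: "\<forall>i\<in>{1..r}. continuous_on (cball 0 \<delta>) (\<gamma> i) \<and> inj_on (\<gamma> i) (cball 0 \<delta>)"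
    and c2: "\<forall>i\<in>{1..r}. \<forall>t\<in>cball 0 \<delta>. \<gamma> i t \<in> C"
    and c3: "\<forall>i\<in>{1..r}. \<forall>j\<in>{1..r} - {i}. \<forall>t\<in>cball 0 \<delta>. \<forall>u\<in>cball 0 \<delta>. \<gamma> i t = \<gamma> j u \<longrightarrow> t = 0"
    by auto
  have cov: "\<forall>\<^sub>F p in nhds 0. \<forall>i\<in>{1..r}. p \<in> B i \<longrightarrow> p \<in> \<gamma> i ` ball 0 \<delta>"
    unfolding \<gamma>_def by (intro eventually_ball_finite ballI puiseux_cover[OF P \<delta>]) auto
  have "\<forall>\<^sub>F p in nhds 0. p \<in> C \<longrightarrow> p \<in> (\<Union>i\<in>{1..r}. \<gamma> i ` ball 0 \<delta>)"
    using cov CB by eventually_elim blast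
  then obtain \<rho> where \<rho>: "\<rho> > 0" "\<And>p. dist p 0 < \<rho> \<Longrightarrow> p \<in> C \<longrightarrow> p \<in> (\<Union>i\<in>{1..r}. \<gamma> i ` ball 0 \<delta>)"
    unfolding eventually_nhds_metric by metis
  have cov2: "C \<inter> ball 0 \<rho> \<subseteq> (\<Union>i\<in>{1..r}. \<gamma> i ` ball 0 \<delta>)"
  proof
    fix p assume "p \<in> C \<inter> ball 0 \<rho>"
    then show "p \<in> (\<Union>i\<in>{1..r}. \<gamma> i ` ball 0 \<delta>)" using \<rho>(2)[of p] by (simp add: dist_commute)
  qed
  have "chart C r \<gamma> \<delta>"
    unfolding chart_def
  proof (intro conjI ballI impI)
    fix i assume i: "i \<in> {1..r}"
    show "continuous_on (cball 0 \<delta>) (\<gamma> i)" using c1 i by blast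
    show "\<gamma> i 0 = 0" unfolding \<gamma>_def by (rule puiseux_curve_zero[OF P[OF i]])
    show "\<gamma> i ` cball 0 \<delta> \<subseteq> C" using c2 i by blast
    fix j t u assume j: "j \<in> {1..r}" and tu: "t \<in> cball 0 \<delta>" "u \<in> cball 0 \<delta>" and eq: "\<gamma> i t = \<gamma> j u"
    show "i = j \<and> t = u \<or> t = 0 \<and> u = 0"
    proof (cases "i = j")
      case True
      then have "t = u" using c1 i tu eq by (metis inj_onD)
      then show ?thesis using True by blast
    next
      case False
      have "t = 0" using c3 i j tu eq False by blast
      moreover have "u = 0" using c3 i j tu eq[symmetric] False by blast
      ultimately show ?thesis by blast
    qed
  next
    show "\<exists>\<rho>>0. C \<inter> ball 0 \<rho> \<subseteq> (\<Union>i\<in>{1..r}. \<gamma> i ` ball 0 \<delta>)" using \<rho>(1) cov2 by blast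
  qed fact
  then have ch: "chart C r (\<lambda>i. puiseux_curve c (n i) (y i)) \<delta>" by (simp add: \<gamma>_def)
  have all: "\<forall>i\<in>{1..r}. puiseux c (n i) (y i) (Y i) (B i)" using P by blast
  show ?thesis
    by (rule conjI, rule r, rule exI[of _ c], rule exI[of _ n], rule exI[of _ y], rule exI[of _ Y], rule exI[of _ \<delta>],
      rule conjI, rule all, rule ch)
qed

text \<open>Collects what one Hoelder map yields. The clause following \<open>f\<close> along each
  branch is recorded so that the branch assignments of \<open>f\<close> and of its inverse, which
  come from two separate applications, can be compared.\<close>

theorem curve_transfer:
  fixes \<alpha> :: real
  assumes P: "\<forall>i\<in>{1..r}. puiseux c (n i) (y i) (Y i) (B i)" and P': "\<forall>i\<in>{1..s}. puiseux c' (n' i) (y' i) (Y' i) (B' i)"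
    and \<gamma>: "\<And>i. \<gamma> i = puiseux_curve c (n i) (y i)" and \<gamma>': "\<And>i. \<gamma>' i = puiseux_curve c' (n' i) (y' i)"
    and C: "chart C r \<gamma> \<delta>" and C': "chart C' s \<gamma>' \<delta>'"
    and hom: "homeomorphism (C \<inter> U) (C' \<inter> V) f g" and U: "open U" "0 \<in> U" and V: "open V" "0 \<in> V"
    and f0: "f 0 = 0" and r: "1 \<le> r" and \<alpha>: "0 < \<alpha>"
    and Hf: "holder_on \<alpha> (C \<inter> U) f" and Hg: "holder_on \<alpha> (C' \<inter> V) g"
  shows "\<exists>\<sigma>. bij_betw \<sigma> {1..r} {1..s} \<and>
    (\<forall>i\<in>{1..r}. \<exists>d \<phi>. 0 < d \<and> continuous_on (ball 0 d) \<phi> \<and> \<phi> 0 = 0 \<and>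
       (\<forall>t\<in>ball 0 d. t \<in> ball 0 \<delta> \<and> \<phi> t \<in> ball 0 \<delta>' \<and> \<gamma> i t \<in> C \<inter> U \<and> f (\<gamma> i t) = \<gamma>' (\<sigma> i) (\<phi> t))) \<and>
    (\<forall>i\<in>{1..r}. rotates \<alpha> (n i) (Y i) (n' (\<sigma> i)) (Y' (\<sigma> i))) \<and>
    (\<forall>i\<in>{1..r}. \<forall>j\<in>{1..r}. \<forall>Q \<zeta> Q' \<zeta>'. n i = n' (\<sigma> i) \<and> n j = n' (\<sigma> j) \<and>
       contact (n i) (y i) (n j) (y j) Q \<zeta> \<and> contact (n i) (y' (\<sigma> i)) (n j) (y' (\<sigma> j)) Q' \<zeta>' \<longrightarrow> \<alpha>\<^sup>2 * real Q \<le> real Q')"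
proof -
  obtain k1 where k1: "k1 > 0" "\<And>p q. p \<in> C \<inter> U \<Longrightarrow> q \<in> C \<inter> U \<Longrightarrow> norm (f p - f q) \<le> k1 * norm (p - q) powr \<alpha>"
    using Hf unfolding holder_on_def by metis
  obtain k2 where k2: "k2 > 0" "\<And>p q. p \<in> C' \<inter> V \<Longrightarrow> q \<in> C' \<inter> V \<Longrightarrow> norm (g p - g q) \<le> k2 * norm (p - q) powr \<alpha>"
    using Hg unfolding holder_on_def by metis
  have gf: "\<And>p. p \<in> C \<inter> U \<Longrightarrow> g (f p) = p" and fim: "\<And>p. p \<in> C \<inter> U \<Longrightarrow> f p \<in> C' \<inter> V"
    using hom by (auto simp: homeomorphism_def)
  have \<delta>: "0 < \<delta>" using C by (simp add: chart_def)
  have zC: "0 \<in> C \<inter> U"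
  proof -
    have "\<gamma> 1 0 = 0" "\<gamma> 1 ` cball 0 \<delta> \<subseteq> C" using C r unfolding chart_def by auto
    then show ?thesis using \<delta> U by (metis IntI centre_in_cball image_subset_iff less_imp_le)
  qed
  obtain \<sigma> \<phi> \<psi> d d' where bij: "bij_betw \<sigma> {1..r} {1..s}" and H: "\<forall>i\<in>{1..r}.
    0 < d i \<and> 0 < d' i \<and> d i \<le> \<delta> \<and> d' i \<le> \<delta>' \<and>
    continuous_on (ball 0 (d i)) (\<phi> i) \<and> \<phi> i 0 = 0 \<and> continuous_on (ball 0 (d' i)) (\<psi> i) \<and>
    (\<forall>t\<in>ball 0 (d i). \<phi> i t \<in> ball 0 (d' i) \<and> \<psi> i (\<phi> i t) = t \<and> (t \<noteq> 0 \<longrightarrow> \<phi> i t \<noteq> 0) \<and>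
       \<gamma> i t \<in> C \<inter> U \<and> f (\<gamma> i t) = \<gamma>' (\<sigma> i) (\<phi> i t)) \<and>
    (\<forall>t\<in>ball 0 (d' i). t \<noteq> 0 \<longrightarrow> \<psi> i t \<noteq> (0 :: complex))"
    using chart_correspondence[OF C C' hom U V f0 r] by (elim exE conjE) (rule that)
  have d: "0 < d i" "0 < d' i" "d i \<le> \<delta>" "d' i \<le> \<delta>'" and \<phi>c: "continuous_on (ball 0 (d i)) (\<phi> i)" "\<phi> i 0 = 0"
    and \<psi>c: "continuous_on (ball 0 (d' i)) (\<psi> i)" if "i \<in> {1..r}" for i
    using H that by blast+
  have \<phi>: "\<phi> i t \<in> ball 0 (d' i)" "\<psi> i (\<phi> i t) = t" "t \<noteq> 0 \<Longrightarrow> \<phi> i t \<noteq> 0" "\<gamma> i t \<in> C \<inter> U" "f (\<gamma> i t) = \<gamma>' (\<sigma> i) (\<phi> i t)"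
    if "i \<in> {1..r}" "t \<in> ball 0 (d i)" for i t using H that by blast+
  have \<psi>: "\<psi> i t \<noteq> 0" if "i \<in> {1..r}" "t \<in> ball 0 (d' i)" "t \<noteq> 0" for i t using H that by blast
  have \<sigma>: "\<sigma> i \<in> {1..s}" if "i \<in> {1..r}" for i using bij that by (auto simp: bij_betw_def)
  have h1: "norm (\<gamma>' (\<sigma> i) (\<phi> i t) - \<gamma>' (\<sigma> j) (\<phi> j u)) \<le> k1 * norm (\<gamma> i t - \<gamma> j u) powr \<alpha>"
    if "i \<in> {1..r}" "j \<in> {1..r}" "t \<in> ball 0 (d i)" "u \<in> ball 0 (d j)" for i j t u
    using k1(2)[OF \<phi>(4)[OF that(1,3)] \<phi>(4)[OF that(2,4)]] \<phi>(5)[OF that(1,3)] \<phi>(5)[OF that(2,4)] by simp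
  have h2: "norm (\<gamma> i t) \<le> k2 * norm (\<gamma>' (\<sigma> i) (\<phi> i t)) powr \<alpha>" if "i \<in> {1..r}" "t \<in> ball 0 (d i)" for i t
  proof -
    note z = \<phi>(4)[OF that]
    have "norm (g (f (\<gamma> i t)) - g (f 0)) \<le> k2 * norm (f (\<gamma> i t) - f 0) powr \<alpha>" by (rule k2(2)[OF fim[OF z] fim[OF zC]])
    then show ?thesis unfolding gf[OF z] gf[OF zC] by (simp add: f0 \<phi>(5)[OF that])
  qed
  have track: "\<forall>i\<in>{1..r}. \<exists>d \<phi>. 0 < d \<and> continuous_on (ball 0 d) \<phi> \<and> \<phi> 0 = 0 \<and>
       (\<forall>t\<in>ball 0 d. t \<in> ball 0 \<delta> \<and> \<phi> t \<in> ball 0 \<delta>' \<and> \<gamma> i t \<in> C \<inter> U \<and> f (\<gamma> i t) = \<gamma>' (\<sigma> i) (\<phi> t))"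
  proof
    fix i assume i: "i \<in> {1..r}"
    have s1: "ball 0 (d i) \<subseteq> ball (0::complex) \<delta>" "ball 0 (d' i) \<subseteq> ball (0::complex) \<delta>'"
      using d(3,4)[OF i] by (simp_all add: subset_ball)
    show "\<exists>d \<phi>. 0 < d \<and> continuous_on (ball 0 d) \<phi> \<and> \<phi> 0 = 0 \<and>
       (\<forall>t\<in>ball 0 d. t \<in> ball 0 \<delta> \<and> \<phi> t \<in> ball 0 \<delta>' \<and> \<gamma> i t \<in> C \<inter> U \<and> f (\<gamma> i t) = \<gamma>' (\<sigma> i) (\<phi> t))"
    proof (rule exI[of _ "d i"], rule exI[of _ "\<phi> i"], intro conjI ballI)
      fix t assume t: "t \<in> ball (0::complex) (d i)"
      show "t \<in> ball 0 \<delta>" using t s1 by blast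
      show "\<phi> i t \<in> ball 0 \<delta>'" using \<phi>(1)[OF i t] s1 by blast
      show "\<gamma> i t \<in> C \<inter> U" by (rule \<phi>(4)[OF i t])
      show "f (\<gamma> i t) = \<gamma>' (\<sigma> i) (\<phi> i t)" by (rule \<phi>(5)[OF i t])
    qed (rule d(1)[OF i] \<phi>c[OF i])+
  qed
  have rot: "\<forall>i\<in>{1..r}. rotates \<alpha> (n i) (Y i) (n' (\<sigma> i)) (Y' (\<sigma> i))"
  proof
    fix i assume i: "i \<in> {1..r}"
    note Pi = bspec[OF P i] and Pi' = bspec[OF P' \<sigma>[OF i]]
    show "rotates \<alpha> (n i) (Y i) (n' (\<sigma> i)) (Y' (\<sigma> i))"
      unfolding rotates_def
    proof (intro allI impI)
      fix k assume k: "0 < k \<and> k < n i \<and> real (n i) < \<alpha>\<^sup>2 * real (conjugate_order (n i) (Y i) k)"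
      show "\<exists>l. 0 < l \<and> l < n' (\<sigma> i) \<and> (rt (n' (\<sigma> i)) ^ l = rt (n i) ^ k \<or> rt (n' (\<sigma> i)) ^ l = inverse (rt (n i) ^ k)) \<and>
          real (n' (\<sigma> i) * conjugate_order (n i) (Y i) k) * \<alpha>\<^sup>2 \<le> real (n i * conjugate_order (n' (\<sigma> i)) (Y' (\<sigma> i)) l)"
      proof (rule rotation_transfer[OF Pi Pi', where \<delta> = "d i" and \<delta>' = "d' i" and \<phi> = "\<phi> i" and \<psi> = "\<psi> i" and ?k1.0 = k1 and ?k2.0 = k2])
        fix t u :: complex assume t: "t \<in> ball 0 (d i)" "u \<in> ball 0 (d i)"
        show "norm (puiseux_curve c' (n' (\<sigma> i)) (y' (\<sigma> i)) (\<phi> i t) - puiseux_curve c' (n' (\<sigma> i)) (y' (\<sigma> i)) (\<phi> i u))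
            \<le> k1 * norm (puiseux_curve c (n i) (y i) t - puiseux_curve c (n i) (y i) u) powr \<alpha>"
          using h1[OF i i t] unfolding \<gamma> \<gamma>' .
      next
        fix t :: complex assume t: "t \<in> ball 0 (d i)"
        show "norm (puiseux_curve c (n i) (y i) t) \<le> k2 * norm (puiseux_curve c' (n' (\<sigma> i)) (y' (\<sigma> i)) (\<phi> i t)) powr \<alpha>"
          using h2[OF i t] unfolding \<gamma> \<gamma>' .
      qed (use i d \<phi>c \<psi>c \<phi> \<psi> k \<alpha> k1(1) k2(1) in blast)+
    qed
  qed
  have con: "\<alpha>\<^sup>2 * real Q \<le> real Q'"
    if ij: "i \<in> {1..r}" "j \<in> {1..r}" and nn: "n i = n' (\<sigma> i)" "n j = n' (\<sigma> j)"
      and Q: "contact (n i) (y i) (n j) (y j) Q \<zeta>" and Q': "contact (n i) (y' (\<sigma> i)) (n j) (y' (\<sigma> j)) Q' \<zeta>'" for i j Q \<zeta> Q' \<zeta>'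
  proof -
    note Pi = bspec[OF P ij(1)] and Pj = bspec[OF P ij(2)]
    have Pi': "puiseux c' (n i) (y' (\<sigma> i)) (Y' (\<sigma> i)) (B' (\<sigma> i))" using bspec[OF P' \<sigma>[OF ij(1)]] nn by simp
    have Pj': "puiseux c' (n j) (y' (\<sigma> j)) (Y' (\<sigma> j)) (B' (\<sigma> j))" using bspec[OF P' \<sigma>[OF ij(2)]] nn by simp
    show ?thesis
    proof (rule contact_transfer[OF Pi Pj Q Pi' Pj' Q', where ?d1.0 = "d i" and ?d2.0 = "d j" and ?\<phi>1.0 = "\<phi> i" and ?\<phi>2.0 = "\<phi> j" and ?k1.0 = k1 and ?k2.0 = k2])
      fix t u :: complex assume t: "t \<in> ball 0 (d i)" "u \<in> ball 0 (d j)"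
      show "norm (puiseux_curve c' (n i) (y' (\<sigma> i)) (\<phi> i t) - puiseux_curve c' (n j) (y' (\<sigma> j)) (\<phi> j u))
            \<le> k1 * norm (puiseux_curve c (n i) (y i) t - puiseux_curve c (n j) (y j) u) powr \<alpha>"
        using h1[OF ij t] unfolding \<gamma> \<gamma>' nn[symmetric] .
    next
      fix t :: complex assume t: "t \<in> ball 0 (d i)"
      show "norm (puiseux_curve c (n i) (y i) t) \<le> k2 * norm (puiseux_curve c' (n i) (y' (\<sigma> i)) (\<phi> i t)) powr \<alpha>"
        using h2[OF ij(1) t] unfolding \<gamma> \<gamma>' nn[symmetric] .
    qed (use ij d \<phi>c \<phi> \<alpha> k1(1) k2(1) in blast)+
  qed
  show ?thesis
  proof (rule exI[of _ \<sigma>], intro conjI)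
    show "\<forall>i\<in>{1..r}. \<forall>j\<in>{1..r}. \<forall>Q \<zeta> Q' \<zeta>'. n i = n' (\<sigma> i) \<and> n j = n' (\<sigma> j) \<and>
       contact (n i) (y i) (n j) (y j) Q \<zeta> \<and> contact (n i) (y' (\<sigma> i)) (n j) (y' (\<sigma> j)) Q' \<zeta>' \<longrightarrow> \<alpha>\<^sup>2 * real Q \<le> real Q'"
      by (intro ballI allI impI, elim conjE) (rule con)
  qed (fact bij track rot)+
qed

text \<open>The witness is \<open>1 - 1 / (2 * M)\<close>; its square exceeds
  \<open>1 - 1 / M\<close> by the square of \<open>1 / (2 * M)\<close>.\<close>

lemma exists_near_one:
  assumes "0 < (M :: nat)"
  shows "\<exists>\<alpha>::real. 0 < \<alpha> \<and> \<alpha> < 1 \<and> 1 - 1 / real M < \<alpha>\<^sup>2"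
proof (intro exI conjI)
  define x where "x = 1 / (2 * real M)"
  have x: "0 < x" "x \<le> 1/2" using assms by (auto simp: x_def field_simps)
  have M: "1 / real M = 2 * x" by (simp add: x_def)
  show "0 < 1 - x" "1 - x < 1" using x by auto
  have "0 < x\<^sup>2" using x by simp
  then show "1 - 1 / real M < (1 - x)\<^sup>2" unfolding M by (simp add: power2_eq_square algebra_simps)
qed

theorem theorem4p7:
  fixes C C' :: "(complex \<times> complex) set"
    and B B' :: "nat \<Rightarrow> (complex \<times> complex) set"
    and r s :: nat
  assumes "plane_curve_germ C" and "plane_curve_germ C'"
    and "branches C r B" and "branches C' s B'"
    and "\<And>\<alpha>::real. 0 < \<alpha> \<Longrightarrow> \<alpha> < 1 \<Longrightarrow> bi_holder_equivalent \<alpha> C C'"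
  shows "\<exists>\<sigma>. bij_betw \<sigma> {1..r} {1..s} \<and>
     (\<forall>i\<in>{1..r}. \<exists>\<beta>. has_characteristic_exponents (B i) \<beta> \<and>
                      has_characteristic_exponents (B' (\<sigma> i)) \<beta>) \<and>
     (\<forall>i\<in>{1..r}. \<forall>j\<in>{1..r}. i \<noteq> j \<longrightarrow>
        (\<exists>k. has_intersection_multiplicity (B i) (B j) k \<and>
             has_intersection_multiplicity (B' (\<sigma> i)) (B' (\<sigma> j)) k))"
proof -
  obtain c n y Y \<delta> where r: "1 \<le> r" and P: "\<forall>i\<in>{1..r}. puiseux c (n i) (y i) (Y i) (B i)"
    and C: "chart C r (\<lambda>i. puiseux_curve c (n i) (y i)) \<delta>"
    using curve_chart[OF assms(1,3)] by (elim exE conjE) (rule that)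
  obtain c' n' y' Y' \<delta>' where s: "1 \<le> s" and P': "\<forall>i\<in>{1..s}. puiseux c' (n' i) (y' i) (Y' i) (B' i)"
    and C': "chart C' s (\<lambda>i. puiseux_curve c' (n' i) (y' i)) \<delta>'"
    using curve_chart[OF assms(2,4)] by (elim exE conjE) (rule that)
  have ne: "\<not> germ_le (B i) (B j)" if "i \<in> {1..r}" "j \<in> {1..r}" "i \<noteq> j" for i j
    using assms(3) that unfolding branches_def by blast
  have ne': "\<not> germ_le (B' i) (B' j)" if "i \<in> {1..s}" "j \<in> {1..s}" "i \<noteq> j" for i j
    using assms(4) that unfolding branches_def by blast
  define \<gamma> where "\<gamma> = (\<lambda>i. puiseux_curve c (n i) (y i))"
  define \<gamma>' where "\<gamma>' = (\<lambda>i. puiseux_curve c' (n' i) (y' i))"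
  have \<gamma>: "\<gamma> i = puiseux_curve c (n i) (y i)" and \<gamma>': "\<gamma>' i = puiseux_curve c' (n' i) (y' i)" for i by (simp_all add: \<gamma>_def \<gamma>'_def)
  note C = C[folded \<gamma>_def] and C' = C'[folded \<gamma>'_def]
  \<comment> \<open>Contact orders are fixed here, before \<alpha>, since \<alpha> is to be chosen
    in terms of a bound on them.\<close>
  define q where "q = (\<lambda>i j. SOME Q. \<exists>\<zeta>. contact (n i) (y i) (n j) (y j) Q \<zeta>)"
  define q' where "q' = (\<lambda>i j. SOME Q. \<exists>\<zeta>. contact (n' i) (y' i) (n' j) (y' j) Q \<zeta>)"
  have q: "\<exists>\<zeta>. contact (n i) (y i) (n j) (y j) (q i j) \<zeta>" if "i \<in> {1..r}" "j \<in> {1..r}" "i \<noteq> j" for i j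
    unfolding q_def by (rule someI_ex) (rule contact_exists[OF bspec[OF P that(1)] bspec[OF P that(2)] ne[OF that]])
  have q': "\<exists>\<zeta>. contact (n' i) (y' i) (n' j) (y' j) (q' i j) \<zeta>" if "i \<in> {1..s}" "j \<in> {1..s}" "i \<noteq> j" for i j
    unfolding q'_def by (rule someI_ex) (rule contact_exists[OF bspec[OF P' that(1)] bspec[OF P' that(2)] ne'[OF that]])
  \<comment> \<open>All integers to be compared, from both curves: the reverse inequalities start
    from the invariants of \<open>C'\<close>.\<close>
  define A where "A = (\<Union>i\<in>{1..r}. conjugate_order (n i) (Y i) ` {..<n i}) \<union> (\<Union>i\<in>{1..s}. conjugate_order (n' i) (Y' i) ` {..<n' i}) \<union>
    (\<Union>i\<in>{1..r}. q i ` {1..r}) \<union> (\<Union>i\<in>{1..s}. q' i ` {1..s})"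
  have "finite A" by (simp add: A_def)
  then obtain m where m: "\<forall>x\<in>A. x \<le> m" unfolding finite_nat_set_iff_bounded_le by blast
  define M where "M = Suc m"
  have M0: "0 < M" by (simp add: M_def)
  have M: "x \<le> M" if "x \<in> A" for x using m that by (simp add: M_def le_SucI)
  have Mro: "conjugate_order (n i) (Y i) k \<le> M" if "i \<in> {1..r}" "k < n i" for i k by (rule M) (use that in \<open>auto simp: A_def\<close>)
  have Mro': "conjugate_order (n' i) (Y' i) k \<le> M" if "i \<in> {1..s}" "k < n' i" for i k by (rule M) (use that in \<open>auto simp: A_def\<close>)
  have Mq: "q i j \<le> M" if "i \<in> {1..r}" "j \<in> {1..r}" for i j
  proof (rule M)
    show "q i j \<in> A" unfolding A_def using that by blast
  qed
  have Mq': "q' i j \<le> M" if "i \<in> {1..s}" "j \<in> {1..s}" for i j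
  proof (rule M)
    have "q' i j \<in> (\<Union>i\<in>{1..s}. q' i ` {1..s})" using that by blast
    then show "q' i j \<in> A" unfolding A_def by (rule UnI2)
  qed
  obtain \<alpha> :: real where \<alpha>: "0 < \<alpha>" "\<alpha> < 1" and \<alpha>M: "1 - 1 / real M < \<alpha>\<^sup>2" using exists_near_one[OF M0] by blast
  obtain U V f g where U: "open U" "0 \<in> U" and V: "open V" "0 \<in> V" and hom: "homeomorphism (C \<inter> U) (C' \<inter> V) f g"
    and f0: "f 0 = 0" and Hf: "holder_on \<alpha> (C \<inter> U) f" and Hg: "holder_on \<alpha> (C' \<inter> V) g"
    using assms(5)[OF \<alpha>] unfolding bi_holder_equivalent_def by (elim exE conjE) (rule that)
  have gf: "\<And>p. p \<in> C \<inter> U \<Longrightarrow> g (f p) = p" using hom by (auto simp: homeomorphism_def)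
  have g0: "g 0 = 0"
  proof -
    have "\<gamma> 1 0 = 0" "\<gamma> 1 ` cball 0 \<delta> \<subseteq> C" "0 < \<delta>" using C r unfolding chart_def by auto
    then have "0 \<in> C \<inter> U" using U by (metis IntI centre_in_cball image_subset_iff less_imp_le)
    then show ?thesis using gf[of 0] f0 by simp
  qed
  obtain \<sigma> where bij: "bij_betw \<sigma> {1..r} {1..s}" and track: "\<forall>i\<in>{1..r}. \<exists>d \<phi>. 0 < d \<and> continuous_on (ball 0 d) \<phi> \<and> \<phi> 0 = 0 \<and>
       (\<forall>t\<in>ball 0 d. t \<in> ball 0 \<delta> \<and> \<phi> t \<in> ball 0 \<delta>' \<and> \<gamma> i t \<in> C \<inter> U \<and> f (\<gamma> i t) = \<gamma>' (\<sigma> i) (\<phi> t))"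
    and rot: "\<forall>i\<in>{1..r}. rotates \<alpha> (n i) (Y i) (n' (\<sigma> i)) (Y' (\<sigma> i))"
    and con: "\<forall>i\<in>{1..r}. \<forall>j\<in>{1..r}. \<forall>Q \<zeta> Q' \<zeta>'. n i = n' (\<sigma> i) \<and> n j = n' (\<sigma> j) \<and>
       contact (n i) (y i) (n j) (y j) Q \<zeta> \<and> contact (n i) (y' (\<sigma> i)) (n j) (y' (\<sigma> j)) Q' \<zeta>' \<longrightarrow> \<alpha>\<^sup>2 * real Q \<le> real Q'"
    using curve_transfer[OF P P' \<gamma> \<gamma>' C C' hom U V f0 r \<alpha>(1) Hf Hg] by (elim exE conjE) (rule that)
  obtain \<tau> where track': "\<forall>i\<in>{1..s}. \<exists>d \<phi>. 0 < d \<and> continuous_on (ball 0 d) \<phi> \<and> \<phi> 0 = 0 \<and>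
       (\<forall>t\<in>ball 0 d. t \<in> ball 0 \<delta>' \<and> \<phi> t \<in> ball 0 \<delta> \<and> \<gamma>' i t \<in> C' \<inter> V \<and> g (\<gamma>' i t) = \<gamma> (\<tau> i) (\<phi> t))"
    and bij': "bij_betw \<tau> {1..s} {1..r}"
    and rot': "\<forall>i\<in>{1..s}. rotates \<alpha> (n' i) (Y' i) (n (\<tau> i)) (Y (\<tau> i))"
    and con': "\<forall>i\<in>{1..s}. \<forall>j\<in>{1..s}. \<forall>Q \<zeta> Q' \<zeta>'. n' i = n (\<tau> i) \<and> n' j = n (\<tau> j) \<and>
       contact (n' i) (y' i) (n' j) (y' j) Q \<zeta> \<and> contact (n' i) (y (\<tau> i)) (n' j) (y (\<tau> j)) Q' \<zeta>' \<longrightarrow> \<alpha>\<^sup>2 * real Q \<le> real Q'"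
    using curve_transfer[OF P' P \<gamma>' \<gamma> C' C homeomorphism_symD[OF hom] V U g0 s \<alpha>(1) Hg Hf] by (elim exE conjE) (rule that)
  have \<sigma>: "\<sigma> i \<in> {1..s}" if "i \<in> {1..r}" for i using bij that by (auto simp: bij_betw_def)
  \<comment> \<open>The two transfers choose their assignments independently. Following a nonzero
    parameter, small enough for both, shows that they are inverse to each other.\<close>
  have \<tau>\<sigma>: "\<tau> (\<sigma> i) = i" if i: "i \<in> {1..r}" for i
  proof -
    obtain d \<phi> where d: "0 < d" "continuous_on (ball 0 d) \<phi>" "\<phi> 0 = 0" and
      \<phi>: "\<forall>t\<in>ball 0 d. t \<in> ball 0 \<delta> \<and> \<phi> t \<in> ball 0 \<delta>' \<and> \<gamma> i t \<in> C \<inter> U \<and> f (\<gamma> i t) = \<gamma>' (\<sigma> i) (\<phi> t)"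
      using bspec[OF track i] by (elim exE conjE) (rule that)
    obtain e \<psi> where e: "0 < e" and
      \<psi>: "\<forall>t\<in>ball 0 e. t \<in> ball 0 \<delta>' \<and> \<psi> t \<in> ball 0 \<delta> \<and> \<gamma>' (\<sigma> i) t \<in> C' \<inter> V \<and> g (\<gamma>' (\<sigma> i) t) = \<gamma> (\<tau> (\<sigma> i)) (\<psi> t)"
      using bspec[OF track' \<sigma>[OF i]] by (elim exE conjE) (rule that)
    have "isCont \<phi> 0" using d by (simp add: continuous_on_eq_continuous_at)
    then obtain d2 where d2: "d2 > 0" "\<And>t. dist t 0 < d2 \<Longrightarrow> dist (\<phi> t) (\<phi> 0) < e"
      using e unfolding continuous_at_eps_delta by blast
    define t where "t = complex_of_real (min d d2 / 2)"
    have t: "t \<noteq> 0" "t \<in> ball 0 d" "dist t 0 < d2" using d(1) d2(1) by (auto simp: t_def min_def)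
    have "\<phi> t \<in> ball 0 e" using d2(2)[OF t(3)] d(3) by simp
    then have b: "\<psi> (\<phi> t) \<in> ball 0 \<delta>" "g (\<gamma>' (\<sigma> i) (\<phi> t)) = \<gamma> (\<tau> (\<sigma> i)) (\<psi> (\<phi> t))" using \<psi> by blast+
    have a: "t \<in> ball 0 \<delta>" "\<gamma> i t \<in> C \<inter> U" "f (\<gamma> i t) = \<gamma>' (\<sigma> i) (\<phi> t)" using \<phi> t(2) by blast+
    have "\<gamma> i t = \<gamma> (\<tau> (\<sigma> i)) (\<psi> (\<phi> t))" using gf[OF a(2)] a(3) b(2) by simp
    moreover have "\<tau> (\<sigma> i) \<in> {1..r}" using bij' \<sigma>[OF i] by (auto simp: bij_betw_def)
    moreover have "t \<in> cball 0 \<delta>" "\<psi> (\<phi> t) \<in> cball 0 \<delta>" using a(1) b(1) by simp_all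
    ultimately have "i = \<tau> (\<sigma> i) \<and> t = \<psi> (\<phi> t) \<or> t = 0 \<and> \<psi> (\<phi> t) = 0"
      using C i unfolding chart_def by blast
    then show ?thesis using t(1) by simp
  qed
  have np: "0 < n i" if "i \<in> {1..r}" for i using P that by (auto simp: puiseux_def)
  have np': "0 < n' i" if "i \<in> {1..s}" for i using P' that by (auto simp: puiseux_def)
  \<comment> \<open>Divisibility in both directions gives equal multiplicities; only then do the
    conjugate orders on the two sides have the same index set and become comparable.\<close>
  have neq: "n' (\<sigma> i) = n i" and req: "\<And>k. 0 < k \<Longrightarrow> k < n i \<Longrightarrow> conjugate_order (n i) (Y i) k = conjugate_order (n i) (Y' (\<sigma> i)) k"
    if i: "i \<in> {1..r}" for i
  proof -
    note Pi = bspec[OF P i] and Pi' = bspec[OF P' \<sigma>[OF i]]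
    have R: "rotates \<alpha> (n i) (Y i) (n' (\<sigma> i)) (Y' (\<sigma> i))" using rot i by blast
    have R': "rotates \<alpha> (n' (\<sigma> i)) (Y' (\<sigma> i)) (n i) (Y i)" using bspec[OF rot' \<sigma>[OF i]] \<tau>\<sigma>[OF i] by simp
    have MM: "conjugate_order (n i) (Y i) k \<le> M" if "0 < k" "k < n i" for k using Mro[OF i] that by blast
    have MM': "conjugate_order (n' (\<sigma> i)) (Y' (\<sigma> i)) k \<le> M" if "0 < k" "k < n' (\<sigma> i)" for k using Mro'[OF \<sigma>[OF i]] that by blast
    note T = rotates_dvd[OF Pi M0 \<alpha>M MM R np'[OF \<sigma>[OF i]]]
    note T' = rotates_dvd[OF Pi' M0 \<alpha>M MM' R' np[OF i]]
    show eq: "n' (\<sigma> i) = n i" using T(1) T'(1) by (intro dvd_antisym) auto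
    show "conjugate_order (n i) (Y i) k = conjugate_order (n i) (Y' (\<sigma> i)) k" if k: "0 < k" "k < n i" for k
    proof (rule antisym)
      show "conjugate_order (n i) (Y i) k \<le> conjugate_order (n i) (Y' (\<sigma> i)) k" by (rule T(2)[OF _ _ eq k])
      have kk: "k < n' (\<sigma> i)" using k eq by simp
      have "conjugate_order (n' (\<sigma> i)) (Y' (\<sigma> i)) k \<le> conjugate_order (n' (\<sigma> i)) (Y i) k" by (rule T'(2)[OF _ _ eq[symmetric] k(1) kk])
      then show "conjugate_order (n i) (Y' (\<sigma> i)) k \<le> conjugate_order (n i) (Y i) k" unfolding eq .
    qed
  qed
  have P2: "puiseux c' (n i) (y' (\<sigma> i)) (Y' (\<sigma> i)) (B' (\<sigma> i))" if i: "i \<in> {1..r}" for i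
    using bspec[OF P' \<sigma>[OF i]] neq[OF i] by simp
  have char: "\<exists>\<beta>. has_characteristic_exponents (B i) \<beta> \<and> has_characteristic_exponents (B' (\<sigma> i)) \<beta>" if i: "i \<in> {1..r}" for i
  proof (rule same_characteristic_exponents[OF bspec[OF P i] P2[OF i]])
    fix e assume e: "1 < e" "e dvd n i"
    note rd = conjugate_order_div[OF e np[OF i]]
    show "min_exponent (Y i) e = min_exponent (Y' (\<sigma> i)) e" using req[OF i rd(1,2)] unfolding rd(3) .
  qed
  have inter: "\<exists>k. has_intersection_multiplicity (B i) (B j) k \<and> has_intersection_multiplicity (B' (\<sigma> i)) (B' (\<sigma> j)) k"
    if ij: "i \<in> {1..r}" "j \<in> {1..r}" "i \<noteq> j" for i j
  proof -
    have sij: "\<sigma> i \<noteq> \<sigma> j" using \<tau>\<sigma>[OF ij(1)] \<tau>\<sigma>[OF ij(2)] ij(3) by metis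
    obtain \<zeta> where Q: "contact (n i) (y i) (n j) (y j) (q i j) \<zeta>" using q[OF ij] by blast
    obtain \<zeta>' where Q': "contact (n i) (y' (\<sigma> i)) (n j) (y' (\<sigma> j)) (q' (\<sigma> i) (\<sigma> j)) \<zeta>'"
      using q'[OF \<sigma>[OF ij(1)] \<sigma>[OF ij(2)] sij] unfolding neq[OF ij(1)] neq[OF ij(2)] by blast
    have "\<alpha>\<^sup>2 * real (q i j) \<le> real (q' (\<sigma> i) (\<sigma> j))"
      using con ij(1,2) neq[OF ij(1)] neq[OF ij(2)] Q Q' by metis
    then have 1: "q i j \<le> q' (\<sigma> i) (\<sigma> j)" by (rule nat_le_if_almost[OF M0 \<alpha>M Mq[OF ij(1,2)]])
    \<comment> \<open>The hypotheses of \<open>con'\<close>, the transfer along the inverse map, at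
      the branches \<open>\<sigma> i\<close> and \<open>\<sigma> j\<close>.\<close>
    have "n' (\<sigma> i) = n (\<tau> (\<sigma> i)) \<and> n' (\<sigma> j) = n (\<tau> (\<sigma> j)) \<and>
       contact (n' (\<sigma> i)) (y' (\<sigma> i)) (n' (\<sigma> j)) (y' (\<sigma> j)) (q' (\<sigma> i) (\<sigma> j)) \<zeta>' \<and>
       contact (n' (\<sigma> i)) (y (\<tau> (\<sigma> i))) (n' (\<sigma> j)) (y (\<tau> (\<sigma> j))) (q i j) \<zeta>"
      using Q Q' by (simp add: neq[OF ij(1)] neq[OF ij(2)] \<tau>\<sigma>[OF ij(1)] \<tau>\<sigma>[OF ij(2)])
    then have "\<alpha>\<^sup>2 * real (q' (\<sigma> i) (\<sigma> j)) \<le> real (q i j)"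
      using bspec[OF bspec[OF con' \<sigma>[OF ij(1)]] \<sigma>[OF ij(2)]] by blast
    then have 2: "q' (\<sigma> i) (\<sigma> j) \<le> q i j" by (rule nat_le_if_almost[OF M0 \<alpha>M Mq'[OF \<sigma>[OF ij(1)] \<sigma>[OF ij(2)]]])
    have qq: "q' (\<sigma> i) (\<sigma> j) = q i j" using 1 2 by simp
    obtain k where k: "has_intersection_multiplicity (B i) (B j) k"
      "n j * k = (\<Sum>a<n j. if a = 0 then q i j else min (q i j) (n i * conjugate_order (n j) (Y j) a))"
      using contact_intersection_multiplicity[OF bspec[OF P ij(1)] bspec[OF P ij(2)] Q] by blast
    obtain k' where k': "has_intersection_multiplicity (B' (\<sigma> i)) (B' (\<sigma> j)) k'"
      "n j * k' = (\<Sum>a<n j. if a = 0 then q' (\<sigma> i) (\<sigma> j) else min (q' (\<sigma> i) (\<sigma> j)) (n i * conjugate_order (n j) (Y' (\<sigma> j)) a))"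
      using contact_intersection_multiplicity[OF P2[OF ij(1)] P2[OF ij(2)] Q'] by blast
    \<comment> \<open>Both multiplicities come from the same formula, whose entries are already
      matched: multiplicities, contact order and conjugate orders of the second branch.\<close>
    have "n j * k = n j * k'"
      unfolding k(2) k'(2) qq by (rule sum.cong) (use req[OF ij(2)] in auto)
    then have "k = k'" using np[OF ij(2)] by simp
    then show ?thesis using k(1) k'(1) by blast
  qed
  show ?thesis
    by (intro exI[of _ \<sigma>] conjI ballI impI) (use bij char inter in blast)+
qed

end
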